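(* Let $\gamma\in(0,1]$. Assume $\sum_{i=0}^{\infty}|a_i|^{\gamma}<\infty$, $\sum_{i=0}^{\infty}|b_i|^{\gamma}<\infty$, $\int_{\mathbb{R}}|\lambda|^{2\gamma}|\phi_{\varepsilon}(\lambda)|^2\,d\lambda<\infty$, $\int_{\mathbb{R}}|\lambda|^{2\gamma}|\phi_{\xi}(\lambda)|^2\,d\lambda<\infty$, and that there is a finite constant $c_{\gamma,2}$ such that for all $\lambda\in\mathbb{R}$ $$\mathbb{E}\,|e^{\iota\lambda\varepsilon_1}-\phi_{\varepsilon}(\lambda)|^{2}\leq c_{\gamma,2}(|\lambda|^{2\gamma}\wedge 1),\qquad \mathbb{E}\,|e^{\iota\lambda\xi_1}-\phi_{\xi}(\lambda)|^{2}\leq c_{\gamma,2}(|\lambda|^{2\gamma}\wedge 1).$$ Assume further that $f$ and $g$ are bounded and $\int_{\mathbb{R}}|\widehat K(\lambda)|\,d\lambda<\infty$. Then there exist positive constants $c,c_1$, independent of $n$, such that $$\mathbb{E}\Big|\widehat D(f,g)-\mathbb{E}\,\widehat D(f,g)-\frac1n\sum_{i=1}^nW_i\Big|\leq c\Big(\frac{1}{nh_n}+\frac{h_n^{\gamma}}{\sqrt n}\Big),$$ $$\big|\mathbb{E}\,\widehat D(f,g)-D(f,g)\big|\leq c_1\Big(\frac1n+h_n^{2\gamma}\Big),$$ where $$W_i=2\Big(f(X_i)-\int_{\mathbb{R}}f^2(x)\,dx+g(Y_i)-\int_{\mathbb{R}}g^2(x)\,dx-g(X_i)-f(Y_i)+2\int_{\mathbb{R}}f(x)g(x)\,dx\Big),$$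 and, if additionally $\sqrt n\,h_n\to\infty$ as $n\to\infty$, $$\sqrt n\,\big[\widehat D(f,g)-\mathbb{E}\,\widehat D(f,g)\big]\overset{\mathcal{L}}{\longrightarrow}N(0,4\sigma^2)$$ for some $\sigma^2\in(0,\infty)$.
   Context: $\{\varepsilon_i\}_{i\in\mathbb{Z}}$ are i.i.d. real random variables, $\{\xi_i\}_{i\in\mathbb{Z}}$ are i.i.d. real random variables, and $\{a_i\}_{i\ge0},\{b_i\}_{i\ge0}$ are real coefficients such that $X_n=\sum_{i=0}^\infty a_i\varepsilon_{n-i}$ and $Y_n=\sum_{j=0}^\infty b_j\xi_{n-j}$ converge in distribution. The linear processes $\{X_n\}$ and $\{Y_n\}$ are independent of each other and have probability density functions $f$ and $g$ respectively. $\phi_\varepsilon(\lambda)=\mathbb{E}[e^{\iota\lambda\varepsilon_1}]$, $\phi_\xi(\lambda)=\mathbb{E}[e^{\iota\lambda\xi_1}]$, $\iota=\sqrt{-1}$. The kernel $K:\mathbb{R}\to\mathbb{R}$ is symmetric and bounded with $\int_{\mathbb{R}}K(u)\,du=1$ and $\int_{\mathbb{R}}u^2|K(u)|\,du<\infty$; $\widehat K(\lambda)=\int_{\mathbb{R}}e^{\iota x\lambda}K(x)\,dx$; the bandwidths satisfy $0<h_n\to0$. The $L_2^2$ divergence is $D(f,g)=\int_{\mathbb{R}}(f(x)-g(x))^2\,dx$, and its estimator is $\widehat D(f,g)=T_n(f,h_n)+T_n(g,h_n)-2T_n(f,g,h_n)$, $n\ge2$, where $$T_n(f,h_n)=\frac{2}{n(n-1)h_n}\sum_{1\le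 i<j\le n}K\Big(\frac{X_i-X_j}{h_n}\Big),\quad T_n(g,h_n)=\frac{2}{n(n-1)h_n}\sum_{1\le i<j\le n}K\Big(\frac{Y_i-Y_j}{h_n}\Big),$$ $$T_n(f,g,h_n)=\frac{1}{n^2h_n}\sum_{1\le i,j\le n}K\Big(\frac{X_i-Y_j}{h_n}\Big).$$ $\overset{\mathcal{L}}{\longrightarrow}$ denotes convergence in distribution.
   Formalization: The limit N(0,4σ²) with σ²>0 is claimed only if Var(W_1+…+W_n)/n does not tend to 0; otherwise the limit is shown to be the point mass at 0. As stated the claim fails, e.g. when f=g, where all W_i vanish. *)

theory Defs
  imports "HOL-Probability.Probability"
begin

definition iid :: "'a measure \<Rightarrow> (int \<Rightarrow> 'a \<Rightarrow> real) \<Rightarrow> bool" where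
  "iid M e \<longleftrightarrow>
     prob_space.indep_vars M (\<lambda>_. borel) e UNIV \<and>
     (\<forall>i j. distr M borel (e i) = distr M borel (e j))"

definition converges_in_distribution :: "'a measure \<Rightarrow> (nat \<Rightarrow> 'a \<Rightarrow> real) \<Rightarrow> bool" where
  "converges_in_distribution M S \<longleftrightarrow>
     (\<exists>\<mu>. real_distribution \<mu> \<and> weak_conv_m (\<lambda>N. distr M borel (S N)) \<mu>)"

definition linear_partial_sum ::
    "(nat \<Rightarrow> real) \<Rightarrow> (int \<Rightarrow> 'a \<Rightarrow> real) \<Rightarrow> int \<Rightarrow> nat \<Rightarrow> 'a \<Rightarrow> real" where
  "linear_partial_sum a e n N \<omega> = (\<Sum>i<N. a i * e (n - int i) \<omega>)"

text \<open>
  The series is taken pointwise. For independent summands, convergence in distribution of the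
  partial sums is equivalent to almost sure convergence (Levy), so under
  \<open>converges_in_distribution M (linear_partial_sum a e n)\<close> this is a genuine sum outside a null set.
\<close>

definition linear_process ::
    "(nat \<Rightarrow> real) \<Rightarrow> (int \<Rightarrow> 'a \<Rightarrow> real) \<Rightarrow> int \<Rightarrow> 'a \<Rightarrow> real" where
  "linear_process a e n \<omega> = (\<Sum>i. a i * e (n - int i) \<omega>)"

text \<open>Independence of the whole processes, i.e. of the two maps into the product space.\<close>

definition indep_processes ::
    "'a measure \<Rightarrow> (int \<Rightarrow> 'a \<Rightarrow> real) \<Rightarrow> (int \<Rightarrow> 'a \<Rightarrow> real) \<Rightarrow> bool" where
  "indep_processes M X Y \<longleftrightarrow>
     prob_space.indep_var M (Pi\<^sub>M UNIV (\<lambda>_. borel)) (\<lambda>\<omega> n. X n \<omega>)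
                            (Pi\<^sub>M UNIV (\<lambda>_. borel)) (\<lambda>\<omega> n. Y n \<omega>)"

definition has_marginal_density ::
    "'a measure \<Rightarrow> (int \<Rightarrow> 'a \<Rightarrow> real) \<Rightarrow> (real \<Rightarrow> real) \<Rightarrow> bool" where
  "has_marginal_density M X f \<longleftrightarrow>
     (\<forall>x. 0 \<le> f x) \<and> (\<forall>n. distributed M lborel (X n) (\<lambda>x. ennreal (f x)))"

definition fourier :: "(real \<Rightarrow> real) \<Rightarrow> real \<Rightarrow> complex" where
  "fourier K t = (CLINT x|lborel. iexp (x * t) * complex_of_real (K x))"

definition smoothing_kernel :: "(real \<Rightarrow> real) \<Rightarrow> bool" where
  "smoothing_kernel K \<longleftrightarrow>
     (\<forall>u. K (- u) = K u) \<and> bounded (range K) \<and>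
     integrable lborel K \<and> (LINT u|lborel. K u) = 1 \<and>
     integrable lborel (\<lambda>u. u\<^sup>2 * \<bar>K u\<bar>)"

definition L2_divergence :: "(real \<Rightarrow> real) \<Rightarrow> (real \<Rightarrow> real) \<Rightarrow> real" where
  "L2_divergence f g = (LINT x|lborel. (f x - g x)\<^sup>2)"

definition T_within ::
    "(real \<Rightarrow> real) \<Rightarrow> (int \<Rightarrow> 'a \<Rightarrow> real) \<Rightarrow> real \<Rightarrow> nat \<Rightarrow> 'a \<Rightarrow> real" where
  "T_within K X h n \<omega> =
     2 / (real n * (real n - 1) * h) *
       (\<Sum>j\<in>{1..int n}. \<Sum>i\<in>{1..<j}. K ((X i \<omega> - X j \<omega>) / h))"

definition T_between ::
    "(real \<Rightarrow> real) \<Rightarrow> (int \<Rightarrow> 'a \<Rightarrow> real) \<Rightarrow> (int \<Rightarrow> 'a \<Rightarrow> real) \<Rightarrow> real \<Rightarrow> nat \<Rightarrow> 'a \<Rightarrow> real" where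
  "T_between K X Y h n \<omega> =
     1 / ((real n)\<^sup>2 * h) *
       (\<Sum>i\<in>{1..int n}. \<Sum>j\<in>{1..int n}. K ((X i \<omega> - Y j \<omega>) / h))"

definition D_hat ::
    "(real \<Rightarrow> real) \<Rightarrow> (int \<Rightarrow> 'a \<Rightarrow> real) \<Rightarrow> (int \<Rightarrow> 'a \<Rightarrow> real) \<Rightarrow>
     (nat \<Rightarrow> real) \<Rightarrow> nat \<Rightarrow> 'a \<Rightarrow> real" where
  "D_hat K X Y h n \<omega> =
     T_within K X (h n) n \<omega> + T_within K Y (h n) n \<omega> - 2 * T_between K X Y (h n) n \<omega>"

definition W ::
    "(real \<Rightarrow> real) \<Rightarrow> (real \<Rightarrow> real) \<Rightarrow> (int \<Rightarrow> 'a \<Rightarrow> real) \<Rightarrow> (int \<Rightarrow> 'a \<Rightarrow> real) \<Rightarrow>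
     int \<Rightarrow> 'a \<Rightarrow> real" where
  "W f g X Y i \<omega> =
     2 * (f (X i \<omega>) - (LINT x|lborel. (f x)\<^sup>2)
          + g (Y i \<omega>) - (LINT x|lborel. (g x)\<^sup>2)
          - g (X i \<omega>) - f (Y i \<omega>)
          + 2 * (LINT x|lborel. f x * g x))"

text \<open>
  Vanishing long-run variance: \<open>Var (Z\<^sub>1 + \<dots> + Z\<^sub>n) / n\<close> tends to \<open>0\<close>. A central limit theorem
  with a strictly positive limiting variance must exclude this case for \<open>Z = W f g X Y\<close>; it does
  occur, e.g. for \<open>f = g\<close> (lemma \<open>W_self\<close>), or when \<open>f\<close> and \<open>g\<close> are uniform densities on disjoint
  intervals of equal length.
\<close>

definition vanishing_long_run_variance :: "'a measure \<Rightarrow> (int \<Rightarrow> 'a \<Rightarrow> real) \<Rightarrow> bool" where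
  "vanishing_long_run_variance M Z \<longleftrightarrow>
     (\<lambda>n. prob_space.variance M (\<lambda>\<omega>. \<Sum>i\<in>{1..int n}. Z i \<omega>) / real n) \<longlonglongrightarrow> 0"

lemma W_self: "W f f X Y i \<omega> = 0"
  by (simp add: W_def power2_eq_square)

lemma vanishing_long_run_variance_W_self:
  "vanishing_long_run_variance M (W f f X Y)"
  by (simp add: vanishing_long_run_variance_def W_self)

end

theory Submission
  imports Defs
begin

text \<open>
  The kernel is the inverse Fourier transform of its integrable transform, so the estimator is an
  integral of quadratic expressions in the empirical exponential sums. The inversion formula holds
  only off a Lebesgue null set, which the differences \<open>X\<^sub>i - X\<^sub>j\<close> and \<open>X\<^sub>i - Y\<^sub>j\<close> do not charge,
  since their characteristic functions are integrable.

  Write the sum of \<open>exp (\<i> t X\<^sub>i)\<close> over \<open>i \<le> n\<close> as \<open>n \<phi>(t) + S(t)\<close>. The covariance of \<open>exp (\<i> t X\<^sub>i)\<close>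
  and \<open>exp (\<i> t X\<^sub>j)\<close> with \<open>i < j\<close> is at most a product of the factors \<open>\<bar>\<phi>\<^sub>\<epsilon> (t a\<^sub>k)\<bar>\<close>, \<open>k < j - i\<close>, times
  \<open>\<bar>t\<bar> powr (2 \<gamma>)\<close> and a sequence summable in \<open>j - i\<close>. Hence \<open>E \<bar>S(t)\<bar>\<^sup>2\<close> is at most \<open>n\<close> times a
  bounded plus an integrable function of \<open>t\<close>: the part quadratic in \<open>S\<close> is \<open>O(1 / (n h))\<close> and the
  linear part is the average of the \<open>W\<^sub>i\<close> with \<open>f - g\<close> smoothed at scale \<open>h\<close>.

  Removing the smoothing needs a bound for the variance of the sum of \<open>G(X\<^sub>i)\<close> by \<open>n\<close> times the squared
  \<open>L\<^sup>2\<close> norm of \<open>G\<close>. Separating the innovation at time \<open>i\<close> splits this sum into martingale differences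
  and a sum of functions of the past, whose Fourier transform carries the decaying factor
  \<open>\<phi>\<^sub>\<epsilon> (t a\<^sub>0)\<close>. The same bound reduces the central limit theorem to \<open>G\<close> with compactly supported
  Fourier transform, then to finite moving averages, and then to independent blocks.
\<close>

subsection \<open>Integrals and translations in \<open>L\<^sup>1\<close>\<close>

text \<open>The innovations make \<open>\<phi> (t * a 0)\<close> square-integrable, but integrating
  a covariance over all frequencies takes two such factors. The second comes from a further nonzero
  coefficient or, at short lags, from a difference of two coefficients; if \<open>a 0\<close> is the
  only nonzero one, the covariances at positive lags vanish. This needs
  \<open>a 0 \<noteq> 0\<close>, which a shift of time provides.

  Bounds on E |S(t)|^2 alone control linear statistics with an integrable transform. That of f - g
  is square-integrable but need not be integrable for small \<gamma>; the factor gained from one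
  separated innovation makes Cauchy-Schwarz applicable, hence the martingale splitting.

  Limits of characteristic functions are taken along partial sums, so the series must converge
  outside a null set. This follows from a finite absolute moment of order \<gamma>, extracted from
  the variance condition on the innovations.

  The limiting variance is never divided by in the central limit theorem, so the same argument
  covers variance zero and then yields a point mass.\<close>

lemma integrable_mult_of_squares:
  fixes f g :: "'b \<Rightarrow> real"
  assumes [measurable]: "f \<in> borel_measurable N" "g \<in> borel_measurable N"
    and f: "integrable N (\<lambda>x. (f x)\<^sup>2)" and g: "integrable N (\<lambda>x. (g x)\<^sup>2)"
  shows "integrable N (\<lambda>x. f x * g x)"
proof (rule Bochner_Integration.integrable_bound[of N "\<lambda>x. (f x)\<^sup>2 + (g x)\<^sup>2"])
  have "\<bar>f x * g x\<bar> \<le> (f x)\<^sup>2 + (g x)\<^sup>2" for x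
  proof -
    have "0 \<le> (\<bar>f x\<bar> - \<bar>g x\<bar>)\<^sup>2" by simp
    then have "2 * (\<bar>f x\<bar> * \<bar>g x\<bar>) \<le> (f x)\<^sup>2 + (g x)\<^sup>2"
      by (simp add: power2_diff)
    moreover have "0 \<le> \<bar>f x\<bar> * \<bar>g x\<bar>" by simp
    ultimately show ?thesis unfolding abs_mult by linarith
  qed
  then show "AE x in N. norm (f x * g x) \<le> norm ((f x)\<^sup>2 + (g x)\<^sup>2)" by simp
qed (use f g in auto)

lemma cauchy_schwarz_integral:
  fixes f g :: "'b \<Rightarrow> real"
  assumes [measurable]: "f \<in> borel_measurable N" "g \<in> borel_measurable N"
    and f: "integrable N (\<lambda>x. (f x)\<^sup>2)" and g: "integrable N (\<lambda>x. (g x)\<^sup>2)"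
  shows "(\<integral>x. \<bar>f x * g x\<bar> \<partial>N)\<^sup>2 \<le> (\<integral>x. (f x)\<^sup>2 \<partial>N) * (\<integral>x. (g x)\<^sup>2 \<partial>N)"
proof -
  define A B C where "A = (\<integral>x. (f x)\<^sup>2 \<partial>N)" and "B = (\<integral>x. (g x)\<^sup>2 \<partial>N)"
    and "C = (\<integral>x. \<bar>f x * g x\<bar> \<partial>N)"
  have fg: "integrable N (\<lambda>x. \<bar>f x * g x\<bar>)"
    using integrable_mult_of_squares[OF assms] by simp
  have quad: "0 \<le> t\<^sup>2 * A - 2 * t * C + B" for t
  proof -
    have "0 \<le> (\<integral>x. (t * \<bar>f x\<bar> - \<bar>g x\<bar>)\<^sup>2 \<partial>N)" by simp
    also have "(\<lambda>x. (t * \<bar>f x\<bar> - \<bar>g x\<bar>)\<^sup>2) = (\<lambda>x. t\<^sup>2 * (f x)\<^sup>2 - 2 * t * \<bar>f x * g x\<bar> + (g x)\<^sup>2)"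
      by (simp add: fun_eq_iff power2_diff power_mult_distrib abs_mult)
    also have "(\<integral>x. t\<^sup>2 * (f x)\<^sup>2 - 2 * t * \<bar>f x * g x\<bar> + (g x)\<^sup>2 \<partial>N) = t\<^sup>2 * A - 2 * t * C + B"
      using f g fg by (simp add: A_def B_def C_def)
    finally show ?thesis .
  qed
  have "C\<^sup>2 \<le> A * B"
  proof (cases "A = 0")
    case True
    then have "AE x in N. (f x)\<^sup>2 = 0"
      using f by (simp add: A_def integral_nonneg_eq_0_iff_AE)
    then have "C = (\<integral>x. 0 \<partial>N)"
      unfolding C_def by (intro integral_cong_AE) auto
    then show ?thesis using True by simp
  next
    case False
    then have A: "A > 0" using Bochner_Integration.integral_nonneg[of N "\<lambda>x. (f x)\<^sup>2"] by (simp add: A_def order_less_le)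
    \<comment> \<open>C / A is the minimiser of the quadratic polynomial in
      \<open>quad\<close>.\<close>
    have "0 \<le> (C / A)\<^sup>2 * A - 2 * (C / A) * C + B" by (rule quad)
    also have "\<dots> = B - C\<^sup>2 / A" using A by (simp add: field_simps power2_eq_square)
    finally show ?thesis using A by (simp add: field_simps)
  qed
  then show ?thesis by (simp add: A_def B_def C_def)
qed

lemma integrable_indicator_Icc [simp]: "integrable lborel (indicator {a..b::real} :: real \<Rightarrow> real)"
  by (rule integrable_real_indicator) (auto intro: emeasure_bounded_finite simp: less_top[symmetric] emeasure_lborel_Icc_eq)

lemma integrable_bounded_support:
  fixes u :: "real \<Rightarrow> real"
  assumes [measurable]: "u \<in> borel_measurable borel" and "\<And>x. \<bar>u x\<bar> \<le> B" and "\<And>x. R < \<bar>x\<bar> \<Longrightarrow> u x = 0"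
  shows "integrable lborel u"
proof (rule Bochner_Integration.integrable_bound[of lborel "\<lambda>x. B * indicator {-R..R} x"])
  show "AE x in lborel. norm (u x) \<le> norm (B * indicator {-R..R} x)"
  proof (rule AE_I2)
    fix x show "norm (u x) \<le> norm (B * indicator {-R..R} x)"
      using assms(2)[of x] assms(3)[of x] by (cases "R < \<bar>x\<bar>") (auto simp: indicator_def)
  qed
qed auto

text \<open>Clamping the values to [-N, N] and multiplying by a trapezoidal cut-off costs little in
  L1. What remains is bounded with bounded support, so F may be replaced inside it by continuous
  functions converging almost everywhere, and dominated convergence applies. Such functions are
  supplied by the description of measurability through \<open>measurable_on\<close>.\<close>

lemma continuous_L1_approx:
  fixes F :: "real \<Rightarrow> real"
  assumes F: "integrable lborel F" and e: "0 < e"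
  obtains \<psi> B R where "continuous_on UNIV \<psi>" "\<And>x. \<bar>\<psi> x\<bar> \<le> B" "\<And>x. R < \<bar>x\<bar> \<Longrightarrow> \<psi> x = 0"
    "integrable lborel \<psi>" "(LBINT x. \<bar>F x - \<psi> x\<bar>) < e"
proof -
  have Fm[measurable]: "F \<in> borel_measurable borel"
    using borel_measurable_integrable[OF F] by simp
  define cl where "cl N y = max (- real N) (min (real N) y)" for N :: nat and y
  define cut where "cut N x = max 0 (min 1 (real N + 1 - \<bar>x\<bar>))" for N :: nat and x :: real
  have cl_le: "\<bar>cl N y\<bar> \<le> real N" for N y by (simp add: cl_def)
  have cut01: "0 \<le> cut N x" "cut N x \<le> 1" for N x by (auto simp: cut_def)
  have cut0: "cut N x = 0" if "real N + 1 < \<bar>x\<bar>" for N x using that by (simp add: cut_def)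
  have cl_cont: "continuous_on UNIV (cl N)" for N unfolding cl_def by (intro continuous_intros)
  have cut_cont: "continuous_on UNIV (cut N)" for N unfolding cut_def by (intro continuous_intros)
  have [measurable]: "cl N \<in> borel_measurable borel" "cut N \<in> borel_measurable borel" for N
    using cl_cont cut_cont by (auto intro: borel_measurable_continuous_onI)
  have "(\<lambda>N. \<integral>x. \<bar>F x - cl N (F x) * cut N x\<bar> \<partial>lborel) \<longlonglongrightarrow> (\<integral>x. 0 \<partial>(lborel::real measure))"
  proof (rule integral_dominated_convergence[where w="\<lambda>x. 2 * \<bar>F x\<bar>"])
    show "AE x in lborel. (\<lambda>N. \<bar>F x - cl N (F x) * cut N x\<bar>) \<longlonglongrightarrow> 0"
    proof (rule AE_I2)
      fix x
      obtain N0 :: nat where N0: "\<bar>F x\<bar> + \<bar>x\<bar> \<le> real N0" using real_arch_simple by blast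
      have "F x - cl N (F x) * cut N x = 0" if "N0 \<le> N" for N
      proof -
        have "\<bar>F x\<bar> + \<bar>x\<bar> \<le> real N" using N0 that by linarith
        then show ?thesis by (auto simp: cl_def cut_def)
      qed
      then show "(\<lambda>N. \<bar>F x - cl N (F x) * cut N x\<bar>) \<longlonglongrightarrow> 0"
        by (intro tendsto_eventually eventually_sequentiallyI[of N0]) simp
    qed
    fix N
    show "AE x in lborel. norm \<bar>F x - cl N (F x) * cut N x\<bar> \<le> 2 * \<bar>F x\<bar>"
    proof (rule AE_I2)
      fix x
      have "\<bar>cl N (F x)\<bar> \<le> \<bar>F x\<bar>" by (auto simp: cl_def)
      then have "\<bar>cl N (F x) * cut N x\<bar> \<le> \<bar>F x\<bar>"
        using cut01[of N x] mult_mono[of "\<bar>cl N (F x)\<bar>" "\<bar>F x\<bar>" "\<bar>cut N x\<bar>" 1] by (simp add: abs_mult)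
      then show "norm \<bar>F x - cl N (F x) * cut N x\<bar> \<le> 2 * \<bar>F x\<bar>" by simp
    qed
  qed (use F in auto)
  then have "(\<lambda>N. \<integral>x. \<bar>F x - cl N (F x) * cut N x\<bar> \<partial>lborel) \<longlonglongrightarrow> 0" by simp
  then have "\<forall>\<^sub>F N in sequentially. (LBINT x. \<bar>F x - cl N (F x) * cut N x\<bar>) < e / 2"
    using e by (intro order_tendstoD(2)) auto
  then obtain N where N: "(LBINT x. \<bar>F x - cl N (F x) * cut N x\<bar>) < e / 2"
    using eventually_happens'[OF sequentially_bot] by blast
  have "F measurable_on UNIV"
    by (simp add: measurable_on_iff_borel_measurable measurable_completion measurable_restrict_space1)
  then obtain Z g where Zg: "negligible Z \<and> (\<forall>n. continuous_on UNIV (g n)) \<and>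
      (\<forall>x. x \<notin> Z \<longrightarrow> (\<lambda>n. g n x) \<longlonglongrightarrow> (if x \<in> UNIV then F x else 0))"
    unfolding measurable_on_def by blast
  from Zg have Z: "negligible Z" by (rule conjunct1)
  from Zg have gc: "continuous_on UNIV (g n)" for n by (rule conjunct1[OF conjunct2, THEN spec])
  from Zg have glim: "(\<lambda>n. g n x) \<longlonglongrightarrow> F x" if "x \<notin> Z" for x using that by simp
  have [measurable]: "g n \<in> borel_measurable borel" for n
    using gc by (intro borel_measurable_continuous_onI) auto
  obtain Z' where Z': "Z' \<in> null_sets lborel" "Z \<subseteq> Z'"
    using Z unfolding negligible_iff_null_sets null_sets_completion_iff2 by auto
  have AEg: "AE x in lborel. (\<lambda>n. g n x) \<longlonglongrightarrow> F x"
    by (rule AE_I'[OF Z'(1)]) (use glim Z'(2) in auto)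
  define \<psi> where "\<psi> n x = cl N (g n x) * cut N x" for n x
  have \<psi>c: "continuous_on UNIV (\<psi> n)" for n
    unfolding \<psi>_def using continuous_on_compose[OF gc continuous_on_subset[OF cl_cont]] cut_cont
    by (intro continuous_on_mult) (auto simp: comp_def)
  have [measurable]: "\<psi> n \<in> borel_measurable borel" for n
    unfolding \<psi>_def by measurable
  have bd: "\<bar>cl N y * cut N x\<bar> \<le> real N" for x y
  proof -
    have "\<bar>cl N y\<bar> * \<bar>cut N x\<bar> \<le> real N * 1"
      using cl_le[of N y] cut01[of N x] by (intro mult_mono) auto
    then show ?thesis by (simp add: abs_mult)
  qed
  have int: "integrable lborel (\<psi> n)" for n
    by (rule integrable_bounded_support[where B=N and R="N+1"]) (auto simp: \<psi>_def bd cut0)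
  have intF: "integrable lborel (\<lambda>x. cl N (F x) * cut N x)"
    by (rule integrable_bounded_support[where B=N and R="N+1"]) (auto simp: bd cut0)
  have "(\<lambda>n. \<integral>x. \<bar>cl N (F x) * cut N x - \<psi> n x\<bar> \<partial>lborel) \<longlonglongrightarrow> (\<integral>x. 0 \<partial>(lborel::real measure))"
  proof (rule integral_dominated_convergence[where w="\<lambda>x. 2 * real N * indicator {-(real N+1)..real N + 1} x"])
    show "AE x in lborel. (\<lambda>n. \<bar>cl N (F x) * cut N x - \<psi> n x\<bar>) \<longlonglongrightarrow> 0"
      using AEg
    proof eventually_elim
      case (elim x)
      then have "(\<lambda>n. cl N (g n x)) \<longlonglongrightarrow> cl N (F x)"
        unfolding cl_def by (intro tendsto_intros)
      then have "(\<lambda>n. \<bar>cl N (F x) * cut N x - \<psi> n x\<bar>) \<longlonglongrightarrow> \<bar>cl N (F x) * cut N x - cl N (F x) * cut N x\<bar>"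
        unfolding \<psi>_def by (intro tendsto_intros)
      then show ?case by simp
    qed
    fix n
    show "AE x in lborel. norm \<bar>cl N (F x) * cut N x - \<psi> n x\<bar> \<le> 2 * real N * indicator {-(real N+1)..real N + 1} x"
    proof (rule AE_I2)
      fix x
      show "norm \<bar>cl N (F x) * cut N x - \<psi> n x\<bar> \<le> 2 * real N * indicator {-(real N+1)..real N + 1} x"
        using bd[of "F x" x] bd[of "g n x" x] cut0[of N x]
        by (cases "real N + 1 < \<bar>x\<bar>") (auto simp: \<psi>_def indicator_def)
    qed
  qed auto
  then have "(\<lambda>n. \<integral>x. \<bar>cl N (F x) * cut N x - \<psi> n x\<bar> \<partial>lborel) \<longlonglongrightarrow> 0" by simp
  then have "\<forall>\<^sub>F n in sequentially. (LBINT x. \<bar>cl N (F x) * cut N x - \<psi> n x\<bar>) < e / 2"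
    using e by (intro order_tendstoD(2)) auto
  then obtain n where n: "(LBINT x. \<bar>cl N (F x) * cut N x - \<psi> n x\<bar>) < e / 2"
    using eventually_happens'[OF sequentially_bot] by blast
  have "(LBINT x. \<bar>F x - \<psi> n x\<bar>) \<le> (LBINT x. \<bar>F x - cl N (F x) * cut N x\<bar> + \<bar>cl N (F x) * cut N x - \<psi> n x\<bar>)"
    by (rule integral_mono) (use F int intF in auto)
  also have "\<dots> < e" using N n F int intF by (subst Bochner_Integration.integral_add) auto
  finally show ?thesis
    by (intro that[of "\<psi> n" "real N" "real N + 1"]) (use \<psi>c int in \<open>auto simp: \<psi>_def bd cut0\<close>)
qed

lemma integrable_translate:
  fixes F :: "real \<Rightarrow> 'b::{banach, second_countable_topology}"
  assumes "integrable lborel F"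
  shows "integrable lborel (\<lambda>x. F (x - t))"
  using lborel_integrable_real_affine[OF assms, of 1 "-t"] by simp

lemma integral_translate:
  fixes F :: "real \<Rightarrow> 'b::{banach, second_countable_topology}"
  shows "(LBINT x. F (x - t)) = (LBINT x. F x)"
  using lborel_integral_real_affine[of 1 F "-t"] by simp

text \<open>Three-epsilon argument with a continuous \<psi> of bounded support. The error F - \<psi>
  enters twice, once shifted and once not, and by translation invariance both occurrences have the
  same size.\<close>

lemma L1_translation_continuous:
  fixes F :: "real \<Rightarrow> real"
  assumes F: "integrable lborel F" and t: "t \<longlonglongrightarrow> 0"
  shows "(\<lambda>n. \<integral>x. \<bar>F (x - t n) - F x\<bar> \<partial>lborel) \<longlonglongrightarrow> 0"
proof (rule LIMSEQ_I)
  fix e :: real assume e: "0 < e"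
  have e3: "0 < e / 3" using e by simp
  obtain \<psi> B R where \<psi>: "continuous_on UNIV \<psi>" "\<And>x. \<bar>\<psi> x\<bar> \<le> B" "\<And>x. R < \<bar>x\<bar> \<Longrightarrow> \<psi> x = 0"
    "integrable lborel \<psi>" and \<psi>e: "(LBINT x. \<bar>F x - \<psi> x\<bar>) < e / 3"
    by (rule continuous_L1_approx[OF F e3]) (rule that; assumption)
  have [measurable]: "\<psi> \<in> borel_measurable borel"
    using \<psi>(1) by (intro borel_measurable_continuous_onI) auto
  have [measurable]: "F \<in> borel_measurable borel"
    using borel_measurable_integrable[OF F] by simp
  \<comment> \<open>Once all shifts are below 1, the shifted copies of \<psi> live on one common
    interval and a single dominating function serves for all of them.\<close>
  obtain n0 where n0: "\<And>n. n0 \<le> n \<Longrightarrow> \<bar>t n\<bar> < 1"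
    using LIMSEQ_D[OF t, of 1] by auto
  have "(\<lambda>n. \<integral>x. \<bar>\<psi> (x - t (n + n0)) - \<psi> x\<bar> \<partial>lborel) \<longlonglongrightarrow> (\<integral>x. 0 \<partial>(lborel::real measure))"
  proof (rule integral_dominated_convergence[where w="\<lambda>x. 2 * B * indicator {-(R+1)..R+1} x"])
    show "AE x in lborel. (\<lambda>n. \<bar>\<psi> (x - t (n + n0)) - \<psi> x\<bar>) \<longlonglongrightarrow> 0"
    proof (rule AE_I2)
      fix x
      have "isCont \<psi> x" using \<psi>(1) by (simp add: continuous_on_eq_continuous_at)
      moreover have "(\<lambda>n. x - t (n + n0)) \<longlonglongrightarrow> x - 0"
        by (intro tendsto_intros LIMSEQ_ignore_initial_segment t)
      ultimately have "(\<lambda>n. \<psi> (x - t (n + n0))) \<longlonglongrightarrow> \<psi> x"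
        by (intro isCont_tendsto_compose[of x \<psi>]) auto
      then have "(\<lambda>n. \<bar>\<psi> (x - t (n + n0)) - \<psi> x\<bar>) \<longlonglongrightarrow> \<bar>\<psi> x - \<psi> x\<bar>"
        by (intro tendsto_intros)
      then show "(\<lambda>n. \<bar>\<psi> (x - t (n + n0)) - \<psi> x\<bar>) \<longlonglongrightarrow> 0" by simp
    qed
    fix n
    show "AE x in lborel. norm \<bar>\<psi> (x - t (n + n0)) - \<psi> x\<bar> \<le> 2 * B * indicator {-(R+1)..R+1} x"
    proof (rule AE_I2)
      fix x
      have "\<bar>t (n + n0)\<bar> < 1" by (rule n0) simp
      then show "norm \<bar>\<psi> (x - t (n + n0)) - \<psi> x\<bar> \<le> 2 * B * indicator {-(R+1)..R+1} x"
        using \<psi>(2)[of "x - t (n + n0)"] \<psi>(2)[of x] \<psi>(3)[of x] \<psi>(3)[of "x - t (n + n0)"]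
        by (cases "R + 1 < \<bar>x\<bar>") (auto simp: indicator_def)
    qed
  qed auto
  then have "(\<lambda>n. \<integral>x. \<bar>\<psi> (x - t n) - \<psi> x\<bar> \<partial>lborel) \<longlonglongrightarrow> 0"
    by (simp add: LIMSEQ_offset)
  then have "\<forall>\<^sub>F n in sequentially. (LBINT x. \<bar>\<psi> (x - t n) - \<psi> x\<bar>) < e / 3"
    using e3 by (rule order_tendstoD(2))
  then obtain n1 where n1: "\<And>n. n1 \<le> n \<Longrightarrow> (LBINT x. \<bar>\<psi> (x - t n) - \<psi> x\<bar>) < e / 3"
    unfolding eventually_sequentially by blast
  show "\<exists>no. \<forall>n\<ge>no. norm ((LBINT x. \<bar>F (x - t n) - F x\<bar>) - 0) < e"
  proof (intro exI allI impI)
    fix n assume "n1 \<le> n"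
    have i1: "integrable lborel (\<lambda>x. \<bar>F (x - t n) - \<psi> (x - t n)\<bar>)"
      using integrable_translate[of "\<lambda>x. F x - \<psi> x" "t n"] F \<psi>(4) by auto
    have i2: "integrable lborel (\<lambda>x. \<bar>\<psi> (x - t n) - \<psi> x\<bar>)" "integrable lborel (\<lambda>x. \<bar>F x - \<psi> x\<bar>)"
        "integrable lborel (\<lambda>x. \<bar>F (x - t n) - F x\<bar>)"
      using integrable_translate[OF \<psi>(4), of "t n"] integrable_translate[OF F, of "t n"] \<psi>(4) F by auto
    have "(LBINT x. \<bar>F (x - t n) - F x\<bar>)
        \<le> (LBINT x. \<bar>F (x - t n) - \<psi> (x - t n)\<bar> + (\<bar>\<psi> (x - t n) - \<psi> x\<bar> + \<bar>F x - \<psi> x\<bar>))"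
      by (rule integral_mono) (use i1 i2 in auto)
    also have "\<dots> = (LBINT x. \<bar>F (x - t n) - \<psi> (x - t n)\<bar>) + ((LBINT x. \<bar>\<psi> (x - t n) - \<psi> x\<bar>) + (LBINT x. \<bar>F x - \<psi> x\<bar>))"
      using i1 i2 by simp
    also have "(LBINT x. \<bar>F (x - t n) - \<psi> (x - t n)\<bar>) = (LBINT x. \<bar>F x - \<psi> x\<bar>)"
      by (rule integral_translate[of "\<lambda>x. \<bar>F x - \<psi> x\<bar>"])
    also have "\<dots> + ((LBINT x. \<bar>\<psi> (x - t n) - \<psi> x\<bar>) + (LBINT x. \<bar>F x - \<psi> x\<bar>)) < e"
      using \<psi>e n1[OF \<open>n1 \<le> n\<close>] by simp
    finally show "norm ((LBINT x. \<bar>F (x - t n) - F x\<bar>) - 0) < e"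
      by simp
  qed
qed

subsection \<open>Fourier transforms, Plancherel and Fourier synthesis\<close>

text \<open>The form in which most exchanges of integrals below are justified: one integrable factor
  in each variable, and a bounded joint factor such as a cosine or an exponential.\<close>

lemma (in pair_sigma_finite) integrable_product_bounded:
  fixes f g :: "_ \<Rightarrow> 'c::{real_normed_field,banach,second_countable_topology}"
  assumes f: "integrable M1 f" and g: "integrable M2 g"
    and h[measurable]: "case_prod h \<in> borel_measurable (M1 \<Otimes>\<^sub>M M2)" and B: "\<And>x y. norm (h x y) \<le> B"
  shows "integrable (M1 \<Otimes>\<^sub>M M2) (\<lambda>(x, y). f x * g y * h x y)"
proof -
  have [measurable]: "f \<in> borel_measurable M1" "g \<in> borel_measurable M2"
    using f g by auto
  have "integrable (M1 \<Otimes>\<^sub>M M2) (\<lambda>p. f (fst p) * g (snd p))"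
  proof (rule Fubini_integrable)
    show "integrable M1 (\<lambda>x. \<integral>y. norm (f (fst (x, y)) * g (snd (x, y))) \<partial>M2)"
      using f by (simp add: norm_mult)
    show "AE x in M1. integrable M2 (\<lambda>y. f (fst (x, y)) * g (snd (x, y)))"
      using g by simp
  qed measurable
  then have i: "integrable (M1 \<Otimes>\<^sub>M M2) (\<lambda>p. B *\<^sub>R (f (fst p) * g (snd p)))" by simp
  show ?thesis
  proof (rule Bochner_Integration.integrable_bound[OF i])
    have B0: "0 \<le> B" using B norm_ge_zero order_trans by blast
    have "norm (f x * g y * h x y) \<le> norm (B *\<^sub>R (f x * g y))" for x y
      using mult_left_mono[OF B[of x y], of "norm (f x * g y)"] B0 by (simp add: norm_mult mult_ac)
    then show "AE x in M1 \<Otimes>\<^sub>M M2. norm (case x of (x, y) \<Rightarrow> f x * g y * h x y) \<le> norm (B *\<^sub>R (f (fst x) * g (snd x)))"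
      by (auto split: prod.split)
  qed measurable
qed

lemma integrable_mult_bounded:
  fixes f h :: "'b \<Rightarrow> 'c::{real_normed_field,banach,second_countable_topology}"
  assumes f: "integrable N f" and [measurable]: "h \<in> borel_measurable N" and B: "\<And>x. norm (h x) \<le> B"
  shows "integrable N (\<lambda>x. f x * h x)"
proof (rule Bochner_Integration.integrable_bound[of N "\<lambda>x. B *\<^sub>R f x"])
  have B0: "0 \<le> B" using B norm_ge_zero order_trans by blast
  show "AE x in N. norm (f x * h x) \<le> norm (B *\<^sub>R f x)"
    using mult_left_mono[OF B, of "norm (f _)"] B0 by (auto simp: norm_mult mult_ac)
qed (use f in auto)

section \<open>Smoothing at a given scale and approximate identities\<close>

text \<open>Convolution of F with \<open>k (u / \<eta>) / \<eta>\<close>, after the substitution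
  that moves the scale into the argument of F.\<close>

definition smooth :: "(real \<Rightarrow> real) \<Rightarrow> real \<Rightarrow> (real \<Rightarrow> real) \<Rightarrow> real \<Rightarrow> real" where
  "smooth k \<eta> F x = (LBINT u. k u * F (x - \<eta> * u))"

lemma smooth_measurable [measurable]:
  assumes [measurable]: "k \<in> borel_measurable borel" "F \<in> borel_measurable borel"
  shows "smooth k \<eta> F \<in> borel_measurable borel"
  unfolding smooth_def by measurable

lemma smooth_bounded:
  assumes k: "integrable lborel k" and [measurable]: "F \<in> borel_measurable borel" and B: "\<And>x. \<bar>F x\<bar> \<le> B"
  shows "\<bar>smooth k \<eta> F x\<bar> \<le> B * (LBINT u. \<bar>k u\<bar>)"
proof -
  have [measurable]: "k \<in> borel_measurable borel" using borel_measurable_integrable[OF k] by simp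
  have "\<bar>smooth k \<eta> F x\<bar> \<le> (LBINT u. \<bar>k u * F (x - \<eta> * u)\<bar>)"
    unfolding smooth_def by (rule integral_abs_bound)
  also have "\<dots> \<le> (LBINT u. B * \<bar>k u\<bar>)"
  proof (rule integral_mono)
    show "integrable lborel (\<lambda>u. \<bar>k u * F (x - \<eta> * u)\<bar>)"
      using integrable_mult_bounded[OF k, of "\<lambda>u. F (x - \<eta> * u)" B] B by auto
    show "\<bar>k u * F (x - \<eta> * u)\<bar> \<le> B * \<bar>k u\<bar>" for u
      using mult_left_mono[OF B[of "x - \<eta> * u"], of "\<bar>k u\<bar>"] by (simp add: abs_mult mult_ac)
  qed (use k in simp)
  finally show ?thesis by simp
qed

text \<open>As k integrates to 1, \<open>smooth k \<eta> F x - F x\<close> is the average over u,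
  with the possibly signed weight k, of \<open>F (x - \<eta> * u) - F x\<close>. Fubini then gives
  the integral form of Minkowski's inequality. The last claim bounds the inner integral
  independently of the shift and provides the dominating function for the limit of small
  \<eta>.\<close>

lemma smooth_diff_L1:
  assumes k: "integrable lborel k" "(LBINT u. k u) = 1"
    and F: "integrable lborel F" and B: "\<And>x. \<bar>F x\<bar> \<le> B"
  shows "integrable lborel (\<lambda>x. smooth k \<eta> F x - F x)"
    and "(LBINT x. \<bar>smooth k \<eta> F x - F x\<bar>) \<le> (LBINT u. \<bar>k u\<bar> * (LBINT x. \<bar>F (x - \<eta> * u) - F x\<bar>))"
    and "integrable lborel (\<lambda>u. \<bar>k u\<bar> * (LBINT x. \<bar>F (x - \<eta> * u) - F x\<bar>))"
    and "(LBINT x. \<bar>F (x - t) - F x\<bar>) \<le> 2 * (LBINT x. \<bar>F x\<bar>)"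
proof -
  have [measurable]: "k \<in> borel_measurable borel" "F \<in> borel_measurable borel"
    using borel_measurable_integrable[OF k(1)] borel_measurable_integrable[OF F] by simp_all
  have Ft: "integrable lborel (\<lambda>x. F (x - t))" for t by (rule integrable_translate[OF F])
  show om: "(LBINT x. \<bar>F (x - t) - F x\<bar>) \<le> 2 * (LBINT x. \<bar>F x\<bar>)" for t
  proof -
    have "(LBINT x. \<bar>F (x - t) - F x\<bar>) \<le> (LBINT x. \<bar>F (x - t)\<bar> + \<bar>F x\<bar>)"
      by (rule integral_mono) (use Ft F in auto)
    also have "\<dots> = 2 * (LBINT x. \<bar>F x\<bar>)"
      using Ft[of t] F integral_translate[of "\<lambda>x. \<bar>F x\<bar>" t] by simp
    finally show ?thesis .
  qed
  show iu: "integrable lborel (\<lambda>u. \<bar>k u\<bar> * (LBINT x. \<bar>F (x - \<eta> * u) - F x\<bar>))"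
    by (rule integrable_mult_bounded[where B="2 * (LBINT x. \<bar>F x\<bar>)"]) (use k om in auto)
  define f where "f = (\<lambda>(u, x). k u * (F (x - \<eta> * u) - F x))"
  have [measurable]: "f \<in> borel_measurable (lborel \<Otimes>\<^sub>M lborel)"
    unfolding f_def by measurable
  have fi: "integrable (lborel \<Otimes>\<^sub>M lborel) f"
  proof (rule lborel_pair.Fubini_integrable)
    show "integrable lborel (\<lambda>u. \<integral>x. norm (f (u, x)) \<partial>lborel)"
      using iu by (simp add: f_def abs_mult)
    show "AE u in lborel. integrable lborel (\<lambda>x. f (u, x))"
      using Ft F by (auto simp: f_def)
  qed measurable
  have eq: "(LBINT u. f (u, x)) = smooth k \<eta> F x - F x" for x
  proof -
    have "integrable lborel (\<lambda>u. k u * F (x - \<eta> * u))"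
      by (rule integrable_mult_bounded[OF k(1), where B=B]) (use B in auto)
    then have "(LBINT u. k u * F (x - \<eta> * u) - k u * F x) = smooth k \<eta> F x - F x"
      using k by (subst Bochner_Integration.integral_diff) (auto simp: smooth_def)
    then show ?thesis by (simp add: f_def algebra_simps)
  qed
  show "integrable lborel (\<lambda>x. smooth k \<eta> F x - F x)"
    using lborel_pair.integrable_snd[of "\<lambda>u x. f (u, x)"] fi by (simp add: eq)
  have ni: "integrable (lborel \<Otimes>\<^sub>M lborel) (\<lambda>(u, x). norm (f (u, x)))"
    using fi by (simp add: split_beta')
  have "(LBINT x. \<bar>smooth k \<eta> F x - F x\<bar>) \<le> (LBINT x. (LBINT u. norm (f (u, x))))"
  proof (rule integral_mono)
    show "integrable lborel (\<lambda>x. \<bar>smooth k \<eta> F x - F x\<bar>)"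
      using lborel_pair.integrable_snd[of "\<lambda>u x. f (u, x)"] fi by (simp add: eq)
    show "integrable lborel (\<lambda>x. \<integral>u. norm (f (u, x)) \<partial>lborel)"
      using lborel_pair.integrable_snd[OF ni] .
    show "\<bar>smooth k \<eta> F x - F x\<bar> \<le> (LBINT u. norm (f (u, x)))" for x
      unfolding eq[symmetric] using integral_norm_bound[of lborel "\<lambda>u. f (u, x)"] by simp
  qed
  also have "\<dots> = (LBINT u. (LBINT x. norm (f (u, x))))"
    by (rule lborel_pair.Fubini_integral[OF ni])
  finally show "(LBINT x. \<bar>smooth k \<eta> F x - F x\<bar>) \<le> (LBINT u. \<bar>k u\<bar> * (LBINT x. \<bar>F (x - \<eta> * u) - F x\<bar>))"
    by (simp add: f_def abs_mult)
qed

lemma approximate_identity: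
  assumes k: "integrable lborel k" "(LBINT u. k u) = 1"
    and F: "integrable lborel F" and B: "\<And>x. \<bar>F x\<bar> \<le> B" and \<eta>: "\<eta> \<longlonglongrightarrow> 0"
  shows "(\<lambda>n. \<integral>x. \<bar>smooth k (\<eta> n) F x - F x\<bar> \<partial>lborel) \<longlonglongrightarrow> 0"
proof -
  have [measurable]: "k \<in> borel_measurable borel" "F \<in> borel_measurable borel"
    using borel_measurable_integrable[OF k(1)] borel_measurable_integrable[OF F] by simp_all
  have "(\<lambda>n. \<integral>u. \<bar>k u\<bar> * (LBINT x. \<bar>F (x - \<eta> n * u) - F x\<bar>) \<partial>lborel) \<longlonglongrightarrow> (LBINT u. \<bar>k u\<bar> * 0)"
  proof (rule integral_dominated_convergence[where w="\<lambda>u. \<bar>k u\<bar> * (2 * (LBINT x. \<bar>F x\<bar>))"])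
    show "AE u in lborel. (\<lambda>n. \<bar>k u\<bar> * (LBINT x. \<bar>F (x - \<eta> n * u) - F x\<bar>)) \<longlonglongrightarrow> \<bar>k u\<bar> * 0"
      by (intro AE_I2 tendsto_intros L1_translation_continuous F tendsto_mult_left_zero \<eta>)
    show "AE u in lborel. norm (\<bar>k u\<bar> * (LBINT x. \<bar>F (x - \<eta> n * u) - F x\<bar>))
         \<le> \<bar>k u\<bar> * (2 * (LBINT x. \<bar>F x\<bar>))" for n
      using smooth_diff_L1(4)[OF k F B] by (auto intro!: mult_left_mono simp: abs_mult)
  qed (use k in auto)
  then have "(\<lambda>n. \<integral>u. \<bar>k u\<bar> * (LBINT x. \<bar>F (x - \<eta> n * u) - F x\<bar>) \<partial>lborel) \<longlonglongrightarrow> 0" by simp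
  then show ?thesis
    by (rule real_tendsto_sandwich[OF _ _ tendsto_const, rotated 2])
       (use smooth_diff_L1(2)[OF k F B] in auto)
qed

section \<open>Fourier inversion and Plancherel for bounded integrable functions\<close>

text \<open>Abstracts from the two kernels in use, the Gaussian and K, so that the formulas for
  smoothing cover both. Inversion is asked for only almost everywhere, since K may be altered on a
  null set without changing its transform.\<close>

definition cos_inversion :: "(real \<Rightarrow> real) \<Rightarrow> (real \<Rightarrow> real) \<Rightarrow> bool" where
  "cos_inversion k \<kappa> \<longleftrightarrow> integrable lborel \<kappa> \<and>
     (AE u in lborel. k u = 1 / (2 * pi) * (LBINT t. \<kappa> t * cos (t * u)))"

lemma gauss_cos: "(LBINT x. std_normal_density x * cos (t * x)) = exp (- t\<^sup>2 / 2)"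
proof -
  interpret real_distribution std_normal_distribution by (rule real_dist_normal_dist)
  have "complex_of_real (exp (- t\<^sup>2 / 2)) = (CLINT x|std_normal_distribution. iexp (t * x))"
    using char_std_normal_distribution by (simp add: char_def fun_eq_iff)
  then have "exp (- t\<^sup>2 / 2) = Re (CLINT x|std_normal_distribution. iexp (t * x))"
    by (metis Re_complex_of_real)
  also have "\<dots> = (\<integral>x. Re (iexp (t * x)) \<partial>std_normal_distribution)"
    by (rule integral_Re[symmetric]) (auto intro!: integrable_iexp)
  also have "\<dots> = (LBINT x. std_normal_density x * cos (t * x))"
    by (subst integral_density) (auto simp: Re_exp normal_density_nonneg)
  finally show ?thesis by simp
qed

lemma integrable_gauss: "integrable lborel (\<lambda>t. exp (- t\<^sup>2 / 2) :: real)"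
proof -
  have "integrable lborel (\<lambda>t. sqrt (2 * pi) * std_normal_density t)"
    by (intro integrable_mult_right integrable_normal_density) simp
  then show ?thesis by (simp add: std_normal_density_def)
qed

lemma gauss_cos_inversion: "cos_inversion std_normal_density (\<lambda>t. exp (- t\<^sup>2 / 2))"
proof -
  have "std_normal_density u = 1 / (2 * pi) * (LBINT t. exp (- t\<^sup>2 / 2) * cos (t * u))" for u
  proof -
    have "(LBINT t. exp (- t\<^sup>2 / 2) * cos (t * u)) = (LBINT t. sqrt (2 * pi) * (std_normal_density t * cos (u * t)))"
      by (rule Bochner_Integration.integral_cong) (auto simp: std_normal_density_def mult_ac)
    also have "\<dots> = sqrt (2 * pi) * exp (- u\<^sup>2 / 2)"
      by (simp add: gauss_cos)
    finally show ?thesis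
      by (simp add: std_normal_density_def field_simps)
  qed
  then show ?thesis
    using integrable_gauss unfolding cos_inversion_def by blast
qed

text \<open>The inversion formula enters under an integral over u, so its exceptional null set is
  harmless and the identity holds at every x.\<close>

lemma smooth_fourier:
  assumes k: "cos_inversion k \<kappa>" "k \<in> borel_measurable borel" and F: "integrable lborel F" and h: "0 < h"
  shows "smooth k h F x = 1 / (2 * pi) * (LBINT t. \<kappa> (h * t) * (LBINT y. F y * cos (t * (x - y))))"
proof -
  have \<kappa>: "integrable lborel \<kappa>" and kae: "AE u in lborel. k u = 1 / (2 * pi) * (LBINT t. \<kappa> t * cos (t * u))"
    using k by (auto simp: cos_inversion_def)
  have [measurable]: "\<kappa> \<in> borel_measurable borel" "F \<in> borel_measurable borel" "k \<in> borel_measurable borel"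
    using borel_measurable_integrable[OF \<kappa>] borel_measurable_integrable[OF F] k by simp_all
  have Fx: "integrable lborel (\<lambda>u. F (x - h * u))"
    using lborel_integrable_real_affine[OF F, of "-h" x] h by simp
  have pi: "integrable (lborel \<Otimes>\<^sub>M lborel) (\<lambda>(t, u). \<kappa> t * F (x - h * u) * cos (t * u))"
    by (rule lborel_pair.integrable_product_bounded[OF \<kappa> Fx, where B=1]) auto
  have "smooth k h F x = (LBINT u. 1 / (2 * pi) * (LBINT t. \<kappa> t * cos (t * u)) * F (x - h * u))"
    unfolding smooth_def by (rule integral_cong_AE) (use kae in auto)
  also have "\<dots> = 1 / (2 * pi) * (LBINT u. (LBINT t. \<kappa> t * F (x - h * u) * cos (t * u)))"
    by (subst integral_mult_right_zero[symmetric], rule Bochner_Integration.integral_cong)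
       (auto simp: mult_ac simp flip: integral_mult_left_zero integral_mult_right_zero)
  also have "(LBINT u. (LBINT t. \<kappa> t * F (x - h * u) * cos (t * u))) =
      (LBINT t. (LBINT u. \<kappa> t * F (x - h * u) * cos (t * u)))"
    using lborel_pair.Fubini_integral[OF pi] by simp
  also have "\<dots> = (LBINT t. \<kappa> t * (1 / h * (LBINT y. F y * cos (t * ((x - y) / h)))))"
  proof (rule Bochner_Integration.integral_cong[OF refl])
    fix t
    have "(LBINT y. F y * cos (t * ((x - y) / h))) = h * (LBINT u. F (x - h * u) * cos (t * u))"
      using lborel_integral_real_affine[of "-h" "\<lambda>y. F y * cos (t * ((x - y) / h))" x] h by simp
    then show "(LBINT u. \<kappa> t * F (x - h * u) * cos (t * u)) = \<kappa> t * (1 / h * (LBINT y. F y * cos (t * ((x - y) / h))))"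
      using h by (simp add: mult.assoc)
  qed
  also have "\<dots> = (LBINT t. \<kappa> (h * t) * (LBINT y. F y * cos (t * (x - y))))"
  proof -
    define G where "G t = (LBINT y. F y * cos (t * (x - y)))" for t
    have "(LBINT y. F y * cos (t * ((x - y) / h))) = G (t / h)" for t
      by (simp add: G_def)
    then have "(LBINT t. \<kappa> t * (1 / h * (LBINT y. F y * cos (t * ((x - y) / h)))))
        = (LBINT t. \<kappa> t * (1 / h * G (t / h)))" by simp
    also have "\<dots> = h * (LBINT t. \<kappa> (h * t) * (1 / h * G t))"
      using lborel_integral_real_affine[of h "\<lambda>t. \<kappa> t * (1 / h * G (t / h))" 0] h by simp
    also have "\<dots> = (LBINT t. h * (\<kappa> (h * t) * (1 / h * G t)))"
      by (rule integral_mult_right_zero[symmetric])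
    also have "\<dots> = (LBINT t. \<kappa> (h * t) * G t)"
      using h by (intro Bochner_Integration.integral_cong) auto
    finally show ?thesis by (simp add: G_def)
  qed
  finally show ?thesis .
qed


lemma cmod_integrable_iexp:
  assumes F: "integrable lborel F"
  shows "integrable lborel (\<lambda>x. iexp (x * t) * complex_of_real (F x))"
proof -
  have "integrable lborel (\<lambda>x. complex_of_real (F x) * iexp (x * t))"
    by (rule integrable_mult_bounded[where B=1]) (use F in auto)
  then show ?thesis by (simp add: mult.commute)
qed

lemma fourier_Re_Im:
  assumes F: "integrable lborel F"
  shows "Re (fourier F t) = (LBINT x. F x * cos (t * x))"
    and "Im (fourier F t) = (LBINT x. F x * sin (t * x))"
proof -
  have "Re (fourier F t) = (LBINT x. Re (iexp (x * t) * complex_of_real (F x)))"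
    unfolding fourier_def by (rule integral_Re[symmetric]) (rule cmod_integrable_iexp[OF F])
  then show "Re (fourier F t) = (LBINT x. F x * cos (t * x))"
    by (simp add: Re_exp mult_ac)
  have "Im (fourier F t) = (LBINT x. Im (iexp (x * t) * complex_of_real (F x)))"
    unfolding fourier_def by (rule integral_Im[symmetric]) (rule cmod_integrable_iexp[OF F])
  then show "Im (fourier F t) = (LBINT x. F x * sin (t * x))"
    by (simp add: Im_exp mult_ac)
qed

lemma fourier_measurable [measurable]:
  assumes [measurable]: "F \<in> borel_measurable borel"
  shows "fourier F \<in> borel_measurable borel"
  unfolding fourier_def by measurable

lemma cmod_fourier_le:
  assumes F: "integrable lborel F"
  shows "cmod (fourier F t) \<le> (LBINT x. \<bar>F x\<bar>)"
proof -
  have "cmod (fourier F t) \<le> (LBINT x. cmod (iexp (x * t) * complex_of_real (F x)))"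
    unfolding fourier_def by (rule integral_norm_bound)
  then show ?thesis by (simp add: norm_mult)
qed

lemma integral_cos_shift:
  assumes F: "integrable lborel F"
  shows "(LBINT y. F y * cos (t * (x - y))) = cos (t * x) * Re (fourier F t) + sin (t * x) * Im (fourier F t)"
proof -
  have i: "integrable lborel (\<lambda>y. F y * cos (t * y))" "integrable lborel (\<lambda>y. F y * sin (t * y))"
    by (rule integrable_mult_bounded[OF F, where B=1]; simp)+
  have "(LBINT y. F y * cos (t * (x - y)))
      = (LBINT y. cos (t * x) * (F y * cos (t * y)) + sin (t * x) * (F y * sin (t * y)))"
    by (rule Bochner_Integration.integral_cong) (auto simp: algebra_simps cos_diff)
  also have "\<dots> = cos (t * x) * Re (fourier F t) + sin (t * x) * Im (fourier F t)"
    using i by (simp add: fourier_Re_Im[OF F])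
  finally show ?thesis .
qed

text \<open>Gaussian smoothing of K at scale \<open>\<eta> n\<close> converges to K in L1. It also
  converges at every point to the inverse transform \<open>K0\<close>, by dominated convergence,
  because the transform of K is integrable. Fatou's lemma shows that the two limits differ by a
  function of integral zero. The sine part is absent because K is even.\<close>

lemma kernel_cos_inversion:
  assumes K: "integrable lborel K" "\<And>x. K (- x) = K x" and B: "\<And>x. \<bar>K x\<bar> \<le> B"
    and Kf: "integrable lborel (\<lambda>t. Re (fourier K t))"
  shows "cos_inversion K (\<lambda>t. Re (fourier K t))"
proof -
  define \<kappa> where "\<kappa> t = Re (fourier K t)" for t
  define K0 where "K0 x = 1 / (2 * pi) * (LBINT t. \<kappa> t * cos (t * x))" for x
  define \<eta> where "\<eta> n = 1 / real (Suc n)" for n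
  have [measurable]: "K \<in> borel_measurable borel" "\<kappa> \<in> borel_measurable borel"
    using borel_measurable_integrable[OF K(1)] unfolding \<kappa>_def by auto
  have [measurable]: "K0 \<in> borel_measurable borel" unfolding K0_def by measurable
  have \<eta>0: "\<eta> \<longlonglongrightarrow> 0" unfolding \<eta>_def using LIMSEQ_Suc[OF lim_1_over_n] by simp
  have im0: "Im (fourier K t) = 0" for t
  proof -
    have "(LBINT x. K x * sin (t * x)) = (LBINT x. K (-x) * sin (t * (-x)))"
      using lborel_integral_real_affine[of "-1" "\<lambda>x. K x * sin (t * x)" 0] by simp
    then show ?thesis by (simp add: fourier_Re_Im[OF K(1)] K(2))
  qed
  have sm: "smooth std_normal_density (\<eta> n) K x = 1 / (2 * pi) * (LBINT t. exp (- (\<eta> n * t)\<^sup>2 / 2) * (\<kappa> t * cos (t * x)))" for n x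
    by (subst smooth_fourier[OF gauss_cos_inversion _ K(1)])
       (auto simp: \<eta>_def integral_cos_shift[OF K(1)] im0 \<kappa>_def mult_ac)
  have lim: "(\<lambda>n. smooth std_normal_density (\<eta> n) K x) \<longlonglongrightarrow> K0 x" for x
    unfolding sm K0_def
  proof (intro tendsto_mult tendsto_const integral_dominated_convergence[where w="\<lambda>t. \<bar>\<kappa> t\<bar>"])
    show "AE t in lborel. (\<lambda>n. exp (- (\<eta> n * t)\<^sup>2 / 2) * (\<kappa> t * cos (t * x))) \<longlonglongrightarrow> \<kappa> t * cos (t * x)"
    proof (rule AE_I2)
      fix t
      have "(\<lambda>n. exp (- (\<eta> n * t)\<^sup>2 / 2) * (\<kappa> t * cos (t * x))) \<longlonglongrightarrow> exp (- (0 * t)\<^sup>2 / 2) * (\<kappa> t * cos (t * x))"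
        by (intro tendsto_intros \<eta>0) simp
      then show "(\<lambda>n. exp (- (\<eta> n * t)\<^sup>2 / 2) * (\<kappa> t * cos (t * x))) \<longlonglongrightarrow> \<kappa> t * cos (t * x)" by simp
    qed
    show "AE t in lborel. norm (exp (- (\<eta> n * t)\<^sup>2 / 2) * (\<kappa> t * cos (t * x))) \<le> \<bar>\<kappa> t\<bar>" for n
    proof (rule AE_I2)
      fix t
      have "\<bar>exp (- (\<eta> n * t)\<^sup>2 / 2) * cos (t * x)\<bar> \<le> 1 * 1"
        unfolding abs_mult by (intro mult_mono) auto
      then show "norm (exp (- (\<eta> n * t)\<^sup>2 / 2) * (\<kappa> t * cos (t * x))) \<le> \<bar>\<kappa> t\<bar>"
        using mult_left_mono[of "\<bar>exp (- (\<eta> n * t)\<^sup>2 / 2) * cos (t * x)\<bar>" 1 "\<bar>\<kappa> t\<bar>"] by (simp add: abs_mult mult_ac)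
    qed
  qed (use Kf in \<open>auto simp: \<kappa>_def\<close>)
  have ap: "(\<lambda>n. \<integral>x. \<bar>smooth std_normal_density (\<eta> n) K x - K x\<bar> \<partial>lborel) \<longlonglongrightarrow> 0"
    by (rule approximate_identity[OF _ _ K(1) B \<eta>0]) auto
  have int: "integrable lborel (\<lambda>x. smooth std_normal_density (\<eta> n) K x - K x)" for n
    by (rule smooth_diff_L1(1)[OF _ _ K(1) B]) auto
  have "(\<integral>\<^sup>+x. ennreal \<bar>K0 x - K x\<bar> \<partial>lborel)
      = (\<integral>\<^sup>+x. liminf (\<lambda>n. ennreal \<bar>smooth std_normal_density (\<eta> n) K x - K x\<bar>) \<partial>lborel)"
  proof (rule nn_integral_cong)
    fix x
    have "(\<lambda>n. ennreal \<bar>smooth std_normal_density (\<eta> n) K x - K x\<bar>) \<longlonglongrightarrow> ennreal \<bar>K0 x - K x\<bar>"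
      by (intro tendsto_ennrealI tendsto_intros lim)
    then show "ennreal \<bar>K0 x - K x\<bar> = liminf (\<lambda>n. ennreal \<bar>smooth std_normal_density (\<eta> n) K x - K x\<bar>)"
      by (rule lim_imp_Liminf[OF trivial_limit_sequentially, symmetric])
  qed
  also have "\<dots> \<le> liminf (\<lambda>n. \<integral>\<^sup>+x. ennreal \<bar>smooth std_normal_density (\<eta> n) K x - K x\<bar> \<partial>lborel)"
    by (rule nn_integral_liminf) measurable
  also have "\<dots> = liminf (\<lambda>n. ennreal (LBINT x. \<bar>smooth std_normal_density (\<eta> n) K x - K x\<bar>))"
    using int by (simp add: nn_integral_eq_integral)
  also have "\<dots> = 0"
    using tendsto_ennrealI[OF ap] by (simp add: lim_imp_Liminf)
  finally have "(\<integral>\<^sup>+x. ennreal \<bar>K0 x - K x\<bar> \<partial>lborel) = 0" by simp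
  then have "AE x in lborel. ennreal \<bar>K0 x - K x\<bar> = 0"
    by (subst (asm) nn_integral_0_iff_AE) auto
  then have "AE x in lborel. K x = K0 x" by eventually_elim simp
  then show ?thesis
    using Kf by (simp add: cos_inversion_def K0_def \<kappa>_def)
qed

lemma cmod_fourier_square_eq:
  assumes F: "integrable lborel F"
  shows "(LBINT x. F x * (LBINT y. F y * cos (t * (x - y)))) = (cmod (fourier F t))\<^sup>2"
proof -
  have i: "integrable lborel (\<lambda>y. F y * cos (t * y))" "integrable lborel (\<lambda>y. F y * sin (t * y))"
    by (rule integrable_mult_bounded[OF F, where B=1]; simp)+
  have "(LBINT x. F x * (LBINT y. F y * cos (t * (x - y))))
     = (LBINT x. Re (fourier F t) * (F x * cos (t * x)) + Im (fourier F t) * (F x * sin (t * x)))"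
    unfolding integral_cos_shift[OF F] by (simp add: algebra_simps)
  also have "\<dots> = (Re (fourier F t))\<^sup>2 + (Im (fourier F t))\<^sup>2"
    using i by (simp add: fourier_Re_Im[OF F] power2_eq_square)
  finally show ?thesis by (simp add: cmod_power2)
qed

text \<open>Plancherel's identity with an additional integrable factor
  \<open>\<kappa> (h * t)\<close>, which makes all integrals absolutely convergent. For the
  Gaussian, h is sent to 0 in \<open>plancherel\<close>; for K the factor stays and describes the
  smoothed divergence.\<close>

lemma smooth_quadratic:
  assumes k: "cos_inversion k \<kappa>" "k \<in> borel_measurable borel" and F: "integrable lborel F" and h: "0 < h"
  shows "(LBINT x. F x * smooth k h F x) = 1 / (2 * pi) * (LBINT t. \<kappa> (h * t) * (cmod (fourier F t))\<^sup>2)"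
proof -
  have \<kappa>: "integrable lborel \<kappa>" using k by (auto simp: cos_inversion_def)
  have [measurable]: "\<kappa> \<in> borel_measurable borel" "F \<in> borel_measurable borel"
    using borel_measurable_integrable[OF \<kappa>] borel_measurable_integrable[OF F] by simp_all
  have \<kappa>h: "integrable lborel (\<lambda>t. \<kappa> (h * t))"
    using lborel_integrable_real_affine[OF \<kappa>, of h 0] h by simp
  have bd: "\<bar>\<integral>y. F y * cos (t * (x - y)) \<partial>lborel\<bar> \<le> (LBINT y. \<bar>F y\<bar>)" for t x
  proof -
    have "\<bar>\<integral>y. F y * cos (t * (x - y)) \<partial>lborel\<bar> \<le> (LBINT y. \<bar>F y * cos (t * (x - y))\<bar>)"
      by (rule integral_abs_bound)
    also have "\<dots> \<le> (LBINT y. \<bar>F y\<bar>)"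
    proof (rule integral_mono)
      show "integrable lborel (\<lambda>y. \<bar>F y * cos (t * (x - y))\<bar>)"
        using integrable_mult_bounded[OF F, of "\<lambda>y. cos (t * (x - y))" 1] by auto
      show "\<bar>F y * cos (t * (x - y))\<bar> \<le> \<bar>F y\<bar>" for y
        by (simp add: abs_mult mult_left_le)
    qed (use F in simp)
    finally show ?thesis .
  qed
  have pi: "integrable (lborel \<Otimes>\<^sub>M lborel) (\<lambda>(x, t). F x * \<kappa> (h * t) * (LBINT y. F y * cos (t * (x - y))))"
    by (rule lborel_pair.integrable_product_bounded[OF F \<kappa>h, where B="\<integral>y. \<bar>F y\<bar> \<partial>lborel"]) (use bd in auto)
  have "(LBINT x. F x * smooth k h F x)
      = 1 / (2 * pi) * (LBINT x. (LBINT t. F x * \<kappa> (h * t) * (LBINT y. F y * cos (t * (x - y)))))"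
    by (subst integral_mult_right_zero[symmetric], rule Bochner_Integration.integral_cong)
       (simp_all add: smooth_fourier[OF k F h] mult.assoc)
  also have "(LBINT x. (LBINT t. F x * \<kappa> (h * t) * (LBINT y. F y * cos (t * (x - y)))))
     = (LBINT t. (LBINT x. F x * \<kappa> (h * t) * (LBINT y. F y * cos (t * (x - y)))))"
    using lborel_pair.Fubini_integral[OF pi] by simp
  also have "\<dots> = (LBINT t. \<kappa> (h * t) * (cmod (fourier F t))\<^sup>2)"
  proof (rule Bochner_Integration.integral_cong[OF refl])
    fix t
    have "(LBINT x. F x * \<kappa> (h * t) * (LBINT y. F y * cos (t * (x - y))))
       = (LBINT x. \<kappa> (h * t) * (F x * (LBINT y. F y * cos (t * (x - y)))))"
      by (simp add: mult_ac)
    then show "(LBINT x. F x * \<kappa> (h * t) * (LBINT y. F y * cos (t * (x - y)))) = \<kappa> (h * t) * (cmod (fourier F t))\<^sup>2"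
      by (simp only: integral_mult_right_zero cmod_fourier_square_eq[OF F])
  qed
  finally show ?thesis .
qed


text \<open>Gaussian case of \<open>smooth_quadratic\<close> with scale tending to 0. The left side
  tends to the integral of the square of F, since smoothing converges in L1 and F is bounded. On the
  right, Fatou first gives integrability of the squared transform, which then dominates the damped
  integrands and allows the passage to the limit.\<close>

lemma plancherel:
  assumes F: "integrable lborel F" and B: "\<And>x. \<bar>F x\<bar> \<le> B"
  shows "integrable lborel (\<lambda>t. (cmod (fourier F t))\<^sup>2)"
    and "(LBINT x. (F x)\<^sup>2) = 1 / (2 * pi) * (LBINT t. (cmod (fourier F t))\<^sup>2)"
proof -
  define \<eta> where "\<eta> n = 1 / real (Suc n)" for n
  have [measurable]: "F \<in> borel_measurable borel"
    using borel_measurable_integrable[OF F] by auto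
  have \<eta>0: "\<eta> \<longlonglongrightarrow> 0" unfolding \<eta>_def using LIMSEQ_Suc[OF lim_1_over_n] by simp
  have FF: "integrable lborel (\<lambda>x. (F x)\<^sup>2)"
    using integrable_mult_bounded[OF F, of F B] B by (simp add: power2_eq_square)
  define A where "A n = (LBINT t. exp (- (\<eta> n * t)\<^sup>2 / 2) * (cmod (fourier F t))\<^sup>2)" for n
  have sm: "(LBINT x. F x * smooth std_normal_density (\<eta> n) F x) = 1 / (2 * pi) * A n" for n
    unfolding A_def by (rule smooth_quadratic[OF gauss_cos_inversion _ F]) (auto simp: \<eta>_def)
  have dint: "integrable lborel (\<lambda>x. smooth std_normal_density (\<eta> n) F x - F x)" for n
    by (rule smooth_diff_L1(1)[OF _ _ F B]) auto
  have "(\<lambda>n. (LBINT x. F x * smooth std_normal_density (\<eta> n) F x) - (LBINT x. (F x)\<^sup>2)) \<longlonglongrightarrow> 0"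
  proof (rule Lim_null_comparison)
    show "(\<lambda>n. B * (LBINT x. \<bar>smooth std_normal_density (\<eta> n) F x - F x\<bar>)) \<longlonglongrightarrow> 0"
      by (intro tendsto_mult_right_zero approximate_identity[OF _ _ F B \<eta>0]) auto
    show "\<forall>\<^sub>F n in sequentially. norm ((LBINT x. F x * smooth std_normal_density (\<eta> n) F x) - (LBINT x. (F x)\<^sup>2))
        \<le> B * (LBINT x. \<bar>smooth std_normal_density (\<eta> n) F x - F x\<bar>)"
    proof (intro always_eventually allI)
      fix n
      have i1: "integrable lborel (\<lambda>x. (smooth std_normal_density (\<eta> n) F x - F x) * F x)"
        by (rule integrable_mult_bounded[OF dint, where B=B]) (use B in auto)
      then have i2: "integrable lborel (\<lambda>x. F x * smooth std_normal_density (\<eta> n) F x)"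
        using Bochner_Integration.integrable_add[OF i1 FF] by (simp add: algebra_simps power2_eq_square)
      have "norm ((LBINT x. F x * smooth std_normal_density (\<eta> n) F x) - (LBINT x. (F x)\<^sup>2))
         = \<bar>\<integral>x. (smooth std_normal_density (\<eta> n) F x - F x) * F x \<partial>lborel\<bar>"
        using i2 FF by (subst Bochner_Integration.integral_diff[symmetric]) (auto simp: algebra_simps power2_eq_square)
      also have "\<dots> \<le> (LBINT x. \<bar>(smooth std_normal_density (\<eta> n) F x - F x) * F x\<bar>)"
        by (rule integral_abs_bound)
      also have "\<dots> \<le> (LBINT x. B * \<bar>smooth std_normal_density (\<eta> n) F x - F x\<bar>)"
      proof (rule integral_mono)
        show "\<bar>(smooth std_normal_density (\<eta> n) F x - F x) * F x\<bar> \<le> B * \<bar>smooth std_normal_density (\<eta> n) F x - F x\<bar>" for x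
          using mult_right_mono[OF B[of x], of "\<bar>smooth std_normal_density (\<eta> n) F x - F x\<bar>"] by (simp add: abs_mult mult_ac)
      qed (use i1 dint in auto)
      finally show "norm ((LBINT x. F x * smooth std_normal_density (\<eta> n) F x) - (LBINT x. (F x)\<^sup>2))
        \<le> B * (LBINT x. \<bar>smooth std_normal_density (\<eta> n) F x - F x\<bar>)" by simp
    qed
  qed
  then have "(\<lambda>n. 1 / (2 * pi) * A n) \<longlonglongrightarrow> (LBINT x. (F x)\<^sup>2)"
    unfolding sm by (rule LIM_zero_cancel)
  then have "(\<lambda>n. (2 * pi) * (1 / (2 * pi) * A n)) \<longlonglongrightarrow> 2 * pi * (LBINT x. (F x)\<^sup>2)"
    by (intro tendsto_mult tendsto_const)
  then have A: "A \<longlonglongrightarrow> 2 * pi * (LBINT x. (F x)\<^sup>2)" by simp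
  have Ai: "integrable lborel (\<lambda>t. exp (- (\<eta> n * t)\<^sup>2 / 2) * (cmod (fourier F t))\<^sup>2)" for n
  proof (rule integrable_mult_bounded[where B="(LBINT x. \<bar>F x\<bar>)\<^sup>2"])
    show "integrable lborel (\<lambda>t. exp (- (\<eta> n * t)\<^sup>2 / 2) :: real)"
      using lborel_integrable_real_affine[OF integrable_gauss, of "\<eta> n" 0] by (simp add: \<eta>_def)
    show "norm ((cmod (fourier F t))\<^sup>2) \<le> (LBINT x. \<bar>F x\<bar>)\<^sup>2" for t
      using power_mono[OF cmod_fourier_le[OF F, of t], of 2] by simp
  qed measurable
  have elim: "(\<lambda>n. exp (- (\<eta> n * t)\<^sup>2 / 2) * (cmod (fourier F t))\<^sup>2) \<longlonglongrightarrow> (cmod (fourier F t))\<^sup>2" for t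
  proof -
    have "(\<lambda>n. exp (- (\<eta> n * t)\<^sup>2 / 2) * (cmod (fourier F t))\<^sup>2) \<longlonglongrightarrow> exp (- (0 * t)\<^sup>2 / 2) * (cmod (fourier F t))\<^sup>2"
      by (intro tendsto_intros \<eta>0) simp
    then show ?thesis by simp
  qed
  have "(\<integral>\<^sup>+t. ennreal ((cmod (fourier F t))\<^sup>2) \<partial>lborel)
      = (\<integral>\<^sup>+t. liminf (\<lambda>n. ennreal (exp (- (\<eta> n * t)\<^sup>2 / 2) * (cmod (fourier F t))\<^sup>2)) \<partial>lborel)"
    by (rule nn_integral_cong, rule lim_imp_Liminf[OF trivial_limit_sequentially, symmetric])
       (intro tendsto_ennrealI elim)
  also have "\<dots> \<le> liminf (\<lambda>n. \<integral>\<^sup>+t. ennreal (exp (- (\<eta> n * t)\<^sup>2 / 2) * (cmod (fourier F t))\<^sup>2) \<partial>lborel)"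
    by (rule nn_integral_liminf) measurable
  also have "\<dots> = liminf (\<lambda>n. ennreal (A n))"
    using Ai by (simp add: nn_integral_eq_integral A_def)
  also have "\<dots> = ennreal (2 * pi * (LBINT x. (F x)\<^sup>2))"
    by (rule lim_imp_Liminf[OF trivial_limit_sequentially]) (intro tendsto_ennrealI A)
  finally have "(\<integral>\<^sup>+t. ennreal ((cmod (fourier F t))\<^sup>2) \<partial>lborel) \<le> ennreal (2 * pi * (LBINT x. (F x)\<^sup>2))" .
  then show int: "integrable lborel (\<lambda>t. (cmod (fourier F t))\<^sup>2)"
    by (intro integrableI_bounded) (auto simp: less_top[symmetric] top_unique)
  have "A \<longlonglongrightarrow> (LBINT t. (cmod (fourier F t))\<^sup>2)"
    unfolding A_def
  proof (rule integral_dominated_convergence[where w="\<lambda>t. (cmod (fourier F t))\<^sup>2"])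
    show "AE t in lborel. norm (exp (- (\<eta> n * t)\<^sup>2 / 2) * (cmod (fourier F t))\<^sup>2) \<le> (cmod (fourier F t))\<^sup>2" for n
      by (rule AE_I2) (auto simp: abs_mult intro!: mult_left_le_one_le)
  qed (use int elim in auto)
  then have "2 * pi * (LBINT x. (F x)\<^sup>2) = (LBINT t. (cmod (fourier F t))\<^sup>2)"
    using A LIMSEQ_unique by blast
  then show "(LBINT x. (F x)\<^sup>2) = 1 / (2 * pi) * (LBINT t. (cmod (fourier F t))\<^sup>2)"
    by (simp add: field_simps)
qed

section \<open>Fourier synthesis of functions\<close>

text \<open>Taking the real part makes the synthesis a real function without any symmetry condition
  on \<Psi>, so a transform can be damped or cut off freely. The factor 1 / (2 pi) of the inverse
  transform is put into \<open>coft\<close> instead.\<close>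

definition synth :: "(real \<Rightarrow> complex) \<Rightarrow> real \<Rightarrow> real" where
  "synth \<Psi> x = Re (CLINT t|lborel. \<Psi> t * iexp (t * x))"

lemma synth_measurable [measurable]:
  assumes [measurable]: "\<Psi> \<in> borel_measurable borel"
  shows "synth \<Psi> \<in> borel_measurable borel"
  unfolding synth_def by measurable

lemma abs_synth_le: "\<bar>synth \<Psi> x\<bar> \<le> (LBINT t. cmod (\<Psi> t))"
proof -
  have "\<bar>synth \<Psi> x\<bar> \<le> cmod (CLINT t|lborel. \<Psi> t * iexp (t * x))"
    unfolding synth_def by (rule abs_Re_le_cmod)
  also have "\<dots> \<le> (LBINT t. cmod (\<Psi> t * iexp (t * x)))"
    by (rule integral_norm_bound)
  finally show ?thesis by (simp add: norm_mult)
qed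

text \<open>Duality. Restricted to [-R, R] the synthesis is integrable and bounded, so Plancherel
  applies to the restriction \<open>g R\<close>. By Fubini the squared norm of \<open>g R\<close> is
  the real part of the pairing of \<Psi> with the transform of \<open>g R\<close>; Cauchy-Schwarz
  bounds it by a product of norms, and one norm of \<open>g R\<close> cancels. Fatou removes the
  restriction.\<close>

lemma synth_L2_bound:
  assumes \<Psi>: "integrable lborel \<Psi>" and \<Psi>2: "integrable lborel (\<lambda>t. (cmod (\<Psi> t))\<^sup>2)"
  shows "integrable lborel (\<lambda>x. (synth \<Psi> x)\<^sup>2)"
    and "(LBINT x. (synth \<Psi> x)\<^sup>2) \<le> 2 * pi * (LBINT t. (cmod (\<Psi> t))\<^sup>2)"
proof -
  define G where "G = synth \<Psi>"
  define B where "B = (LBINT t. cmod (\<Psi> t))"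
  define Q where "Q = (LBINT t. (cmod (\<Psi> t))\<^sup>2)"
  have [measurable]: "\<Psi> \<in> borel_measurable borel"
    using borel_measurable_integrable[OF \<Psi>] by simp
  have [measurable]: "G \<in> borel_measurable borel" unfolding G_def by measurable
  have GB: "\<bar>G x\<bar> \<le> B" for x unfolding G_def B_def by (rule abs_synth_le)
  have Q0: "0 \<le> Q" by (simp add: Q_def)
  define g where "g R x = G x * indicator {-real R..real R} x" for R :: nat and x
  have [measurable]: "g R \<in> borel_measurable borel" for R unfolding g_def by measurable
  have gB: "\<bar>g R x\<bar> \<le> B" for R x
    using GB[of x] by (auto simp: g_def indicator_def)
  have gi: "integrable lborel (g R)" for R
    by (rule integrable_bounded_support[where B=B and R=R]) (use gB in \<open>auto simp: g_def indicator_def\<close>)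
  have gg: "(LBINT x. (g R x)\<^sup>2) \<le> 2 * pi * Q" for R
  proof -
    have pi: "integrable (lborel \<Otimes>\<^sub>M lborel) (\<lambda>(x, t). complex_of_real (g R x) * \<Psi> t * iexp (t * x))"
      by (rule lborel_pair.integrable_product_bounded[where B=1]) (use gi \<Psi> in auto)
    have "(LBINT x. (g R x)\<^sup>2) = (LBINT x. Re (CLINT t|lborel. complex_of_real (g R x) * \<Psi> t * iexp (t * x)))"
    proof (rule Bochner_Integration.integral_cong[OF refl])
      fix x
      have "(g R x)\<^sup>2 = g R x * G x" by (auto simp: g_def power2_eq_square indicator_def)
      also have "\<dots> = Re (complex_of_real (g R x) * (CLINT t|lborel. \<Psi> t * iexp (t * x)))"
        by (simp add: G_def synth_def)
      finally show "(g R x)\<^sup>2 = Re (CLINT t|lborel. complex_of_real (g R x) * \<Psi> t * iexp (t * x))"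
        by (simp add: mult.assoc)
    qed
    also have "\<dots> = Re (CLINT x|lborel. (CLINT t|lborel. complex_of_real (g R x) * \<Psi> t * iexp (t * x)))"
      using lborel_pair.integrable_fst[OF pi] by (rule integral_Re)
    also have "(CLINT x|lborel. (CLINT t|lborel. complex_of_real (g R x) * \<Psi> t * iexp (t * x)))
        = (CLINT t|lborel. (CLINT x|lborel. complex_of_real (g R x) * \<Psi> t * iexp (t * x)))"
      using lborel_pair.Fubini_integral[OF pi] by simp
    also have "\<dots> = (CLINT t|lborel. \<Psi> t * fourier (g R) t)"
      unfolding fourier_def by (rule Bochner_Integration.integral_cong)
        (auto simp: mult_ac simp flip: integral_mult_right_zero)
    also have "Re \<dots> \<le> cmod \<dots>" by (rule complex_Re_le_cmod)
    also have "\<dots> \<le> (LBINT t. \<bar>cmod (\<Psi> t) * cmod (fourier (g R) t)\<bar>)"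
      using integral_norm_bound[of lborel "\<lambda>t. \<Psi> t * fourier (g R) t"] by (simp add: norm_mult)
    finally have "(LBINT x. (g R x)\<^sup>2)\<^sup>2 \<le> (LBINT t. \<bar>cmod (\<Psi> t) * cmod (fourier (g R) t)\<bar>)\<^sup>2"
      by (intro power_mono) auto
    also have "\<dots> \<le> Q * (LBINT t. (cmod (fourier (g R) t))\<^sup>2)"
      unfolding Q_def
      by (rule cauchy_schwarz_integral) (use \<Psi>2 plancherel(1)[OF gi gB] in auto)
    also have "\<dots> = 2 * pi * Q * (LBINT x. (g R x)\<^sup>2)"
      using plancherel(2)[OF gi gB, of R] by (simp add: field_simps)
    finally have *: "(LBINT x. (g R x)\<^sup>2)\<^sup>2 \<le> 2 * pi * Q * (LBINT x. (g R x)\<^sup>2)" .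
    show ?thesis
    proof (cases "(LBINT x. (g R x)\<^sup>2) = 0")
      case True
      then show ?thesis using Q0 by simp
    next
      case False
      moreover have "0 \<le> (LBINT x. (g R x)\<^sup>2)" by simp
      ultimately have "0 < (LBINT x. (g R x)\<^sup>2)" by linarith
      then show ?thesis using * by (simp add: power2_eq_square)
    qed
  qed
  have g2: "integrable lborel (\<lambda>x. (g R x)\<^sup>2)" for R
    using integrable_mult_bounded[OF gi, of "g R" B R] gB by (simp add: power2_eq_square)
  have "(\<integral>\<^sup>+x. ennreal ((G x)\<^sup>2) \<partial>lborel) = (\<integral>\<^sup>+x. liminf (\<lambda>R. ennreal ((g R x)\<^sup>2)) \<partial>lborel)"
  proof (rule nn_integral_cong, rule lim_imp_Liminf[OF trivial_limit_sequentially, symmetric])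
    fix x
    obtain R0 :: nat where R0: "\<bar>x\<bar> \<le> real R0" using real_arch_simple by blast
    have "g R x = G x" if "R0 \<le> R" for R
    proof -
      have "\<bar>x\<bar> \<le> real R" using R0 that by linarith
      then show ?thesis by (auto simp: g_def indicator_def)
    qed
    then show "(\<lambda>R. ennreal ((g R x)\<^sup>2)) \<longlonglongrightarrow> ennreal ((G x)\<^sup>2)"
      by (intro tendsto_eventually eventually_sequentiallyI[of R0]) simp
  qed
  also have "\<dots> \<le> liminf (\<lambda>R. \<integral>\<^sup>+x. ennreal ((g R x)\<^sup>2) \<partial>lborel)"
    by (rule nn_integral_liminf) measurable
  also have "\<dots> \<le> liminf (\<lambda>R::nat. ennreal (2 * pi * Q))"
    by (intro Liminf_mono always_eventually allI) (simp add: nn_integral_eq_integral g2 gg ennreal_leI)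
  also have "\<dots> = ennreal (2 * pi * Q)" by (simp add: Liminf_const)
  finally have le: "(\<integral>\<^sup>+x. ennreal ((G x)\<^sup>2) \<partial>lborel) \<le> ennreal (2 * pi * Q)" .
  then show i: "integrable lborel (\<lambda>x. (synth \<Psi> x)\<^sup>2)"
    unfolding G_def[symmetric] by (intro integrableI_bounded) (auto simp: less_top[symmetric] top_unique)
  show "(LBINT x. (synth \<Psi> x)\<^sup>2) \<le> 2 * pi * (LBINT t. (cmod (\<Psi> t))\<^sup>2)"
    using le i Q0 unfolding G_def[symmetric] Q_def[symmetric] by (simp add: nn_integral_eq_integral)
qed

subsection \<open>Laws with an integrable characteristic function\<close>

text \<open>The integrand in Levy's inversion formula is at most the length of the interval times
  the modulus of the characteristic function. The formula requires endpoints of measure zero; atoms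
  are countably many, so every interval can be enlarged by an arbitrarily small amount to one with
  such endpoints. The factor 1 / (2 pi) is estimated by 1.\<close>

lemma (in real_distribution) measure_Icc_le_char:
  assumes int: "integrable lborel (\<lambda>t. cmod (char M t))" and cd: "c \<le> d"
  shows "measure M {c..d} \<le> (LBINT t. cmod (char M t)) * (d - c)"
proof -
  define L where "L = (LBINT t. cmod (char M t))"
  have L0: "0 \<le> L" by (simp add: L_def)
  have pi1: "1 / (2 * pi) \<le> 1" using pi_ge_two by (simp add: field_simps)
  have 1: "measure M {a<..b} \<le> L * (b - a)" if ab: "a \<le> b" "measure M {a} = 0" "measure M {b} = 0" for a b
  proof -
    define F where "F t = (iexp (-(t * a)) - iexp (-(t * b))) / (\<i> * t) * char M t" for t
    have [measurable]: "F \<in> borel_measurable borel"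
      unfolding F_def by measurable
    have Fb: "cmod (F t) \<le> (b - a) * cmod (char M t)" for t
    proof (cases "t = 0")
      \<comment> \<open>At t = 0 numerator and denominator both vanish and the quotient has the
        value 0.\<close>
      case True then show ?thesis using ab by (simp add: F_def)
    next
      case False
      have "cmod ((iexp (-(t * a)) - iexp (-(t * b))) / (\<i> * t)) = cmod ((iexp (-t * b) - iexp (-t * a)) / (\<i> * (-t)))"
        by (simp add: norm_divide norm_minus_commute norm_mult)
      also have "\<dots> \<le> b - a" using Levy_Inversion_aux2[of a b "-t"] ab False by simp
      finally show ?thesis unfolding F_def norm_mult by (intro mult_right_mono) auto
    qed
    have "(\<lambda>T::nat. 1 / (2 * pi) * (CLBINT t=-real T..real T. F t)) \<longlonglongrightarrow> complex_of_real (measure M {a<..b})"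
      using Levy_Inversion[OF ab] unfolding F_def by simp
    then have lim: "(\<lambda>T::nat. cmod (1 / (2 * pi) * (CLBINT t=-real T..real T. F t))) \<longlonglongrightarrow> cmod (complex_of_real (measure M {a<..b}))"
      by (rule tendsto_norm)
    have "cmod (1 / (2 * pi) * (CLBINT t=-real T..real T. F t)) \<le> L * (b - a)" for T :: nat
    proof -
      have "(CLBINT t=-real T..real T. F t) = (CLINT t|lborel. indicator {-real T<..<real T} t *\<^sub>R F t)"
        by (simp add: interval_lebesgue_integral_def set_lebesgue_integral_def einterval_eq)
      also have "cmod \<dots> \<le> (LBINT t. cmod (indicator {-real T<..<real T} t *\<^sub>R F t))"
        by (rule integral_norm_bound)
      also have "\<dots> \<le> (LBINT t. (b - a) * cmod (char M t))"
      proof (rule integral_mono)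
        show "integrable lborel (\<lambda>t. (b - a) * cmod (char M t))" using int by simp
        show le: "cmod (indicator {-real T<..<real T} t *\<^sub>R F t) \<le> (b - a) * cmod (char M t)" for t
          using Fb[of t] ab by (auto simp: indicator_def)
        show "integrable lborel (\<lambda>t. cmod (indicator {-real T<..<real T} t *\<^sub>R F t))"
          by (rule Bochner_Integration.integrable_bound[OF \<open>integrable lborel (\<lambda>t. (b - a) * cmod (char M t))\<close>])
             (use le ab in auto)
      qed
      finally have "cmod (CLBINT t=-real T..real T. F t) \<le> L * (b - a)"
        by (simp add: L_def mult.commute)
      moreover have "cmod (1 / (2 * pi) * (CLBINT t=-real T..real T. F t)) = 1 / (2 * pi) * cmod (CLBINT t=-real T..real T. F t)"
        by (simp add: norm_mult norm_divide)
      moreover have "\<dots> \<le> 1 * cmod (CLBINT t=-real T..real T. F t)"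
        using pi1 by (intro mult_right_mono) auto
      ultimately show ?thesis by simp
    qed
    then have "cmod (complex_of_real (measure M {a<..b})) \<le> L * (b - a)"
      by (intro LIMSEQ_le_const2[OF lim]) auto
    then show ?thesis by simp
  qed
  have "measure M {c..d} \<le> L * (d - c) + e" if e: "0 < e" for e
  proof -
    define e' where "e' = e / (2 * (L + 1))"
    have e': "0 < e'" using e L0 by (simp add: e'_def)
    have count: "countable {x. measure M {x} \<noteq> 0}" by (rule countable_support)
    obtain a where a: "c - e' < a" "a < c" "measure M {a} = 0"
      using open_minus_countable[OF count, of "{c - e' <..< c}"] e' by auto
    obtain b where b: "d < b" "b < d + e'" "measure M {b} = 0"
      using open_minus_countable[OF count, of "{d <..< d + e'}"] e' by auto
    have "measure M {c..d} \<le> measure M {a<..b}"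
      using a b by (intro finite_measure_mono) auto
    also have "\<dots> \<le> L * (b - a)" using 1[of a b] a b cd by simp
    also have "\<dots> \<le> L * ((d - c) + 2 * e')"
      using a b L0 by (intro mult_left_mono) auto
    also have "\<dots> \<le> L * (d - c) + e"
    proof -
      have "L * (2 * e') \<le> (L + 1) * (2 * e')" using e' by (intro mult_right_mono) auto
      also have "\<dots> = e" using L0 by (simp add: e'_def field_simps)
      finally show ?thesis by (simp add: algebra_simps)
    qed
    finally show ?thesis .
  qed
  then show ?thesis
    unfolding L_def[symmetric] by (rule field_le_epsilon)
qed

text \<open>The law is absolutely continuous: a bounded piece of a null set lies in an open set of
  small Lebesgue measure, is covered there by countably many intervals with disjoint interiors, and
  each interval has mass at most L times its length.\<close>

lemma (in real_distribution) integrable_char_null_sets: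
  assumes int: "integrable lborel (\<lambda>t. cmod (char M t))" and N: "N \<in> null_sets lborel"
  shows "N \<in> null_sets M"
proof -
  define L where "L = (LBINT t. cmod (char M t))"
  have L0: "0 \<le> L" by (simp add: L_def)
  have Nb[measurable]: "N \<in> sets borel" using N by auto
  have bdd: "emeasure M (N \<inter> {-real R<..<real R}) = 0" for R :: nat
  proof (cases "R = 0")
    case True then show ?thesis by simp
  next
    case False
    define S where "S = N \<inter> {-real R<..<real R}"
    have S0: "S \<in> null_sets lborel" unfolding S_def by (rule null_set_Int2) (use N in auto)
    have Sl: "S \<in> sets lebesgue" "emeasure lebesgue S = 0"
      using S0 by (auto simp: null_sets_def)
    have "emeasure M S \<le> ennreal e" if e: "0 < e" for e
    proof -
      define e' where "e' = e / (L + 1)"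
      have e': "0 < e'" using e L0 by (simp add: e'_def)
      obtain T where T: "open T" "S \<subseteq> T" "emeasure lebesgue (T - S) < ennreal e'"
        using sets_lebesgue_outer_open[OF Sl(1) e'] by blast
      \<comment> \<open>This gauge keeps the covering inside T: each box contains a point of S to
        which it is subordinate, that point lies in T, and there the gauge set is T.\<close>
      have gauge: "gauge (\<lambda>x. if x \<in> T then T else UNIV)"
        using T(1) by (auto simp: gauge_def)
      have ScR: "S \<subseteq> cbox (-real R) (real R)" by (auto simp: S_def)
      have bne: "box (-real R) (real R) \<noteq> {}" using False by simp
      obtain D where D: "countable D" "\<And>K. K \<in> D \<Longrightarrow> interior K \<noteq> {} \<and> (\<exists>c d. K = cbox c d)"
          "pairwise (\<lambda>A B. interior A \<inter> interior B = {}) D"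
          "\<And>K. K \<in> D \<Longrightarrow> \<exists>x \<in> S \<inter> K. K \<subseteq> (if x \<in> T then T else UNIV)" "S \<subseteq> \<Union>D"
        by (rule covering_lemma[OF ScR bne gauge]) (rule that; assumption)
      have DT: "K \<subseteq> T" if "K \<in> D" for K
        using D(4)[OF that] T(2) by (auto split: if_splits)
      have D_borel: "K \<in> sets borel" if "K \<in> D" for K using D(2)[OF that] by auto
      \<comment> \<open>Length is measured on interiors, because the boxes may share endpoints and
        only their interiors are disjoint.\<close>
      have KM: "emeasure M K \<le> ennreal L * emeasure lborel (interior K)" if KD: "K \<in> D" for K
      proof -
        obtain c d where K: "K = {c..d}" using D(2)[OF KD] by auto
        have cd: "c < d" using D(2)[OF KD] by (auto simp: K)
        have "emeasure M K = ennreal (measure M {c..d})" by (simp add: K emeasure_eq_measure)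
        also have "\<dots> \<le> ennreal (L * (d - c))"
          using measure_Icc_le_char[OF int, of c d] cd by (intro ennreal_leI) (simp add: L_def)
        also have "\<dots> = ennreal L * emeasure lborel (interior K)"
          using cd L0 by (simp add: K ennreal_mult)
        finally show ?thesis .
      qed
      \<comment> \<open>An enumeration of the countable family D by natural numbers, with the empty
        set at the numbers that code no member.\<close>
      define A where "A n = (if n \<in> to_nat_on D ` D then from_nat_into D n else {})" for n
      have AD: "A n \<in> D" if "n \<in> to_nat_on D ` D" for n
        using that D(1) by (auto simp: A_def)
      have A0: "A n = {}" if "n \<notin> to_nat_on D ` D" for n using that by (simp add: A_def)
      have A_inj: "m = n" if "m \<in> to_nat_on D ` D" "n \<in> to_nat_on D ` D" "A m = A n" for m n
        using that D(1) by (auto simp: A_def)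
      have UA: "\<Union>D \<subseteq> (\<Union>n. A n)"
      proof
        fix x assume "x \<in> \<Union>D"
        then obtain K where K: "K \<in> D" "x \<in> K" by auto
        then have "A (to_nat_on D K) = K" using D(1) by (simp add: A_def)
        then show "x \<in> (\<Union>n. A n)" using K by auto
      qed
      have A_borel: "A n \<in> sets borel" for n
        using AD[of n] A0[of n] D_borel by (cases "n \<in> to_nat_on D ` D") auto
      have "emeasure M S \<le> emeasure M (\<Union>n. A n)"
        using D(5) UA A_borel by (intro emeasure_mono) auto
      also have "\<dots> \<le> (\<Sum>n. emeasure M (A n))"
        using A_borel by (intro emeasure_subadditive_countably) auto
      also have "\<dots> \<le> (\<Sum>n. ennreal L * emeasure lborel (interior (A n)))"
      proof (intro suminf_le summableI)
        show "emeasure M (A n) \<le> ennreal L * emeasure lborel (interior (A n))" for n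
          using AD[of n] A0[of n] KM by (cases "n \<in> to_nat_on D ` D") auto
      qed
      also have "\<dots> = ennreal L * (\<Sum>n. emeasure lborel (interior (A n)))"
        by (rule ennreal_suminf_cmult)
      also have "(\<Sum>n. emeasure lborel (interior (A n))) = emeasure lborel (\<Union>n. interior (A n))"
      proof (rule suminf_emeasure)
        show "disjoint_family (\<lambda>n. interior (A n))"
          unfolding disjoint_family_on_def
        proof (intro ballI impI)
          fix m n :: nat assume "m \<noteq> n"
          then show "interior (A m) \<inter> interior (A n) = {}"
            using A_inj[of m n] D(3) AD[of m] AD[of n] A0[of m] A0[of n]
            by (cases "m \<in> to_nat_on D ` D"; cases "n \<in> to_nat_on D ` D") (auto simp: pairwise_def)
        qed
      qed auto
      also have "\<dots> \<le> emeasure lborel T"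
      proof (rule emeasure_mono)
        show "(\<Union>n. interior (A n)) \<subseteq> T"
        proof
          fix x assume "x \<in> (\<Union>n. interior (A n))"
          then obtain n where "x \<in> A n" using interior_subset by blast
          then show "x \<in> T" using AD[of n] A0[of n] DT by (cases "n \<in> to_nat_on D ` D") auto
        qed
      qed (use T(1) in simp)
      also have "emeasure lborel T \<le> ennreal e'"
      proof -
        have "emeasure lborel T = emeasure lebesgue T" using T(1) by simp
        also have "\<dots> = emeasure lebesgue ((T - S) \<union> S)"
          using T(2) by (simp add: Un_absorb2)
        also have "\<dots> \<le> emeasure lebesgue (T - S) + emeasure lebesgue S"
          using T(1) Sl(1) by (intro emeasure_subadditive) auto
        also have "\<dots> \<le> ennreal e'" using T(3) Sl(2) by simp
        finally show ?thesis .
      qed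
      finally have "emeasure M S \<le> ennreal L * ennreal e'" by (simp add: mult_left_mono)
      also have "\<dots> = ennreal (L * e')" using L0 e' by (simp add: ennreal_mult)
      also have "\<dots> \<le> ennreal e"
        using L0 e by (intro ennreal_leI) (simp add: e'_def field_simps)
      finally show ?thesis .
    qed
    then have "emeasure M S \<le> 0 + ennreal e" if "0 < e" for e using that by simp
    then have "emeasure M S \<le> 0" by (rule ennreal_le_epsilon)
    then show ?thesis by (simp add: S_def)
  qed
  have "N = (\<Union>R::nat. N \<inter> {-real R<..<real R})"
  proof safe
    fix x assume "x \<in> N"
    moreover obtain R :: nat where "\<bar>x\<bar> < real R" using reals_Archimedean2 by blast
    ultimately show "x \<in> (\<Union>R::nat. N \<inter> {-real R<..<real R})" by (auto intro!: exI[of _ R])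
  qed
  moreover have "(\<Union>R::nat. N \<inter> {-real R<..<real R}) \<in> null_sets M"
    using bdd by (intro null_sets_UN) (auto simp: null_sets_def)
  ultimately show ?thesis by simp
qed

subsection \<open>Linear processes\<close>

lemma powr_add_le:
  fixes x y g :: real
  assumes "0 \<le> x" "0 \<le> y" "0 < g" "g \<le> 1"
  shows "(x + y) powr g \<le> x powr g + y powr g"
proof (cases "x + y = 0")
  case True then show ?thesis using assms by simp
next
  case False
  then have s: "0 < x + y" using assms by linarith
  have "(x / (x + y)) powr 1 \<le> (x / (x + y)) powr g" "(y / (x + y)) powr 1 \<le> (y / (x + y)) powr g"
    using assms s by (intro powr_mono'; simp)+
  then have "x / (x + y) + y / (x + y) \<le> (x / (x + y)) powr g + (y / (x + y)) powr g"
    using assms s by simp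
  also have "\<dots> = (x powr g + y powr g) / (x + y) powr g"
    using assms s by (simp add: powr_divide add_divide_distrib)
  finally have "1 \<le> (x powr g + y powr g) / (x + y) powr g"
    using s by (simp flip: add_divide_distrib)
  moreover have "0 < (x + y) powr g" using s by simp
  ultimately show ?thesis by (simp add: le_divide_eq)
qed

section \<open>The innovations\<close>

text \<open>The assumption \<open>a0\<close> is a normalisation: a process with a density has a
  nonzero coefficient, and delaying the innovations moves the first one to index 0, as carried out
  in \<open>kernel_process_exists\<close>.\<close>

locale linproc = prob_space M for M :: "'a measure" +
  fixes e :: "int \<Rightarrow> 'a \<Rightarrow> real" and a :: "nat \<Rightarrow> real" and \<gamma> C :: real
  assumes indep: "indep_vars (\<lambda>_. borel) e UNIV"
    and ident: "distr M borel (e i) = distr M borel (e j)"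
    and a0: "a 0 \<noteq> 0" and \<gamma>_pos: "0 < \<gamma>" and \<gamma>_le: "\<gamma> \<le> 1"
    and a_summable: "summable (\<lambda>i. \<bar>a i\<bar> powr \<gamma>)"
    and char_int: "integrable lborel (\<lambda>t. \<bar>t\<bar> powr (2 * \<gamma>) * (cmod (char (distr M borel (e 1)) t))\<^sup>2)"
    and char_var: "(LINT w|M. (cmod (iexp (t * e 1 w) - char (distr M borel (e 1)) t))\<^sup>2) \<le> C * min (\<bar>t\<bar> powr (2 * \<gamma>)) 1"
begin

definition \<phi> :: "real \<Rightarrow> complex" where "\<phi> = char (distr M borel (e 1))"

lemma e_meas [measurable]: "e i \<in> borel_measurable M"
  using indep by (auto simp: indep_vars_def)

sublocale E1: real_distribution "distr M borel (e 1)"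
  by (rule real_distribution_distr) simp

lemma integral_e_ident:
  fixes u :: "real \<Rightarrow> 'b::{banach, second_countable_topology}"
  assumes [measurable]: "u \<in> borel_measurable borel"
  shows "(\<integral>w. u (e i w) \<partial>M) = (\<integral>w. u (e j w) \<partial>M)"
proof -
  have "(\<integral>x. u x \<partial>distr M borel (e i)) = (\<integral>x. u x \<partial>distr M borel (e j))"
    by (simp only: ident[of i j])
  then show ?thesis by (simp add: integral_distr)
qed

lemma char_e: "(CLINT w|M. iexp (t * e i w)) = \<phi> t"
proof -
  have "(CLINT w|M. iexp (t * e i w)) = (CLINT w|M. iexp (t * e 1 w))"
    by (rule integral_e_ident) measurable
  then show ?thesis by (simp add: \<phi>_def char_def integral_distr)
qed

lemma \<phi>_le1: "cmod (\<phi> t) \<le> 1"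
  unfolding \<phi>_def by (rule E1.cmod_char_le_1)

lemma \<phi>_meas [measurable]: "\<phi> \<in> borel_measurable borel"
  unfolding \<phi>_def by simp

lemma \<phi>_0 [simp]: "\<phi> 0 = 1"
  unfolding \<phi>_def by (rule E1.char_zero)

lemma cnj_\<phi>: "cnj (\<phi> t) = \<phi> (- t)"
proof -
  have "cnj (\<phi> t) = (CLINT w|M. cnj (iexp (t * e 1 w)))"
    by (simp only: char_e[of t 1, symmetric] Bochner_Integration.integral_cnj)
  also have "\<dots> = (CLINT w|M. iexp (- t * e 1 w))"
    by (simp add: exp_cnj)
  finally show ?thesis by (simp only: char_e)
qed

lemma integrable_iexp_M:
  assumes [measurable]: "u \<in> borel_measurable M"
  shows "integrable M (\<lambda>w. iexp (u w))"
  by (rule integrable_const_bound[of _ 1]) auto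

lemma integrable_bounded_M:
  fixes u :: "'a \<Rightarrow> 'b::{banach, second_countable_topology}"
  assumes [measurable]: "u \<in> borel_measurable M" and "\<And>w. norm (u w) \<le> B"
  shows "integrable M u"
  by (rule integrable_const_bound[of _ B]) (use assms in auto)

lemma char_var_e: "(LINT w|M. (cmod (iexp (t * e i w) - \<phi> t))\<^sup>2) \<le> C * \<bar>t\<bar> powr (2 * \<gamma>)"
  and C_nonneg: "0 \<le> C"
proof -
  have eq: "(LINT w|M. (cmod (iexp (t * e i w) - \<phi> t))\<^sup>2) = (LINT w|M. (cmod (iexp (t * e 1 w) - \<phi> t))\<^sup>2)" for t i
    by (rule integral_e_ident) measurable
  have "0 \<le> (LINT w|M. (cmod (iexp (1 * e 1 w) - \<phi> 1))\<^sup>2)" by simp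
  also have "\<dots> \<le> C * min (\<bar>1\<bar> powr (2 * \<gamma>)) 1"
    using char_var[of 1] by (simp add: \<phi>_def)
  finally show C0: "0 \<le> C" by simp
  have "(LINT w|M. (cmod (iexp (t * e 1 w) - \<phi> t))\<^sup>2) \<le> C * min (\<bar>t\<bar> powr (2 * \<gamma>)) 1"
    using char_var[of t] by (simp add: \<phi>_def)
  also have "\<dots> \<le> C * \<bar>t\<bar> powr (2 * \<gamma>)"
    using C0 by (intro mult_left_mono) auto
  finally show "(LINT w|M. (cmod (iexp (t * e i w) - \<phi> t))\<^sup>2) \<le> C * \<bar>t\<bar> powr (2 * \<gamma>)"
    by (subst eq)
qed

text \<open>On the left is the covariance of the exponentials of one innovation at the frequencies s
  and t, so Cauchy-Schwarz applies and each variance is bounded by hypothesis. With s and t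
  proportional to two coefficients this yields the products of powers of coefficients that add up to
  \<open>r\<close>.\<close>

lemma char_cov_e: "cmod (\<phi> (s - t) - \<phi> s * \<phi> (- t)) \<le> C * (\<bar>s\<bar> powr \<gamma> * \<bar>t\<bar> powr \<gamma>)"
proof -
  define S T where "S w = iexp (s * e 1 w) - \<phi> s" and "T w = iexp (t * e 1 w) - \<phi> t" for w
  have [measurable]: "S \<in> borel_measurable M" "T \<in> borel_measurable M"
    unfolding S_def T_def by auto
  have bd: "cmod (iexp (s * e 1 w) - \<phi> s) \<le> 2" for s w
    using norm_triangle_ineq4[of "iexp (s * e 1 w)" "\<phi> s"] \<phi>_le1[of s] by simp
  have sq0: "integrable M (\<lambda>w. (cmod (iexp (s * e 1 w) - \<phi> s))\<^sup>2)" for s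
  proof (rule integrable_bounded_M[where B="2\<^sup>2"])
    show "norm ((cmod (iexp (s * e 1 w) - \<phi> s))\<^sup>2) \<le> 2\<^sup>2" for w
      using power_mono[OF bd[of s w] norm_ge_zero, of 2] by (simp only: real_norm_def abs_power2)
  qed measurable
  have sq: "integrable M (\<lambda>w. (cmod (S w))\<^sup>2)" "integrable M (\<lambda>w. (cmod (T w))\<^sup>2)"
    unfolding S_def T_def by (rule sq0)+
  have i: "integrable M (\<lambda>w. iexp ((s - t) * e 1 w))" "integrable M (\<lambda>w. iexp (s * e 1 w))"
    "integrable M (\<lambda>w. iexp (- t * e 1 w))"
    by (rule integrable_iexp_M, measurable)+
  have "S w * cnj (T w) = iexp ((s - t) * e 1 w) - \<phi> (-t) * iexp (s * e 1 w) - \<phi> s * iexp (- t * e 1 w) + \<phi> s * \<phi> (-t)" for w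
    by (simp add: S_def T_def exp_cnj cnj_\<phi> algebra_simps flip: exp_add)
  then have "(CLINT w|M. S w * cnj (T w)) = \<phi> (s - t) - \<phi> (-t) * \<phi> s - \<phi> s * \<phi> (-t) + \<phi> s * \<phi> (-t)"
    using i char_e[of "s - t" 1] char_e[of s 1] char_e[of "-t" 1] by (simp add: prob_space)
  then have "cmod (\<phi> (s - t) - \<phi> s * \<phi> (- t)) = cmod (CLINT w|M. S w * cnj (T w))"
    by (simp add: mult.commute)
  also have "\<dots> \<le> (LINT w|M. \<bar>cmod (S w) * cmod (T w)\<bar>)"
    using integral_norm_bound[of M "\<lambda>w. S w * cnj (T w)"] by (simp add: norm_mult)
  also have "\<dots> \<le> C * (\<bar>s\<bar> powr \<gamma> * \<bar>t\<bar> powr \<gamma>)"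
  proof (rule power2_le_imp_le)
    have "(LINT w|M. \<bar>cmod (S w) * cmod (T w)\<bar>)\<^sup>2 \<le> (LINT w|M. (cmod (S w))\<^sup>2) * (LINT w|M. (cmod (T w))\<^sup>2)"
      by (rule cauchy_schwarz_integral) (use sq in auto)
    also have "\<dots> \<le> (C * \<bar>s\<bar> powr (2 * \<gamma>)) * (C * \<bar>t\<bar> powr (2 * \<gamma>))"
      unfolding S_def T_def using C_nonneg by (intro mult_mono char_var_e) auto
    also have "\<dots> = (C * (\<bar>s\<bar> powr \<gamma> * \<bar>t\<bar> powr \<gamma>))\<^sup>2"
      by (simp add: powr_power power2_eq_square powr_add[symmetric] mult_ac flip: powr_mult)
    finally show "(LINT w|M. \<bar>cmod (S w) * cmod (T w)\<bar>)\<^sup>2 \<le> (C * (\<bar>s\<bar> powr \<gamma> * \<bar>t\<bar> powr \<gamma>))\<^sup>2" .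
    show "0 \<le> C * (\<bar>s\<bar> powr \<gamma> * \<bar>t\<bar> powr \<gamma>)" using C_nonneg by simp
  qed
  finally show ?thesis .
qed

lemma char_lincomb:
  assumes "finite L"
  shows "(CLINT w|M. iexp (\<Sum>l\<in>L. c l * e l w)) = (\<Prod>l\<in>L. \<phi> (c l))"
proof -
  have "indep_vars (\<lambda>_. borel) (\<lambda>l w. c l * e l w) L"
    by (rule indep_vars_compose2[OF indep_vars_subset[OF indep], of L "\<lambda>l x. c l * x" "\<lambda>_. borel"]) auto
  from char_distr_sum[OF this, of 1]
  have "(CLINT w|M. iexp (\<Sum>l\<in>L. c l * e l w)) = (\<Prod>l\<in>L. char (distr M borel (\<lambda>w. c l * e l w)) 1)"
    by (simp add: char_def integral_distr)
  also have "\<dots> = (\<Prod>l\<in>L. \<phi> (c l))"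
  proof (rule prod.cong[OF refl])
    fix l
    have "char (distr M borel (\<lambda>w. c l * e l w)) 1 = (CLINT w|M. iexp (c l * e l w))"
      by (simp add: char_def integral_distr)
    then show "char (distr M borel (\<lambda>w. c l * e l w)) 1 = \<phi> (c l)" by (simp only: char_e)
  qed
  finally show ?thesis .
qed

section \<open>A fractional moment of the innovations and convergence of the series\<close>

text \<open>A dyadic substitute for \<open>\<integral> (1 - cos (t x)) t powr (-1-\<gamma>) dt\<close>, which is a multiple of \<open>\<bar>x\<bar> powr \<gamma>\<close>.\<close>

lemma moment_dyadic_bound:
  fixes x :: real
  shows "\<exists>k::nat. \<bar>x\<bar> powr \<gamma> \<le> 1 + 2 / (1 - cos 1) * ((2 powr \<gamma>) ^ k * (1 - cos (x / 2 ^ k)))"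
proof (cases "\<bar>x\<bar> \<le> 1")
  case True
  then have "\<bar>x\<bar> powr \<gamma> \<le> 1" using \<gamma>_pos powr_mono2[of \<gamma> "\<bar>x\<bar>" 1] by simp
  moreover have "cos (1::real) < 1" using cos_monotone_0_pi[of 0 1] pi_gt3 by simp
  ultimately show ?thesis
    by (intro exI[of _ 0]) (simp add: add_increasing2)
next
  case False
  have c1: "cos (1::real) < 1" using cos_monotone_0_pi[of 0 1] pi_gt3 by simp
  \<comment> \<open>This scale brings |x| / 2^k into [1, 2). As 2 < pi, the cosine is there at most
    cos 1.\<close>
  define k where "k = nat \<lfloor>log 2 \<bar>x\<bar>\<rfloor>"
  have lg: "0 < log 2 \<bar>x\<bar>" using False by simp
  then have kr: "real k \<le> log 2 \<bar>x\<bar>" "log 2 \<bar>x\<bar> < real k + 1" unfolding k_def by linarith+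
  have "2 powr real k \<le> 2 powr log 2 \<bar>x\<bar>" using kr by (intro powr_mono) auto
  then have l: "2 ^ k \<le> \<bar>x\<bar>" using False by (simp add: powr_realpow)
  have "2 powr log 2 \<bar>x\<bar> < 2 powr (real k + 1)" using kr by (intro powr_less_mono) auto
  then have u: "\<bar>x\<bar> < 2 * 2 ^ k" using False by (simp add: powr_realpow powr_add)
  have y: "1 \<le> \<bar>x\<bar> / 2 ^ k" "\<bar>x\<bar> / 2 ^ k \<le> pi"
  proof -
    have "2 * 2 ^ k \<le> pi * 2 ^ k" using pi_gt3 by (intro mult_right_mono) auto
    with u have "\<bar>x\<bar> \<le> pi * 2 ^ k" by linarith
    with l show "1 \<le> \<bar>x\<bar> / 2 ^ k" "\<bar>x\<bar> / 2 ^ k \<le> pi" by (auto simp: field_simps)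
  qed
  have "cos (x / 2 ^ k) = cos (\<bar>x\<bar> / 2 ^ k)"
    using cos_abs_real[of "x / 2 ^ k"] by (simp add: abs_divide)
  also have "\<dots> \<le> cos 1" using y by (intro cos_monotone_0_pi_le) auto
  finally have c: "1 - cos 1 \<le> 1 - cos (x / 2 ^ k)" by simp
  have "\<bar>x\<bar> powr \<gamma> \<le> (2 * 2 ^ k) powr \<gamma>" using u \<gamma>_pos by (intro powr_mono2) auto
  also have "\<dots> = 2 powr \<gamma> * (2 powr \<gamma>) ^ k"
    by (simp add: powr_mult powr_realpow[symmetric] powr_powr mult.commute)
  also have "\<dots> \<le> 2 * (2 powr \<gamma>) ^ k"
    using powr_mono[OF \<gamma>_le, of 2] by (intro mult_right_mono) auto
  also have "2 * (2 powr \<gamma>) ^ k = 2 * (2 powr \<gamma>) ^ k * 1" by simp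
  also have "\<dots> \<le> 2 * (2 powr \<gamma>) ^ k * ((1 - cos (x / 2 ^ k)) / (1 - cos 1))"
  proof (rule mult_left_mono)
    show "1 \<le> (1 - cos (x / 2 ^ k)) / (1 - cos 1)"
      unfolding le_divide_eq using c c1 by simp
  qed simp
  also have "\<dots> = 2 / (1 - cos 1) * ((2 powr \<gamma>) ^ k * (1 - cos (x / 2 ^ k)))" by simp
  finally have "\<bar>x\<bar> powr \<gamma> \<le> 1 + 2 / (1 - cos 1) * ((2 powr \<gamma>) ^ k * (1 - cos (x / 2 ^ k)))" by linarith
  then show ?thesis by blast
qed


text \<open>Symmetrisation: the difference of two independent copies has the real characteristic
  function |\<phi>(t)|^2, and 1 - |\<phi>(t)|^2 is the covariance in \<open>char_cov_e\<close> at s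
  = t.\<close>

lemma E_cos_diff: "(LINT w|M. 1 - cos (t * (e 1 w - e 2 w))) \<le> C * \<bar>t\<bar> powr (2 * \<gamma>)"
proof -
  have i: "integrable M (\<lambda>w. cos (t * (e 1 w - e 2 w)))"
    by (rule integrable_bounded_M[where B=1]) auto
  have "(CLINT w|M. iexp (\<Sum>l\<in>{1,2}. (if l = 1 then t else -t) * e l w)) = \<phi> t * \<phi> (- t)"
    by (subst char_lincomb) auto
  then have eq: "(CLINT w|M. iexp (t * (e 1 w - e 2 w))) = \<phi> t * \<phi> (- t)"
    by (simp add: algebra_simps)
  have "(LINT w|M. cos (t * (e 1 w - e 2 w))) = (LINT w|M. Re (iexp (t * (e 1 w - e 2 w))))"
    by (simp only: Re_exp) simp
  also have "\<dots> = Re (CLINT w|M. iexp (t * (e 1 w - e 2 w)))"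
    by (rule integral_Re) (rule integrable_iexp_M, measurable)
  finally have "(LINT w|M. 1 - cos (t * (e 1 w - e 2 w))) = Re (\<phi> 0 - \<phi> t * \<phi> (- t))"
    unfolding eq using i by (simp add: prob_space)
  also have "\<dots> \<le> cmod (\<phi> (t - t) - \<phi> t * \<phi> (- t))"
    using complex_Re_le_cmod[of "\<phi> (t - t) - \<phi> t * \<phi> (- t)"] by simp
  also have "\<dots> \<le> C * (\<bar>t\<bar> powr \<gamma> * \<bar>t\<bar> powr \<gamma>)" by (rule char_cov_e)
  also have "\<dots> = C * \<bar>t\<bar> powr (2 * \<gamma>)" by (simp add: powr_add[symmetric])
  finally show ?thesis .
qed

text \<open>The scale in \<open>moment_dyadic_bound\<close> depends on the point, so the bound is
  summed over all scales. The term at scale k has expectation at most a constant times 2^(\<gamma>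
  k) 2^(-2 \<gamma> k), a geometric series.\<close>

lemma moment_diff_finite: "(\<integral>\<^sup>+w. ennreal (\<bar>e 1 w - e 2 w\<bar> powr \<gamma>) \<partial>M) < \<infinity>"
proof -
  define c1 where "c1 = 2 / (1 - cos (1::real))"
  have "cos (1::real) < 1" using cos_monotone_0_pi[of 0 1] pi_gt3 by simp
  then have c1: "0 < c1" by (simp add: c1_def)
  define u where "u k x = c1 * ((2 powr \<gamma>) ^ k * (1 - cos (x / 2 ^ k)))" for k :: nat and x
  have u0: "0 \<le> u k x" for k x using c1 by (simp add: u_def)
  have [measurable]: "u k \<in> borel_measurable borel" for k unfolding u_def by measurable
  have q: "2 powr - \<gamma> < 1" using \<gamma>_pos by (simp add: powr_less_one)
  have "ennreal (\<bar>x\<bar> powr \<gamma>) \<le> 1 + (\<Sum>k. ennreal (u k x))" for x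
  proof -
    obtain k :: nat where k: "\<bar>x\<bar> powr \<gamma> \<le> 1 + u k x"
      using moment_dyadic_bound[of x] unfolding u_def c1_def by blast
    have "ennreal (\<bar>x\<bar> powr \<gamma>) \<le> ennreal (1 + u k x)" using k by (rule ennreal_leI)
    also have "\<dots> = 1 + ennreal (u k x)" using u0 by simp
    also have "ennreal (u k x) \<le> (\<Sum>k. ennreal (u k x))"
      using sum_le_suminf[of "\<lambda>k. ennreal (u k x)" "{k}"] by simp
    finally show ?thesis by (simp add: add_left_mono)
  qed
  then have "(\<integral>\<^sup>+w. ennreal (\<bar>e 1 w - e 2 w\<bar> powr \<gamma>) \<partial>M) \<le> (\<integral>\<^sup>+w. 1 + (\<Sum>k. ennreal (u k (e 1 w - e 2 w))) \<partial>M)"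
    by (intro nn_integral_mono) auto
  also have "\<dots> = 1 + (\<Sum>k. \<integral>\<^sup>+w. ennreal (u k (e 1 w - e 2 w)) \<partial>M)"
    by (simp add: nn_integral_add nn_integral_suminf emeasure_space_1)
  also have "\<dots> \<le> 1 + (\<Sum>k. ennreal (c1 * C * (2 powr - \<gamma>) ^ k))"
  proof (intro add_left_mono suminf_le summableI)
    fix k :: nat
    have i: "integrable M (\<lambda>w. u k (e 1 w - e 2 w))"
    proof (rule integrable_bounded_M[where B="c1 * ((2 powr \<gamma>) ^ k * 2)"])
      show "norm (u k (e 1 w - e 2 w)) \<le> c1 * ((2 powr \<gamma>) ^ k * 2)" for w
      proof -
        have "- 1 \<le> cos ((e 1 w - e 2 w) / 2 ^ k)" by simp
        then have "1 - cos ((e 1 w - e 2 w) / 2 ^ k) \<le> 2" by linarith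
        then have "u k (e 1 w - e 2 w) \<le> c1 * ((2 powr \<gamma>) ^ k * 2)"
          unfolding u_def using c1 by (intro mult_left_mono) auto
        then show ?thesis using u0 by simp
      qed
    qed measurable
    have "(\<integral>\<^sup>+w. ennreal (u k (e 1 w - e 2 w)) \<partial>M) = ennreal (LINT w|M. u k (e 1 w - e 2 w))"
      using i u0 by (intro nn_integral_eq_integral) auto
    also have "(LINT w|M. u k (e 1 w - e 2 w)) = c1 * ((2 powr \<gamma>) ^ k * (LINT w|M. 1 - cos (1 / 2 ^ k * (e 1 w - e 2 w))))"
      by (simp only: u_def integral_mult_right_zero) simp
    also have "\<dots> \<le> c1 * ((2 powr \<gamma>) ^ k * (C * \<bar>1 / 2 ^ k\<bar> powr (2 * \<gamma>)))"
      using c1 by (intro mult_left_mono E_cos_diff) auto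
    also have "\<bar>1 / 2 ^ k :: real\<bar> powr (2 * \<gamma>) = (2 powr (- 2 * \<gamma>)) ^ k"
    proof -
      have "\<bar>1 / 2 ^ k :: real\<bar> = 2 powr (- real k)"
        by (simp add: powr_minus powr_realpow divide_inverse)
      then have "\<bar>1 / 2 ^ k :: real\<bar> powr (2 * \<gamma>) = 2 powr (- real k * (2 * \<gamma>))"
        by (simp only: powr_powr)
      also have "\<dots> = 2 powr ((- 2 * \<gamma>) * real k)" by (simp add: mult_ac)
      also have "\<dots> = (2 powr (- 2 * \<gamma>)) ^ k"
        by (simp only: powr_powr[symmetric], rule powr_realpow) simp
      finally show ?thesis .
    qed
    also have "c1 * ((2 powr \<gamma>) ^ k * (C * (2 powr (- 2 * \<gamma>)) ^ k)) = c1 * C * (2 powr \<gamma> * 2 powr (- 2 * \<gamma>)) ^ k"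
      by (simp add: power_mult_distrib)
    also have "2 powr \<gamma> * 2 powr (- 2 * \<gamma>) = (2::real) powr - \<gamma>"
      by (simp add: powr_add[symmetric])
    finally show "(\<integral>\<^sup>+w. ennreal (u k (e 1 w - e 2 w)) \<partial>M) \<le> ennreal (c1 * C * (2 powr - \<gamma>) ^ k)"
      by (simp add: ennreal_leI)
  qed
  also have "\<dots> = 1 + ennreal (\<Sum>k. c1 * C * (2 powr - \<gamma>) ^ k)"
    using c1 C_nonneg q by (subst suminf_ennreal2) (auto intro!: summable_mult summable_geometric)
  also have "\<dots> < \<infinity>" by simp
  finally show ?thesis .
qed

text \<open>Undoes the symmetrisation. On the event \<open>\<bar>e 2 w\<bar> \<le> real A\<close>,
  which is independent of \<open>e 1\<close> and has positive probability, the power of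
  \<open>e 1\<close> is bounded by that of \<open>e 1 - e 2\<close> plus a constant. Independence
  factors the expectation over this event, so finiteness carries over to the moment itself.\<close>

lemma moment_finite: "(\<integral>\<^sup>+w. ennreal (\<bar>e i w\<bar> powr \<gamma>) \<partial>M) < \<infinity>"
proof -
  obtain A :: nat where A: "1/2 < prob {w \<in> space M. \<bar>e 2 w\<bar> \<le> real A}"
  proof -
    have "(\<lambda>A. prob {w \<in> space M. \<bar>e 2 w\<bar> \<le> real A}) \<longlonglongrightarrow> prob (\<Union>A. {w \<in> space M. \<bar>e 2 w\<bar> \<le> real A})"
      by (rule finite_Lim_measure_incseq) (auto simp: incseq_def)
    also have "(\<Union>A. {w \<in> space M. \<bar>e 2 w\<bar> \<le> real A}) = space M"
      using real_arch_simple by auto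
    finally have "(\<lambda>A. prob {w \<in> space M. \<bar>e 2 w\<bar> \<le> real A}) \<longlonglongrightarrow> 1" by (simp add: prob_space)
    then have "\<forall>\<^sub>F A in sequentially. 1/2 < prob {w \<in> space M. \<bar>e 2 w\<bar> \<le> real A}"
      by (rule order_tendstoD) simp
    then show ?thesis using that eventually_happens'[OF sequentially_bot] by blast
  qed
  define S where "S = {w \<in> space M. \<bar>e 2 w\<bar> \<le> real A}"
  have [measurable]: "S \<in> sets M" unfolding S_def by measurable
  define m where "m = (\<integral>\<^sup>+w. ennreal (\<bar>e 1 w\<bar> powr \<gamma>) \<partial>M)"
  \<comment> \<open>The power and the indicator are merged into one family indexed by l, so that the
    product rule for independent families applies.\<close>
  define U where "U l x = (if l = (1::int) then ennreal (\<bar>x\<bar> powr \<gamma>) else indicator {-real A..real A} x)" for l x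
  have Um: "U l \<in> borel_measurable borel" for l unfolding U_def by (cases "l = 1") auto
  have "indep_vars (\<lambda>_. borel) (\<lambda>l w. U l (e l w)) {1,2}"
    by (rule indep_vars_compose2[OF indep_vars_subset[OF indep]]) (use Um in auto)
  then have "(\<integral>\<^sup>+w. (\<Prod>l\<in>{1,2}. U l (e l w)) \<partial>M) = (\<Prod>l\<in>{1,2}. \<integral>\<^sup>+w. U l (e l w) \<partial>M)"
    by (intro indep_vars_nn_integral) auto
  then have prod: "(\<integral>\<^sup>+w. ennreal (\<bar>e 1 w\<bar> powr \<gamma>) * indicator {-real A..real A} (e 2 w) \<partial>M)
      = m * (\<integral>\<^sup>+w. indicator {-real A..real A} (e 2 w) \<partial>M)"
    by (simp add: U_def m_def)
  have "(\<integral>\<^sup>+w. indicator {-real A..real A} (e 2 w) \<partial>M) = (\<integral>\<^sup>+w. indicator S w \<partial>M)"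
    by (rule nn_integral_cong) (auto simp: S_def indicator_def)
  also have "\<dots> = ennreal (prob S)" by (simp add: emeasure_eq_measure)
  finally have pS: "(\<integral>\<^sup>+w. indicator {-real A..real A} (e 2 w) \<partial>M) = ennreal (prob S)" .
  have "m * ennreal (prob S) = (\<integral>\<^sup>+w. ennreal (\<bar>e 1 w\<bar> powr \<gamma>) * indicator {-real A..real A} (e 2 w) \<partial>M)"
    by (simp only: prod pS)
  also have "\<dots> \<le> (\<integral>\<^sup>+w. ennreal (\<bar>e 1 w - e 2 w\<bar> powr \<gamma>) + ennreal (real A powr \<gamma>) \<partial>M)"
  proof (rule nn_integral_mono)
    fix w
    show "ennreal (\<bar>e 1 w\<bar> powr \<gamma>) * indicator {-real A..real A} (e 2 w)
        \<le> ennreal (\<bar>e 1 w - e 2 w\<bar> powr \<gamma>) + ennreal (real A powr \<gamma>)"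
    proof (cases "e 2 w \<in> {-real A..real A}")
      case True
      have "\<bar>e 1 w\<bar> powr \<gamma> \<le> (\<bar>e 1 w - e 2 w\<bar> + real A) powr \<gamma>"
        using True \<gamma>_pos by (intro powr_mono2) auto
      also have "\<dots> \<le> \<bar>e 1 w - e 2 w\<bar> powr \<gamma> + real A powr \<gamma>"
        by (rule powr_add_le) (use \<gamma>_pos \<gamma>_le in auto)
      finally show ?thesis using True by (simp flip: ennreal_plus add: ennreal_leI)
    qed simp
  qed
  also have "\<dots> < \<infinity>"
    using moment_diff_finite by (simp add: nn_integral_add emeasure_space_1)
  finally have "m * ennreal (prob S) < \<infinity>" .
  moreover have "0 < prob S" using A by (simp add: S_def)
  ultimately have m: "m < \<infinity>" by (auto simp: ennreal_mult_less_top)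
  have "(\<integral>\<^sup>+x. ennreal (\<bar>x\<bar> powr \<gamma>) \<partial>distr M borel (e i)) = (\<integral>\<^sup>+x. ennreal (\<bar>x\<bar> powr \<gamma>) \<partial>distr M borel (e 1))"
    by (simp only: ident[of i 1])
  then have "(\<integral>\<^sup>+w. ennreal (\<bar>e i w\<bar> powr \<gamma>) \<partial>M) = m"
    by (simp add: nn_integral_distr m_def)
  then show ?thesis using m by simp
qed

text \<open>The series of the \<gamma>-th powers has finite expectation, hence converges almost
  surely. Its terms are then eventually below 1, and for such terms the first power is at most the
  \<gamma>-th.\<close>

lemma AE_abs_summable: "AE \<omega> in M. summable (\<lambda>t. \<bar>a t * e (n - int t) \<omega>\<bar>)"
proof -
  define m where "m = enn2real (\<integral>\<^sup>+\<omega>. ennreal (\<bar>e 1 \<omega>\<bar> powr \<gamma>) \<partial>M)"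
  have m: "(\<integral>\<^sup>+\<omega>. ennreal (\<bar>e i \<omega>\<bar> powr \<gamma>) \<partial>M) = ennreal m" for i
  proof -
    have "(\<integral>\<^sup>+x. ennreal (\<bar>x\<bar> powr \<gamma>) \<partial>distr M borel (e i)) = (\<integral>\<^sup>+x. ennreal (\<bar>x\<bar> powr \<gamma>) \<partial>distr M borel (e 1))"
      by (simp only: ident[of i 1])
    then show ?thesis using moment_finite[of 1] by (simp add: nn_integral_distr m_def less_top)
  qed
  have m0: "0 \<le> m" by (simp add: m_def)
  have "(\<integral>\<^sup>+\<omega>. (\<Sum>t. ennreal (\<bar>a t * e (n - int t) \<omega>\<bar> powr \<gamma>)) \<partial>M) = (\<Sum>t. \<integral>\<^sup>+\<omega>. ennreal (\<bar>a t * e (n - int t) \<omega>\<bar> powr \<gamma>) \<partial>M)"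
    by (rule nn_integral_suminf) measurable
  also have "\<dots> = (\<Sum>t. ennreal (\<bar>a t\<bar> powr \<gamma> * m))"
    using m0 by (simp add: abs_mult powr_mult ennreal_mult nn_integral_cmult m)
  also have "\<dots> = ennreal (\<Sum>t. \<bar>a t\<bar> powr \<gamma> * m)"
    using m0 a_summable by (intro suminf_ennreal2 summable_mult2) auto
  also have "\<dots> < \<infinity>" by simp
  finally have "AE \<omega> in M. (\<Sum>t. ennreal (\<bar>a t * e (n - int t) \<omega>\<bar> powr \<gamma>)) \<noteq> \<infinity>"
    by (intro nn_integral_PInf_AE) auto
  then show ?thesis
  proof eventually_elim
    case (elim \<omega>)
    define w where "w = (\<lambda>t. \<bar>a t * e (n - int t) \<omega>\<bar>)"
    have s: "summable (\<lambda>t. w t powr \<gamma>)"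
      using elim by (intro summable_suminf_not_top) (auto simp: w_def)
    then have "(\<lambda>t. w t powr \<gamma>) \<longlonglongrightarrow> 0" by (rule summable_LIMSEQ_zero)
    then have "\<forall>\<^sub>F t in sequentially. w t powr \<gamma> < 1" by (rule order_tendstoD) simp
    then have ev: "\<forall>\<^sub>F t in sequentially. norm (w t) \<le> w t powr \<gamma>"
    proof eventually_elim
      case (elim t)
      have w0: "0 \<le> w t" by (simp add: w_def)
      have "w t \<le> 1"
      proof (rule ccontr)
        assume "\<not> w t \<le> 1"
        then have "1 \<le> w t powr \<gamma>" using \<gamma>_pos by (intro ge_one_powr_ge_zero) auto
        with elim show False by simp
      qed
      then have "w t powr 1 \<le> w t powr \<gamma>" using w0 \<gamma>_pos \<gamma>_le by (intro powr_mono') auto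
      then show ?case using w0 by simp
    qed
    have "summable w" by (rule summable_comparison_test_ev[OF ev s])
    then show ?case by (simp only: w_def)
  qed
qed

end

section \<open>Joint characteristic functions and the basic covariance bound\<close>

context linproc
begin

text \<open>The full sequence \<open>a\<close>, its truncations, its tails and the sequence without
  the current innovation all satisfy this, so one covariance bound serves for all of them.\<close>

definition dom :: "(nat \<Rightarrow> real) \<Rightarrow> bool" where "dom c \<longleftrightarrow> (\<forall>t. \<bar>c t\<bar> \<le> \<bar>a t\<bar>)"

abbreviation lp :: "(nat \<Rightarrow> real) \<Rightarrow> int \<Rightarrow> 'a \<Rightarrow> real" where "lp c \<equiv> linear_process c e"

abbreviation psum :: "(nat \<Rightarrow> real) \<Rightarrow> int \<Rightarrow> nat \<Rightarrow> 'a \<Rightarrow> real" where "psum c \<equiv> linear_partial_sum c e"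

lemma domD: "dom c \<Longrightarrow> \<bar>c t\<bar> \<le> \<bar>a t\<bar>" by (simp add: dom_def)

lemma dom_a [simp]: "dom a" by (simp add: dom_def)

lemma lp_meas [measurable]: "lp c n \<in> borel_measurable M"
  unfolding linear_process_def by measurable

lemma psum_meas [measurable]: "psum c n m \<in> borel_measurable M"
  unfolding linear_partial_sum_def by measurable

lemma lp_summable: "dom c \<Longrightarrow> AE w in M. summable (\<lambda>t. c t * e (n - int t) w)"
  using AE_abs_summable[of n]
proof eventually_elim
  case (elim w)
  have "norm (c t * e (n - int t) w) \<le> \<bar>a t * e (n - int t) w\<bar>" for t
    using domD[OF elim(1), of t] by (simp add: abs_mult mult_right_mono)
  then show ?case using elim(2) by (rule summable_comparison_test'[rotated])
qed

lemma lp_lim: "dom c \<Longrightarrow> AE w in M. (\<lambda>m. psum c n m w) \<longlonglongrightarrow> lp c n w"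
  using lp_summable[of c n]
  by (auto simp: linear_partial_sum_def linear_process_def intro: summable_LIMSEQ elim: AE_mp)

text \<open>The zero extension to all integers lets partial sums at two different times be written
  over one common set of innovations.\<close>

definition ext :: "(nat \<Rightarrow> real) \<Rightarrow> nat \<Rightarrow> int \<Rightarrow> real" where
  "ext c m z = (if 0 \<le> z \<and> z < int m then c (nat z) else 0)"

lemma psum_ext:
  assumes L: "finite L" "{n - int m <.. n} \<subseteq> L"
  shows "psum c n m w = (\<Sum>l\<in>L. ext c m (n - l) * e l w)"
proof -
  have inj: "inj_on (\<lambda>t. n - int t) {..<m}" by (auto simp: inj_on_def)
  have im: "(\<lambda>t. n - int t) ` {..<m} = {n - int m <.. n}"
  proof safe
    fix x assume "x \<in> {n - int m<..n}"
    then show "x \<in> (\<lambda>t. n - int t) ` {..<m}"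
      by (intro image_eqI[of _ _ "nat (n - x)"]) auto
  qed auto
  have "(\<Sum>l\<in>L. ext c m (n - l) * e l w) = (\<Sum>l\<in>{n - int m <.. n}. ext c m (n - l) * e l w)"
    by (rule sum.mono_neutral_right) (use L in \<open>auto simp: ext_def\<close>)
  also have "\<dots> = (\<Sum>t<m. ext c m (n - (n - int t)) * e (n - int t) w)"
    unfolding im[symmetric] by (simp add: sum.reindex[OF inj])
  also have "\<dots> = psum c n m w"
    by (auto simp: linear_partial_sum_def ext_def intro!: sum.cong)
  finally show ?thesis by simp
qed

lemma char_joint_fin:
  assumes L: "finite L" "{j - int m <.. j} \<subseteq> L" "{i - int m <.. i} \<subseteq> L"
  shows "(CLINT w|M. iexp (s * psum c j m w + t * psum d i m w))
     = (\<Prod>l\<in>L. \<phi> (s * ext c m (j - l) + t * ext d m (i - l)))"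
proof -
  have "s * psum c j m w + t * psum d i m w = (\<Sum>l\<in>L. (s * ext c m (j - l) + t * ext d m (i - l)) * e l w)" for w
    by (simp add: psum_ext[OF L(1,2)] psum_ext[OF L(1,3)] sum_distrib_left sum.distrib algebra_simps)
  then show ?thesis by (simp only: char_lincomb[OF L(1)])
qed

lemma char_joint_lim:
  assumes c: "dom c" and d: "dom d"
  shows "(\<lambda>m. CLINT \<omega>|M. iexp (s * psum c j m \<omega> + t * psum d i m \<omega>))
     \<longlonglongrightarrow> (CLINT \<omega>|M. iexp (s * lp c j \<omega> + t * lp d i \<omega>))"
proof (rule integral_dominated_convergence[where w="\<lambda>_. 1"])
  show "AE \<omega> in M. (\<lambda>m. iexp (s * psum c j m \<omega> + t * psum d i m \<omega>)) \<longlonglongrightarrow> iexp (s * lp c j \<omega> + t * lp d i \<omega>)"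
    using lp_lim[OF c, of j] lp_lim[OF d, of i]
  proof eventually_elim
    case (elim \<omega>)
    then show ?case by (intro tendsto_intros isCont_tendsto_compose[OF isCont_iexp])
  qed
qed auto

text \<open>Autocorrelation of the summable sequence \<open>\<bar>a t\<bar> powr \<gamma>\<close>.
  Summing over the lag first shows that its total is at most the square of the sum of that
  sequence.\<close>

definition r :: "nat \<Rightarrow> real" where "r k = (\<Sum>t. \<bar>a (k + t)\<bar> powr \<gamma> * \<bar>a t\<bar> powr \<gamma>)"

definition A1 :: real where "A1 = (\<Sum>t. \<bar>a t\<bar> powr \<gamma>)"

lemma a_powr_le_A1: "\<bar>a t\<bar> powr \<gamma> \<le> A1"
  unfolding A1_def using sum_le_suminf[OF a_summable, of "{t}"] by simp

lemma r_summable_inner: "summable (\<lambda>t. \<bar>a (k + t)\<bar> powr \<gamma> * \<bar>a t\<bar> powr \<gamma>)"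
  by (rule summable_comparison_test'[OF summable_mult[OF a_summable, of A1]])
     (auto simp: a_powr_le_A1 intro!: mult_right_mono)

lemma r_nonneg: "0 \<le> r k"
  unfolding r_def by (rule suminf_nonneg[OF r_summable_inner]) simp

lemma r_sum_le: "(\<Sum>k<N. r k) \<le> A1 * A1"
proof -
  have "(\<Sum>k<N. r k) = (\<Sum>t. \<Sum>k<N. \<bar>a (k + t)\<bar> powr \<gamma> * \<bar>a t\<bar> powr \<gamma>)"
    unfolding r_def by (rule suminf_sum[symmetric]) (rule r_summable_inner)
  also have "\<dots> \<le> (\<Sum>t. A1 * \<bar>a t\<bar> powr \<gamma>)"
  proof (rule suminf_le)
    fix t
    have "(\<Sum>k<N. \<bar>a (k + t)\<bar> powr \<gamma>) = (\<Sum>k\<in>(\<lambda>k. k + t) ` {..<N}. \<bar>a k\<bar> powr \<gamma>)"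
      by (subst sum.reindex) (auto simp: inj_on_def)
    also have "\<dots> \<le> A1" unfolding A1_def by (rule sum_le_suminf[OF a_summable]) auto
    finally show "(\<Sum>k<N. \<bar>a (k + t)\<bar> powr \<gamma> * \<bar>a t\<bar> powr \<gamma>) \<le> A1 * \<bar>a t\<bar> powr \<gamma>"
      unfolding sum_distrib_right[symmetric] by (intro mult_right_mono) auto
    show "summable (\<lambda>t. \<Sum>k<N. \<bar>a (k + t)\<bar> powr \<gamma> * \<bar>a t\<bar> powr \<gamma>)"
      by (intro summable_sum r_summable_inner)
    show "summable (\<lambda>t. A1 * \<bar>a t\<bar> powr \<gamma>)" by (intro summable_mult a_summable)
  qed
  also have "\<dots> = A1 * A1" using a_summable by (simp add: A1_def suminf_mult)
  finally show ?thesis .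
qed

lemma r_summable: "summable r"
  by (rule summableI_nonneg_bounded[OF r_nonneg r_sum_le])

lemma ext_dom: "dom c \<Longrightarrow> \<bar>ext c m z\<bar> \<le> \<bar>a (nat z)\<bar>"
  using domD[of c "nat z"] by (auto simp: ext_def)

lemma cov_fin:
  assumes c: "dom c" and d: "dom d" and ij: "i \<le> j"
  shows "cmod ((CLINT \<omega>|M. iexp (s * psum c j m \<omega> + - s * psum d i m \<omega>))
     - (CLINT \<omega>|M. iexp (s * psum c j m \<omega> + 0 * psum d i m \<omega>)) * (CLINT \<omega>|M. iexp (0 * psum c j m \<omega> + - s * psum d i m \<omega>)))
     \<le> (\<Prod>t<nat (j - i). cmod (\<phi> (s * ext c m (int t)))) * (C * \<bar>s\<bar> powr (2 * \<gamma>) * r (nat (j - i)))"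
proof -
  define k where "k = nat (j - i)"
  have jk: "j = i + int k" using ij by (simp add: k_def)
  define L1 L2 where "L1 = {i - int m .. i}" and "L2 = {i <.. j}"
  have fin: "finite L1" "finite L2" "L1 \<inter> L2 = {}" by (auto simp: L1_def L2_def)
  have sub: "{j - int m <.. j} \<subseteq> L1 \<union> L2" "{i - int m <.. i} \<subseteq> L1 \<union> L2"
    using ij by (auto simp: L1_def L2_def)
  define z where "z l = \<phi> (s * ext c m (j - l) + - s * ext d m (i - l))" for l
  define w where "w l = \<phi> (s * ext c m (j - l)) * \<phi> (- s * ext d m (i - l))" for l
  define P where "P = (\<Prod>l\<in>L2. \<phi> (s * ext c m (j - l)))"
  have d0: "ext d m (i - l) = 0" if "l \<in> L2" for l using that by (auto simp: ext_def L2_def)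
  have zP: "(\<Prod>l\<in>L2. z l) = P" "(\<Prod>l\<in>L2. w l) = P"
    unfolding P_def z_def w_def by (rule prod.cong[OF refl]; simp add: d0)+
  have 1: "(CLINT \<omega>|M. iexp (s * psum c j m \<omega> + - s * psum d i m \<omega>)) = P * (\<Prod>l\<in>L1. z l)"
    using char_joint_fin[OF _ sub, of s c "- s" d] fin
    by (simp only: finite_Un prod.union_disjoint zP z_def[symmetric] mult.commute)
  have 2: "(CLINT \<omega>|M. iexp (s * psum c j m \<omega> + 0 * psum d i m \<omega>)) * (CLINT \<omega>|M. iexp (0 * psum c j m \<omega> + - s * psum d i m \<omega>))
      = P * (\<Prod>l\<in>L1. w l)"
  proof -
    have "(CLINT \<omega>|M. iexp (s * psum c j m \<omega> + 0 * psum d i m \<omega>)) * (CLINT \<omega>|M. iexp (0 * psum c j m \<omega> + - s * psum d i m \<omega>))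
       = (\<Prod>l\<in>L1 \<union> L2. w l)"
      using char_joint_fin[OF _ sub, of s c 0 d] char_joint_fin[OF _ sub, of 0 c "- s" d] fin
      by (simp only: finite_Un prod.distrib[symmetric] w_def mult_zero_left add_0_left add_0_right)
    then show ?thesis using fin by (simp only: prod.union_disjoint zP mult.commute)
  qed
  have "cmod ((\<Prod>l\<in>L1. z l) - (\<Prod>l\<in>L1. w l)) \<le> (\<Sum>l\<in>L1. cmod (z l - w l))"
    by (rule norm_prod_diff) (auto simp: z_def w_def \<phi>_le1 norm_mult intro!: mult_le_one)
  also have "\<dots> \<le> (\<Sum>l\<in>L1. C * \<bar>s\<bar> powr (2 * \<gamma>) * (\<bar>a (k + nat (i - l))\<bar> powr \<gamma> * \<bar>a (nat (i - l))\<bar> powr \<gamma>))"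
  proof (rule sum_mono)
    fix l assume l: "l \<in> L1"
    have "cmod (z l - w l) \<le> C * (\<bar>s * ext c m (j - l)\<bar> powr \<gamma> * \<bar>s * ext d m (i - l)\<bar> powr \<gamma>)"
      using char_cov_e[of "s * ext c m (j - l)" "s * ext d m (i - l)"] by (simp add: z_def w_def)
    also have "\<dots> = C * (\<bar>s\<bar> powr \<gamma> * \<bar>s\<bar> powr \<gamma>) * (\<bar>ext c m (j - l)\<bar> powr \<gamma> * \<bar>ext d m (i - l)\<bar> powr \<gamma>)"
      by (simp add: abs_mult powr_mult mult_ac)
    also have "\<bar>s\<bar> powr \<gamma> * \<bar>s\<bar> powr \<gamma> = \<bar>s\<bar> powr (2 * \<gamma>)"
      by (simp add: powr_add[symmetric])
    also have "C * \<bar>s\<bar> powr (2 * \<gamma>) * (\<bar>ext c m (j - l)\<bar> powr \<gamma> * \<bar>ext d m (i - l)\<bar> powr \<gamma>)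
       \<le> C * \<bar>s\<bar> powr (2 * \<gamma>) * (\<bar>a (nat (j - l))\<bar> powr \<gamma> * \<bar>a (nat (i - l))\<bar> powr \<gamma>)"
      using C_nonneg \<gamma>_pos by (intro mult_left_mono mult_mono powr_mono2 ext_dom c d) auto
    also have "nat (j - l) = k + nat (i - l)" using l by (auto simp: jk L1_def)
    finally show "cmod (z l - w l) \<le> C * \<bar>s\<bar> powr (2 * \<gamma>) * (\<bar>a (k + nat (i - l))\<bar> powr \<gamma> * \<bar>a (nat (i - l))\<bar> powr \<gamma>)" .
  qed
  also have "\<dots> = C * \<bar>s\<bar> powr (2 * \<gamma>) * (\<Sum>l\<in>L1. \<bar>a (k + nat (i - l))\<bar> powr \<gamma> * \<bar>a (nat (i - l))\<bar> powr \<gamma>)"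
    by (simp only: sum_distrib_left)
  also have "\<dots> \<le> C * \<bar>s\<bar> powr (2 * \<gamma>) * r k"
  proof (rule mult_left_mono)
    have inj: "inj_on (\<lambda>l. nat (i - l)) L1" by (auto simp: inj_on_def L1_def)
    have "(\<Sum>l\<in>L1. \<bar>a (k + nat (i - l))\<bar> powr \<gamma> * \<bar>a (nat (i - l))\<bar> powr \<gamma>)
        = (\<Sum>t\<in>(\<lambda>l. nat (i - l)) ` L1. \<bar>a (k + t)\<bar> powr \<gamma> * \<bar>a t\<bar> powr \<gamma>)"
      by (simp add: sum.reindex[OF inj])
    also have "\<dots> \<le> r k"
      unfolding r_def using fin(1) by (intro sum_le_suminf r_summable_inner) auto
    finally show "(\<Sum>l\<in>L1. \<bar>a (k + nat (i - l))\<bar> powr \<gamma> * \<bar>a (nat (i - l))\<bar> powr \<gamma>) \<le> r k" .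
  qed (use C_nonneg in auto)
  finally have main: "cmod ((\<Prod>l\<in>L1. z l) - (\<Prod>l\<in>L1. w l)) \<le> C * \<bar>s\<bar> powr (2 * \<gamma>) * r k" .
  have Pn: "cmod P = (\<Prod>t<k. cmod (\<phi> (s * ext c m (int t))))"
  proof -
    have inj: "inj_on (\<lambda>t. j - int t) {..<k}" by (auto simp: inj_on_def)
    have im: "(\<lambda>t. j - int t) ` {..<k} = L2"
    proof safe
      fix x assume "x \<in> L2"
      then show "x \<in> (\<lambda>t. j - int t) ` {..<k}"
        by (intro image_eqI[of _ _ "nat (j - x)"]) (auto simp: L2_def jk)
    qed (auto simp: L2_def jk)
    have "cmod P = (\<Prod>l\<in>L2. cmod (\<phi> (s * ext c m (j - l))))" by (simp add: P_def prod_norm)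
    also have "\<dots> = (\<Prod>t<k. cmod (\<phi> (s * ext c m (j - (j - int t)))))"
      unfolding im[symmetric] by (simp add: prod.reindex[OF inj])
    finally show ?thesis by simp
  qed
  show ?thesis
    unfolding 1 2 right_diff_distrib[symmetric] norm_mult Pn k_def[symmetric]
    using main by (intro mult_left_mono prod_nonneg) auto
qed

lemma cov_bound:
  assumes c: "dom c" and d: "dom d" and ij: "i \<le> j"
  shows "cmod ((CLINT w|M. iexp (s * lp c j w - s * lp d i w))
     - (CLINT w|M. iexp (s * lp c j w)) * (CLINT w|M. iexp (- s * lp d i w)))
     \<le> (\<Prod>t<nat (j - i). cmod (\<phi> (s * c t))) * (C * \<bar>s\<bar> powr (2 * \<gamma>) * r (nat (j - i)))"
proof -
  define k where "k = nat (j - i)"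
  have "(\<lambda>m. cmod ((CLINT w|M. iexp (s * psum c j m w + - s * psum d i m w))
     - (CLINT w|M. iexp (s * psum c j m w + 0 * psum d i m w)) * (CLINT w|M. iexp (0 * psum c j m w + - s * psum d i m w))))
     \<longlonglongrightarrow> cmod ((CLINT w|M. iexp (s * lp c j w + - s * lp d i w))
     - (CLINT w|M. iexp (s * lp c j w + 0 * lp d i w)) * (CLINT w|M. iexp (0 * lp c j w + - s * lp d i w)))"
    by (intro tendsto_intros char_joint_lim c d)
  moreover have "\<forall>\<^sub>F m in sequentially. cmod ((CLINT w|M. iexp (s * psum c j m w + - s * psum d i m w))
     - (CLINT w|M. iexp (s * psum c j m w + 0 * psum d i m w)) * (CLINT w|M. iexp (0 * psum c j m w + - s * psum d i m w)))
     \<le> (\<Prod>t<k. cmod (\<phi> (s * c t))) * (C * \<bar>s\<bar> powr (2 * \<gamma>) * r k)"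
  \<comment> \<open>For m at least k, truncation leaves the first k coefficients untouched and the
    bound no longer depends on m.\<close>
  proof (rule eventually_sequentiallyI[of k])
    fix m assume "k \<le> m"
    then have "(\<Prod>t<k. cmod (\<phi> (s * ext c m (int t)))) = (\<Prod>t<k. cmod (\<phi> (s * c t)))"
      by (intro prod.cong) (auto simp: ext_def)
    then show "cmod ((CLINT w|M. iexp (s * psum c j m w + - s * psum d i m w))
     - (CLINT w|M. iexp (s * psum c j m w + 0 * psum d i m w)) * (CLINT w|M. iexp (0 * psum c j m w + - s * psum d i m w)))
     \<le> (\<Prod>t<k. cmod (\<phi> (s * c t))) * (C * \<bar>s\<bar> powr (2 * \<gamma>) * r k)"
      using cov_fin[OF c d ij, of s m] unfolding k_def[symmetric] by simp
  qed
  ultimately have "cmod ((CLINT w|M. iexp (s * lp c j w + - s * lp d i w))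
     - (CLINT w|M. iexp (s * lp c j w + 0 * lp d i w)) * (CLINT w|M. iexp (0 * lp c j w + - s * lp d i w)))
     \<le> (\<Prod>t<k. cmod (\<phi> (s * c t))) * (C * \<bar>s\<bar> powr (2 * \<gamma>) * r k)"
    by (rule tendsto_upperbound[OF _ _ sequentially_bot])
  then show ?thesis by (simp add: k_def)
qed

lemma char_lp_stationary:
  assumes c: "dom c"
  shows "(CLINT w|M. iexp (s * lp c i w)) = (CLINT w|M. iexp (s * lp c j w))"
proof -
  have "(CLINT w|M. iexp (s * psum c n m w + 0 * psum c n m w)) = (\<Prod>t<m. \<phi> (s * c t))" for n m
  proof -
    have inj: "inj_on (\<lambda>t. n - int t) {..<m}" by (auto simp: inj_on_def)
    have im: "(\<lambda>t. n - int t) ` {..<m} = {n - int m <.. n}"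
    proof safe
      fix x assume "x \<in> {n - int m<..n}"
      then show "x \<in> (\<lambda>t. n - int t) ` {..<m}"
        by (intro image_eqI[of _ _ "nat (n - x)"]) auto
    qed auto
    have "(CLINT w|M. iexp (s * psum c n m w + 0 * psum c n m w)) = (\<Prod>l\<in>{n - int m <.. n}. \<phi> (s * ext c m (n - l)))"
      using char_joint_fin[of "{n - int m <.. n}" n m n s c 0 c] by simp
    also have "\<dots> = (\<Prod>t<m. \<phi> (s * c t))"
      unfolding im[symmetric] by (simp add: prod.reindex[OF inj] ext_def)
    finally show ?thesis .
  qed
  then have "(\<lambda>m. \<Prod>t<m. \<phi> (s * c t)) \<longlonglongrightarrow> (CLINT w|M. iexp (s * lp c n w + 0 * lp c n w))" for n
    using char_joint_lim[OF c c, of s n 0 n] by simp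
  from LIMSEQ_unique[OF this[of i] this[of j]] show ?thesis by simp
qed

end

subsection \<open>Covariances of exponentials of a linear process\<close>

lemma cnj_borel_measurable [measurable]: "cnj \<in> borel_measurable borel"
  by (rule borel_measurable_continuous_onI) (intro continuous_intros)

lemma powr_twice: "(x powr g)\<^sup>2 = (x::real) powr (2 * g)"
  by (simp add: power2_eq_square powr_add[symmetric])

text \<open>The expectation is the double sum of all covariances. They are bounded through the lag
  alone, so each row sums to at most \<open>suminf b\<close> on either side of the diagonal; the
  case i > j follows by conjugation.\<close>

lemma (in prob_space) expectation_sq_sum_le:
  fixes \<zeta> :: "int \<Rightarrow> 'a \<Rightarrow> complex" and b :: "nat \<Rightarrow> real"
  assumes [measurable]: "\<And>i. \<zeta> i \<in> borel_measurable M" and B: "\<And>i w. cmod (\<zeta> i w) \<le> B"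
    and I: "finite I" and b0: "\<And>k. 0 \<le> b k" and bs: "summable b"
    and cov: "\<And>i j. i \<in> I \<Longrightarrow> j \<in> I \<Longrightarrow> i \<le> j \<Longrightarrow>
      cmod ((CLINT w|M. \<zeta> j w * cnj (\<zeta> i w)) - (CLINT w|M. \<zeta> j w) * cnj (CLINT w|M. \<zeta> i w)) \<le> b (nat (j - i))"
  shows "(LINT w|M. (cmod (\<Sum>i\<in>I. \<zeta> i w - (CLINT w|M. \<zeta> i w)))\<^sup>2) \<le> real (card I) * (2 * suminf b)"
proof -
  define m where "m i = (CLINT w|M. \<zeta> i w)" for i
  define cv where "cv i j = (CLINT w|M. \<zeta> j w * cnj (\<zeta> i w)) - m j * cnj (m i)" for i j
  have B0: "0 \<le> B" using B norm_ge_zero order_trans by blast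
  have int1: "integrable M (\<zeta> i)" for i by (rule integrable_const_bound[of _ B]) (use B in auto)
  have int2: "integrable M (\<lambda>w. \<zeta> j w * cnj (\<zeta> i w))" for i j
    by (rule integrable_mult_bounded[OF int1, where B=B]) (use B in auto)
  have cvE: "integrable M (\<lambda>w. (\<zeta> j w - m j) * cnj (\<zeta> i w - m i))"
    "(CLINT w|M. (\<zeta> j w - m j) * cnj (\<zeta> i w - m i)) = cv i j" for i j
  proof -
    have eq: "(\<zeta> j w - m j) * cnj (\<zeta> i w - m i) = \<zeta> j w * cnj (\<zeta> i w) - cnj (m i) * \<zeta> j w - m j * cnj (\<zeta> i w) + m j * cnj (m i)" for w
      by (simp add: algebra_simps)
    have ci: "integrable M (\<lambda>w. cnj (\<zeta> i w))" using int1 by simp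
    show "integrable M (\<lambda>w. (\<zeta> j w - m j) * cnj (\<zeta> i w - m i))"
      unfolding eq using int1 int2 ci by (intro Bochner_Integration.integrable_add Bochner_Integration.integrable_diff integrable_mult_right) auto
    show "(CLINT w|M. (\<zeta> j w - m j) * cnj (\<zeta> i w - m i)) = cv i j"
      unfolding eq using int1 int2 ci by (simp add: cv_def prob_space m_def)
  qed
  have cv_sym: "cv j i = cnj (cv i j)" for i j
    unfolding cv_def by (simp add: mult.commute flip: Bochner_Integration.integral_cnj)
  have cvb: "cmod (cv i j) \<le> b (nat \<bar>i - j\<bar>)" if "i \<in> I" "j \<in> I" for i j
  proof (cases "i \<le> j")
    case True then show ?thesis using cov[OF that True] by (simp add: cv_def m_def abs_minus_commute)
  next
    case False
    then have "cmod (cv j i) \<le> b (nat (i - j))" using cov[OF that(2,1)] by (simp add: cv_def m_def)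
    then show ?thesis using False cv_sym[of j i] by simp
  qed
  have row: "(\<Sum>j\<in>I. b (nat \<bar>i - j\<bar>)) \<le> 2 * suminf b" for i
  proof -
    have "(\<Sum>j\<in>I. b (nat \<bar>i - j\<bar>)) = (\<Sum>j\<in>{j\<in>I. i \<le> j}. b (nat \<bar>i - j\<bar>)) + (\<Sum>j\<in>{j\<in>I. j < i}. b (nat \<bar>i - j\<bar>))"
      using I by (subst sum.union_disjoint[symmetric]) (auto intro!: sum.cong)
    also have "(\<Sum>j\<in>{j\<in>I. i \<le> j}. b (nat \<bar>i - j\<bar>)) = sum b ((\<lambda>j. nat \<bar>i - j\<bar>) ` {j\<in>I. i \<le> j})"
      by (subst sum.reindex) (auto simp: inj_on_def)
    also have "\<dots> \<le> suminf b" using I b0 by (intro sum_le_suminf bs) auto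
    also have "(\<Sum>j\<in>{j\<in>I. j < i}. b (nat \<bar>i - j\<bar>)) = sum b ((\<lambda>j. nat \<bar>i - j\<bar>) ` {j\<in>I. j < i})"
      by (subst sum.reindex) (auto simp: inj_on_def)
    also have "\<dots> \<le> suminf b" using I b0 by (intro sum_le_suminf bs) auto
    finally show ?thesis by simp
  qed
  have sq: "complex_of_real ((cmod (\<Sum>i\<in>I. \<zeta> i w - m i))\<^sup>2) = (\<Sum>i\<in>I. \<Sum>j\<in>I. (\<zeta> j w - m j) * cnj (\<zeta> i w - m i))" for w
    unfolding complex_norm_square cnj_sum sum_product by (rule sum.swap)
  have "complex_of_real (LINT w|M. (cmod (\<Sum>i\<in>I. \<zeta> i w - m i))\<^sup>2) = (CLINT w|M. (\<Sum>i\<in>I. \<Sum>j\<in>I. (\<zeta> j w - m j) * cnj (\<zeta> i w - m i)))"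
    unfolding sq[symmetric] by (rule integral_complex_of_real[symmetric])
  also have "\<dots> = (\<Sum>i\<in>I. \<Sum>j\<in>I. cv i j)"
    by (subst Bochner_Integration.integral_sum Bochner_Integration.integrable_sum, intro Bochner_Integration.integrable_sum cvE, rule sum.cong[OF refl],
        subst Bochner_Integration.integral_sum, rule cvE, rule sum.cong[OF refl], rule cvE)
  finally have ceq: "complex_of_real (LINT w|M. (cmod (\<Sum>i\<in>I. \<zeta> i w - m i))\<^sup>2) = (\<Sum>i\<in>I. \<Sum>j\<in>I. cv i j)" .
  have "(LINT w|M. (cmod (\<Sum>i\<in>I. \<zeta> i w - m i))\<^sup>2) = Re (complex_of_real (LINT w|M. (cmod (\<Sum>i\<in>I. \<zeta> i w - m i))\<^sup>2))"
    by (rule Re_complex_of_real[symmetric])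
  also have "\<dots> = Re (\<Sum>i\<in>I. \<Sum>j\<in>I. cv i j)" by (simp only: ceq)
  also have "\<dots> \<le> cmod (\<Sum>i\<in>I. \<Sum>j\<in>I. cv i j)" by (rule complex_Re_le_cmod)
  also have "\<dots> \<le> (\<Sum>i\<in>I. \<Sum>j\<in>I. cmod (cv i j))"
    by (rule order_trans[OF norm_sum sum_mono[OF norm_sum]])
  also have "\<dots> \<le> (\<Sum>i\<in>I. 2 * suminf b)"
  proof (rule sum_mono)
    fix i assume i: "i \<in> I"
    have "(\<Sum>j\<in>I. cmod (cv i j)) \<le> (\<Sum>j\<in>I. b (nat \<bar>i - j\<bar>))"
      by (rule sum_mono) (rule cvb[OF i])
    then show "(\<Sum>j\<in>I. cmod (cv i j)) \<le> 2 * suminf b" using row[of i] by linarith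
  qed
  finally show ?thesis by (simp add: m_def)
qed

text \<open>Keeps two chosen factors and estimates the others by 1. Two square-integrable factors
  are what makes a characteristic function integrable below.\<close>

lemma norm_prod_le_two:
  fixes f :: "'b \<Rightarrow> complex"
  assumes "finite L" "x \<in> L" "y \<in> L" "x \<noteq> y" and le: "\<And>l. l \<in> L \<Longrightarrow> cmod (f l) \<le> 1"
  shows "cmod (\<Prod>l\<in>L. f l) \<le> cmod (f x) * cmod (f y)"
proof -
  have "cmod (\<Prod>l\<in>L. f l) = cmod (f x) * (cmod (f y) * (\<Prod>l\<in>L - {x} - {y}. cmod (f l)))"
    using assms by (simp add: norm_mult prod_norm[symmetric] prod.remove[of L x] prod.remove[of "L - {x}" y])
  also have "\<dots> \<le> cmod (f x) * (cmod (f y) * 1)"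
    using le by (intro mult_left_mono prod_le_1) auto
  finally show ?thesis by simp
qed

context linproc
begin

lemma \<phi>_sq_int: "integrable lborel (\<lambda>t. (cmod (\<phi> t))\<^sup>2)"
proof (rule Bochner_Integration.integrable_bound)
  show "integrable lborel (\<lambda>t. indicator {-1..1} t + \<bar>t\<bar> powr (2 * \<gamma>) * (cmod (\<phi> t))\<^sup>2)"
    using char_int by (intro Bochner_Integration.integrable_add) (auto simp: \<phi>_def)
  show "AE t in lborel. norm ((cmod (\<phi> t))\<^sup>2) \<le> norm (indicator {-1..1} t + \<bar>t\<bar> powr (2 * \<gamma>) * (cmod (\<phi> t))\<^sup>2)"
  proof (rule AE_I2)
    fix t
    show "norm ((cmod (\<phi> t))\<^sup>2) \<le> norm (indicator {-1..1} t + \<bar>t\<bar> powr (2 * \<gamma>) * (cmod (\<phi> t))\<^sup>2)"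
    proof (cases "\<bar>t\<bar> \<le> 1")
      case True
      then show ?thesis using power_mono[OF \<phi>_le1[of t], of 2] by (auto simp: indicator_def intro: add_increasing2)
    next
      case False
      then have "1 \<le> \<bar>t\<bar> powr (2 * \<gamma>)" using \<gamma>_pos by (intro ge_one_powr_ge_zero) auto
      from mult_right_mono[OF this, of "(cmod (\<phi> t))\<^sup>2"] show ?thesis by (auto simp: indicator_def)
    qed
  qed
qed measurable

lemma \<phi>_scaled_int:
  assumes "\<alpha> \<noteq> 0"
  shows "integrable lborel (\<lambda>t. (cmod (\<phi> (t * \<alpha>)))\<^sup>2)"
    and "integrable lborel (\<lambda>t. (\<bar>t\<bar> powr \<gamma> * cmod (\<phi> (t * \<alpha>)))\<^sup>2)"
proof -
  show "integrable lborel (\<lambda>t. (cmod (\<phi> (t * \<alpha>)))\<^sup>2)"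
    using lborel_integrable_real_affine[OF \<phi>_sq_int assms, of 0] by (simp add: mult.commute)
  have "integrable lborel (\<lambda>t. \<bar>0 + \<alpha> * t\<bar> powr (2 * \<gamma>) * (cmod (\<phi> (0 + \<alpha> * t)))\<^sup>2)"
    using lborel_integrable_real_affine[OF char_int assms, of 0] unfolding \<phi>_def .
  then have "integrable lborel (\<lambda>t. (1 / \<bar>\<alpha>\<bar> powr (2 * \<gamma>)) * (\<bar>0 + \<alpha> * t\<bar> powr (2 * \<gamma>) * (cmod (\<phi> (0 + \<alpha> * t)))\<^sup>2))"
    by (rule integrable_mult_right)
  also have "(\<lambda>t. (1 / \<bar>\<alpha>\<bar> powr (2 * \<gamma>)) * (\<bar>0 + \<alpha> * t\<bar> powr (2 * \<gamma>) * (cmod (\<phi> (0 + \<alpha> * t)))\<^sup>2))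
      = (\<lambda>t. (\<bar>t\<bar> powr \<gamma> * cmod (\<phi> (t * \<alpha>)))\<^sup>2)"
    using assms by (auto simp: abs_mult powr_mult power_mult_distrib powr_twice fun_eq_iff mult.commute[of _ \<alpha>])
  finally show "integrable lborel (\<lambda>t. (\<bar>t\<bar> powr \<gamma> * cmod (\<phi> (t * \<alpha>)))\<^sup>2)" .
qed

lemma char_lp_le: "cmod (CLINT w|M. iexp (s * lp a j w)) \<le> cmod (\<phi> (s * a 0))"
proof -
  have lim: "(\<lambda>m. cmod (CLINT w|M. iexp (s * psum a j m w + 0 * psum a j m w)))
      \<longlonglongrightarrow> cmod (CLINT w|M. iexp (s * lp a j w + 0 * lp a j w))"
    by (intro tendsto_intros char_joint_lim) auto
  have "cmod (CLINT w|M. iexp (s * lp a j w + 0 * lp a j w)) \<le> cmod (\<phi> (s * a 0))"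
  proof (rule tendsto_upperbound[OF lim _ sequentially_bot], rule eventually_sequentiallyI[of 1])
    fix m :: nat assume m: "1 \<le> m"
    \<comment> \<open>The index j - m carries the coefficient 0. It is adjoined to supply the second
      index that \<open>norm_prod_le_two\<close> asks for, even when m = 1.\<close>
    have "cmod (\<Prod>l\<in>insert (j - int m) {j - int m <.. j}. \<phi> (s * ext a m (j - l) + 0 * ext a m (j - l)))
       \<le> cmod (\<phi> (s * ext a m (j - j) + 0 * ext a m (j - j))) * cmod (\<phi> (s * ext a m (j - (j - int m)) + 0 * ext a m (j - (j - int m))))"
      using m by (intro norm_prod_le_two) (auto simp: \<phi>_le1)
    also have "\<dots> \<le> cmod (\<phi> (s * a 0)) * 1"
      using m by (intro mult_mono \<phi>_le1) (auto simp: ext_def)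
    finally show "cmod (CLINT w|M. iexp (s * psum a j m w + 0 * psum a j m w)) \<le> cmod (\<phi> (s * a 0))"
      by (subst char_joint_fin[of "insert (j - int m) {j - int m <.. j}"]) auto
  qed
  then show ?thesis by simp
qed

text \<open>Otherwise \<open>a\<close> would be periodic with period k, and the value
  \<open>a 0 \<noteq> 0\<close> would recur infinitely often in a null sequence.\<close>

lemma exists_shift_diff: "0 < k \<Longrightarrow> \<exists>t. a (t + k) \<noteq> a t"
proof (rule ccontr)
  assume k: "0 < k" and "\<nexists>t. a (t + k) \<noteq> a t"
  then have eq: "a (t + k) = a t" for t by auto
  have per: "a (n * k) = a 0" for n
    by (induction n) (simp_all add: add.commute[of k] eq)
  have "(\<lambda>n. \<bar>a n\<bar> powr \<gamma>) \<longlonglongrightarrow> 0" by (rule summable_LIMSEQ_zero[OF a_summable])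
  moreover have "strict_mono (\<lambda>n. n * k)" using k by (auto simp: strict_mono_def)
  ultimately have "((\<lambda>n. \<bar>a n\<bar> powr \<gamma>) \<circ> (\<lambda>n. n * k)) \<longlonglongrightarrow> 0" by (rule LIMSEQ_subseq_LIMSEQ)
  then have "(\<lambda>n::nat. \<bar>a 0\<bar> powr \<gamma>) \<longlonglongrightarrow> 0" by (simp add: comp_def per)
  then have "\<bar>a 0\<bar> powr \<gamma> = 0" using LIMSEQ_unique tendsto_const by blast
  then show False using a0 by simp
qed

text \<open>In the difference of the variables at times i + k and i, the newest innovation has the
  coefficient \<open>a 0\<close> and the one at time i - t the coefficient
  \<open>a (t + k) - a t\<close>. The latter is nonzero for some t that depends on k alone, which
  gives a second square-integrable factor valid for all i.\<close>

lemma char_diff_le: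
  assumes k: "0 < k"
  obtains \<alpha> where "\<alpha> \<noteq> 0"
    "\<And>s i. cmod (CLINT w|M. iexp (s * lp a (i + int k) w - s * lp a i w)) \<le> cmod (\<phi> (s * a 0)) * cmod (\<phi> (s * \<alpha>))"
proof -
  obtain t where t: "a (t + k) \<noteq> a t" using exists_shift_diff[OF k] by blast
  have "cmod (CLINT w|M. iexp (s * lp a (i + int k) w - s * lp a i w)) \<le> cmod (\<phi> (s * a 0)) * cmod (\<phi> (s * (a (t + k) - a t)))" for s i
  proof -
    define j where "j = i + int k"
    have lim: "(\<lambda>m. cmod (CLINT w|M. iexp (s * psum a j m w + - s * psum a i m w)))
        \<longlonglongrightarrow> cmod (CLINT w|M. iexp (s * lp a j w + - s * lp a i w))"
      by (intro tendsto_intros char_joint_lim) auto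
    have "cmod (CLINT w|M. iexp (s * lp a j w + - s * lp a i w)) \<le> cmod (\<phi> (s * a 0)) * cmod (\<phi> (s * (a (t + k) - a t)))"
    proof (rule tendsto_upperbound[OF lim _ sequentially_bot], rule eventually_sequentiallyI[of "t + k + 1"])
      fix m :: nat assume m: "t + k + 1 \<le> m"
      define L where "L = {i - int m .. j}"
      define f where "f l = \<phi> (s * ext a m (j - l) + - s * ext a m (i - l))" for l
      have L: "finite L" "{j - int m <.. j} \<subseteq> L" "{i - int m <.. i} \<subseteq> L" by (auto simp: L_def j_def)
      have "cmod (\<Prod>l\<in>L. f l) \<le> cmod (f j) * cmod (f (i - int t))"
        using m k by (intro norm_prod_le_two L) (auto simp: f_def \<phi>_le1 L_def j_def)
      also have "f j = \<phi> (s * a 0)" using m k by (auto simp: f_def ext_def j_def)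
      also have "f (i - int t) = \<phi> (s * (a (t + k) - a t))"
        using m by (auto simp: f_def ext_def j_def nat_add_distrib add.commute algebra_simps)
      finally show "cmod (CLINT w|M. iexp (s * psum a j m w + - s * psum a i m w)) \<le> cmod (\<phi> (s * a 0)) * cmod (\<phi> (s * (a (t + k) - a t)))"
        by (subst char_joint_fin[OF L]) (simp add: f_def)
    qed
    then show ?thesis by (simp add: j_def)
  qed
  then show ?thesis using t by (intro that[of "a (t + k) - a t"]) auto
qed

text \<open>Beyond the position of a second nonzero coefficient \<open>a j1\<close>, the product
  contains the factors of \<open>a 0\<close> and \<open>a j1\<close>; the weight
  \<open>\<bar>s\<bar> powr (2 * \<gamma>)\<close> is split evenly between them and leaves two
  square-integrable functions. Without a second nonzero coefficient \<open>r\<close> vanishes at all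
  positive lags and v = 0 will do.\<close>

lemma prod_\<phi>_dominating:
  obtains J v where "integrable lborel v" "\<And>s. 0 \<le> v s"
    "\<And>k s. J < k \<Longrightarrow> (\<Prod>t<k. cmod (\<phi> (s * a t))) * (C * \<bar>s\<bar> powr (2 * \<gamma>) * r k) \<le> C * r k * v s"
proof (cases "\<exists>j1>0. a j1 \<noteq> 0")
  case True
  then obtain j1 where j1: "0 < j1" "a j1 \<noteq> 0" by blast
  define v where "v s = (\<bar>s\<bar> powr \<gamma> * cmod (\<phi> (s * a 0))) * (\<bar>s\<bar> powr \<gamma> * cmod (\<phi> (s * a j1)))" for s
  have vi: "integrable lborel v"
    unfolding v_def by (rule integrable_mult_of_squares) (use \<phi>_scaled_int(2) a0 j1 in auto)
  have v0: "0 \<le> v s" for s by (simp add: v_def)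
  have "(\<Prod>t<k. cmod (\<phi> (s * a t))) * (C * \<bar>s\<bar> powr (2 * \<gamma>) * r k) \<le> C * r k * v s" if k: "j1 < k" for k s
  proof -
    have "cmod (\<Prod>t\<in>{..<k}. \<phi> (s * a t)) \<le> cmod (\<phi> (s * a 0)) * cmod (\<phi> (s * a j1))"
      using j1 k by (intro norm_prod_le_two) (auto simp: \<phi>_le1)
    then have "(\<Prod>t<k. cmod (\<phi> (s * a t))) \<le> cmod (\<phi> (s * a 0)) * cmod (\<phi> (s * a j1))"
      by (simp add: prod_norm)
    then have "(\<Prod>t<k. cmod (\<phi> (s * a t))) * (C * \<bar>s\<bar> powr (2 * \<gamma>) * r k)
        \<le> (cmod (\<phi> (s * a 0)) * cmod (\<phi> (s * a j1))) * (C * \<bar>s\<bar> powr (2 * \<gamma>) * r k)"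
      using C_nonneg r_nonneg by (intro mult_right_mono) auto
    moreover have "v s = \<bar>s\<bar> powr (2 * \<gamma>) * (cmod (\<phi> (s * a 0)) * cmod (\<phi> (s * a j1)))"
      unfolding v_def powr_twice[symmetric] power2_eq_square by (simp add: mult_ac)
    ultimately show ?thesis by (simp add: mult_ac)
  qed
  then show ?thesis using that vi v0 by blast
next
  case False
  have "r k = 0" if "0 < k" for k
  proof -
    have "a (k + t) = 0" for t using False that by (meson trans_less_add1)
    then show ?thesis by (simp add: r_def)
  qed
  then show ?thesis by (intro that[of "\<lambda>_. 0" 0]) auto
qed

lemma iexp_cov:
  fixes u w :: "'a \<Rightarrow> real"
  shows "(CLINT \<omega>|M. iexp (u \<omega>) * cnj (iexp (w \<omega>))) = (CLINT \<omega>|M. iexp (u \<omega> - w \<omega>))"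
    and "cnj (CLINT \<omega>|M. iexp (w \<omega>)) = (CLINT \<omega>|M. iexp (- w \<omega>))"
  by (simp_all add: exp_cnj exp_diff exp_minus field_simps flip: Bochner_Integration.integral_cnj)

lemma cov_bound_cnj:
  assumes c: "dom c" and d: "dom d" and ij: "i \<le> j"
  shows "cmod ((CLINT w|M. iexp (s * lp c j w) * cnj (iexp (s * lp d i w)))
     - (CLINT w|M. iexp (s * lp c j w)) * cnj (CLINT w|M. iexp (s * lp d i w)))
     \<le> (\<Prod>t<nat (j - i). cmod (\<phi> (s * c t))) * (C * \<bar>s\<bar> powr (2 * \<gamma>) * r (nat (j - i)))"
  using cov_bound[OF assms, of s] by (simp only: iexp_cov mult_minus_left)

lemma cov_bound_cnj':
  assumes c: "dom c" and d: "dom d" and ij: "i \<le> j"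
  shows "cmod ((CLINT w|M. iexp (s * lp c j w) * cnj (iexp (s * lp d i w)))
     - (CLINT w|M. iexp (s * lp c j w)) * cnj (CLINT w|M. iexp (s * lp d i w)))
     \<le> C * \<bar>s\<bar> powr (2 * \<gamma>) * r (nat (j - i))"
proof -
  have "(\<Prod>t<nat (j - i). cmod (\<phi> (s * c t))) * (C * \<bar>s\<bar> powr (2 * \<gamma>) * r (nat (j - i)))
      \<le> 1 * (C * \<bar>s\<bar> powr (2 * \<gamma>) * r (nat (j - i)))"
    using C_nonneg r_nonneg by (intro mult_right_mono prod_le_1) (auto simp: \<phi>_le1)
  then show ?thesis using cov_bound_cnj[OF assms, of s] by linarith
qed

definition Sx :: "(nat \<Rightarrow> real) \<Rightarrow> int set \<Rightarrow> real \<Rightarrow> 'a \<Rightarrow> complex" where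
  "Sx c I s w = (\<Sum>i\<in>I. iexp (s * lp c i w) - (CLINT w|M. iexp (s * lp c i w)))"

lemma Sx_var:
  assumes c: "dom c" and I: "finite I"
  shows "(LINT w|M. (cmod (Sx c I s w))\<^sup>2) \<le> real (card I) * (2 * (C * \<bar>s\<bar> powr (2 * \<gamma>) * suminf r))"
proof -
  have "(LINT w|M. (cmod (Sx c I s w))\<^sup>2) \<le> real (card I) * (2 * (\<Sum>k. C * \<bar>s\<bar> powr (2 * \<gamma>) * r k))"
    unfolding Sx_def
    by (rule expectation_sq_sum_le[where B=1])
       (use I C_nonneg r_nonneg r_summable cov_bound_cnj'[OF c c] in \<open>auto intro!: summable_mult\<close>)
  then show ?thesis using r_summable by (simp add: suminf_mult)
qed

text \<open>Lags up to J are estimated trivially by 2 and give the constant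
  \<open>4 * (real J + 1)\<close>; longer lags are dominated by an integrable function of s. In
  contrast to \<open>Sx_var\<close> the part that is not integrable stays bounded in s, but the
  coefficients must be the full sequence \<open>a\<close>.\<close>

lemma Sx_var_a:
  obtains A :: real and v :: "real \<Rightarrow> real" where "integrable lborel v" "\<And>s. 0 \<le> v s" "0 \<le> A"
    "\<And>I s. finite I \<Longrightarrow> (LINT w|M. (cmod (Sx a I s w))\<^sup>2) \<le> real (card I) * (A + v s)"
proof -
  obtain J v where v: "integrable lborel v" "\<And>s. 0 \<le> v s"
    "\<And>k s. J < k \<Longrightarrow> (\<Prod>t<k. cmod (\<phi> (s * a t))) * (C * \<bar>s\<bar> powr (2 * \<gamma>) * r k) \<le> C * r k * v s"
    by (rule prod_\<phi>_dominating) (rule that; assumption)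
  have fs: "summable (\<lambda>k. if k \<le> J then 2 else 0 :: real)"
    by (rule summable_finite[of "{..J}"]) auto
  have fe: "(\<Sum>k. if k \<le> J then 2 else 0 :: real) = 2 * (real J + 1)"
    by (subst suminf_finite[of "{..J}"]) auto
  have "(LINT w|M. (cmod (Sx a I s w))\<^sup>2) \<le> real (card I) * (4 * (real J + 1) + 2 * C * suminf r * v s)" if I: "finite I" for I s
  proof -
    define b where "b k = (if k \<le> J then 2 else 0) + C * v s * r k" for k
    have bs: "summable b" unfolding b_def by (intro summable_add fs summable_mult r_summable)
    have b0: "0 \<le> b k" for k using C_nonneg r_nonneg v(2) by (simp add: b_def)
    have "(LINT w|M. (cmod (Sx a I s w))\<^sup>2) \<le> real (card I) * (2 * suminf b)"
      unfolding Sx_def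
    proof (rule expectation_sq_sum_le[where B=1])
      fix i j :: int assume ij: "i \<le> j"
      show "cmod ((CLINT w|M. iexp (s * lp a j w) * cnj (iexp (s * lp a i w)))
       - (CLINT w|M. iexp (s * lp a j w)) * cnj (CLINT w|M. iexp (s * lp a i w))) \<le> b (nat (j - i))"
      proof (cases "nat (j - i) \<le> J")
        case False
        then have "b (nat (j - i)) = C * r (nat (j - i)) * v s" by (simp add: b_def)
        then show ?thesis using cov_bound_cnj[OF dom_a dom_a ij, of s] v(3)[of "nat (j - i)" s] False by linarith
      next
        case True
        have le1: "cmod (CLINT w|M. z w) \<le> 1" if "\<And>w. cmod (z w) \<le> 1" "z \<in> borel_measurable M" for z
        proof -
          have "cmod (CLINT w|M. z w) \<le> (LINT w|M. cmod (z w))" by (rule integral_norm_bound)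
          also have "\<dots> \<le> (LINT w|M. 1)"
            using that by (intro integral_mono integrable_bounded_M[where B=1]) auto
          finally show ?thesis by (simp add: prob_space)
        qed
        have "cmod ((CLINT w|M. iexp (s * lp a j w) * cnj (iexp (s * lp a i w)))
          - (CLINT w|M. iexp (s * lp a j w)) * cnj (CLINT w|M. iexp (s * lp a i w))) \<le> 1 + 1 * 1"
          by (rule order_trans[OF norm_triangle_ineq4 add_mono])
             (auto simp: norm_mult intro!: le1 mult_le_one)
        also have "\<dots> \<le> b (nat (j - i))" using True C_nonneg r_nonneg v(2) by (simp add: b_def)
        finally show ?thesis .
      qed
    qed (use I b0 bs in auto)
    also have "suminf b = 2 * (real J + 1) + C * v s * suminf r"
      unfolding b_def using fs r_summable by (simp add: suminf_add[symmetric] summable_mult suminf_mult fe)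
    finally show ?thesis by (simp add: algebra_simps)
  qed
  then show ?thesis
    using v(1,2) C_nonneg suminf_nonneg[OF r_summable r_nonneg]
    by (intro that[of "\<lambda>s. 2 * C * suminf r * v s" "4 * (real J + 1)"]) auto
qed

end

section \<open>Covariances integrated over all frequencies\<close>

context linproc
begin

lemma char_fun_measurable [measurable]:
  assumes [measurable]: "u \<in> borel_measurable M"
  shows "(\<lambda>s. CLINT w|M. iexp (s * u w)) \<in> borel_measurable borel"
  by measurable

definition covx :: "int \<Rightarrow> int \<Rightarrow> real \<Rightarrow> complex" where
  "covx i j s = (CLINT w|M. iexp (s * lp a j w - s * lp a i w)) - (CLINT w|M. iexp (s * lp a j w)) * cnj (CLINT w|M. iexp (s * lp a i w))"

lemma covx_measurable [measurable]: "covx i j \<in> borel_measurable borel"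
  unfolding covx_def by measurable

text \<open>This integrability makes the law of the difference absolutely continuous, so that the
  exceptional set of the inversion formula for K is not charged.\<close>

lemma char_diff_integrable:
  assumes "i < j"
  shows "integrable lborel (\<lambda>s. cmod (CLINT w|M. iexp (s * lp a j w - s * lp a i w)))"
proof -
  define k where "k = nat (j - i)"
  have k: "0 < k" "j = i + int k" using assms by (auto simp: k_def)
  obtain \<alpha> where \<alpha>: "\<alpha> \<noteq> 0"
    "\<And>s i. cmod (CLINT w|M. iexp (s * lp a (i + int k) w - s * lp a i w)) \<le> cmod (\<phi> (s * a 0)) * cmod (\<phi> (s * \<alpha>))"
    by (rule char_diff_le[OF k(1)]) (rule that; assumption)
  show ?thesis
  proof (rule Bochner_Integration.integrable_bound)
    show "integrable lborel (\<lambda>s. cmod (\<phi> (s * a 0)) * cmod (\<phi> (s * \<alpha>)))"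
      by (rule integrable_mult_of_squares) (use \<phi>_scaled_int(1) a0 \<alpha> in auto)
    show "AE s in lborel. norm (cmod (CLINT w|M. iexp (s * lp a j w - s * lp a i w))) \<le> norm (cmod (\<phi> (s * a 0)) * cmod (\<phi> (s * \<alpha>)))"
      using \<alpha>(2) by (auto simp: k(2) simp del: of_real_diff)
  qed measurable
qed

text \<open>At lags up to J the joint term and the product term are bounded separately, each by two
  square-integrable factors. At longer lags the function from \<open>prod_\<phi>_dominating\<close>
  enters with the summable coefficient \<open>r k\<close>. The sum over lags controls the bias of
  the within-sample statistic.\<close>

lemma covx_integral_summable:
  obtains \<beta> :: "nat \<Rightarrow> real" where "summable \<beta>" "\<And>k. 0 \<le> \<beta> k"
    "\<And>i j. i < j \<Longrightarrow> integrable lborel (\<lambda>s. cmod (covx i j s))"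
    "\<And>i j. i < j \<Longrightarrow> (LBINT s. cmod (covx i j s)) \<le> \<beta> (nat (j - i))"
proof -
  obtain J and v :: "real \<Rightarrow> real" where v: "integrable lborel v" "\<And>s. 0 \<le> v s"
    "\<And>k s. J < k \<Longrightarrow> (\<Prod>t<k. cmod (\<phi> (s * a t))) * (C * \<bar>s\<bar> powr (2 * \<gamma>) * r k) \<le> C * r k * v s"
    by (rule prod_\<phi>_dominating) (rule that; assumption)
  have "\<exists>\<alpha>. \<alpha> \<noteq> 0 \<and> (\<forall>s i. cmod (CLINT w|M. iexp (s * lp a (i + int k) w - s * lp a i w)) \<le> cmod (\<phi> (s * a 0)) * cmod (\<phi> (s * \<alpha>)))"
    if "0 < k" for k
    using char_diff_le[OF that] by metis
  then obtain \<alpha> where \<alpha>: "\<And>k. 0 < k \<Longrightarrow> \<alpha> k \<noteq> 0"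
    "\<And>k s i. 0 < k \<Longrightarrow> cmod (CLINT w|M. iexp (s * lp a (i + int k) w - s * lp a i w)) \<le> cmod (\<phi> (s * a 0)) * cmod (\<phi> (s * \<alpha> k))"
    by metis
  define q where "q k s = (if k \<le> J then cmod (\<phi> (s * a 0)) * cmod (\<phi> (s * \<alpha> k)) + cmod (\<phi> (s * a 0)) * cmod (\<phi> (s * a 0)) else C * r k * v s)" for k s
  have qi: "integrable lborel (q k)" if "0 < k" for k
  proof -
    have "integrable lborel (\<lambda>s. cmod (\<phi> (s * a 0)) * cmod (\<phi> (s * \<alpha> k)))"
         "integrable lborel (\<lambda>s. cmod (\<phi> (s * a 0)) * cmod (\<phi> (s * a 0)))"
      by (rule integrable_mult_of_squares; use \<phi>_scaled_int(1) a0 \<alpha>(1)[OF that] in auto)+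
    then show ?thesis using v(1) by (cases "k \<le> J") (auto simp: q_def[abs_def])
  qed
  have q0: "0 \<le> q k s" for k s using C_nonneg r_nonneg v(2) by (simp add: q_def)
  have cq: "cmod (covx i j s) \<le> q (nat (j - i)) s" if "i < j" for i j s
  proof (cases "nat (j - i) \<le> J")
    case True
    have "cmod (covx i j s) \<le> cmod (CLINT w|M. iexp (s * lp a j w - s * lp a i w))
       + cmod (CLINT w|M. iexp (s * lp a j w)) * cmod (CLINT w|M. iexp (s * lp a i w))"
      unfolding covx_def by (rule order_trans[OF norm_triangle_ineq4]) (simp add: norm_mult)
    also have "\<dots> \<le> cmod (\<phi> (s * a 0)) * cmod (\<phi> (s * \<alpha> (nat (j - i)))) + cmod (\<phi> (s * a 0)) * cmod (\<phi> (s * a 0))"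
      using \<alpha>(2)[of "nat (j - i)" s i] that
      by (intro add_mono mult_mono char_lp_le) (auto simp del: of_real_diff)
    finally show ?thesis using True by (simp add: q_def)
  next
    case False
    have "cmod (covx i j s) \<le> (\<Prod>t<nat (j - i). cmod (\<phi> (s * a t))) * (C * \<bar>s\<bar> powr (2 * \<gamma>) * r (nat (j - i)))"
      using cov_bound_cnj[OF dom_a dom_a, of i j s] that by (simp only: iexp_cov(1) covx_def less_imp_le)
    also have "\<dots> \<le> C * r (nat (j - i)) * v s" using False by (intro v(3)) auto
    finally show ?thesis using False by (simp add: q_def)
  qed
  have ci: "integrable lborel (\<lambda>s. cmod (covx i j s))" if "i < j" for i j
    by (rule Bochner_Integration.integrable_bound[OF qi[of "nat (j - i)"]]) (use that cq q0 in auto)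
  define \<beta> where "\<beta> k = (LBINT s. q k s)" for k
  have "summable \<beta>"
  proof (rule summable_comparison_test_ev)
    show "summable (\<lambda>k. C * (LBINT s. v s) * r k)" by (intro summable_mult r_summable)
    show "\<forall>\<^sub>F k in sequentially. norm (\<beta> k) \<le> C * (LBINT s. v s) * r k"
    proof (rule eventually_sequentiallyI[of "Suc J"])
      fix k assume "Suc J \<le> k"
      then have "\<beta> k = C * (LBINT s. v s) * r k" by (simp add: \<beta>_def q_def)
      then show "norm (\<beta> k) \<le> C * (LBINT s. v s) * r k"
        using C_nonneg r_nonneg v(2) by simp
    qed
  qed
  moreover have "0 \<le> \<beta> k" for k unfolding \<beta>_def using q0 by simp
  moreover have "(LBINT s. cmod (covx i j s)) \<le> \<beta> (nat (j - i))" if "i < j" for i j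
    unfolding \<beta>_def by (rule integral_mono) (use ci qi cq that in auto)
  ultimately show ?thesis using that ci by blast
qed

section \<open>Martingale differences with respect to the innovations\<close>

text \<open>Removing the coefficient of the current innovation makes \<open>lp a' j\<close> a
  function of the innovations strictly before j.\<close>

definition a' :: "nat \<Rightarrow> real" where "a' = a(0 := 0)"

lemma dom_a' [simp]: "dom a'" by (simp add: dom_def a'_def)

lemma lp_split: "AE w in M. lp a j w = lp a' j w + a 0 * e j w"
  using lp_summable[OF dom_a, of j] lp_summable[OF dom_a', of j]
proof eventually_elim
  case (elim w)
  have "lp a j w = a 0 * e j w + (\<Sum>t. a (Suc t) * e (j - int (Suc t)) w)"
    unfolding linear_process_def using suminf_split_head[OF elim(1)] by simp
  moreover have "lp a' j w = (\<Sum>t. a (Suc t) * e (j - int (Suc t)) w)"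
    unfolding linear_process_def using suminf_split_head[OF elim(2)] by (simp add: a'_def)
  ultimately show ?case by simp
qed

definition past :: "int \<Rightarrow> 'a \<Rightarrow> int \<Rightarrow> real" where
  "past j w = restrict (\<lambda>l. e l w) {..<j}"

text \<open>Rebuilds a linear process as a measurable function on the product space of the
  innovations before j. Terms at or after j are set to 0, so the unspecified values of a restricted
  trajectory are never read.\<close>

definition xf :: "(nat \<Rightarrow> real) \<Rightarrow> int \<Rightarrow> int \<Rightarrow> (int \<Rightarrow> real) \<Rightarrow> real" where
  "xf c i j v = (\<Sum>t. if i - int t < j then c t * v (i - int t) else 0)"

lemma past_measurable [measurable]: "past j \<in> M \<rightarrow>\<^sub>M PiM {..<j} (\<lambda>_. borel)"
  unfolding past_def by (rule measurable_restrict) simp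

lemma xf_measurable [measurable]: "xf c i j \<in> borel_measurable (PiM {..<j} (\<lambda>_. borel))"
proof -
  have "(\<lambda>v. if i - int t < j then c t * v (i - int t) else 0) \<in> borel_measurable (PiM {..<j} (\<lambda>_. borel))" for t
  proof (cases "i - int t < j")
    case True
    then have "(\<lambda>v. v (i - int t)) \<in> borel_measurable (PiM {..<j} (\<lambda>_. borel))"
      by (intro measurable_component_singleton) auto
    then show ?thesis using True by simp
  qed simp
  then show ?thesis unfolding xf_def by (rule borel_measurable_suminf)
qed

lemma xf_past:
  assumes "i < j \<or> i = j \<and> c 0 = 0"
  shows "xf c i j (past j w) = lp c i w"
  unfolding xf_def linear_process_def past_def
  by (rule suminf_cong) (use assms in \<open>auto simp: not_less\<close>)

definition pres :: "int \<Rightarrow> 'a \<Rightarrow> int \<Rightarrow> real" where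
  "pres j w = restrict (\<lambda>l. e l w) {j}"

lemma pres_measurable [measurable]: "pres j \<in> M \<rightarrow>\<^sub>M PiM {j} (\<lambda>_. borel)"
  unfolding pres_def by (rule measurable_restrict) simp

lemma indep_past: "indep_var (PiM {j} (\<lambda>_. borel)) (pres j) (PiM {..<j} (\<lambda>_. borel)) (past j)"
  unfolding pres_def[abs_def] past_def[abs_def] by (rule indep_var_restrict[OF indep]) auto

text \<open>Evaluated at \<open>lp a' j\<close> this is the conditional expectation of G at the
  process, given the innovations before j.\<close>

definition cond :: "(real \<Rightarrow> real) \<Rightarrow> real \<Rightarrow> real" where
  "cond G x = (LINT w|M. G (x + a 0 * e 1 w))"

lemma cond_measurable [measurable]:
  assumes [measurable]: "G \<in> borel_measurable borel"
  shows "cond G \<in> borel_measurable borel"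
  unfolding cond_def by measurable

lemma cond_bounded:
  assumes [measurable]: "G \<in> borel_measurable borel" and B: "\<And>x. \<bar>G x\<bar> \<le> B"
  shows "\<bar>cond G x\<bar> \<le> B"
proof -
  have "\<bar>cond G x\<bar> \<le> (LINT w|M. \<bar>G (x + a 0 * e 1 w)\<bar>)"
    unfolding cond_def by (rule integral_abs_bound)
  also have "\<dots> \<le> (LINT w|M. B)"
    using B order_trans[OF abs_ge_zero B] by (intro integral_mono integrable_bounded_M[where B=B]) auto
  finally show ?thesis by (simp add: prob_space)
qed

text \<open>Written with \<open>lp a' j w + a 0 * e j w\<close> in place of \<open>lp a j w\<close>,
  with which it agrees almost surely. In this form it is everywhere a function of the present
  innovation and the past.\<close>

definition mdiff :: "(real \<Rightarrow> real) \<Rightarrow> int \<Rightarrow> 'a \<Rightarrow> real" where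
  "mdiff G j w = G (lp a' j w + a 0 * e j w) - cond G (lp a' j w)"

lemma mdiff_measurable [measurable]:
  assumes [measurable]: "G \<in> borel_measurable borel"
  shows "mdiff G j \<in> borel_measurable M"
  unfolding mdiff_def by measurable

text \<open>Present and past have a product law. For a fixed past, the integral over the present
  innovation vanishes by the definition of \<open>cond\<close>, and Fubini concludes. Testing
  against bounded functions of the past replaces the use of conditional expectations.\<close>

lemma mdiff_orthogonal:
  assumes [measurable]: "G \<in> borel_measurable borel" and B: "\<And>x. \<bar>G x\<bar> \<le> B"
    and U[measurable]: "U \<in> borel_measurable (PiM {..<j} (\<lambda>_. borel))" and UB: "\<And>v. \<bar>U v\<bar> \<le> B'"
  shows "(LINT w|M. U (past j w) * mdiff G j w) = 0"
proof -
  define P where "P = PiM {..<j} (\<lambda>_::int. borel :: real measure)"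
  define Q where "Q = PiM {j} (\<lambda>_::int. borel :: real measure)"
  define \<Phi> where "\<Phi> x p = U p * (G (xf a' j j p + a 0 * x j) - cond G (xf a' j j p))" for x p
  define N1 N2 where "N1 = distr M Q (pres j)" and "N2 = distr M P (past j)"
  have [measurable]: "pres j \<in> M \<rightarrow>\<^sub>M Q" "(\<lambda>x. x j) \<in> borel_measurable Q"
    unfolding Q_def by (auto intro: measurable_component_singleton)
  have [measurable]: "past j \<in> M \<rightarrow>\<^sub>M P" "U \<in> borel_measurable P" "xf a' j j \<in> borel_measurable P"
    unfolding P_def by measurable
  interpret N1: prob_space N1 unfolding N1_def by (rule prob_space_distr) simp
  interpret N2: prob_space N2 unfolding N2_def by (rule prob_space_distr) simp
  interpret N: pair_prob_space N1 N2 ..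
  have s1[measurable_cong]: "sets N1 = sets Q" "sets N2 = sets P" by (auto simp: N1_def N2_def)
  have prod: "N1 \<Otimes>\<^sub>M N2 = distr M (Q \<Otimes>\<^sub>M P) (\<lambda>w. (pres j w, past j w))"
    using indep_past[of j] unfolding indep_var_distribution_eq N1_def N2_def P_def Q_def by simp
  have \<Phi>m[measurable]: "(\<lambda>(x, p). \<Phi> x p) \<in> borel_measurable (Q \<Otimes>\<^sub>M P)"
    unfolding \<Phi>_def by measurable
  have Gb: "\<bar>G y - cond G z\<bar> \<le> 2 * B" for y z
    using B[of y] cond_bounded[OF assms(1) B, of z] unfolding abs_le_iff by linarith
  have \<Phi>b: "\<bar>\<Phi> x p\<bar> \<le> B' * (2 * B)" for x p
    unfolding \<Phi>_def abs_mult using UB[of p] Gb by (intro mult_mono) auto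
  have int: "integrable (N1 \<Otimes>\<^sub>M N2) (\<lambda>(x, p). \<Phi> x p)"
    by (rule N.integrable_const_bound[of _ "B' * (2 * B)"]) (use \<Phi>b in \<open>auto simp: split_beta\<close>)
  have inner: "(\<integral>x. \<Phi> x p \<partial>N1) = 0" for p
  proof -
    have "(LINT w|M. G (xf a' j j p + a 0 * e j w)) = cond G (xf a' j j p)"
      unfolding cond_def by (rule integral_e_ident) measurable
    moreover have "integrable M (\<lambda>w. G (xf a' j j p + a 0 * e j w))"
      by (rule integrable_bounded_M[where B=B]) (use B in auto)
    ultimately show ?thesis
      unfolding N1_def \<Phi>_def by (subst integral_distr) (auto simp: prob_space pres_def)
  qed
  have "(LINT w|M. U (past j w) * mdiff G j w) = (LINT w|M. (\<lambda>(x, p). \<Phi> x p) (pres j w, past j w))"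
    by (simp add: \<Phi>_def mdiff_def xf_past a'_def pres_def)
  also have "\<dots> = (\<integral>z. (\<lambda>(x, p). \<Phi> x p) z \<partial>(N1 \<Otimes>\<^sub>M N2))"
    unfolding prod by (rule integral_distr[symmetric]) measurable
  also have "\<dots> = (\<integral>p. (\<integral>x. \<Phi> x p \<partial>N1) \<partial>N2)"
    using N.integral_snd[OF int] by simp
  finally show ?thesis by (simp add: inner)
qed

text \<open>For i < j the earlier difference is a function of the past of j, so all mixed terms
  vanish. Each difference is also orthogonal to the conditional mean subtracted in it, so by
  Pythagoras its second moment is at most that of G itself.\<close>

lemma mdiff_sum_var:
  assumes [measurable]: "G \<in> borel_measurable borel" and B: "\<And>x. \<bar>G x\<bar> \<le> B" and I: "finite I"
  shows "(LINT w|M. (\<Sum>i\<in>I. mdiff G i w)\<^sup>2) \<le> (\<Sum>i\<in>I. LINT w|M. (G (lp a i w))\<^sup>2)"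
proof -
  have B0: "0 \<le> B" using B abs_ge_zero order_trans by blast
  have Db: "\<bar>mdiff G i w\<bar> \<le> 2 * B" for i w
    using B[of "lp a' i w + a 0 * e i w"] cond_bounded[OF assms(1) B, of "lp a' i w"]
    unfolding mdiff_def abs_le_iff by linarith
  have DDi: "integrable M (\<lambda>w. mdiff G i w * mdiff G j w)" for i j
  proof (rule integrable_bounded_M[where B="(2 * B) * (2 * B)"])
    show "norm (mdiff G i w * mdiff G j w) \<le> (2 * B) * (2 * B)" for w
      unfolding real_norm_def abs_mult using B0 Db by (intro mult_mono) auto
  qed measurable
  have orth: "(LINT w|M. mdiff G i w * mdiff G j w) = 0" if "i < j" for i j
  proof -
    define U where "U v = G (xf a' i j v + a 0 * v i) - cond G (xf a' i j v)" for v
    have [measurable]: "(\<lambda>v. v i) \<in> borel_measurable (PiM {..<j} (\<lambda>_. borel))"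
      using that by (intro measurable_component_singleton) auto
    have "U \<in> borel_measurable (PiM {..<j} (\<lambda>_. borel))" unfolding U_def by measurable
    moreover have "\<bar>U v\<bar> \<le> 2 * B" for v
      using B[of "xf a' i j v + a 0 * v i"] cond_bounded[OF assms(1) B, of "xf a' i j v"]
      unfolding U_def abs_le_iff by linarith
    ultimately have "(LINT w|M. U (past j w) * mdiff G j w) = 0"
      by (intro mdiff_orthogonal[where B=B and B'="2 * B"]) (use B in auto)
    moreover have "U (past j w) = mdiff G i w" for w
      using that by (simp add: U_def mdiff_def xf_past) (simp add: past_def)
    ultimately show ?thesis by simp
  qed
  have orth': "(LINT w|M. mdiff G i w * mdiff G j w) = 0" if "i \<noteq> j" for i j
    using orth[of i j] orth[of j i] that by (cases "i < j") (auto simp: mult.commute)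
  have sq: "(LINT w|M. (mdiff G i w)\<^sup>2) \<le> (LINT w|M. (G (lp a i w))\<^sup>2)" for i
  proof -
    define h where "h w = cond G (lp a' i w)" for w
    have [measurable]: "h \<in> borel_measurable M" unfolding h_def by measurable
    have hb: "\<bar>h w\<bar> \<le> B" for w unfolding h_def by (rule cond_bounded) (use B in auto)
    have "(LINT w|M. cond G (xf a' i i (past i w)) * mdiff G i w) = 0"
      by (intro mdiff_orthogonal[where B=B and B'=B]) (use B in \<open>auto intro!: cond_bounded\<close>)
    then have hD: "(LINT w|M. h w * mdiff G i w) = 0"
      by (simp add: h_def xf_past a'_def)
    have i1: "integrable M (\<lambda>w. h w * mdiff G i w)"
    proof (rule integrable_bounded_M[where B="B * (2 * B)"])
      show "norm (h w * mdiff G i w) \<le> B * (2 * B)" for w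
        unfolding real_norm_def abs_mult using B0 Db hb by (intro mult_mono) auto
    qed measurable
    have i2: "integrable M (\<lambda>w. h w * h w)"
    proof (rule integrable_bounded_M[where B="B * B"])
      show "norm (h w * h w) \<le> B * B" for w
        unfolding real_norm_def abs_mult using B0 hb by (intro mult_mono) auto
    qed measurable
    have "(LINT w|M. (G (lp a i w))\<^sup>2) = (LINT w|M. (mdiff G i w + h w)\<^sup>2)"
    proof (rule integral_cong_AE)
      show "AE w in M. (G (lp a i w))\<^sup>2 = (mdiff G i w + h w)\<^sup>2"
        using lp_split[of i] by eventually_elim (simp add: mdiff_def h_def)
    qed measurable
    also have "\<dots> = (LINT w|M. mdiff G i w * mdiff G i w + 2 * (h w * mdiff G i w) + h w * h w)"
      by (rule Bochner_Integration.integral_cong) (auto simp: power2_eq_square algebra_simps)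
    also have "\<dots> = (LINT w|M. mdiff G i w * mdiff G i w) + 2 * (LINT w|M. h w * mdiff G i w) + (LINT w|M. h w * h w)"
      using DDi i1 i2 by simp
    also have "\<dots> = (LINT w|M. (mdiff G i w)\<^sup>2) + (LINT w|M. h w * h w)"
      by (simp add: hD power2_eq_square)
    finally show ?thesis by simp
  qed
  have "(LINT w|M. (\<Sum>i\<in>I. mdiff G i w)\<^sup>2) = (LINT w|M. (\<Sum>i\<in>I. \<Sum>j\<in>I. mdiff G i w * mdiff G j w))"
    by (simp add: power2_eq_square sum_product)
  also have "\<dots> = (\<Sum>i\<in>I. LINT w|M. (\<Sum>j\<in>I. mdiff G i w * mdiff G j w))"
    by (rule Bochner_Integration.integral_sum) (intro Bochner_Integration.integrable_sum DDi)
  also have "\<dots> = (\<Sum>i\<in>I. \<Sum>j\<in>I. LINT w|M. mdiff G i w * mdiff G j w)"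
    by (intro sum.cong refl Bochner_Integration.integral_sum DDi)
  also have "\<dots> = (\<Sum>i\<in>I. LINT w|M. (mdiff G i w)\<^sup>2)"
  proof (rule sum.cong[OF refl])
    fix i assume i: "i \<in> I"
    have "(\<Sum>j\<in>I. LINT w|M. mdiff G i w * mdiff G j w) = (\<Sum>j\<in>{i}. LINT w|M. mdiff G i w * mdiff G j w)"
      by (rule sum.mono_neutral_right) (use I i orth' in auto)
    then show "(\<Sum>j\<in>I. LINT w|M. mdiff G i w * mdiff G j w) = (LINT w|M. (mdiff G i w)\<^sup>2)"
      by (simp add: power2_eq_square)
  qed
  also have "\<dots> \<le> (\<Sum>i\<in>I. LINT w|M. (G (lp a i w))\<^sup>2)" by (rule sum_mono) (rule sq)
  finally show ?thesis .
qed

end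

subsection \<open>Variances of sums over a linear process\<close>

text \<open>The modulus of \<Theta> is split as the square root of |\<Theta>| w times the square
  root of |\<Theta>| / w. The weight compensates the growth in t of the second moment of S, and
  Fubini moves the expectation inside.\<close>

lemma (in prob_space) weighted_cauchy_schwarz:
  fixes \<Theta> :: "real \<Rightarrow> complex" and S :: "real \<Rightarrow> 'a \<Rightarrow> complex" and w :: "real \<Rightarrow> real"
  assumes \<Theta>: "integrable lborel \<Theta>" and [measurable]: "w \<in> borel_measurable borel" and w1: "\<And>t. 1 \<le> w t"
    and iw: "integrable lborel (\<lambda>t. cmod (\<Theta> t) * w t)"
    and Sm[measurable]: "case_prod S \<in> borel_measurable (borel \<Otimes>\<^sub>M M)" and SB: "\<And>t \<omega>. cmod (S t \<omega>) \<le> B"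
  shows "(LINT \<omega>|M. (Re (CLINT t|lborel. \<Theta> t * S t \<omega>))\<^sup>2)
     \<le> (LBINT t. cmod (\<Theta> t) * w t) * (LBINT t. cmod (\<Theta> t) / w t * (LINT \<omega>|M. (cmod (S t \<omega>))\<^sup>2))"
proof -
  interpret LM: pair_sigma_finite lborel M ..
  have [measurable]: "\<Theta> \<in> borel_measurable borel" using borel_measurable_integrable[OF \<Theta>] by simp
  have w0: "0 < w t" for t using w1[of t] by linarith
  have B0: "0 \<le> B" using SB norm_ge_zero order_trans by blast
  have \<Theta>n: "integrable lborel (\<lambda>t. cmod (\<Theta> t))" using \<Theta> by simp
  have tw: "integrable lborel (\<lambda>t. cmod (\<Theta> t) * (1 / w t))"
    by (rule integrable_mult_bounded[OF \<Theta>n, where B=1]) (use w1 w0 in \<open>auto simp: less_imp_le\<close>)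
  have SB2: "norm ((cmod (S t \<omega>))\<^sup>2) \<le> B\<^sup>2" for t \<omega>
    using power_mono[OF SB norm_ge_zero, of t \<omega> 2] by (simp only: real_norm_def abs_power2)
  have LMi: "integrable (lborel \<Otimes>\<^sub>M M) (\<lambda>(t, \<omega>). (cmod (\<Theta> t) * (1 / w t)) * 1 * (cmod (S t \<omega>))\<^sup>2)"
    by (rule LM.integrable_product_bounded[OF tw, where B="B\<^sup>2"]) (use SB2 in auto)
  have inS: "integrable lborel (\<lambda>t. (cmod (\<Theta> t) * (1 / w t)) * (cmod (S t \<omega>))\<^sup>2)" if "\<omega> \<in> space M" for \<omega>
    by (rule integrable_mult_bounded[OF tw, where B="B\<^sup>2"]) (use SB2 that in auto)
  have rint: "integrable M (\<lambda>\<omega>. \<integral>t. (cmod (\<Theta> t) * (1 / w t)) * (cmod (S t \<omega>))\<^sup>2 \<partial>lborel)"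
    using LM.integrable_snd[OF LMi] by simp
  have pt: "(Re (CLINT t|lborel. \<Theta> t * S t \<omega>))\<^sup>2
     \<le> (LBINT t. cmod (\<Theta> t) * w t) * (LBINT t. (cmod (\<Theta> t) * (1 / w t)) * (cmod (S t \<omega>))\<^sup>2)"
    if "\<omega> \<in> space M" for \<omega>
  proof -
    define p q where "p t = sqrt (cmod (\<Theta> t) * w t)" and "q t = sqrt (cmod (\<Theta> t) * (1 / w t)) * cmod (S t \<omega>)" for t
    have [measurable]: "p \<in> borel_measurable borel" "q \<in> borel_measurable borel"
      unfolding p_def q_def using that by measurable
    have p2: "(p t)\<^sup>2 = cmod (\<Theta> t) * w t" for t using w0[of t] by (simp add: p_def)
    have q2: "(q t)\<^sup>2 = (cmod (\<Theta> t) * (1 / w t)) * (cmod (S t \<omega>))\<^sup>2" for t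
      using w0[of t] by (simp add: q_def power_mult_distrib)
    have pq: "\<bar>p t * q t\<bar> = cmod (\<Theta> t * S t \<omega>)" for t
    proof -
      have "p t * q t = sqrt ((cmod (\<Theta> t) * w t) * (cmod (\<Theta> t) * (1 / w t))) * cmod (S t \<omega>)"
        by (simp only: p_def q_def real_sqrt_mult mult.assoc)
      also have "(cmod (\<Theta> t) * w t) * (cmod (\<Theta> t) * (1 / w t)) = (cmod (\<Theta> t))\<^sup>2"
        using w0[of t] by (simp add: power2_eq_square)
      finally show ?thesis by (simp add: norm_mult)
    qed
    have "(Re (CLINT t|lborel. \<Theta> t * S t \<omega>))\<^sup>2 \<le> (cmod (CLINT t|lborel. \<Theta> t * S t \<omega>))\<^sup>2"
      using abs_Re_le_cmod by (intro power2_le_iff_abs_le[THEN iffD2]) auto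
    also have "\<dots> \<le> (LBINT t. \<bar>p t * q t\<bar>)\<^sup>2"
      unfolding pq by (intro power_mono integral_norm_bound) simp
    also have "\<dots> \<le> (LBINT t. (p t)\<^sup>2) * (LBINT t. (q t)\<^sup>2)"
      by (rule cauchy_schwarz_integral) (use iw inS[OF that] in \<open>auto simp: p2 q2\<close>)
    finally show ?thesis by (simp only: p2 q2)
  qed
  have "(LINT \<omega>|M. (Re (CLINT t|lborel. \<Theta> t * S t \<omega>))\<^sup>2)
    \<le> (LINT \<omega>|M. (LBINT t. cmod (\<Theta> t) * w t) * (LBINT t. (cmod (\<Theta> t) * (1 / w t)) * (cmod (S t \<omega>))\<^sup>2))"
  proof (rule integral_mono_AE)
    show i: "integrable M (\<lambda>\<omega>. (LBINT t. cmod (\<Theta> t) * w t) * (LBINT t. (cmod (\<Theta> t) * (1 / w t)) * (cmod (S t \<omega>))\<^sup>2))"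
      using rint by (rule integrable_mult_right)
    show "AE \<omega> in M. (Re (CLINT t|lborel. \<Theta> t * S t \<omega>))\<^sup>2
      \<le> (LBINT t. cmod (\<Theta> t) * w t) * (LBINT t. (cmod (\<Theta> t) * (1 / w t)) * (cmod (S t \<omega>))\<^sup>2)"
      using pt by (intro AE_I2)
    then show "integrable M (\<lambda>\<omega>. (Re (CLINT t|lborel. \<Theta> t * S t \<omega>))\<^sup>2)"
      by (intro Bochner_Integration.integrable_bound[OF i]) (auto elim: AE_mp)
  qed
  also have "\<dots> = (LBINT t. cmod (\<Theta> t) * w t) * (LINT \<omega>|M. (LBINT t. (cmod (\<Theta> t) * (1 / w t)) * (cmod (S t \<omega>))\<^sup>2))"
    by (rule integral_mult_right_zero)
  also have "(LINT \<omega>|M. (LBINT t. (cmod (\<Theta> t) * (1 / w t)) * (cmod (S t \<omega>))\<^sup>2))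
     = (LBINT t. (LINT \<omega>|M. (cmod (\<Theta> t) * (1 / w t)) * (cmod (S t \<omega>))\<^sup>2))"
    using LM.Fubini_integral[OF LMi] by simp
  finally show ?thesis by simp
qed

lemma (in prob_space) expectation_synth:
  assumes \<Theta>: "integrable lborel \<Theta>" and [measurable]: "u \<in> borel_measurable M"
  shows "(LINT w|M. synth \<Theta> (u w)) = Re (CLINT t|lborel. \<Theta> t * (CLINT w|M. iexp (t * u w)))"
proof -
  interpret LM: pair_sigma_finite lborel M ..
  have [measurable]: "\<Theta> \<in> borel_measurable borel" using borel_measurable_integrable[OF \<Theta>] by simp
  have i: "integrable (lborel \<Otimes>\<^sub>M M) (\<lambda>(t, w). \<Theta> t * 1 * iexp (t * u w))"
    by (rule LM.integrable_product_bounded[OF \<Theta>, where B=1]) auto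
  have "(LINT w|M. synth \<Theta> (u w)) = Re (CLINT w|M. (CLINT t|lborel. \<Theta> t * iexp (t * u w)))"
    unfolding synth_def using LM.integrable_snd[OF i] by (intro integral_Re) simp
  also have "(CLINT w|M. (CLINT t|lborel. \<Theta> t * iexp (t * u w))) = (CLINT t|lborel. (CLINT w|M. \<Theta> t * iexp (t * u w)))"
    using LM.Fubini_integral[OF i] by simp
  finally show ?thesis by simp
qed

lemma integrable_synth:
  assumes \<Theta>: "integrable lborel \<Theta>"
  shows "integrable lborel (\<lambda>t. \<Theta> t * iexp (t * x))"
  by (rule integrable_mult_bounded[OF \<Theta>, where B=1]) auto

context linproc
begin

lemma Sx_measurable [measurable]: "case_prod (Sx c I) \<in> borel_measurable (borel \<Otimes>\<^sub>M M)"
  unfolding Sx_def by measurable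

lemma cmod_char_le1:
  assumes "u \<in> borel_measurable M"
  shows "cmod (CLINT w|M. iexp (u w)) \<le> 1"
proof -
  have "cmod (CLINT w|M. iexp (u w)) \<le> (LINT w|M. cmod (iexp (u w)))" by (rule integral_norm_bound)
  then show ?thesis by (simp add: prob_space)
qed

lemma Sx_bounded: "cmod (Sx c I s w) \<le> 2 * real (card I)"
proof -
  have "cmod (Sx c I s w) \<le> (\<Sum>i\<in>I. cmod (iexp (s * lp c i w) - (CLINT w|M. iexp (s * lp c i w))))"
    unfolding Sx_def by (rule norm_sum)
  also have "\<dots> \<le> (\<Sum>i\<in>I. 2)"
  proof (rule sum_mono)
    fix i
    have "cmod (iexp (s * lp c i w) - (CLINT w|M. iexp (s * lp c i w))) \<le> cmod (iexp (s * lp c i w)) + cmod (CLINT w|M. iexp (s * lp c i w))"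
      by (rule norm_triangle_ineq4)
    also have "\<dots> \<le> 1 + 1" by (intro add_mono cmod_char_le1) auto
    finally show "cmod (iexp (s * lp c i w) - (CLINT w|M. iexp (s * lp c i w))) \<le> 2" by simp
  qed
  finally show ?thesis by simp
qed

lemma synth_sum:
  assumes \<Theta>: "integrable lborel \<Theta>"
  shows "(\<Sum>i\<in>I. synth \<Theta> (lp c i w) - (LINT w|M. synth \<Theta> (lp c i w))) = Re (CLINT t|lborel. \<Theta> t * Sx c I t w)"
proof -
  have [measurable]: "\<Theta> \<in> borel_measurable borel" using borel_measurable_integrable[OF \<Theta>] by simp
  have i2: "integrable lborel (\<lambda>t. \<Theta> t * (CLINT w|M. iexp (t * lp c i w)))" for i
    by (rule integrable_mult_bounded[OF \<Theta>, where B=1]) (auto intro!: cmod_char_le1 simp del: of_real_mult)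
  have "(CLINT t|lborel. \<Theta> t * Sx c I t w)
     = (CLINT t|lborel. (\<Sum>i\<in>I. \<Theta> t * iexp (t * lp c i w) - \<Theta> t * (CLINT w|M. iexp (t * lp c i w))))"
    by (simp add: Sx_def sum_distrib_left right_diff_distrib)
  also have "\<dots> = (\<Sum>i\<in>I. (CLINT t|lborel. \<Theta> t * iexp (t * lp c i w)) - (CLINT t|lborel. \<Theta> t * (CLINT w|M. iexp (t * lp c i w))))"
    by (subst Bochner_Integration.integral_sum)
       (auto intro!: sum.cong Bochner_Integration.integral_diff Bochner_Integration.integrable_diff integrable_synth[OF \<Theta>] i2 simp del: of_real_mult)
  finally show ?thesis
    by (simp only: expectation_synth[OF \<Theta> lp_meas]) (simp add: synth_def)
qed

text \<open>Averaging over one innovation multiplies the transform by its characteristic function.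
  This is the gain that makes a merely square-integrable transform integrable, even with a growing
  weight.\<close>

lemma cond_synth:
  assumes \<Psi>: "integrable lborel \<Psi>"
  shows "cond (synth \<Psi>) x = synth (\<lambda>t. \<Psi> t * \<phi> (t * a 0)) x"
proof -
  have eq: "(CLINT w|M. iexp (t * (x + a 0 * e 1 w))) = \<phi> (t * a 0) * iexp (t * x)" for t
  proof -
    have "(CLINT w|M. iexp (t * (x + a 0 * e 1 w))) = (CLINT w|M. iexp (t * x) * iexp ((t * a 0) * e 1 w))"
      by (rule Bochner_Integration.integral_cong) (auto simp: exp_add[symmetric] algebra_simps)
    also have "\<dots> = iexp (t * x) * \<phi> (t * a 0)"
      by (simp only: integral_mult_right_zero char_e)
    finally show ?thesis by simp
  qed
  have "cond (synth \<Psi>) x = Re (CLINT t|lborel. \<Psi> t * (CLINT w|M. iexp (t * (x + a 0 * e 1 w))))"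
    unfolding cond_def by (rule expectation_synth[OF \<Psi>]) measurable
  also have "\<dots> = synth (\<lambda>t. \<Psi> t * \<phi> (t * a 0)) x"
    unfolding synth_def eq by (simp only: mult.assoc)
  finally show ?thesis .
qed

lemma weighted_\<phi>_int: "integrable lborel (\<lambda>t. (cmod (\<phi> (t * a 0)) * (1 + \<bar>t\<bar> powr \<gamma>))\<^sup>2)"
proof (rule Bochner_Integration.integrable_bound)
  show "integrable lborel (\<lambda>t. 2 * (cmod (\<phi> (t * a 0)))\<^sup>2 + 2 * (\<bar>t\<bar> powr \<gamma> * cmod (\<phi> (t * a 0)))\<^sup>2)"
    using \<phi>_scaled_int[OF a0] by auto
  have "(x * (1 + y))\<^sup>2 \<le> 2 * x\<^sup>2 + 2 * (y * x)\<^sup>2" for x y :: real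
  proof -
    have "0 \<le> (x - y * x)\<^sup>2" by simp
    then show ?thesis by (simp add: power2_eq_square algebra_simps)
  qed
  then show "AE t in lborel. norm ((cmod (\<phi> (t * a 0)) * (1 + \<bar>t\<bar> powr \<gamma>))\<^sup>2)
    \<le> norm (2 * (cmod (\<phi> (t * a 0)))\<^sup>2 + 2 * (\<bar>t\<bar> powr \<gamma> * cmod (\<phi> (t * a 0)))\<^sup>2)"
    by (intro AE_I2) (simp only: real_norm_def abs_power2, rule order_trans[OF _ abs_ge_self])
qed measurable

text \<open>Let w(t) = 1 + |t|^\<gamma>. By Cauchy-Schwarz the w-weighted L1 norm Z of
  \<open>\<Psi> t * \<phi> (t * a 0)\<close> is at most the L2 norm of \<Psi> times that of
  \<open>\<phi> (t * a 0) * w t\<close>. The second moment of \<open>Sx a'\<close> is at most a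
  multiple of w(t)^2, so \<open>weighted_cauchy_schwarz\<close> produces Z twice, with the constant
  2 C R in front.\<close>

lemma smooth_part_var:
  obtains Cs :: real where "0 \<le> Cs"
    "\<And>\<Psi> I. integrable lborel \<Psi> \<Longrightarrow> integrable lborel (\<lambda>t. (cmod (\<Psi> t))\<^sup>2) \<Longrightarrow> finite I \<Longrightarrow>
      (LINT \<omega>|M. (\<Sum>i\<in>I. cond (synth \<Psi>) (lp a' i \<omega>) - (LINT \<omega>|M. cond (synth \<Psi>) (lp a' i \<omega>)))\<^sup>2)
        \<le> real (card I) * (Cs * (LBINT t. (cmod (\<Psi> t))\<^sup>2))"
proof -
  define R where "R = suminf r"
  have R0: "0 \<le> R" unfolding R_def by (rule suminf_nonneg[OF r_summable r_nonneg])
  define w where "w t = 1 + \<bar>t\<bar> powr \<gamma>" for t :: real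
  have w1: "1 \<le> w t" for t by (simp add: w_def)
  have [measurable]: "w \<in> borel_measurable borel" unfolding w_def by measurable
  define Wt where "Wt = (LBINT t. (cmod (\<phi> (t * a 0)) * w t)\<^sup>2)"
  have Wi: "integrable lborel (\<lambda>t. (cmod (\<phi> (t * a 0)) * w t)\<^sup>2)"
    using weighted_\<phi>_int by (simp add: w_def)
  have W0: "0 \<le> Wt" by (simp add: Wt_def)
  show ?thesis
  proof (rule that[of "2 * C * R * Wt"])
    show "0 \<le> 2 * C * R * Wt" using C_nonneg R0 W0 by simp
    fix \<Psi> :: "real \<Rightarrow> complex" and I :: "int set"
    assume \<Psi>: "integrable lborel \<Psi>" and \<Psi>2: "integrable lborel (\<lambda>t. (cmod (\<Psi> t))\<^sup>2)" and I: "finite I"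
    have [measurable]: "\<Psi> \<in> borel_measurable borel" using borel_measurable_integrable[OF \<Psi>] by simp
    define \<Theta> where "\<Theta> t = \<Psi> t * \<phi> (t * a 0)" for t
    have \<Theta>: "integrable lborel \<Theta>"
      unfolding \<Theta>_def by (rule integrable_mult_bounded[OF \<Psi>, where B=1]) (auto simp: \<phi>_le1)
    have iw: "integrable lborel (\<lambda>t. cmod (\<Theta> t) * w t)"
      using integrable_mult_of_squares[OF _ _ \<Psi>2 Wi] by (simp add: \<Theta>_def norm_mult mult.assoc)
    define Z where "Z = (LBINT t. cmod (\<Theta> t) * w t)"
    have Z0: "0 \<le> Z" unfolding Z_def
    by (intro Bochner_Integration.integral_nonneg mult_nonneg_nonneg norm_ge_zero order_trans[OF zero_le_one w1])
    have Z2: "Z\<^sup>2 \<le> (LBINT t. (cmod (\<Psi> t))\<^sup>2) * Wt"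
    proof -
      have "Z = (LBINT t. \<bar>cmod (\<Psi> t) * (cmod (\<phi> (t * a 0)) * w t)\<bar>)"
        unfolding Z_def using w1 by (intro Bochner_Integration.integral_cong) (auto simp: \<Theta>_def norm_mult abs_mult w_def)
      then show ?thesis unfolding Wt_def
        by (simp only:) (rule cauchy_schwarz_integral[OF _ _ \<Psi>2 Wi]; measurable)
    qed
    have "(LINT \<omega>|M. (\<Sum>i\<in>I. cond (synth \<Psi>) (lp a' i \<omega>) - (LINT \<omega>|M. cond (synth \<Psi>) (lp a' i \<omega>)))\<^sup>2)
       = (LINT \<omega>|M. (Re (CLINT t|lborel. \<Theta> t * Sx a' I t \<omega>))\<^sup>2)"
    proof -
      have "cond (synth \<Psi>) = synth \<Theta>"
        by (simp add: fun_eq_iff cond_synth[OF \<Psi>] \<Theta>_def[abs_def])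
      then show ?thesis by (simp only: synth_sum[OF \<Theta>])
    qed
    also have "\<dots> \<le> Z * (LBINT t. cmod (\<Theta> t) / w t * (LINT \<omega>|M. (cmod (Sx a' I t \<omega>))\<^sup>2))"
      unfolding Z_def by (rule weighted_cauchy_schwarz[OF \<Theta> _ w1 iw _ Sx_bounded]) measurable
    also have "\<dots> \<le> Z * (LBINT t. real (card I) * (2 * C * R) * (cmod (\<Theta> t) * w t))"
    proof (intro mult_left_mono Z0 integral_mono')
      show "integrable lborel (\<lambda>t. real (card I) * (2 * C * R) * (cmod (\<Theta> t) * w t))"
        using iw by (rule integrable_mult_right)
      fix t
      have "\<bar>t\<bar> powr (2 * \<gamma>) \<le> (w t)\<^sup>2"
        unfolding powr_twice[symmetric] w_def by (intro power_mono) auto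
      then have "C * \<bar>t\<bar> powr (2 * \<gamma>) * R \<le> C * (w t)\<^sup>2 * R"
        using C_nonneg R0 by (intro mult_right_mono mult_left_mono) auto
      then have "real (card I) * (2 * (C * \<bar>t\<bar> powr (2 * \<gamma>) * R)) \<le> real (card I) * (2 * (C * (w t)\<^sup>2 * R))"
        by (intro mult_left_mono) auto
      then have "(LINT \<omega>|M. (cmod (Sx a' I t \<omega>))\<^sup>2) \<le> real (card I) * (2 * (C * (w t)\<^sup>2 * R))"
        by (rule order_trans[OF Sx_var[OF dom_a' I, of t, folded R_def]])
      then have "cmod (\<Theta> t) / w t * (LINT \<omega>|M. (cmod (Sx a' I t \<omega>))\<^sup>2) \<le> cmod (\<Theta> t) / w t * (real (card I) * (2 * (C * (w t)\<^sup>2 * R)))"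
        using w1[of t] by (intro mult_left_mono) auto
      also have "\<dots> = real (card I) * (2 * C * R) * (cmod (\<Theta> t) * w t)"
        using w1[of t] by (simp add: power2_eq_square)
      finally show "cmod (\<Theta> t) / w t * (LINT \<omega>|M. (cmod (Sx a' I t \<omega>))\<^sup>2) \<le> real (card I) * (2 * C * R) * (cmod (\<Theta> t) * w t)" .
      show "0 \<le> real (card I) * (2 * C * R) * (cmod (\<Theta> t) * w t)"
        using C_nonneg R0 w1[of t] by simp
    qed
    also have "\<dots> = real (card I) * (2 * C * R) * Z\<^sup>2"
      by (simp add: Z_def power2_eq_square)
    also have "\<dots> \<le> real (card I) * (2 * C * R) * ((LBINT t. (cmod (\<Psi> t))\<^sup>2) * Wt)"
      using Z2 C_nonneg R0 by (intro mult_left_mono) auto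
    finally show "(LINT \<omega>|M. (\<Sum>i\<in>I. cond (synth \<Psi>) (lp a' i \<omega>) - (LINT \<omega>|M. cond (synth \<Psi>) (lp a' i \<omega>)))\<^sup>2)
        \<le> real (card I) * (2 * C * R * Wt * (LBINT t. (cmod (\<Psi> t))\<^sup>2))"
      by (simp add: mult_ac)
  qed
qed

end

lemma sum_squares_le: "(x + y)\<^sup>2 \<le> 2 * x\<^sup>2 + 2 * (y::real)\<^sup>2"
proof -
  have "0 \<le> (x - y)\<^sup>2" by simp
  then show ?thesis by (simp add: power2_eq_square algebra_simps)
qed

text \<open>The transform whose synthesis represents G once it is damped by
  \<open>\<kappa> (h * t)\<close>, see \<open>smooth_eq_synth\<close>. The conjugate appears because
  \<open>fourier\<close> and \<open>synth\<close> use exponentials of the same sign.\<close>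

definition coft :: "(real \<Rightarrow> real) \<Rightarrow> real \<Rightarrow> complex" where
  "coft G t = complex_of_real (1 / (2 * pi)) * cnj (fourier G t)"

lemma coft_measurable [measurable]: "G \<in> borel_measurable borel \<Longrightarrow> coft G \<in> borel_measurable borel"
  unfolding coft_def by measurable

lemma coft_sq_integrable:
  assumes G: "integrable lborel G" and B: "\<And>x. \<bar>G x\<bar> \<le> B"
  shows "integrable lborel (\<lambda>t. (cmod (coft G t))\<^sup>2)"
proof -
  have "(\<lambda>t. (cmod (coft G t))\<^sup>2) = (\<lambda>t. (1 / (2 * pi))\<^sup>2 * (cmod (fourier G t))\<^sup>2)"
    by (simp add: coft_def norm_divide norm_mult power_divide fun_eq_iff)
  then show ?thesis using plancherel(1)[OF G B] by simp
qed

lemma smooth_eq_synth: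
  assumes k: "cos_inversion k \<kappa>" "k \<in> borel_measurable borel" and G: "integrable lborel G" and h: "0 < h"
  shows "smooth k h G = synth (\<lambda>t. \<kappa> (h * t) * coft G t)"
    and "integrable lborel (\<lambda>t. \<kappa> (h * t) * coft G t)"
proof -
  have \<kappa>: "integrable lborel \<kappa>" using k by (simp add: cos_inversion_def)
  have [measurable]: "\<kappa> \<in> borel_measurable borel" "G \<in> borel_measurable borel"
    using borel_measurable_integrable[OF \<kappa>] borel_measurable_integrable[OF G] by simp_all
  have \<kappa>h: "integrable lborel (\<lambda>t. complex_of_real (\<kappa> (h * t)))"
    using lborel_integrable_real_affine[OF \<kappa>, of h 0] h by simp
  show i: "integrable lborel (\<lambda>t. \<kappa> (h * t) * coft G t)"
  proof (rule integrable_mult_bounded[OF \<kappa>h])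
    show "cmod (coft G t) \<le> (LBINT x. \<bar>G x\<bar>) / (2 * pi)" for t
      using cmod_fourier_le[OF G, of t] by (simp add: coft_def norm_divide norm_mult divide_right_mono)
  qed measurable
  show "smooth k h G = synth (\<lambda>t. \<kappa> (h * t) * coft G t)"
  proof
    fix x
    have "synth (\<lambda>t. \<kappa> (h * t) * coft G t) x = (LBINT t. Re (\<kappa> (h * t) * coft G t * iexp (t * x)))"
      unfolding synth_def by (rule integral_Re[symmetric]) (rule integrable_synth[OF i])
    also have "\<dots> = (LBINT t. 1 / (2 * pi) * (\<kappa> (h * t) * (LBINT y. G y * cos (t * (x - y)))))"
    proof (rule Bochner_Integration.integral_cong[OF refl])
      fix t
      have "Re (\<kappa> (h * t) * coft G t * iexp (t * x)) = 1 / (2 * pi) * (\<kappa> (h * t) * Re (cnj (fourier G t) * iexp (t * x)))"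
        unfolding coft_def by (simp only: mult.assoc Re_complex_of_real mult_ac) (simp add: algebra_simps add_divide_distrib)
      also have "Re (cnj (fourier G t) * iexp (t * x)) = (LBINT y. G y * cos (t * (x - y)))"
        by (simp add: integral_cos_shift[OF G] Re_exp Im_exp mult.commute)
      finally show "Re (\<kappa> (h * t) * coft G t * iexp (t * x)) = 1 / (2 * pi) * (\<kappa> (h * t) * (LBINT y. G y * cos (t * (x - y))))" .
    qed
    also have "\<dots> = 1 / (2 * pi) * (LBINT t. \<kappa> (h * t) * (LBINT y. G y * cos (t * (x - y))))"
      by (rule integral_mult_right_zero)
    also have "\<dots> = smooth k h G x" by (rule smooth_fourier[OF k G h, symmetric])
    finally show "smooth k h G x = synth (\<lambda>t. \<kappa> (h * t) * coft G t) x" ..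
  qed
qed

lemma (in prob_space) variance_le_second_moment:
  fixes Z :: "'a \<Rightarrow> real"
  assumes [measurable]: "Z \<in> borel_measurable M" and B: "\<And>w. \<bar>Z w\<bar> \<le> B"
  shows "(LINT w|M. (Z w - (LINT w|M. Z w))\<^sup>2) \<le> (LINT w|M. (Z w)\<^sup>2)"
proof -
  have B2: "\<bar>(Z w)\<^sup>2\<bar> \<le> B\<^sup>2" for w
    using power_mono[OF B[of w], of 2] by simp
  have "integrable M Z" by (rule integrable_const_bound[of _ B]) (use B in auto)
  moreover have "integrable M (\<lambda>w. (Z w)\<^sup>2)" by (rule integrable_const_bound[of _ "B\<^sup>2"]) (use B2 in auto)
  ultimately have "(LINT w|M. (Z w - (LINT w|M. Z w))\<^sup>2) = (LINT w|M. (Z w)\<^sup>2) - (LINT w|M. Z w)\<^sup>2"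
    by (rule variance_eq)
  then show ?thesis by simp
qed

locale linproc_dens = linproc +
  fixes f :: "real \<Rightarrow> real" and Fb :: real
  assumes dens: "distributed M lborel (lp a n) (\<lambda>x. ennreal (f x))"
    and f0: "0 \<le> f x" and fB: "f x \<le> Fb"
begin

lemma f_meas [measurable]: "f \<in> borel_measurable borel"
  using distributed_real_measurable[OF _ dens[of 0]] f0 by simp

lemma Fb0: "0 \<le> Fb" using f0[of 0] fB[of 0] by linarith

lemma E_dens:
  fixes u :: "real \<Rightarrow> real"
  assumes "u \<in> borel_measurable borel"
  shows "(LINT w|M. u (lp a n w)) = (LBINT x. f x * u x)"
  using distributed_integral[OF dens[of n], of u] assms f0 by simp

lemma f_int: "integrable lborel f"
  using distributed_integrable[OF dens[of 0], of "\<lambda>_. 1"] f0 by simp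

lemma f_abs: "\<bar>f x\<bar> \<le> Fb" using f0[of x] fB[of x] by simp

lemma char_f: "(CLINT w|M. iexp (s * lp a n w)) = fourier f s"
proof -
  have "(CLINT w|M. iexp (s * lp a n w)) = (CLINT x|distr M lborel (lp a n). iexp (s * x))"
    by (subst integral_distr) auto
  also have "\<dots> = (CLINT x|density lborel (\<lambda>x. ennreal (f x)). iexp (s * x))"
    by (simp only: distributed_distr_eq_density[OF dens])
  also have "\<dots> = (CLINT x|lborel. f x *\<^sub>R iexp (s * x))"
    by (rule integral_density) (use f0 in auto)
  finally show ?thesis by (simp add: fourier_def scaleR_conv_of_real mult.commute)
qed

lemma E_sq_le:
  assumes [measurable]: "u \<in> borel_measurable borel" and i: "integrable lborel (\<lambda>x. (u x)\<^sup>2)"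
  shows "(LINT w|M. (u (lp a n w))\<^sup>2) \<le> Fb * (LBINT x. (u x)\<^sup>2)"
proof -
  have "(LINT w|M. (u (lp a n w))\<^sup>2) = (LBINT x. f x * (u x)\<^sup>2)"
    by (rule E_dens) measurable
  also have "\<dots> \<le> (LBINT x. Fb * (u x)\<^sup>2)"
    by (rule integral_mono') (use i fB Fb0 in \<open>auto intro!: mult_right_mono\<close>)
  finally show ?thesis by simp
qed

text \<open>Each summand is split into its martingale difference and its conditional mean. The
  differences cost at most the squared L2 norm of G times the bound \<open>Fb\<close> on the
  density; the conditional means are covered by \<open>smooth_part_var\<close>. The constant is
  uniform in \<Psi> and I, on which the approximation arguments below rely, and it doubles both
  contributions because the parts are combined by \<open>sum_squares_le\<close>.\<close>

lemma synth_var: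
  obtains Cv :: real where "0 \<le> Cv"
    "\<And>\<Psi> I. integrable lborel \<Psi> \<Longrightarrow> integrable lborel (\<lambda>t. (cmod (\<Psi> t))\<^sup>2) \<Longrightarrow> finite I \<Longrightarrow>
      (LINT w|M. (\<Sum>i\<in>I. synth \<Psi> (lp a i w) - (LINT w|M. synth \<Psi> (lp a i w)))\<^sup>2)
        \<le> real (card I) * (Cv * (LBINT t. (cmod (\<Psi> t))\<^sup>2))"
proof -
  obtain Cs :: real where Cs: "0 \<le> Cs"
    "\<And>\<Psi> I. integrable lborel \<Psi> \<Longrightarrow> integrable lborel (\<lambda>t. (cmod (\<Psi> t))\<^sup>2) \<Longrightarrow> finite I \<Longrightarrow>
      (LINT w|M. (\<Sum>i\<in>I. cond (synth \<Psi>) (lp a' i w) - (LINT w|M. cond (synth \<Psi>) (lp a' i w)))\<^sup>2)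
        \<le> real (card I) * (Cs * (LBINT t. (cmod (\<Psi> t))\<^sup>2))"
    by (rule smooth_part_var) (rule that; assumption)
  show ?thesis
  proof (rule that[of "2 * (Fb * (2 * pi)) + 2 * Cs"])
    show "0 \<le> 2 * (Fb * (2 * pi)) + 2 * Cs" using Fb0 Cs by simp
    fix \<Psi> :: "real \<Rightarrow> complex" and I :: "int set"
    assume \<Psi>: "integrable lborel \<Psi>" and \<Psi>2: "integrable lborel (\<lambda>t. (cmod (\<Psi> t))\<^sup>2)" and I: "finite I"
    define G where "G = synth \<Psi>"
    define Q where "Q = (LBINT t. (cmod (\<Psi> t))\<^sup>2)"
    define B where "B = (LBINT t. cmod (\<Psi> t))"
    have [measurable]: "\<Psi> \<in> borel_measurable borel" using borel_measurable_integrable[OF \<Psi>] by simp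
    have [measurable]: "G \<in> borel_measurable borel" unfolding G_def by measurable
    have GB: "\<bar>G x\<bar> \<le> B" for x unfolding G_def B_def by (rule abs_synth_le)
    have B0: "0 \<le> B" using GB abs_ge_zero order_trans by blast
    have cb: "\<bar>cond G x\<bar> \<le> B" for x by (rule cond_bounded) (use GB in auto)
    have mb: "\<bar>mdiff G i w\<bar> \<le> 2 * B" for i w
      using GB[of "lp a' i w + a 0 * e i w"] cb[of "lp a' i w"] unfolding mdiff_def abs_le_iff by linarith
    \<comment> \<open>Tested against the constant 1, a martingale difference has mean zero; hence
      the sum of the differences needs no centring.\<close>
    have Em: "(LINT w|M. G (lp a i w)) = (LINT w|M. cond G (lp a' i w))" for i
    proof -
      have "(LINT w|M. (\<lambda>_. 1) (past i w) * mdiff G i w) = 0"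
        by (rule mdiff_orthogonal[where B=B and B'=1]) (use GB in auto)
      moreover have "(LINT w|M. G (lp a i w)) = (LINT w|M. mdiff G i w + cond G (lp a' i w))"
      proof (rule integral_cong_AE)
        show "AE w in M. G (lp a i w) = mdiff G i w + cond G (lp a' i w)"
          using lp_split[of i] by eventually_elim (simp add: mdiff_def)
      qed measurable
      moreover have "integrable M (mdiff G i)"
        by (rule integrable_bounded_M[where B="2 * B"]) (use mb in auto)
      moreover have "integrable M (\<lambda>w. cond G (lp a' i w))"
        by (rule integrable_bounded_M[where B=B]) (use cb in auto)
      ultimately show ?thesis by simp
    qed
    define P where "P w = (\<Sum>i\<in>I. mdiff G i w)" for w
    define H where "H w = (\<Sum>i\<in>I. cond G (lp a' i w) - (LINT w|M. cond G (lp a' i w)))" for w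
    have [measurable]: "P \<in> borel_measurable M" "H \<in> borel_measurable M" unfolding P_def H_def by auto
    have Eb: "\<bar>LINT w|M. cond G (lp a' i w)\<bar> \<le> B" for i
    proof -
      have "\<bar>LINT w|M. cond G (lp a' i w)\<bar> \<le> (LINT w|M. \<bar>cond G (lp a' i w)\<bar>)" by (rule integral_abs_bound)
      also have "\<dots> \<le> (LINT w|M. B)" by (rule integral_mono') (use cb B0 in auto)
      finally show ?thesis by (simp add: prob_space)
    qed
    have Pb: "\<bar>P w\<bar> \<le> real (card I) * (2 * B)" for w
      unfolding P_def using sum_bounded_above[of I "\<lambda>i. \<bar>mdiff G i w\<bar>" "2 * B"] mb
      by (intro order_trans[OF sum_abs]) auto
    have Hb: "\<bar>H w\<bar> \<le> real (card I) * (2 * B)" for w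
    proof -
      have "\<bar>cond G (lp a' i w) - (LINT w|M. cond G (lp a' i w))\<bar> \<le> 2 * B" for i
        using cb[of "lp a' i w"] Eb[of i] unfolding abs_le_iff by linarith
      then show ?thesis
        unfolding H_def using sum_bounded_above[of I "\<lambda>i. \<bar>cond G (lp a' i w) - (LINT w|M. cond G (lp a' i w))\<bar>" "2 * B"]
        by (intro order_trans[OF sum_abs]) auto
    qed
    have sqi: "integrable M (\<lambda>w. (P w)\<^sup>2)" "integrable M (\<lambda>w. (H w)\<^sup>2)"
      using power_mono[OF Pb, of _ 2] power_mono[OF Hb, of _ 2]
      by (auto intro!: integrable_bounded_M[where B="(real (card I) * (2 * B))\<^sup>2"])
    have "(LINT w|M. (\<Sum>i\<in>I. G (lp a i w) - (LINT w|M. G (lp a i w)))\<^sup>2) = (LINT w|M. (P w + H w)\<^sup>2)"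
    proof (rule integral_cong_AE)
      have "AE w in M. \<forall>i\<in>I. lp a i w = lp a' i w + a 0 * e i w"
        using I lp_split by (intro AE_finite_allI) auto
      then show "AE w in M. (\<Sum>i\<in>I. G (lp a i w) - (LINT w|M. G (lp a i w)))\<^sup>2 = (P w + H w)\<^sup>2"
        by eventually_elim (simp add: P_def H_def Em mdiff_def sum.distrib[symmetric])
    qed measurable
    also have "\<dots> \<le> (LINT w|M. 2 * (P w)\<^sup>2 + 2 * (H w)\<^sup>2)"
      by (rule integral_mono') (use sqi sum_squares_le in auto)
    also have "\<dots> = 2 * (LINT w|M. (P w)\<^sup>2) + 2 * (LINT w|M. (H w)\<^sup>2)"
      using sqi by simp
    also have "(LINT w|M. (P w)\<^sup>2) \<le> real (card I) * (Fb * (2 * pi) * Q)"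
    proof -
      have "(LINT w|M. (P w)\<^sup>2) \<le> (\<Sum>i\<in>I. LINT w|M. (G (lp a i w))\<^sup>2)"
        unfolding P_def by (rule mdiff_sum_var[OF _ GB I]) measurable
      also have "\<dots> \<le> (\<Sum>i\<in>I. Fb * (2 * pi) * Q)"
      proof (rule sum_mono)
        fix i
        have "(LINT w|M. (G (lp a i w))\<^sup>2) \<le> Fb * (LBINT x. (G x)\<^sup>2)"
          unfolding G_def by (rule E_sq_le) (use synth_L2_bound(1)[OF \<Psi> \<Psi>2] in auto)
        also have "\<dots> \<le> Fb * (2 * pi * Q)"
          unfolding G_def Q_def by (intro mult_left_mono synth_L2_bound \<Psi> \<Psi>2 Fb0)
        finally show "(LINT w|M. (G (lp a i w))\<^sup>2) \<le> Fb * (2 * pi) * Q" by (simp add: mult_ac)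
      qed
      finally show ?thesis by simp
    qed
    also have "(LINT w|M. (H w)\<^sup>2) \<le> real (card I) * (Cs * Q)"
      unfolding H_def G_def Q_def by (rule Cs(2)[OF \<Psi> \<Psi>2 I])
    finally show "(LINT w|M. (\<Sum>i\<in>I. synth \<Psi> (lp a i w) - (LINT w|M. synth \<Psi> (lp a i w)))\<^sup>2)
        \<le> real (card I) * ((2 * (Fb * (2 * pi)) + 2 * Cs) * (LBINT t. (cmod (\<Psi> t))\<^sup>2))"
      unfolding G_def[symmetric] Q_def[symmetric] by (simp add: algebra_simps)
  qed
qed

end

subsection \<open>Truncation to finite moving averages\<close>

lemma synth_diff:
  assumes "integrable lborel \<Psi>1" "integrable lborel \<Psi>2"
  shows "synth (\<lambda>t. \<Psi>1 t - \<Psi>2 t) x = synth \<Psi>1 x - synth \<Psi>2 x"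
  using integrable_synth[OF assms(1), of x] integrable_synth[OF assms(2), of x]
  by (simp add: synth_def left_diff_distrib)

lemma cmod_diff_square_le: "(cmod (x - y))\<^sup>2 \<le> 2 * (cmod x)\<^sup>2 + 2 * (cmod y)\<^sup>2"
proof -
  have "(cmod (x - y))\<^sup>2 \<le> (cmod x + cmod y)\<^sup>2"
    by (intro power_mono norm_triangle_ineq4) simp
  then show ?thesis using sum_squares_le[of "cmod x" "cmod y"] by linarith
qed

lemma cmod_diff_square_integrable:
  assumes "integrable N (\<lambda>t. (cmod (x t))\<^sup>2)" "integrable N (\<lambda>t. (cmod (y t))\<^sup>2)"
    and [measurable]: "x \<in> borel_measurable N" "y \<in> borel_measurable N"
  shows "integrable N (\<lambda>t. (cmod (x t - y t))\<^sup>2)"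
proof (rule Bochner_Integration.integrable_bound)
  show "integrable N (\<lambda>t. 2 * (cmod (x t))\<^sup>2 + 2 * (cmod (y t))\<^sup>2)" using assms by auto
  show "AE t in N. norm ((cmod (x t - y t))\<^sup>2) \<le> norm (2 * (cmod (x t))\<^sup>2 + 2 * (cmod (y t))\<^sup>2)"
    by (intro AE_I2) (simp only: real_norm_def abs_power2, rule order_trans[OF cmod_diff_square_le abs_ge_self])
qed measurable

context prob_space
begin

definition csum :: "(int \<Rightarrow> 'a \<Rightarrow> real) \<Rightarrow> int set \<Rightarrow> 'a \<Rightarrow> real" where
  "csum Z I w = (\<Sum>i\<in>I. Z i w - (LINT w|M. Z i w))"

lemma csum_measurable [measurable]:
  assumes [measurable]: "\<And>i. Z i \<in> borel_measurable M"
  shows "csum Z I \<in> borel_measurable M"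
  unfolding csum_def by measurable

lemma csum_bounded:
  assumes [measurable]: "\<And>i. Z i \<in> borel_measurable M" and B: "\<And>i w. \<bar>Z i w\<bar> \<le> B"
  shows "\<bar>csum Z I w\<bar> \<le> real (card I) * (2 * B)"
proof -
  have B0: "0 \<le> B" using B abs_ge_zero order_trans by blast
  have E: "\<bar>LINT w|M. Z i w\<bar> \<le> B" for i
  proof -
    have "\<bar>LINT w|M. Z i w\<bar> \<le> (LINT w|M. \<bar>Z i w\<bar>)" by (rule integral_abs_bound)
    also have "\<dots> \<le> (LINT w|M. B)" by (rule integral_mono') (use B B0 in auto)
    finally show ?thesis by (simp add: prob_space)
  qed
  have "\<bar>csum Z I w\<bar> \<le> (\<Sum>i\<in>I. \<bar>Z i w - (LINT w|M. Z i w)\<bar>)"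
    unfolding csum_def by (rule sum_abs)
  also have "\<dots> \<le> (\<Sum>i\<in>I. 2 * B)"
  proof (rule sum_mono)
    fix i show "\<bar>Z i w - (LINT w|M. Z i w)\<bar> \<le> 2 * B"
      using B[of i w] E[of i] unfolding abs_le_iff by linarith
  qed
  finally show ?thesis by simp
qed

lemma bounded_square_integrable:
  assumes [measurable]: "(Y :: 'a \<Rightarrow> real) \<in> borel_measurable M" and B: "\<And>w. \<bar>Y w\<bar> \<le> B"
  shows "integrable M (\<lambda>w. (Y w)\<^sup>2)"
proof (rule integrable_const_bound[of _ "B\<^sup>2"])
  show "AE w in M. norm ((Y w)\<^sup>2) \<le> B\<^sup>2"
    using power_mono[OF B abs_ge_zero, of _ 2] by (intro AE_I2) simp
qed measurable

lemma csum_sq_integrable: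
  assumes "\<And>i. Z i \<in> borel_measurable M" and B: "\<And>i w. \<bar>Z i w\<bar> \<le> B"
  shows "integrable M (\<lambda>w. (csum Z I w)\<^sup>2)"
  by (rule bounded_square_integrable[OF csum_measurable[OF assms(1)] csum_bounded[OF assms]])

lemma csum_add:
  assumes [measurable]: "\<And>i. Z i \<in> borel_measurable M" "\<And>i. Z' i \<in> borel_measurable M"
    and B: "\<And>i w. \<bar>Z i w\<bar> \<le> B" and B': "\<And>i w. \<bar>Z' i w\<bar> \<le> B'"
  shows "csum (\<lambda>i w. Z i w + Z' i w) I w = csum Z I w + csum Z' I w"
proof -
  have "integrable M (Z i)" "integrable M (Z' i)" for i
    by (rule integrable_const_bound[of _ B]; use B in simp) (rule integrable_const_bound[of _ B']; use B' in simp)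
  then show ?thesis by (simp add: csum_def sum.distrib[symmetric] algebra_simps)
qed

lemma csum_diff:
  assumes [measurable]: "\<And>i. Z i \<in> borel_measurable M" "\<And>i. Z' i \<in> borel_measurable M"
    and B: "\<And>i w. \<bar>Z i w\<bar> \<le> B" and B': "\<And>i w. \<bar>Z' i w\<bar> \<le> B'"
  shows "csum (\<lambda>i w. Z i w - Z' i w) I w = csum Z I w - csum Z' I w"
proof -
  have "csum (\<lambda>i w. Z i w + - Z' i w) I w = csum Z I w + csum (\<lambda>i w. - Z' i w) I w"
    by (rule csum_add[where B=B and B'=B']) (use B B' in auto)
  then show ?thesis by (simp add: csum_def sum_subtractf sum_negf)
qed

text \<open>Uses nothing about the dependence between the summands. The quadratic factor does no
  harm where I is fixed and v tends to 0.\<close>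

lemma csum_var_crude:
  assumes [measurable]: "\<And>i. Z i \<in> borel_measurable M" and B: "\<And>i w. \<bar>Z i w\<bar> \<le> B"
    and v: "\<And>i. (LINT w|M. (Z i w)\<^sup>2) \<le> v"
  shows "(LINT w|M. (csum Z I w)\<^sup>2) \<le> real (card I) * (real (card I) * v)"
proof -
  have sq: "integrable M (\<lambda>w. (Z i w - (LINT w|M. Z i w))\<^sup>2)" for i
    using csum_sq_integrable[OF assms(1) B, where I="{i}"] by (simp add: csum_def)
  have "(LINT w|M. (csum Z I w)\<^sup>2) \<le> (LINT w|M. (\<Sum>i\<in>I. (Z i w - (LINT w|M. Z i w))\<^sup>2) * real (card I))"
    unfolding csum_def by (rule integral_mono') (use sq sum_squared_le_sum_of_squares in \<open>auto intro!: sum_nonneg mult_nonneg_nonneg\<close>)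
  also have "\<dots> = (\<Sum>i\<in>I. LINT w|M. (Z i w - (LINT w|M. Z i w))\<^sup>2) * real (card I)"
    using sq by (simp add: Bochner_Integration.integral_sum)
  also have "\<dots> \<le> (\<Sum>i\<in>I. v) * real (card I)"
    by (intro mult_right_mono sum_mono order_trans[OF variance_le_second_moment v]) (use B in auto)
  finally show ?thesis by (simp add: mult_ac)
qed

end

context linproc_dens
begin

text \<open>Carries \<open>synth_var\<close> over to a G whose transform need not be integrable. Its
  Gaussian smoothing is a synthesis of an integrable transform, and the damped transforms converge
  to \<open>coft G\<close> in L2. The constant does not depend on \<Psi> or I.\<close>

lemma residual_var:
  assumes G: "integrable lborel G" and B: "\<And>x. \<bar>G x\<bar> \<le> B"
  obtains Cw :: real where "0 \<le> Cw"
    "\<And>\<Psi> I. integrable lborel \<Psi> \<Longrightarrow>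
       integrable lborel (\<lambda>t. (cmod (\<Psi> t))\<^sup>2) \<Longrightarrow> finite I \<Longrightarrow>
       (LINT \<omega>|M. (csum (\<lambda>i \<omega>. G (lp a i \<omega>) - synth \<Psi> (lp a i \<omega>)) I \<omega>)\<^sup>2)
         \<le> real (card I) * (Cw * (LBINT t. (cmod (coft G t - \<Psi> t))\<^sup>2))"
proof -
  obtain Cv :: real where Cv: "0 \<le> Cv"
    "\<And>\<Psi> I. integrable lborel \<Psi> \<Longrightarrow> integrable lborel (\<lambda>t. (cmod (\<Psi> t))\<^sup>2) \<Longrightarrow> finite I \<Longrightarrow>
      (LINT \<omega>|M. (\<Sum>i\<in>I. synth \<Psi> (lp a i \<omega>) - (LINT \<omega>|M. synth \<Psi> (lp a i \<omega>)))\<^sup>2)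
        \<le> real (card I) * (Cv * (LBINT t. (cmod (\<Psi> t))\<^sup>2))"
    by (rule synth_var) (rule that; assumption)
  show ?thesis
  proof (rule that[of "2 * Cv"])
    show "0 \<le> 2 * Cv" using Cv by simp
    fix \<Psi> :: "real \<Rightarrow> complex" and I :: "int set"
    assume \<Psi>: "integrable lborel \<Psi>"
      and \<Psi>2: "integrable lborel (\<lambda>t. (cmod (\<Psi> t))\<^sup>2)" and I: "finite I"
    have [measurable]: "G \<in> borel_measurable borel" "\<Psi> \<in> borel_measurable borel"
      using borel_measurable_integrable[OF G] borel_measurable_integrable[OF \<Psi>] by simp_all
    define \<eta> where "\<eta> n = 1 / real (Suc n)" for n
    have \<eta>0: "\<eta> \<longlonglongrightarrow> 0" unfolding \<eta>_def using LIMSEQ_Suc[OF lim_1_over_n] by simp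
    have \<eta>p: "0 < \<eta> n" for n by (simp add: \<eta>_def)
    define Gs where "Gs n = smooth std_normal_density (\<eta> n) G" for n
    define \<Gamma> where "\<Gamma> n t = complex_of_real (exp (- (\<eta> n * t)\<^sup>2 / 2)) * coft G t" for n t
    have Gs: "Gs n = synth (\<Gamma> n)" and \<Gamma>: "integrable lborel (\<Gamma> n)" for n
      using smooth_eq_synth[OF gauss_cos_inversion _ G \<eta>p[of n]] unfolding Gs_def \<Gamma>_def[abs_def] by auto
    have [measurable]: "\<Gamma> n \<in> borel_measurable borel" for n unfolding \<Gamma>_def by measurable
    have [measurable]: "Gs n \<in> borel_measurable borel" for n unfolding Gs by measurable
    have \<Gamma>le: "cmod (\<Gamma> n t) \<le> cmod (coft G t)" for n t
      by (simp add: \<Gamma>_def norm_mult mult_left_le_one_le)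
    have c2: "integrable lborel (\<lambda>t. (cmod (coft G t))\<^sup>2)" by (rule coft_sq_integrable[OF G B])
    have \<Gamma>2: "integrable lborel (\<lambda>t. (cmod (\<Gamma> n t))\<^sup>2)" for n
      by (rule Bochner_Integration.integrable_bound[OF c2]) (auto intro!: power_mono \<Gamma>le)
    have GsB: "\<bar>Gs n x\<bar> \<le> B" for n x
      using smooth_bounded[of std_normal_density G B "\<eta> n" x] B by (simp add: Gs_def normal_density_nonneg)
    define D where "D n = (LBINT x. \<bar>Gs n x - G x\<bar>)" for n
    have D0: "D \<longlonglongrightarrow> 0"
      unfolding D_def Gs_def by (rule approximate_identity[OF _ _ G B \<eta>0]) auto
    have Di: "integrable lborel (\<lambda>x. Gs n x - G x)" for n
      unfolding Gs_def by (rule smooth_diff_L1(1)[OF _ _ G B]) auto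
    define q where "q n = (LBINT t. (cmod (\<Gamma> n t - \<Psi> t))\<^sup>2)" for n
    have q: "q \<longlonglongrightarrow> (LBINT t. (cmod (coft G t - \<Psi> t))\<^sup>2)"
      unfolding q_def
    proof (rule integral_dominated_convergence[where w="\<lambda>t. 2 * (cmod (coft G t))\<^sup>2 + 2 * (cmod (\<Psi> t))\<^sup>2"])
      show "AE t in lborel. (\<lambda>n. (cmod (\<Gamma> n t - \<Psi> t))\<^sup>2) \<longlonglongrightarrow> (cmod (coft G t - \<Psi> t))\<^sup>2"
      proof (rule AE_I2)
        fix t
        have "(\<lambda>n. complex_of_real (exp (- (\<eta> n * t)\<^sup>2 / 2)) * coft G t) \<longlonglongrightarrow> complex_of_real (exp (- (0 * t)\<^sup>2 / 2)) * coft G t"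
          by (intro tendsto_intros \<eta>0) simp
        then have "(\<lambda>n. \<Gamma> n t) \<longlonglongrightarrow> coft G t" by (simp add: \<Gamma>_def)
        then show "(\<lambda>n. (cmod (\<Gamma> n t - \<Psi> t))\<^sup>2) \<longlonglongrightarrow> (cmod (coft G t - \<Psi> t))\<^sup>2"
          by (intro tendsto_intros)
      qed
      show "AE t in lborel. norm ((cmod (\<Gamma> n t - \<Psi> t))\<^sup>2) \<le> 2 * (cmod (coft G t))\<^sup>2 + 2 * (cmod (\<Psi> t))\<^sup>2" for n
      proof (rule AE_I2)
        fix t
        have "(cmod (\<Gamma> n t - \<Psi> t))\<^sup>2 \<le> 2 * (cmod (\<Gamma> n t))\<^sup>2 + 2 * (cmod (\<Psi> t))\<^sup>2" by (rule cmod_diff_square_le)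
        also have "\<dots> \<le> 2 * (cmod (coft G t))\<^sup>2 + 2 * (cmod (\<Psi> t))\<^sup>2"
          using power_mono[OF \<Gamma>le[of n t] norm_ge_zero, of 2] by simp
        finally show "norm ((cmod (\<Gamma> n t - \<Psi> t))\<^sup>2) \<le> 2 * (cmod (coft G t))\<^sup>2 + 2 * (cmod (\<Psi> t))\<^sup>2" by simp
      qed
    qed (use c2 \<Psi>2 in auto)
    define V where "V = (LINT \<omega>|M. (csum (\<lambda>i \<omega>. G (lp a i \<omega>) - synth \<Psi> (lp a i \<omega>)) I \<omega>)\<^sup>2)"
    define N where "N = real (card I)"
    \<comment> \<open>Here n indexes the smoothing scale while I stays fixed. The second term,
      although quadratic in the size of I, disappears as the scale tends to 0.\<close>
    have "V \<le> 2 * (N * (Cv * q n)) + 2 * (N * (N * (Fb * (2 * B * D n))))" for n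
    proof -
      define Z1 Z2 where "Z1 i \<omega> = synth (\<lambda>t. \<Gamma> n t - \<Psi> t) (lp a i \<omega>)" and "Z2 i \<omega> = G (lp a i \<omega>) - Gs n (lp a i \<omega>)" for i \<omega>
      have d: "integrable lborel (\<lambda>t. \<Gamma> n t - \<Psi> t)" using \<Gamma> \<Psi> by simp
      have d2: "integrable lborel (\<lambda>t. (cmod (\<Gamma> n t - \<Psi> t))\<^sup>2)"
        by (rule cmod_diff_square_integrable[OF \<Gamma>2 \<Psi>2]) measurable
      have [measurable]: "Z1 i \<in> borel_measurable M" "Z2 i \<in> borel_measurable M" for i
        unfolding Z1_def Z2_def by measurable
      have Z1b: "\<bar>Z1 i \<omega>\<bar> \<le> (LBINT t. cmod (\<Gamma> n t - \<Psi> t))" for i \<omega> unfolding Z1_def by (rule abs_synth_le)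
      have Z2b: "\<bar>Z2 i \<omega>\<bar> \<le> 2 * B" for i \<omega>
        using B[of "lp a i \<omega>"] GsB[of n "lp a i \<omega>"] unfolding Z2_def abs_le_iff by linarith
      have split: "csum (\<lambda>i \<omega>. G (lp a i \<omega>) - synth \<Psi> (lp a i \<omega>)) I \<omega> = csum Z1 I \<omega> + csum Z2 I \<omega>" for \<omega>
      proof -
        have "(\<lambda>i \<omega>. G (lp a i \<omega>) - synth \<Psi> (lp a i \<omega>)) = (\<lambda>i \<omega>. Z1 i \<omega> + Z2 i \<omega>)"
          by (simp add: fun_eq_iff Z1_def Z2_def synth_diff[OF \<Gamma> \<Psi>] Gs)
        then show ?thesis by (simp only: csum_add[OF _ _ Z1b Z2b] \<open>\<And>i. Z1 i \<in> borel_measurable M\<close> \<open>\<And>i. Z2 i \<in> borel_measurable M\<close>)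
      qed
      have i12: "integrable M (\<lambda>\<omega>. (csum Z1 I \<omega>)\<^sup>2)" "integrable M (\<lambda>\<omega>. (csum Z2 I \<omega>)\<^sup>2)"
        by (rule csum_sq_integrable[OF _ Z1b] csum_sq_integrable[OF _ Z2b]; measurable)+
      have "V \<le> (LINT \<omega>|M. 2 * (csum Z1 I \<omega>)\<^sup>2 + 2 * (csum Z2 I \<omega>)\<^sup>2)"
        unfolding V_def split by (rule integral_mono') (use i12 sum_squares_le in auto)
      also have "\<dots> = 2 * (LINT \<omega>|M. (csum Z1 I \<omega>)\<^sup>2) + 2 * (LINT \<omega>|M. (csum Z2 I \<omega>)\<^sup>2)"
        using i12 by simp
      also have "(LINT \<omega>|M. (csum Z1 I \<omega>)\<^sup>2) \<le> N * (Cv * q n)"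
        using Cv(2)[OF d d2 I] by (simp add: csum_def Z1_def N_def q_def)
      also have "(LINT \<omega>|M. (csum Z2 I \<omega>)\<^sup>2) \<le> N * (N * (Fb * (2 * B * D n)))"
        unfolding N_def
      proof (rule csum_var_crude[OF _ Z2b])
        fix i
        have B0: "0 \<le> B" using B abs_ge_zero order_trans by blast
        have le: "(G x - Gs n x)\<^sup>2 \<le> 2 * B * \<bar>Gs n x - G x\<bar>" for x
        proof -
          have "\<bar>Gs n x - G x\<bar> \<le> 2 * B"
            using B[of x] GsB[of n x] unfolding abs_le_iff by linarith
          then have "\<bar>Gs n x - G x\<bar> * \<bar>Gs n x - G x\<bar> \<le> 2 * B * \<bar>Gs n x - G x\<bar>" by (intro mult_right_mono) auto
          also have "\<bar>Gs n x - G x\<bar> * \<bar>Gs n x - G x\<bar> = (G x - Gs n x)\<^sup>2"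
            by (simp add: power2_eq_square algebra_simps)
          finally show ?thesis .
        qed
        have i2: "integrable lborel (\<lambda>x. 2 * B * \<bar>Gs n x - G x\<bar>)" using Di by simp
        have i1: "integrable lborel (\<lambda>x. (G x - Gs n x)\<^sup>2)"
          by (rule Bochner_Integration.integrable_bound[OF i2]) (use le B0 in auto)
        have "(LINT \<omega>|M. (Z2 i \<omega>)\<^sup>2) \<le> Fb * (LBINT x. (G x - Gs n x)\<^sup>2)"
          unfolding Z2_def by (rule E_sq_le[OF _ i1]) measurable
        also have "\<dots> \<le> Fb * (LBINT x. 2 * B * \<bar>Gs n x - G x\<bar>)"
          by (intro mult_left_mono integral_mono i1 i2 le Fb0)
        finally show "(LINT \<omega>|M. (Z2 i \<omega>)\<^sup>2) \<le> Fb * (2 * B * D n)" by (simp add: D_def)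
      qed measurable
      finally show ?thesis by simp
    qed
    moreover have "(\<lambda>n. 2 * (N * (Cv * q n)) + 2 * (N * (N * (Fb * (2 * B * D n)))))
        \<longlonglongrightarrow> 2 * (N * (Cv * (LBINT t. (cmod (coft G t - \<Psi> t))\<^sup>2))) + 2 * (N * (N * (Fb * (2 * B * 0))))"
      by (intro tendsto_intros q D0)
    ultimately have "V \<le> 2 * (N * (Cv * (LBINT t. (cmod (coft G t - \<Psi> t))\<^sup>2))) + 2 * (N * (N * (Fb * (2 * B * 0))))"
      by (intro LIMSEQ_le_const) auto
    then show "(LINT \<omega>|M. (csum (\<lambda>i \<omega>. G (lp a i \<omega>) - synth \<Psi> (lp a i \<omega>)) I \<omega>)\<^sup>2)
         \<le> real (card I) * (2 * Cv * (LBINT t. (cmod (coft G t - \<Psi> t))\<^sup>2))"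
      unfolding V_def N_def by (simp add: mult_ac)
  qed
qed

end

section \<open>Comparison with truncated processes\<close>

context linproc
begin

lemma AE_lp_diff:
  assumes "dom c" "dom d" "dom (\<lambda>t. c t - d t)"
  shows "AE w in M. lp c i w - lp d i w = lp (\<lambda>t. c t - d t) i w"
  using lp_summable[OF assms(1), of i] lp_summable[OF assms(2), of i]
proof eventually_elim
  case (elim w)
  then show ?case unfolding linear_process_def by (simp add: suminf_diff left_diff_distrib)
qed

definition tr :: "nat \<Rightarrow> nat \<Rightarrow> real" where "tr m t = (if t < m then a t else 0)"

lemma dom_tr [simp]: "dom (tr m)" by (simp add: dom_def tr_def)

lemma lp_tr: "lp (tr m) i w = psum a i m w"
proof -
  have "(\<Sum>t. tr m t * e (i - int t) w) = (\<Sum>t<m. tr m t * e (i - int t) w)"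
    by (rule suminf_finite) (auto simp: tr_def)
  then show ?thesis by (simp add: linear_process_def linear_partial_sum_def tr_def)
qed

text \<open>The mean square distance between the exponentials of the full and the truncated process
  at frequency s. By stationarity of the tail process it is the same at every time.\<close>

definition em :: "nat \<Rightarrow> real \<Rightarrow> real" where
  "em m s = 2 - 2 * Re (CLINT w|M. iexp (s * lp (\<lambda>t. a t - tr m t) 0 w))"

lemma dom_tail [simp]: "dom (\<lambda>t. a t - tr m t)" by (simp add: dom_def tr_def)

lemma em_measurable [measurable]: "em m \<in> borel_measurable borel"
  unfolding em_def by measurable

lemma em_bounds: "0 \<le> em m s" "em m s \<le> 4"
  using cmod_char_le1[of "\<lambda>w. s * lp (\<lambda>t. a t - tr m t) 0 w"]
    abs_Re_le_cmod[of "CLINT w|M. iexp (s * lp (\<lambda>t. a t - tr m t) 0 w)"]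
  unfolding em_def by (auto simp: abs_le_iff)

lemma em_tendsto: "(\<lambda>m. em m s) \<longlonglongrightarrow> 0"
proof -
  have "AE \<omega> in M. (\<lambda>m. lp (\<lambda>t. a t - tr m t) 0 \<omega>) \<longlonglongrightarrow> 0"
  proof -
    have "AE \<omega> in M. \<forall>m. lp a 0 \<omega> - lp (tr m) 0 \<omega> = lp (\<lambda>t. a t - tr m t) 0 \<omega>"
      by (subst AE_all_countable) (intro allI AE_lp_diff, simp_all)
    then show ?thesis using lp_lim[OF dom_a, of 0]
    proof eventually_elim
      case (elim \<omega>)
      have "(\<lambda>m. lp a 0 \<omega> - psum a 0 m \<omega>) \<longlonglongrightarrow> lp a 0 \<omega> - lp a 0 \<omega>"
        by (intro tendsto_intros elim)
      then show ?case using elim(1) by (simp add: lp_tr)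
    qed
  qed
  then have "(\<lambda>m. CLINT \<omega>|M. iexp (s * lp (\<lambda>t. a t - tr m t) 0 \<omega>)) \<longlonglongrightarrow> (CLINT \<omega>|M. 1)"
  proof (intro integral_dominated_convergence[where w="\<lambda>_. 1"], goal_cases)
    case 4
    then show ?case
    proof eventually_elim
      case (elim \<omega>)
      have "(\<lambda>m. iexp (s * lp (\<lambda>t. a t - tr m t) 0 \<omega>)) \<longlonglongrightarrow> iexp (s * 0)"
        by (intro isCont_tendsto_compose[OF isCont_iexp] tendsto_intros elim)
      then show ?case by simp
    qed
  qed auto
  then have "(\<lambda>m. em m s) \<longlonglongrightarrow> 2 - 2 * Re (CLINT \<omega>|M. 1)"
    unfolding em_def by (intro tendsto_intros)
  then show ?thesis by (simp add: prob_space)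
qed

lemma E_iexp_diff_le: "(LINT w|M. cmod (iexp (s * lp a i w) - iexp (s * lp (tr m) i w))) \<le> sqrt (em m s)"
proof -
  define z where "z w = cmod (iexp (s * lp a i w) - iexp (s * lp (tr m) i w))" for w
  have [measurable]: "z \<in> borel_measurable M" unfolding z_def by measurable
  have zb: "\<bar>z w\<bar> \<le> 2" for w
    using norm_triangle_ineq4[of "iexp (s * lp a i w)" "iexp (s * lp (tr m) i w)"] by (simp add: z_def)
  have zi: "integrable M z" by (rule integrable_bounded_M[where B=2]) (use zb in auto)
  have z2i: "integrable M (\<lambda>w. (z w)\<^sup>2)" by (rule bounded_square_integrable[OF _ zb]) measurable
  have sq: "(cmod (iexp u - iexp v))\<^sup>2 = 2 - 2 * Re (iexp (u - v))" for u v :: real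
  proof -
    have "(cmod (iexp u - iexp v))\<^sup>2 = (cos u - cos v)\<^sup>2 + (sin u - sin v)\<^sup>2"
      by (simp add: cmod_power2 Re_exp Im_exp)
    also have "\<dots> = ((cos u)\<^sup>2 + (sin u)\<^sup>2) + ((cos v)\<^sup>2 + (sin v)\<^sup>2) - 2 * (cos u * cos v + sin u * sin v)"
      by (simp add: power2_eq_square algebra_simps)
    also have "\<dots> = 2 - 2 * cos (u - v)"
      by (simp only: cos_squared_eq) (simp add: cos_diff)
    finally show ?thesis by (simp add: Re_exp)
  qed
  have "(LINT w|M. (z w)\<^sup>2) = (LINT w|M. 2 - 2 * Re (iexp (s * lp (\<lambda>t. a t - tr m t) i w)))"
  proof (rule integral_cong_AE)
    have "AE w in M. lp a i w - lp (tr m) i w = lp (\<lambda>t. a t - tr m t) i w"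
      by (rule AE_lp_diff) simp_all
    then show "AE w in M. (z w)\<^sup>2 = 2 - 2 * Re (iexp (s * lp (\<lambda>t. a t - tr m t) i w))"
      by eventually_elim (simp only: z_def sq right_diff_distrib[symmetric])
  qed measurable
  also have "\<dots> = 2 - 2 * Re (CLINT w|M. iexp (s * lp (\<lambda>t. a t - tr m t) i w))"
  proof -
    have i: "integrable M (\<lambda>w. iexp (s * lp (\<lambda>t. a t - tr m t) i w))"
      by (rule integrable_iexp_M) measurable
    have "(LINT w|M. 2 - 2 * Re (iexp (s * lp (\<lambda>t. a t - tr m t) i w))) = 2 - 2 * (LINT w|M. Re (iexp (s * lp (\<lambda>t. a t - tr m t) i w)))"
      using integrable_Re[OF i] by (subst Bochner_Integration.integral_diff) (auto simp: prob_space)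
    then show ?thesis by (simp only: integral_Re[OF i])
  qed
  also have "\<dots> = em m s"
    unfolding em_def by (subst char_lp_stationary[OF dom_tail, of s m i 0]) simp
  finally have Ez2: "(LINT w|M. (z w)\<^sup>2) = em m s" .
  have "(LINT w|M. z w)\<^sup>2 \<le> (LINT w|M. (z w)\<^sup>2)"
  proof -
    have "0 \<le> variance z" by (rule variance_positive)
    then show ?thesis using variance_eq[OF zi z2i] by simp
  qed
  then show ?thesis unfolding Ez2 z_def[symmetric] by (rule real_le_rsqrt)
qed

text \<open>At lags below L the covariances of the differences of exponentials are small because the
  differences themselves are, with bound \<open>4 * sqrt (em m s)\<close>. At lags from L on they
  expand into four covariances, each bounded by the tail of the summable sequence \<open>r\<close>.
  Bounded support of \<Psi> keeps the factor \<open>\<bar>s\<bar> powr (2 * \<gamma>)\<close> under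
  control.\<close>

lemma truncation_var:
  assumes \<Psi>: "integrable lborel \<Psi>" and R: "\<And>t. R < \<bar>t\<bar> \<Longrightarrow> \<Psi> t = 0" and \<delta>: "0 < \<delta>"
  obtains m where "0 < m" "\<And>I. finite I \<Longrightarrow>
    (LINT \<omega>|M. (csum (\<lambda>i \<omega>. synth \<Psi> (lp a i \<omega>) - synth \<Psi> (lp (tr m) i \<omega>)) I \<omega>)\<^sup>2) \<le> real (card I) * \<delta>"
proof -
  have [measurable]: "\<Psi> \<in> borel_measurable borel" using borel_measurable_integrable[OF \<Psi>] by simp
  define Z where "Z = (LBINT t. cmod (\<Psi> t))"
  have Z0: "0 \<le> Z" by (simp add: Z_def)
  have \<Psi>n: "integrable lborel (\<lambda>t. cmod (\<Psi> t))" using \<Psi> by simp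
  define \<rho> where "\<rho> L = (\<Sum>k. if L \<le> k then r k else 0)" for L :: nat
  have \<rho>s: "summable (\<lambda>k. if L \<le> k then r k else 0)" for L
    by (rule summable_comparison_test'[OF r_summable]) (auto simp: r_nonneg)
  have \<rho>0: "0 \<le> \<rho> L" for L unfolding \<rho>_def by (rule suminf_nonneg[OF \<rho>s]) (simp add: r_nonneg)
  have \<rho>lim: "\<rho> \<longlonglongrightarrow> 0"
  proof -
    have "\<rho> = (\<lambda>L. suminf r - (\<Sum>k<L. r k))"
    proof
      fix L
      have f: "summable (\<lambda>k. if k < L then r k else 0)" by (rule summable_finite[of "{..<L}"]) auto
      have "\<rho> L + (\<Sum>k. if k < L then r k else 0) = (\<Sum>k. (if L \<le> k then r k else 0) + (if k < L then r k else 0))"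
        unfolding \<rho>_def by (rule suminf_add[OF \<rho>s f])
      also have "\<dots> = suminf r" by (rule arg_cong[where f=suminf]) (auto simp: fun_eq_iff)
      also have "(\<Sum>k. if k < L then r k else 0) = (\<Sum>k<L. r k)"
        by (subst suminf_finite[of "{..<L}"]) auto
      finally show "\<rho> L = suminf r - (\<Sum>k<L. r k)" by simp
    qed
    moreover have "(\<lambda>L. suminf r - (\<Sum>k<L. r k)) \<longlonglongrightarrow> suminf r - suminf r"
      by (intro tendsto_intros summable_LIMSEQ r_summable)
    ultimately show ?thesis by simp
  qed
  have Svar: "(LINT \<omega>|M. (cmod (Sx a I s \<omega> - Sx (tr m) I s \<omega>))\<^sup>2)
      \<le> real (card I) * (2 * (real L * (4 * sqrt (em m s)) + 4 * (C * \<bar>s\<bar> powr (2 * \<gamma>)) * \<rho> L))"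
    if I: "finite I" for I s m L
  proof -
    define x y where "x i \<omega> = iexp (s * lp a i \<omega>)" and "y i \<omega> = iexp (s * lp (tr m) i \<omega>)" for i \<omega>
    have [measurable]: "x i \<in> borel_measurable M" "y i \<in> borel_measurable M" for i
      unfolding x_def y_def by measurable
    have xi: "integrable M (x i)" "integrable M (y i)" for i
      unfolding x_def[abs_def] y_def[abs_def] by (rule integrable_iexp_M; measurable)+
    have n1: "cmod (x i \<omega>) = 1" "cmod (y i \<omega>) = 1" for i \<omega> by (simp_all add: x_def y_def)
    have xyi: "integrable M (\<lambda>\<omega>. x j \<omega> * cnj (x i \<omega>))" "integrable M (\<lambda>\<omega>. x j \<omega> * cnj (y i \<omega>))"
      "integrable M (\<lambda>\<omega>. y j \<omega> * cnj (x i \<omega>))" "integrable M (\<lambda>\<omega>. y j \<omega> * cnj (y i \<omega>))" for i j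
      by (rule integrable_bounded_M[where B=1]; simp add: norm_mult n1)+
    define K where "K u v = (CLINT \<omega>|M. u \<omega> * cnj (v \<omega>)) - (CLINT \<omega>|M. u \<omega>) * cnj (CLINT \<omega>|M. v \<omega>)" for u v :: "'a \<Rightarrow> complex"
    define b where "b k = (if k < L then 4 * sqrt (em m s) else 0) + 4 * (C * \<bar>s\<bar> powr (2 * \<gamma>)) * (if L \<le> k then r k else 0)" for k
    have f: "summable (\<lambda>k. if k < L then 4 * sqrt (em m s) else 0)" by (rule summable_finite[of "{..<L}"]) auto
    have bs: "summable b" unfolding b_def by (intro summable_add f summable_mult \<rho>s)
    have b0: "0 \<le> b k" for k using C_nonneg r_nonneg em_bounds(1) by (simp add: b_def)
    have zle: "(LINT \<omega>|M. cmod (x i \<omega> - y i \<omega>)) \<le> sqrt (em m s)" for i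
      unfolding x_def y_def by (rule E_iexp_diff_le)
    have z2: "cmod (x i \<omega> - y i \<omega>) \<le> 2" for i \<omega>
      using norm_triangle_ineq4[of "x i \<omega>" "y i \<omega>"] by (simp add: n1)
    have zi: "integrable M (\<lambda>\<omega>. cmod (x i \<omega> - y i \<omega>))" for i using xi by simp
    have "(LINT \<omega>|M. (cmod (\<Sum>i\<in>I. (x i \<omega> - y i \<omega>) - (CLINT \<omega>|M. x i \<omega> - y i \<omega>)))\<^sup>2) \<le> real (card I) * (2 * suminf b)"
    proof (rule expectation_sq_sum_le[where B=2])
      fix i j :: int assume ij: "i \<le> j"
      define k where "k = nat (j - i)"
      show "cmod ((CLINT \<omega>|M. (x j \<omega> - y j \<omega>) * cnj (x i \<omega> - y i \<omega>)) - (CLINT \<omega>|M. x j \<omega> - y j \<omega>) * cnj (CLINT \<omega>|M. x i \<omega> - y i \<omega>)) \<le> b (nat (j - i))"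
        unfolding k_def[symmetric]
      proof (cases "k < L")
        case True
        have 1: "cmod (CLINT \<omega>|M. (x j \<omega> - y j \<omega>) * cnj (x i \<omega> - y i \<omega>)) \<le> 2 * sqrt (em m s)"
        proof -
          have "cmod (CLINT \<omega>|M. (x j \<omega> - y j \<omega>) * cnj (x i \<omega> - y i \<omega>)) \<le> (LINT \<omega>|M. cmod ((x j \<omega> - y j \<omega>) * cnj (x i \<omega> - y i \<omega>)))"
            by (rule integral_norm_bound)
          also have "\<dots> \<le> (LINT \<omega>|M. 2 * cmod (x j \<omega> - y j \<omega>))"
          proof (rule integral_mono')
            show "cmod ((x j \<omega> - y j \<omega>) * cnj (x i \<omega> - y i \<omega>)) \<le> 2 * cmod (x j \<omega> - y j \<omega>)" for \<omega>
              unfolding norm_mult complex_mod_cnj using mult_left_mono[OF z2[of i \<omega>] norm_ge_zero, of "x j \<omega> - y j \<omega>"] by (simp only: mult.commute)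
          qed (use zi in auto)
          also have "\<dots> \<le> 2 * sqrt (em m s)" using zle[of j] by simp
          finally show ?thesis .
        qed
        have n: "cmod (CLINT \<omega>|M. x i \<omega> - y i \<omega>) \<le> sqrt (em m s)" for i
          using zle[of i] by (intro order_trans[OF integral_norm_bound])
        have n': "cmod (CLINT \<omega>|M. x i \<omega> - y i \<omega>) \<le> 2" for i
        proof -
          have "sqrt (em m s) \<le> sqrt 4" using em_bounds(2) by (simp only: real_sqrt_le_iff)
          then show ?thesis using n[of i] by simp
        qed
        have 2: "cmod ((CLINT \<omega>|M. x j \<omega> - y j \<omega>) * cnj (CLINT \<omega>|M. x i \<omega> - y i \<omega>)) \<le> sqrt (em m s) * 2"
          unfolding norm_mult complex_mod_cnj using n[of j] n'[of i] em_bounds(1)[of m s] by (intro mult_mono) auto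
        show "cmod ((CLINT \<omega>|M. (x j \<omega> - y j \<omega>) * cnj (x i \<omega> - y i \<omega>)) - (CLINT \<omega>|M. x j \<omega> - y j \<omega>) * cnj (CLINT \<omega>|M. x i \<omega> - y i \<omega>)) \<le> b k"
          using norm_triangle_le_diff[OF add_mono[OF 1 2]] True by (simp add: b_def)
      next
        case False
        have eq: "(CLINT \<omega>|M. (x j \<omega> - y j \<omega>) * cnj (x i \<omega> - y i \<omega>)) - (CLINT \<omega>|M. x j \<omega> - y j \<omega>) * cnj (CLINT \<omega>|M. x i \<omega> - y i \<omega>)
           = (K (x j) (x i) + K (y j) (y i)) - (K (x j) (y i) + K (y j) (x i))"
        proof -
          have "(CLINT \<omega>|M. (x j \<omega> - y j \<omega>) * cnj (x i \<omega> - y i \<omega>))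
             = (CLINT \<omega>|M. x j \<omega> * cnj (x i \<omega>) - x j \<omega> * cnj (y i \<omega>) - y j \<omega> * cnj (x i \<omega>) + y j \<omega> * cnj (y i \<omega>))"
            by (rule Bochner_Integration.integral_cong) (auto simp: algebra_simps)
          also have "\<dots> = (CLINT \<omega>|M. x j \<omega> * cnj (x i \<omega>)) - (CLINT \<omega>|M. x j \<omega> * cnj (y i \<omega>)) - (CLINT \<omega>|M. y j \<omega> * cnj (x i \<omega>)) + (CLINT \<omega>|M. y j \<omega> * cnj (y i \<omega>))"
            using xyi by simp
          finally have e1: "(CLINT \<omega>|M. (x j \<omega> - y j \<omega>) * cnj (x i \<omega> - y i \<omega>)) = \<dots>" .
          have e2: "(CLINT \<omega>|M. x i \<omega> - y i \<omega>) = (CLINT \<omega>|M. x i \<omega>) - (CLINT \<omega>|M. y i \<omega>)" for i using xi by simp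
          show ?thesis unfolding e1 e2 K_def by (simp add: algebra_simps)
        qed
        define q where "q = C * \<bar>s\<bar> powr (2 * \<gamma>) * r k"
        \<comment> \<open>All pairings of the full with the truncated process occur here; they are
          covered because the covariance bound admits two different dominated sequences.\<close>
        have "cmod (K (x j) (x i)) \<le> q" "cmod (K (y j) (y i)) \<le> q" "cmod (K (x j) (y i)) \<le> q" "cmod (K (y j) (x i)) \<le> q"
          unfolding K_def x_def y_def q_def k_def by (rule cov_bound_cnj'[OF _ _ ij]; simp)+
        then have "cmod ((K (x j) (x i) + K (y j) (y i)) - (K (x j) (y i) + K (y j) (x i))) \<le> (q + q) + (q + q)"
          by (intro norm_triangle_le_diff add_mono norm_triangle_le)
        also have "\<dots> = b k" using False by (simp add: b_def q_def)
        finally show "cmod ((CLINT \<omega>|M. (x j \<omega> - y j \<omega>) * cnj (x i \<omega> - y i \<omega>)) - (CLINT \<omega>|M. x j \<omega> - y j \<omega>) * cnj (CLINT \<omega>|M. x i \<omega> - y i \<omega>)) \<le> b k"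
          by (simp only: eq)
      qed
    qed (use I b0 bs z2 in auto)
    also have "suminf b = real L * (4 * sqrt (em m s)) + 4 * (C * \<bar>s\<bar> powr (2 * \<gamma>)) * \<rho> L"
    proof -
      have "suminf b = (\<Sum>k. if k < L then 4 * sqrt (em m s) else 0) + (\<Sum>k. 4 * (C * \<bar>s\<bar> powr (2 * \<gamma>)) * (if L \<le> k then r k else 0))"
        unfolding b_def by (rule suminf_add[symmetric, OF f summable_mult[OF \<rho>s]])
      also have "(\<Sum>k. if k < L then 4 * sqrt (em m s) else 0) = real L * (4 * sqrt (em m s))"
        by (subst suminf_finite[of "{..<L}"]) auto
      also have "(\<Sum>k. 4 * (C * \<bar>s\<bar> powr (2 * \<gamma>)) * (if L \<le> k then r k else 0)) = 4 * (C * \<bar>s\<bar> powr (2 * \<gamma>)) * \<rho> L"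
        unfolding \<rho>_def by (rule suminf_mult[OF \<rho>s])
      finally show ?thesis .
    qed
    also have "(\<lambda>\<omega>. (cmod (\<Sum>i\<in>I. (x i \<omega> - y i \<omega>) - (CLINT \<omega>|M. x i \<omega> - y i \<omega>)))\<^sup>2) = (\<lambda>\<omega>. (cmod (Sx a I s \<omega> - Sx (tr m) I s \<omega>))\<^sup>2)"
    proof
      fix \<omega>
      have e2: "(CLINT \<omega>|M. x i \<omega> - y i \<omega>) = (CLINT \<omega>|M. x i \<omega>) - (CLINT \<omega>|M. y i \<omega>)" for i using xi by simp
      have "(\<Sum>i\<in>I. (x i \<omega> - y i \<omega>) - (CLINT \<omega>|M. x i \<omega> - y i \<omega>)) = Sx a I s \<omega> - Sx (tr m) I s \<omega>"
        unfolding e2 Sx_def x_def[symmetric] y_def[symmetric] by (simp add: sum_subtractf)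
      then show "(cmod (\<Sum>i\<in>I. (x i \<omega> - y i \<omega>) - (CLINT \<omega>|M. x i \<omega> - y i \<omega>)))\<^sup>2 = (cmod (Sx a I s \<omega> - Sx (tr m) I s \<omega>))\<^sup>2" by simp
    qed
    finally show ?thesis .
  qed
  define RR where "RR = \<bar>R\<bar> powr (2 * \<gamma>)"
  have RR0: "0 \<le> RR" by (simp add: RR_def)
  have main: "(LINT \<omega>|M. (csum (\<lambda>i \<omega>. synth \<Psi> (lp a i \<omega>) - synth \<Psi> (lp (tr m) i \<omega>)) I \<omega>)\<^sup>2)
      \<le> real (card I) * (Z * (8 * real L * (LBINT t. cmod (\<Psi> t) * sqrt (em m t))) + Z * (8 * C * RR * \<rho> L * Z))"
    if I: "finite I" for I m L
  proof -
    have emi: "integrable lborel (\<lambda>t. cmod (\<Psi> t) * sqrt (em m t))"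
    proof (rule integrable_mult_bounded[OF \<Psi>n, where B=2])
      show "norm (sqrt (em m t)) \<le> 2" for t
        using em_bounds[of m t] real_sqrt_le_mono[of "em m t" 4] by simp
    qed measurable
    have iS: "integrable lborel (\<lambda>t. \<Psi> t * Sx c I t \<omega>)" if "\<omega> \<in> space M" for c \<omega>
      by (rule integrable_mult_bounded[OF \<Psi>, where B="2 * real (card I)"]) (use that Sx_bounded in auto)
    have "csum (\<lambda>i \<omega>. synth \<Psi> (lp a i \<omega>) - synth \<Psi> (lp (tr m) i \<omega>)) I \<omega>
       = Re (CLINT t|lborel. \<Psi> t * (Sx a I t \<omega> - Sx (tr m) I t \<omega>))" if \<omega>: "\<omega> \<in> space M" for \<omega>
    proof -
      have "csum (\<lambda>i \<omega>. synth \<Psi> (lp a i \<omega>) - synth \<Psi> (lp (tr m) i \<omega>)) I \<omega>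
        = csum (\<lambda>i \<omega>. synth \<Psi> (lp a i \<omega>)) I \<omega> - csum (\<lambda>i \<omega>. synth \<Psi> (lp (tr m) i \<omega>)) I \<omega>"
        by (rule csum_diff[where B=Z and B'=Z]) (auto simp: Z_def abs_synth_le)
      also have "\<dots> = Re (CLINT t|lborel. \<Psi> t * Sx a I t \<omega>) - Re (CLINT t|lborel. \<Psi> t * Sx (tr m) I t \<omega>)"
        unfolding csum_def synth_sum[OF \<Psi>] ..
      also have "\<dots> = Re (CLINT t|lborel. \<Psi> t * (Sx a I t \<omega> - Sx (tr m) I t \<omega>))"
        using iS[OF \<omega>] by (simp add: right_diff_distrib)
      finally show ?thesis .
    qed
    then have "(LINT \<omega>|M. (csum (\<lambda>i \<omega>. synth \<Psi> (lp a i \<omega>) - synth \<Psi> (lp (tr m) i \<omega>)) I \<omega>)\<^sup>2)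
      = (LINT \<omega>|M. (Re (CLINT t|lborel. \<Psi> t * (Sx a I t \<omega> - Sx (tr m) I t \<omega>)))\<^sup>2)"
      by (intro Bochner_Integration.integral_cong) auto
    also have "\<dots> \<le> (LBINT t. cmod (\<Psi> t) * 1) * (LBINT t. cmod (\<Psi> t) / 1 * (LINT \<omega>|M. (cmod (Sx a I t \<omega> - Sx (tr m) I t \<omega>))\<^sup>2))"
    proof (rule weighted_cauchy_schwarz[OF \<Psi>])
      show "cmod (Sx a I t \<omega> - Sx (tr m) I t \<omega>) \<le> 2 * real (card I) + 2 * real (card I)" for t \<omega>
        by (rule norm_triangle_le_diff[OF add_mono[OF Sx_bounded Sx_bounded]])
    qed (use \<Psi>n in auto)
    also have "\<dots> \<le> Z * (LBINT t. real (card I) * (8 * real L * (cmod (\<Psi> t) * sqrt (em m t)) + 8 * C * RR * \<rho> L * cmod (\<Psi> t)))"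
      unfolding Z_def[symmetric] mult_1_right div_by_1
    proof (intro mult_left_mono Z0 integral_mono')
      show "integrable lborel (\<lambda>t. real (card I) * (8 * real L * (cmod (\<Psi> t) * sqrt (em m t)) + 8 * C * RR * \<rho> L * cmod (\<Psi> t)))"
        using emi \<Psi>n by auto
      fix t
      show "0 \<le> real (card I) * (8 * real L * (cmod (\<Psi> t) * sqrt (em m t)) + 8 * C * RR * \<rho> L * cmod (\<Psi> t))"
        using C_nonneg RR0 \<rho>0 em_bounds(1) by simp
      show "cmod (\<Psi> t) * (LINT \<omega>|M. (cmod (Sx a I t \<omega> - Sx (tr m) I t \<omega>))\<^sup>2)
          \<le> real (card I) * (8 * real L * (cmod (\<Psi> t) * sqrt (em m t)) + 8 * C * RR * \<rho> L * cmod (\<Psi> t))"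
      proof (cases "R < \<bar>t\<bar>")
        case True then show ?thesis using R[OF True] by simp
      next
        case False
        then have "\<bar>t\<bar> powr (2 * \<gamma>) \<le> RR" unfolding RR_def using \<gamma>_pos by (intro powr_mono2) auto
        then have "4 * (C * \<bar>t\<bar> powr (2 * \<gamma>)) * \<rho> L \<le> 4 * (C * RR) * \<rho> L"
          using C_nonneg \<rho>0 by (intro mult_right_mono mult_left_mono) auto
        then have "real (card I) * (2 * (real L * (4 * sqrt (em m t)) + 4 * (C * \<bar>t\<bar> powr (2 * \<gamma>)) * \<rho> L))
          \<le> real (card I) * (2 * (real L * (4 * sqrt (em m t)) + 4 * (C * RR) * \<rho> L))"
          by (intro mult_left_mono add_left_mono) auto
        then have "(LINT \<omega>|M. (cmod (Sx a I t \<omega> - Sx (tr m) I t \<omega>))\<^sup>2) \<le> real (card I) * (2 * (real L * (4 * sqrt (em m t)) + 4 * (C * RR) * \<rho> L))"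
          by (rule order_trans[OF Svar[OF I]])
        from mult_left_mono[OF this, of "cmod (\<Psi> t)"] show ?thesis by (simp add: algebra_simps)
      qed
    qed
    also have "\<dots> = real (card I) * (Z * (8 * real L * (LBINT t. cmod (\<Psi> t) * sqrt (em m t))) + Z * (8 * C * RR * \<rho> L * Z))"
    proof -
      have lin: "(LBINT t. c * (\<alpha> * u t + \<beta> * w t)) = c * (\<alpha> * (LBINT t. u t) + \<beta> * (LBINT t. w t))"
        if "integrable lborel u" "integrable lborel w" for c \<alpha> \<beta> :: real and u w :: "real \<Rightarrow> real"
        using that by simp
      show ?thesis unfolding lin[OF emi \<Psi>n] Z_def[symmetric] by (simp add: algebra_simps)
    qed
    finally show ?thesis .
  qed
  \<comment> \<open>The lag threshold L is fixed first, by the tail of \<open>r\<close>; then m is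
    chosen depending on L, since the short lags carry the factor L.\<close>
  have "(\<lambda>L. Z * (8 * C * RR * \<rho> L * Z)) \<longlonglongrightarrow> Z * (8 * C * RR * 0 * Z)"
    by (intro tendsto_intros \<rho>lim)
  then have "\<forall>\<^sub>F L in sequentially. Z * (8 * C * RR * \<rho> L * Z) < \<delta> / 2"
    using \<delta> by (intro order_tendstoD(2)) auto
  then obtain L where L: "Z * (8 * C * RR * \<rho> L * Z) < \<delta> / 2"
    using eventually_happens'[OF sequentially_bot] by blast
  have "(\<lambda>m. \<integral>t. cmod (\<Psi> t) * sqrt (em m t) \<partial>lborel) \<longlonglongrightarrow> (\<integral>t. 0 \<partial>(lborel :: real measure))"
  proof (rule integral_dominated_convergence[where w="\<lambda>t. cmod (\<Psi> t) * 2"])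
    show "AE t in lborel. (\<lambda>m. cmod (\<Psi> t) * sqrt (em m t)) \<longlonglongrightarrow> 0"
    proof (rule AE_I2)
      fix t
      have "(\<lambda>m. cmod (\<Psi> t) * sqrt (em m t)) \<longlonglongrightarrow> cmod (\<Psi> t) * sqrt 0" by (intro tendsto_intros em_tendsto)
      then show "(\<lambda>m. cmod (\<Psi> t) * sqrt (em m t)) \<longlonglongrightarrow> 0" by simp
    qed
    show "AE t in lborel. norm (cmod (\<Psi> t) * sqrt (em m t)) \<le> cmod (\<Psi> t) * 2" for m
    proof (rule AE_I2)
      fix t
      have "sqrt (em m t) \<le> 2" "0 \<le> sqrt (em m t)" using em_bounds[of m t] real_sqrt_le_mono[of "em m t" 4] by simp_all
      then show "norm (cmod (\<Psi> t) * sqrt (em m t)) \<le> cmod (\<Psi> t) * 2" by (simp add: abs_mult mult_left_mono)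
    qed
  qed (use \<Psi>n in auto)
  then have "(\<lambda>m. Z * (8 * real L * (LBINT t. cmod (\<Psi> t) * sqrt (em m t)))) \<longlonglongrightarrow> Z * (8 * real L * 0)"
    by (intro tendsto_intros) simp
  then have "\<forall>\<^sub>F m in sequentially. Z * (8 * real L * (LBINT t. cmod (\<Psi> t) * sqrt (em m t))) < \<delta> / 2"
    using \<delta> by (intro order_tendstoD(2)) auto
  then have "\<forall>\<^sub>F m in sequentially. Z * (8 * real L * (LBINT t. cmod (\<Psi> t) * sqrt (em m t))) < \<delta> / 2 \<and> 0 < m"
    using eventually_gt_at_top[of 0] by eventually_elim simp
  then obtain m where m: "Z * (8 * real L * (LBINT t. cmod (\<Psi> t) * sqrt (em m t))) < \<delta> / 2" "0 < m"
    using eventually_happens'[OF sequentially_bot] by blast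
  show ?thesis
  proof (rule that[OF m(2)])
    fix I :: "int set" assume I: "finite I"
    have "(LINT \<omega>|M. (csum (\<lambda>i \<omega>. synth \<Psi> (lp a i \<omega>) - synth \<Psi> (lp (tr m) i \<omega>)) I \<omega>)\<^sup>2)
      \<le> real (card I) * (Z * (8 * real L * (LBINT t. cmod (\<Psi> t) * sqrt (em m t))) + Z * (8 * C * RR * \<rho> L * Z))"
      by (rule main[OF I])
    also have "\<dots> \<le> real (card I) * \<delta>" using L m by (intro mult_left_mono) auto
    finally show "(LINT \<omega>|M. (csum (\<lambda>i \<omega>. synth \<Psi> (lp a i \<omega>) - synth \<Psi> (lp (tr m) i \<omega>)) I \<omega>)\<^sup>2) \<le> real (card I) * \<delta>" .
  qed
qed

text \<open>Applied to truncated processes, which are not known to have a bounded density, so that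
  \<open>synth_var\<close> is out of reach. Bounded support of \<Psi> takes the place of the density
  bound.\<close>

lemma synth_compact_var:
  assumes \<Psi>: "integrable lborel \<Psi>" and R: "\<And>t. R < \<bar>t\<bar> \<Longrightarrow> \<Psi> t = 0" and c: "dom c" and I: "finite I"
  shows "(LINT w|M. (csum (\<lambda>i w. synth \<Psi> (lp c i w)) I w)\<^sup>2)
    \<le> real (card I) * ((LBINT t. cmod (\<Psi> t))\<^sup>2 * (2 * (C * \<bar>R\<bar> powr (2 * \<gamma>) * suminf r)))"
proof -
  define Z where "Z = (LBINT t. cmod (\<Psi> t))"
  have Z0: "0 \<le> Z" by (simp add: Z_def)
  have [measurable]: "\<Psi> \<in> borel_measurable borel" using borel_measurable_integrable[OF \<Psi>] by simp
  have R0: "0 \<le> suminf r" by (rule suminf_nonneg[OF r_summable r_nonneg])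
  define Q where "Q = real (card I) * (2 * (C * \<bar>R\<bar> powr (2 * \<gamma>) * suminf r))"
  have Q0: "0 \<le> Q" using C_nonneg R0 by (simp add: Q_def)
  have "(LINT w|M. (csum (\<lambda>i w. synth \<Psi> (lp c i w)) I w)\<^sup>2) = (LINT w|M. (Re (CLINT t|lborel. \<Psi> t * Sx c I t w))\<^sup>2)"
    unfolding csum_def synth_sum[OF \<Psi>] ..
  also have "\<dots> \<le> (LBINT t. cmod (\<Psi> t) * 1) * (LBINT t. cmod (\<Psi> t) / 1 * (LINT w|M. (cmod (Sx c I t w))\<^sup>2))"
    by (rule weighted_cauchy_schwarz[OF \<Psi> _ _ _ _ Sx_bounded]) (use \<Psi> in auto)
  also have "\<dots> \<le> Z * (LBINT t. cmod (\<Psi> t) * Q)"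
    unfolding Z_def[symmetric] mult_1_right div_by_1
  proof (rule mult_left_mono[OF _ Z0], rule integral_mono')
    fix t
    show "cmod (\<Psi> t) * (LINT w|M. (cmod (Sx c I t w))\<^sup>2) \<le> cmod (\<Psi> t) * Q"
    proof (cases "R < \<bar>t\<bar>")
      case True then show ?thesis using R[OF True] by simp
    next
      case False
      then have "\<bar>t\<bar> powr (2 * \<gamma>) \<le> \<bar>R\<bar> powr (2 * \<gamma>)" using \<gamma>_pos by (intro powr_mono2) auto
      then have "C * \<bar>t\<bar> powr (2 * \<gamma>) * suminf r \<le> C * \<bar>R\<bar> powr (2 * \<gamma>) * suminf r"
        using C_nonneg R0 by (intro mult_right_mono mult_left_mono) auto
      then have "real (card I) * (2 * (C * \<bar>t\<bar> powr (2 * \<gamma>) * suminf r)) \<le> Q"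
        unfolding Q_def by (intro mult_left_mono) auto
      then show ?thesis by (intro mult_left_mono order_trans[OF Sx_var[OF c I]]) auto
    qed
  qed (use \<Psi> Q0 in auto)
  also have "\<dots> = Z * (Z * Q)" by (simp add: Z_def)
  finally show ?thesis by (simp add: Z_def Q_def power2_eq_square mult_ac)
qed

end

subsection \<open>The central limit theorem for linear processes\<close>

lemma div_ratio_tendsto:
  assumes p: "0 < p"
  shows "(\<lambda>n. real (n div p) / real n) \<longlonglongrightarrow> 1 / real p"
proof -
  have "(\<lambda>n. (1 - real (n mod p) / real n) / real p) \<longlonglongrightarrow> (1 - 0) / real p"
  proof (intro tendsto_intros)
    show "(\<lambda>n. real (n mod p) / real n) \<longlonglongrightarrow> 0"
    proof (rule real_tendsto_sandwich[OF _ _ tendsto_const])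
      show "(\<lambda>n. real p * (1 / real n)) \<longlonglongrightarrow> 0"
        by (intro tendsto_mult_right_zero lim_1_over_n)
      show "\<forall>\<^sub>F n in sequentially. real (n mod p) / real n \<le> real p * (1 / real n)"
        using p by (auto intro!: always_eventually divide_right_mono)
    qed auto
  qed (use p in auto)
  moreover have "\<forall>\<^sub>F n in sequentially. (1 - real (n mod p) / real n) / real p = real (n div p) / real n"
  proof (rule eventually_sequentiallyI[of 1])
    fix n :: nat assume "1 \<le> n"
    have "real n = real (n div p) * real p + real (n mod p)"
      by (metis div_mult_mod_eq of_nat_add of_nat_mult)
    then have m: "real (n mod p) = real n - real (n div p) * real p" by linarith
    show "(1 - real (n mod p) / real n) / real p = real (n div p) / real n"
      unfolding m using p \<open>1 \<le> n\<close> by (simp add: diff_divide_distrib)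
  qed
  ultimately show ?thesis by (simp cong: filterlim_cong add: tendsto_cong)
qed

lemma exp_limit_div:
  assumes p: "0 < p"
  shows "(\<lambda>n. (1 + x / real n) ^ (n div p)) \<longlonglongrightarrow> exp (x / real p)"
proof -
  have "(\<lambda>n. ((1 + x / real n) ^ n) powr (real (n div p) / real n)) \<longlonglongrightarrow> exp x powr (1 / real p)"
    by (intro tendsto_powr tendsto_exp_limit_sequentially div_ratio_tendsto p) simp
  moreover have "\<forall>\<^sub>F n in sequentially. ((1 + x / real n) ^ n) powr (real (n div p) / real n) = (1 + x / real n) ^ (n div p)"
  proof -
    have "(\<lambda>n. 1 + x / real n) \<longlonglongrightarrow> 1 + 0"
      by (intro tendsto_intros lim_const_over_n)
    then have "\<forall>\<^sub>F n in sequentially. 0 < 1 + x / real n" by (intro order_tendstoD(1)) auto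
    then show ?thesis using eventually_gt_at_top[of 0]
    proof eventually_elim
      case (elim n)
      then show ?case by (simp add: powr_realpow[symmetric] powr_powr)
    qed
  qed
  ultimately have "(\<lambda>n. (1 + x / real n) ^ (n div p)) \<longlonglongrightarrow> exp x powr (1 / real p)"
    by (rule Lim_transform_eventually)
  then show ?thesis by (simp add: powr_def)
qed

lemma cmod_iexp_diff_le: "cmod (iexp u - iexp v) \<le> \<bar>u - v\<bar>"
proof -
  have "cmod (iexp u - iexp v) = cmod (iexp v * (iexp (u - v) - 1))"
    by (simp add: right_diff_distrib exp_add[symmetric] algebra_simps)
  also have "\<dots> \<le> \<bar>u - v\<bar>"
    using iexp_approx1[of "u - v" 0] by (simp add: norm_mult)
  finally show ?thesis .
qed

lemma exp_square_lipschitz: "\<bar>exp (- x\<^sup>2 / 2) - exp (- y\<^sup>2 / 2)\<bar> \<le> \<bar>x - (y::real)\<bar>"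
proof -
  have "norm ((\<lambda>x. exp (- x\<^sup>2 / 2)) x - (\<lambda>x. exp (- x\<^sup>2 / 2)) y) \<le> 1 * norm (x - y)"
  proof (rule field_differentiable_bound[where S=UNIV and f'="\<lambda>x. - x * exp (- x\<^sup>2 / 2)"])
    fix z :: real
    show "((\<lambda>x. exp (- x\<^sup>2 / 2)) has_field_derivative - z * exp (- z\<^sup>2 / 2)) (at z within UNIV)"
      by (auto intro!: derivative_eq_intros)
    have "\<bar>z\<bar> \<le> 1 + z\<^sup>2 / 2"
      using zero_le_power2[of "\<bar>z\<bar> - 1"] by (simp add: power2_diff)
    also have "\<dots> \<le> exp (z\<^sup>2 / 2)" by (rule exp_ge_add_one_self)
    finally have "\<bar>z\<bar> * exp (- z\<^sup>2 / 2) \<le> exp (z\<^sup>2 / 2) * exp (- z\<^sup>2 / 2)"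
      by (intro mult_right_mono) auto
    then show "norm (- z * exp (- z\<^sup>2 / 2)) \<le> 1"
      by (simp add: abs_mult exp_minus)
  qed auto
  then show ?thesis by simp
qed

context prob_space
begin

lemma L2_triangle:
  fixes x y :: "'a \<Rightarrow> real"
  assumes [measurable]: "x \<in> borel_measurable M" "y \<in> borel_measurable M"
    and x: "integrable M (\<lambda>w. (x w)\<^sup>2)" and y: "integrable M (\<lambda>w. (y w)\<^sup>2)"
  shows "sqrt (LINT w|M. (x w + y w)\<^sup>2) \<le> sqrt (LINT w|M. (x w)\<^sup>2) + sqrt (LINT w|M. (y w)\<^sup>2)"
proof -
  define X Y where "X = (LINT w|M. (x w)\<^sup>2)" and "Y = (LINT w|M. (y w)\<^sup>2)"
  have XY0: "0 \<le> X" "0 \<le> Y" by (simp_all add: X_def Y_def)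
  have xy: "integrable M (\<lambda>w. x w * y w)" by (rule integrable_mult_of_squares) (use x y in auto)
  have "(LINT w|M. x w * y w) \<le> (LINT w|M. \<bar>x w * y w\<bar>)"
    using xy by (intro integral_mono) auto
  also have "\<dots> \<le> sqrt (X * Y)"
    using cauchy_schwarz_integral[OF _ _ x y] by (intro real_le_rsqrt) (simp add: X_def Y_def)
  finally have le: "(LINT w|M. x w * y w) \<le> sqrt X * sqrt Y" by (simp add: real_sqrt_mult)
  have "(LINT w|M. (x w + y w)\<^sup>2) = (LINT w|M. (x w)\<^sup>2 + 2 * (x w * y w) + (y w)\<^sup>2)"
    by (rule Bochner_Integration.integral_cong) (auto simp: power2_sum)
  also have "\<dots> = X + 2 * (LINT w|M. x w * y w) + Y"
    using x y xy by (simp add: X_def Y_def)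
  also have "\<dots> \<le> X + 2 * (sqrt X * sqrt Y) + Y" using le by simp
  also have "\<dots> = (sqrt X + sqrt Y)\<^sup>2" using XY0 by (simp add: power2_sum)
  finally have "sqrt (LINT w|M. (x w + y w)\<^sup>2) \<le> sqrt ((sqrt X + sqrt Y)\<^sup>2)" by (rule real_sqrt_le_mono)
  then show ?thesis using XY0 by (simp add: X_def Y_def)
qed

lemma L1_le_L2:
  fixes x :: "'a \<Rightarrow> real"
  assumes [measurable]: "x \<in> borel_measurable M" and x: "integrable M (\<lambda>w. (x w)\<^sup>2)"
  shows "integrable M x" "(LINT w|M. \<bar>x w\<bar>) \<le> sqrt (LINT w|M. (x w)\<^sup>2)"
proof -
  show "integrable M x" by (rule square_integrable_imp_integrable[OF _ x]) simp
  have "(LINT w|M. \<bar>x w * 1\<bar>)\<^sup>2 \<le> (LINT w|M. (x w)\<^sup>2) * (LINT w|M. 1\<^sup>2)"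
    by (rule cauchy_schwarz_integral) (use x in auto)
  then show "(LINT w|M. \<bar>x w\<bar>) \<le> sqrt (LINT w|M. (x w)\<^sup>2)"
    by (intro real_le_rsqrt) (simp add: prob_space)
qed

lemma char_diff_le_L1:
  assumes [measurable]: "x \<in> borel_measurable M" "y \<in> borel_measurable M"
    and d: "integrable M (\<lambda>w. x w - y w)"
  shows "cmod ((CLINT w|M. iexp (t * x w)) - (CLINT w|M. iexp (t * y w))) \<le> \<bar>t\<bar> * (LINT w|M. \<bar>x w - y w\<bar>)"
proof -
  have i: "integrable M (\<lambda>w. iexp (t * x w))" "integrable M (\<lambda>w. iexp (t * y w))"
    by (rule integrable_const_bound[of _ 1]; simp)+
  have "cmod ((CLINT w|M. iexp (t * x w)) - (CLINT w|M. iexp (t * y w))) = cmod (CLINT w|M. iexp (t * x w) - iexp (t * y w))"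
    using i by simp
  also have "\<dots> \<le> (LINT w|M. cmod (iexp (t * x w) - iexp (t * y w)))" by (rule integral_norm_bound)
  also have "\<dots> \<le> (LINT w|M. \<bar>t\<bar> * \<bar>x w - y w\<bar>)"
  proof (rule integral_mono')
    show "cmod (iexp (t * x w) - iexp (t * y w)) \<le> \<bar>t\<bar> * \<bar>x w - y w\<bar>" for w
      using cmod_iexp_diff_le[of "t * x w" "t * y w"] by (simp only: right_diff_distrib[symmetric] abs_mult)
  qed (use d in auto)
  finally show ?thesis by simp
qed

text \<open>The variances of the approximants are not assumed to converge. The L2 norms of
  \<open>T n\<close> stay within 2 \<delta> of some s for every \<delta>, hence form a Cauchy
  sequence, and their limit \<sigma> is within 2 \<delta> of s. As exp (-x^2 / 2) is Lipschitz with
  constant 1, the Gaussian characteristic functions for s and \<sigma> are close as well. Nothing is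
  divided by \<sigma>, which may be 0.\<close>

lemma clt_approx:
  fixes T :: "nat \<Rightarrow> 'a \<Rightarrow> real"
  assumes T[measurable]: "\<And>n. T n \<in> borel_measurable M" and T2: "\<And>n. integrable M (\<lambda>\<omega>. (T n \<omega>)\<^sup>2)"
    and ap: "\<And>\<delta>. 0 < \<delta> \<Longrightarrow> \<exists>V s. (\<forall>n. V n \<in> borel_measurable M \<and> integrable M (\<lambda>\<omega>. (V n \<omega>)\<^sup>2)) \<and> 0 \<le> s \<and>
      (\<forall>t. (\<lambda>n. CLINT \<omega>|M. iexp (t * V n \<omega>)) \<longlonglongrightarrow> complex_of_real (exp (- (s * t)\<^sup>2 / 2))) \<and>
      (\<lambda>n. LINT \<omega>|M. (V n \<omega>)\<^sup>2) \<longlonglongrightarrow> s\<^sup>2 \<and>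
      (\<forall>\<^sub>F n in sequentially. (LINT \<omega>|M. (T n \<omega> - V n \<omega>)\<^sup>2) \<le> \<delta>\<^sup>2)"
  shows "\<exists>\<sigma>\<ge>0. (\<lambda>n. LINT \<omega>|M. (T n \<omega>)\<^sup>2) \<longlonglongrightarrow> \<sigma>\<^sup>2 \<and>
    (\<forall>t. (\<lambda>n. CLINT \<omega>|M. iexp (t * T n \<omega>)) \<longlonglongrightarrow> complex_of_real (exp (- (\<sigma> * t)\<^sup>2 / 2)))"
proof -
  define N where "N n = sqrt (LINT \<omega>|M. (T n \<omega>)\<^sup>2)" for n
  have approx: "\<exists>s\<ge>0. (\<forall>\<^sub>F n in sequentially. \<bar>N n - s\<bar> \<le> 2 * \<delta>) \<and>
     (\<forall>t. \<forall>\<^sub>F n in sequentially. cmod ((CLINT \<omega>|M. iexp (t * T n \<omega>)) - complex_of_real (exp (- (s * t)\<^sup>2 / 2))) \<le> \<bar>t\<bar> * \<delta> + \<delta>)"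
    if \<delta>: "0 < \<delta>" for \<delta>
  proof -
    obtain V s where V: "\<And>n. V n \<in> borel_measurable M" "\<And>n. integrable M (\<lambda>\<omega>. (V n \<omega>)\<^sup>2)" and s: "0 \<le> s"
      and ch: "\<And>t. (\<lambda>n. CLINT \<omega>|M. iexp (t * V n \<omega>)) \<longlonglongrightarrow> complex_of_real (exp (- (s * t)\<^sup>2 / 2))"
      and Vs: "(\<lambda>n. LINT \<omega>|M. (V n \<omega>)\<^sup>2) \<longlonglongrightarrow> s\<^sup>2"
      and ev: "\<forall>\<^sub>F n in sequentially. (LINT \<omega>|M. (T n \<omega> - V n \<omega>)\<^sup>2) \<le> \<delta>\<^sup>2"
      using ap[OF \<delta>] by blast
    note V(1)[measurable]
    have TV2: "integrable M (\<lambda>\<omega>. (T n \<omega> - V n \<omega>)\<^sup>2)" for n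
    proof (rule Bochner_Integration.integrable_bound)
      show "integrable M (\<lambda>\<omega>. 2 * (T n \<omega>)\<^sup>2 + 2 * (V n \<omega>)\<^sup>2)" using T2 V(2) by auto
      show "AE \<omega> in M. norm ((T n \<omega> - V n \<omega>)\<^sup>2) \<le> norm (2 * (T n \<omega>)\<^sup>2 + 2 * (V n \<omega>)\<^sup>2)"
        using sum_squares_le[of "T n _" "- V n _"] by (intro AE_I2) simp
    qed measurable
    have "(\<lambda>n. sqrt (LINT \<omega>|M. (V n \<omega>)\<^sup>2)) \<longlonglongrightarrow> sqrt (s\<^sup>2)" by (intro tendsto_intros Vs)
    then have "(\<lambda>n. sqrt (LINT \<omega>|M. (V n \<omega>)\<^sup>2)) \<longlonglongrightarrow> s" using s by simp
    then have "\<forall>\<^sub>F n in sequentially. dist (sqrt (LINT \<omega>|M. (V n \<omega>)\<^sup>2)) s < \<delta>"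
      using \<delta> by (rule tendstoD)
    then have 1: "\<forall>\<^sub>F n in sequentially. \<bar>N n - s\<bar> \<le> 2 * \<delta>"
      using ev
    proof eventually_elim
      case (elim n)
      have d: "sqrt (LINT \<omega>|M. (T n \<omega> - V n \<omega>)\<^sup>2) \<le> \<delta>"
        using real_sqrt_le_mono[OF elim(2)] \<delta> by simp
      have "N n \<le> sqrt (LINT \<omega>|M. (V n \<omega>)\<^sup>2) + sqrt (LINT \<omega>|M. (T n \<omega> - V n \<omega>)\<^sup>2)"
        using L2_triangle[of "V n" "\<lambda>\<omega>. T n \<omega> - V n \<omega>"] V(2) TV2 by (simp add: N_def)
      moreover have "sqrt (LINT \<omega>|M. (V n \<omega>)\<^sup>2) \<le> N n + sqrt (LINT \<omega>|M. (T n \<omega> - V n \<omega>)\<^sup>2)"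
        using L2_triangle[of "T n" "\<lambda>\<omega>. V n \<omega> - T n \<omega>"] T2 TV2[of n] by (simp add: N_def power2_commute)
      ultimately show ?case using d elim(1) unfolding dist_real_def by linarith
    qed
    have 2: "\<forall>\<^sub>F n in sequentially. cmod ((CLINT \<omega>|M. iexp (t * T n \<omega>)) - complex_of_real (exp (- (s * t)\<^sup>2 / 2))) \<le> \<bar>t\<bar> * \<delta> + \<delta>" for t
    proof -
      have "\<forall>\<^sub>F n in sequentially. dist (CLINT \<omega>|M. iexp (t * V n \<omega>)) (complex_of_real (exp (- (s * t)\<^sup>2 / 2))) < \<delta>"
        using ch \<delta> by (rule tendstoD)
      then show ?thesis using ev
      proof eventually_elim
        case (elim n)
        have d: "sqrt (LINT \<omega>|M. (T n \<omega> - V n \<omega>)\<^sup>2) \<le> \<delta>"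
          using real_sqrt_le_mono[OF elim(2)] \<delta> by simp
        have "cmod ((CLINT \<omega>|M. iexp (t * T n \<omega>)) - (CLINT \<omega>|M. iexp (t * V n \<omega>))) \<le> \<bar>t\<bar> * (LINT \<omega>|M. \<bar>T n \<omega> - V n \<omega>\<bar>)"
          by (rule char_diff_le_L1) (use L1_le_L2(1)[OF _ TV2[of n]] in auto)
        also have "\<dots> \<le> \<bar>t\<bar> * \<delta>"
          using L1_le_L2(2)[OF _ TV2[of n]] d by (intro mult_left_mono) auto
        finally have "cmod ((CLINT \<omega>|M. iexp (t * T n \<omega>)) - (CLINT \<omega>|M. iexp (t * V n \<omega>))) \<le> \<bar>t\<bar> * \<delta>" .
        moreover have "cmod ((CLINT \<omega>|M. iexp (t * V n \<omega>)) - complex_of_real (exp (- (s * t)\<^sup>2 / 2))) < \<delta>"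
          using elim(1) by (simp only: dist_norm)
        ultimately show ?case
          using norm_triangle_ineq[of "(CLINT \<omega>|M. iexp (t * T n \<omega>)) - (CLINT \<omega>|M. iexp (t * V n \<omega>))"
             "(CLINT \<omega>|M. iexp (t * V n \<omega>)) - complex_of_real (exp (- (s * t)\<^sup>2 / 2))"] by simp
      qed
    qed
    show ?thesis using s 1 2 by blast
  qed
  have "Cauchy N"
  proof (rule metric_CauchyI)
    fix \<epsilon> :: real assume \<epsilon>: "0 < \<epsilon>"
    then obtain s where "\<forall>\<^sub>F n in sequentially. \<bar>N n - s\<bar> \<le> 2 * (\<epsilon> / 8)" using approx[of "\<epsilon> / 8"] by auto
    then obtain n0 where n0: "\<And>n. n0 \<le> n \<Longrightarrow> \<bar>N n - s\<bar> \<le> 2 * (\<epsilon> / 8)" unfolding eventually_sequentially by blast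
    show "\<exists>M. \<forall>m\<ge>M. \<forall>n\<ge>M. dist (N m) (N n) < \<epsilon>"
    proof (intro exI allI impI)
      fix m n assume "n0 \<le> m" "n0 \<le> n"
      then show "dist (N m) (N n) < \<epsilon>" using n0[of m] n0[of n] \<epsilon> unfolding dist_real_def by linarith
    qed
  qed
  then obtain \<sigma> where \<sigma>: "N \<longlonglongrightarrow> \<sigma>" using Cauchy_convergent convergentD by blast
  have \<sigma>0: "0 \<le> \<sigma>" by (rule LIMSEQ_le_const[OF \<sigma>]) (auto simp: N_def)
  have "(\<lambda>n. (N n)\<^sup>2) \<longlonglongrightarrow> \<sigma>\<^sup>2" by (intro tendsto_intros \<sigma>)
  then have v: "(\<lambda>n. LINT \<omega>|M. (T n \<omega>)\<^sup>2) \<longlonglongrightarrow> \<sigma>\<^sup>2" by (simp add: N_def)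
  have "(\<lambda>n. CLINT \<omega>|M. iexp (t * T n \<omega>)) \<longlonglongrightarrow> complex_of_real (exp (- (\<sigma> * t)\<^sup>2 / 2))" for t
  proof (rule tendstoI)
    fix \<epsilon> :: real assume \<epsilon>: "0 < \<epsilon>"
    \<comment> \<open>Chosen so that the total error |t| \<delta> + \<delta> + 2 \<delta> |t| equals
      \<epsilon> / 2.\<close>
    define \<delta> where "\<delta> = \<epsilon> / (2 * (3 * \<bar>t\<bar> + 1))"
    have \<delta>: "0 < \<delta>" using \<epsilon> by (simp add: \<delta>_def)
    obtain s where s: "\<forall>\<^sub>F n in sequentially. \<bar>N n - s\<bar> \<le> 2 * \<delta>"
      "\<forall>\<^sub>F n in sequentially. cmod ((CLINT \<omega>|M. iexp (t * T n \<omega>)) - complex_of_real (exp (- (s * t)\<^sup>2 / 2))) \<le> \<bar>t\<bar> * \<delta> + \<delta>"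
      using approx[OF \<delta>] by blast
    have "\<bar>\<sigma> - s\<bar> \<le> 2 * \<delta>"
      by (rule tendsto_upperbound[OF _ s(1) sequentially_bot]) (intro tendsto_intros \<sigma>)
    then have "\<bar>s * t - \<sigma> * t\<bar> \<le> 2 * \<delta> * \<bar>t\<bar>"
      using mult_right_mono[of "\<bar>\<sigma> - s\<bar>" "2 * \<delta>" "\<bar>t\<bar>"] by (simp only: left_diff_distrib[symmetric] abs_mult abs_minus_commute abs_ge_zero)
    then have e: "\<bar>exp (- (s * t)\<^sup>2 / 2) - exp (- (\<sigma> * t)\<^sup>2 / 2)\<bar> \<le> 2 * \<delta> * \<bar>t\<bar>"
      using exp_square_lipschitz[of "s * t" "\<sigma> * t"] by linarith
    have e': "cmod (complex_of_real (exp (- (s * t)\<^sup>2 / 2)) - complex_of_real (exp (- (\<sigma> * t)\<^sup>2 / 2))) \<le> 2 * \<delta> * \<bar>t\<bar>"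
      using e by (simp only: of_real_diff[symmetric] norm_of_real)
    have fin: "\<bar>t\<bar> * \<delta> + \<delta> + 2 * \<delta> * \<bar>t\<bar> < \<epsilon>"
    proof -
      have "\<bar>t\<bar> * \<delta> + \<delta> + 2 * \<delta> * \<bar>t\<bar> = \<delta> * (3 * \<bar>t\<bar> + 1)" by (simp add: algebra_simps)
      also have "\<dots> = \<epsilon> / 2"
      proof -
        have "3 * \<bar>t\<bar> + 1 \<noteq> 0" using abs_ge_zero[of t] by linarith
        moreover have "x / (2 * w) * w = x / 2" if "w \<noteq> 0" for x w :: real using that by simp
        ultimately show ?thesis unfolding \<delta>_def by blast
      qed
      finally show ?thesis using \<epsilon> by simp
    qed
    show "\<forall>\<^sub>F n in sequentially. dist (CLINT \<omega>|M. iexp (t * T n \<omega>)) (complex_of_real (exp (- (\<sigma> * t)\<^sup>2 / 2))) < \<epsilon>"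
      using s(2)
    proof eventually_elim
      case (elim n)
      have "dist (CLINT \<omega>|M. iexp (t * T n \<omega>)) (complex_of_real (exp (- (\<sigma> * t)\<^sup>2 / 2)))
        \<le> cmod ((CLINT \<omega>|M. iexp (t * T n \<omega>)) - complex_of_real (exp (- (s * t)\<^sup>2 / 2)))
          + cmod (complex_of_real (exp (- (s * t)\<^sup>2 / 2)) - complex_of_real (exp (- (\<sigma> * t)\<^sup>2 / 2)))"
        unfolding dist_norm by (rule norm_diff_triangle_ineq[of _ 0, simplified] norm_diff_triangle_le[OF order_refl order_refl])
      also have "\<dots> \<le> \<bar>t\<bar> * \<delta> + \<delta> + 2 * \<delta> * \<bar>t\<bar>" using elim e' by linarith
      finally show ?case using fin by linarith
    qed
  qed
  then show ?thesis using \<sigma>0 v by blast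
qed

text \<open>There are about n / p blocks but the normalisation is the square root of n, whence the
  limiting variance v / p. The expansion of the characteristic function to second order, with a
  cubic error from boundedness, does not require v > 0.\<close>

lemma iid_block_clt:
  fixes U :: "nat \<Rightarrow> 'a \<Rightarrow> real"
  assumes ind: "indep_vars (\<lambda>_. borel) U UNIV" and id: "\<And>b. distr M borel (U b) = distr M borel (U 0)"
    and B: "\<And>b w. \<bar>U b w\<bar> \<le> B" and E0: "\<And>b. (LINT w|M. U b w) = 0" and p: "0 < p"
  shows "\<exists>s\<ge>0. (\<forall>t. (\<lambda>n. CLINT w|M. iexp (t * ((\<Sum>b<n div p. U b w) / sqrt (real n)))) \<longlonglongrightarrow> complex_of_real (exp (- (s * t)\<^sup>2 / 2))) \<and>
     (\<lambda>n. LINT w|M. ((\<Sum>b<n div p. U b w) / sqrt (real n))\<^sup>2) \<longlonglongrightarrow> s\<^sup>2"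
proof -
  have [measurable]: "U b \<in> borel_measurable M" for b using ind by (auto simp: indep_vars_def)
  have B0: "0 \<le> B" using B abs_ge_zero order_trans by blast
  have Ui: "integrable M (U b)" for b by (rule integrable_const_bound[of _ B]) (use B in auto)
  have U2i: "integrable M (\<lambda>w. (U b w)\<^sup>2)" for b by (rule bounded_square_integrable[OF _ B]) measurable
  define v where "v = (LINT w|M. (U 0 w)\<^sup>2)"
  have v0: "0 \<le> v" by (simp add: v_def)
  have v: "(LINT w|M. (U b w)\<^sup>2) = v" for b
  proof -
    have "(\<integral>x. x\<^sup>2 \<partial>distr M borel (U b)) = (\<integral>x. x\<^sup>2 \<partial>distr M borel (U 0))" by (simp only: id[of b])
    then show ?thesis by (simp add: integral_distr v_def)
  qed
  define \<psi> where "\<psi> = char (distr M borel (U 0))"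
  interpret D: real_distribution "distr M borel (U 0)" by (rule real_distribution_distr) simp
  have \<psi>1: "cmod (\<psi> t) \<le> 1" for t unfolding \<psi>_def by (rule D.cmod_char_le_1)
  have \<psi>_approx: "cmod (\<psi> t - (1 - t\<^sup>2 * v / 2)) \<le> \<bar>t\<bar> ^ 3 * B ^ 3" for t
  proof -
    have "cmod (\<psi> t - (1 - t\<^sup>2 * v / 2)) \<le> (t\<^sup>2 / 6) * (LINT w|M. min (6 * (U 0 w)\<^sup>2) (\<bar>t\<bar> * \<bar>U 0 w\<bar> ^ 3))"
      unfolding \<psi>_def by (rule char_approx3'[OF _ Ui U2i E0 _ refl]) (simp_all add: E0 v_def)
    also have "\<dots> \<le> (t\<^sup>2 / 6) * (LINT w|M. \<bar>t\<bar> * B ^ 3)"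
    proof (intro mult_left_mono integral_mono')
      fix w
      have "\<bar>U 0 w\<bar> ^ 3 \<le> B ^ 3" using B by (intro power_mono) auto
      then show "min (6 * (U 0 w)\<^sup>2) (\<bar>t\<bar> * \<bar>U 0 w\<bar> ^ 3) \<le> \<bar>t\<bar> * B ^ 3"
        by (intro min.coboundedI2 mult_left_mono) auto
    qed (use B0 in auto)
    also have "\<dots> = \<bar>t\<bar> ^ 3 * B ^ 3 / 6"
      by (simp add: prob_space power3_eq_cube power2_eq_square abs_mult_self_eq flip: mult.assoc)
    also have "\<dots> \<le> \<bar>t\<bar> ^ 3 * B ^ 3" using B0 by simp
    finally show ?thesis .
  qed
  have prodchar: "(CLINT w|M. iexp (t * ((\<Sum>b<q. U b w) / x))) = \<psi> (t / x) ^ q" for t x q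
  proof -
    have "(CLINT w|M. iexp (t * ((\<Sum>b<q. U b w) / x))) = char (distr M borel (\<lambda>w. \<Sum>b<q. U b w)) (t / x)"
      by (simp add: char_def integral_distr)
    also have "\<dots> = (\<Prod>b<q. char (distr M borel (U b)) (t / x))"
      by (rule char_distr_sum) (rule indep_vars_subset[OF ind], simp)
    also have "\<dots> = (\<Prod>b<q. \<psi> (t / x))"
      by (rule prod.cong[OF refl], subst id) (simp add: \<psi>_def)
    also have "\<dots> = \<psi> (t / x) ^ q" by simp
    finally show ?thesis .
  qed
  define s where "s = sqrt (v / real p)"
  have s2: "s\<^sup>2 = v / real p" using v0 by (simp add: s_def)
  have ch: "(\<lambda>n. CLINT w|M. iexp (t * ((\<Sum>b<n div p. U b w) / sqrt (real n)))) \<longlonglongrightarrow> complex_of_real (exp (- (s * t)\<^sup>2 / 2))" for t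
  proof -
    define y where "y = - (t\<^sup>2 * v / 2)"
    have lim: "(\<lambda>n. complex_of_real ((1 + y / real n) ^ (n div p))) \<longlonglongrightarrow> complex_of_real (exp (y / real p))"
      by (intro tendsto_intros exp_limit_div p)
    have ye: "y / real p = - (s * t)\<^sup>2 / 2" by (simp add: y_def power_mult_distrib s2 mult.commute)
    have "(\<lambda>n. \<psi> (t / sqrt (real n)) ^ (n div p) - complex_of_real ((1 + y / real n) ^ (n div p))) \<longlonglongrightarrow> 0"
    proof (rule Lim_null_comparison)
      show "(\<lambda>n. \<bar>t\<bar> ^ 3 * B ^ 3 * (1 / sqrt (real n))) \<longlonglongrightarrow> 0"
        by (intro tendsto_mult_right_zero tendsto_divide_0[OF tendsto_const] filterlim_at_top_imp_at_infinity
            filterlim_compose[OF sqrt_at_top filterlim_real_sequentially])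
      \<comment> \<open>Comparing powers through the difference of their bases requires both bases
        in the unit disc. The quadratic approximation 1 + y / n is at most 1 since y is not
        positive, and it is positive for large n. The error is then at most n times a multiple of
        n^(-3/2).\<close>
      have "(\<lambda>n. 1 + y / real n) \<longlonglongrightarrow> 1 + 0" by (intro tendsto_intros lim_const_over_n)
      then have "\<forall>\<^sub>F n in sequentially. 0 < 1 + y / real n" by (intro order_tendstoD(1)) auto
      then show "\<forall>\<^sub>F n in sequentially. norm (\<psi> (t / sqrt (real n)) ^ (n div p) - complex_of_real ((1 + y / real n) ^ (n div p))) \<le> \<bar>t\<bar> ^ 3 * B ^ 3 * (1 / sqrt (real n))"
        using eventually_gt_at_top[of 0]
      proof eventually_elim
        case (elim n)
        have y0: "y / real n \<le> 0" using v0 by (simp add: y_def divide_nonpos_nonneg)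
        have "norm (\<psi> (t / sqrt (real n)) ^ (n div p) - (complex_of_real (1 + y / real n)) ^ (n div p))
          \<le> real (n div p) * norm (\<psi> (t / sqrt (real n)) - complex_of_real (1 + y / real n))"
        proof (intro norm_power_diff \<psi>1)
          show "norm (complex_of_real (1 + y / real n)) \<le> 1"
            unfolding norm_of_real using elim(1) y0 by linarith
        qed
        also have "\<dots> \<le> real n * (\<bar>t / sqrt (real n)\<bar> ^ 3 * B ^ 3)"
        proof (rule mult_mono)
          have "1 + y / real n = 1 - (t / sqrt (real n))\<^sup>2 * v / 2" by (simp add: y_def power_divide)
          then have "complex_of_real (1 + y / real n) = 1 - (t / sqrt (real n))\<^sup>2 * v / 2" by simp
          then show "norm (\<psi> (t / sqrt (real n)) - complex_of_real (1 + y / real n)) \<le> \<bar>t / sqrt (real n)\<bar> ^ 3 * B ^ 3"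
            using \<psi>_approx[of "t / sqrt (real n)"] by (simp only:)
        qed auto
        also have "\<dots> = \<bar>t\<bar> ^ 3 * B ^ 3 * (1 / sqrt (real n))"
        proof -
          have "real n = sqrt (real n) * sqrt (real n)" by simp
          then have A: "real n * (1 / sqrt (real n)) ^ 3 = 1 / sqrt (real n)"
            using elim by (simp add: power3_eq_cube field_simps)
          have Bf: "\<bar>t / sqrt (real n)\<bar> ^ 3 = \<bar>t\<bar> ^ 3 * (1 / sqrt (real n)) ^ 3"
            by (simp add: power_divide)
          have "real n * (\<bar>t / sqrt (real n)\<bar> ^ 3 * B ^ 3) = \<bar>t\<bar> ^ 3 * B ^ 3 * (real n * (1 / sqrt (real n)) ^ 3)"
            by (simp only: Bf mult_ac)
          then show ?thesis by (simp only: A)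
        qed
        finally show ?case by (simp only: of_real_power)
      qed
    qed
    from tendsto_add[OF this lim] show ?thesis unfolding prodchar ye by simp
  qed
  have cross: "(LINT w|M. U b w * U c w) = (if b = c then v else 0)" for b c
  proof (cases "b = c")
    case True then show ?thesis using v[of c] by (simp add: power2_eq_square)
  next
    case False
    have "(LINT w|M. (\<Prod>i\<in>{b, c}. U i w)) = (\<Prod>i\<in>{b, c}. LINT w|M. U i w)"
      by (rule indep_vars_lebesgue_integral) (use indep_vars_subset[OF ind] Ui in auto)
    then show ?thesis using False by (simp add: E0)
  qed
  have ci: "integrable M (\<lambda>w. U b w * U c w)" for b c
    by (rule integrable_mult_of_squares[OF _ _ U2i U2i]) measurable
  have "(LINT w|M. ((\<Sum>b<q. U b w) / sqrt (real n))\<^sup>2) = v * (real q / real n)" for q n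
  proof -
    have "(LINT w|M. ((\<Sum>b<q. U b w) / sqrt (real n))\<^sup>2) = (LINT w|M. (\<Sum>b<q. \<Sum>c<q. U b w * U c w) / real n)"
      by (simp add: power_divide power2_eq_square sum_product)
    also have "\<dots> = (\<Sum>b<q. \<Sum>c<q. LINT w|M. U b w * U c w) / real n"
      using ci by (simp add: Bochner_Integration.integral_sum Bochner_Integration.integrable_sum)
    also have "\<dots> = v * (real q / real n)" by (simp add: cross)
    finally show ?thesis .
  qed
  moreover have "(\<lambda>n. v * (real (n div p) / real n)) \<longlonglongrightarrow> v * (1 / real p)"
    by (intro tendsto_intros div_ratio_tendsto p)
  ultimately have "(\<lambda>n. LINT w|M. ((\<Sum>b<n div p. U b w) / sqrt (real n))\<^sup>2) \<longlonglongrightarrow> s\<^sup>2"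
    by (simp add: s2)
  moreover have "0 \<le> s" using v0 by (simp add: s_def)
  ultimately show ?thesis using ch by blast
qed

end

context linproc
begin

lemma distr_lp_stationary:
  assumes c: "dom c"
  shows "distr M borel (lp c i) = distr M borel (lp c j)"
proof (rule Levy_uniqueness)
  show "char (distr M borel (lp c i)) = char (distr M borel (lp c j))"
  proof
    fix t show "char (distr M borel (lp c i)) t = char (distr M borel (lp c j)) t"
      using char_lp_stationary[OF c, of t i j] by (simp add: char_def integral_distr)
  qed
qed (rule real_distribution_distr, simp)+

text \<open>The m indices left out before each block separate the innovations used by different
  blocks, which gives independence. Every block sum is one fixed function F of the innovations moved
  back by b p, and reindexing a product of identical laws does not change it, so the laws
  agree.\<close>

lemma block_iid:
  assumes u[measurable]: "u \<in> borel_measurable borel" and m: "0 < m" "m < p"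
  defines "U \<equiv> \<lambda>b::nat. csum (\<lambda>i \<omega>. u (lp (tr m) i \<omega>)) {int (b * p) + int m ..< int (b * p) + int p}"
  shows "indep_vars (\<lambda>_. borel) U UNIV" "distr M borel (U b) = distr M borel (U 0)"
proof -
  define \<nu> where "\<nu> = distr M borel (e 1)"
  define \<mu> where "\<mu> = (LINT \<omega>|M. u (lp (tr m) 0 \<omega>))"
  have \<mu>: "(LINT \<omega>|M. u (lp (tr m) i \<omega>)) = \<mu>" for i
  proof -
    have "(\<integral>x. u x \<partial>distr M borel (lp (tr m) i)) = (\<integral>x. u x \<partial>distr M borel (lp (tr m) 0))"
      by (simp only: distr_lp_stationary[OF dom_tr, of m i 0])
    then show ?thesis by (simp add: integral_distr \<mu>_def)
  qed
  define S where "S = {1 ..< int p}"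
  \<comment> \<open>The oldest innovation used in block b has index b p + m - (m - 1) = b p +
    1.\<close>
  define K where "K b = {int (b * p) + 1 ..< int (b * p) + int p}" for b :: nat
  define P where "P = PiM S (\<lambda>_::int. borel :: real measure)"
  define Pb where "Pb b = PiM (K b) (\<lambda>_::int. borel :: real measure)" for b
  define sh where "sh b v = (\<lambda>l\<in>S. v (int (b * p) + l))" for b :: nat and v :: "int \<Rightarrow> real"
  define F where "F w = (\<Sum>i\<in>{int m ..< int p}. u (\<Sum>t<m. a t * w (i - int t)) - \<mu>)" for w :: "int \<Rightarrow> real"
  define rs where "rs b \<omega> = restrict (\<lambda>l. e l \<omega>) (K b)" for b \<omega>
  have Fm[measurable]: "F \<in> borel_measurable P"
  proof -
    have "(\<lambda>w. w (i - int t)) \<in> borel_measurable P" if "i \<in> {int m ..< int p}" "t < m" for i t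
      unfolding P_def by (rule measurable_component_singleton) (use that in \<open>auto simp: S_def\<close>)
    then show ?thesis unfolding F_def
      by (intro borel_measurable_sum borel_measurable_diff borel_measurable_const measurable_compose[OF _ u] borel_measurable_times) auto
  qed
  have shm[measurable]: "sh b \<in> Pb b \<rightarrow>\<^sub>M P" for b
    unfolding sh_def P_def Pb_def
    by (rule measurable_restrict, rule measurable_component_singleton) (auto simp: S_def K_def)
  have rsm[measurable]: "rs b \<in> M \<rightarrow>\<^sub>M Pb b" for b
    unfolding rs_def Pb_def by (rule measurable_restrict) simp
  have U_eq: "U b \<omega> = F (sh b (rs b \<omega>))" for b \<omega>
  proof -
    have inj: "inj_on (\<lambda>i. int (b * p) + i) {int m ..< int p}" by (auto simp: inj_on_def)
    have im: "(\<lambda>i. int (b * p) + i) ` {int m ..< int p} = {int (b * p) + int m ..< int (b * p) + int p}"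
      by (simp add: image_add_atLeastLessThan add.commute)
    have "U b \<omega> = (\<Sum>i\<in>{int m ..< int p}. u (psum a (int (b * p) + i) m \<omega>) - \<mu>)"
      unfolding U_def csum_def \<mu> im[symmetric] sum.reindex[OF inj] by (simp add: lp_tr)
    also have "\<dots> = F (sh b (rs b \<omega>))"
      unfolding F_def linear_partial_sum_def
      by (intro sum.cong refl arg_cong[where f="\<lambda>x. u x - \<mu>"]) (auto simp: sh_def rs_def S_def K_def algebra_simps)
    finally show ?thesis .
  qed
  have "disjoint_family_on K UNIV"
    unfolding disjoint_family_on_def
  proof (intro ballI impI)
    fix b c :: nat assume "b \<noteq> c"
    then have "b * p + p \<le> c * p \<or> c * p + p \<le> b * p"
      using m by (metis add.commute mult_Suc mult_le_mono1 not_less_eq_eq le_antisym nle_le)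
    then have "int (b * p) + int p \<le> int (c * p) \<or> int (c * p) + int p \<le> int (b * p)" by linarith
    then show "K b \<inter> K c = {}" by (auto simp: K_def)
  qed
  then have "indep_vars (\<lambda>b. Pb b) rs UNIV"
    unfolding Pb_def rs_def[abs_def] by (intro indep_vars_restrict[OF indep]) auto
  then have "indep_vars (\<lambda>_. borel) (\<lambda>b \<omega>. F (sh b (rs b \<omega>))) UNIV"
    by (rule indep_vars_compose2) measurable
  then show "indep_vars (\<lambda>_. borel) U UNIV" by (simp add: U_eq[abs_def])
  have law: "distr M P (\<lambda>\<omega>. sh b (rs b \<omega>)) = PiM S (\<lambda>_. \<nu>)" for b
  proof -
    have ne: "K b \<noteq> {}" using m by (auto simp: K_def)
    have "distr M (Pb b) (rs b) = PiM (K b) (\<lambda>i. distr M borel (e i))"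
      using indep_vars_iff_distr_eq_PiM'[OF ne, where X=e and M'="\<lambda>_. borel"] indep_vars_subset[OF indep, of "K b"]
      unfolding Pb_def rs_def[abs_def] by simp
    also have "\<dots> = PiM (K b) (\<lambda>_. \<nu>)"
      unfolding \<nu>_def by (rule PiM_cong[OF refl]) (rule ident)
    finally have 1: "distr M (Pb b) (rs b) = PiM (K b) (\<lambda>_. \<nu>)" .
    have "distr M P (\<lambda>\<omega>. sh b (rs b \<omega>)) = distr (distr M (Pb b) (rs b)) P (sh b)"
      by (subst distr_distr) (auto simp: comp_def)
    also have "\<dots> = distr (PiM (K b) (\<lambda>_. \<nu>)) P (sh b)" by (simp only: 1)
    also have "\<dots> = distr (PiM (K b) (\<lambda>_. \<nu>)) (PiM S (\<lambda>_. \<nu>)) (sh b)"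
      by (rule distr_cong) (auto simp: P_def \<nu>_def intro!: sets_PiM_cong)
    also have "\<dots> = PiM S (\<lambda>_. \<nu>)"
      unfolding sh_def[abs_def]
      by (rule distr_PiM_reindex[where f="\<lambda>l. int (b * p) + l" and M="\<lambda>_. \<nu>"])
         (auto simp: \<nu>_def S_def K_def inj_on_def intro!: prob_space_distr)
    finally show ?thesis .
  qed
  have dU: "distr M borel (U b) = distr (PiM S (\<lambda>_. \<nu>)) borel F" for b
  proof -
    have "distr M borel (U b) = distr (distr M P (\<lambda>\<omega>. sh b (rs b \<omega>))) borel F"
      by (subst distr_distr) (auto simp: comp_def U_eq[abs_def])
    then show ?thesis by (simp only: law)
  qed
  show "distr M borel (U b) = distr M borel (U 0)" by (simp only: dU)
qed

end

lemma (in prob_space) csum_union: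
  assumes "finite I" "finite J" "I \<inter> J = {}"
  shows "csum Z (I \<union> J) w = csum Z I w + csum Z J w"
  using assms by (simp add: csum_def sum.union_disjoint)

lemma sum_three_squares_le: "(x + y + z)\<^sup>2 \<le> 3 * x\<^sup>2 + 3 * y\<^sup>2 + 3 * (z::real)\<^sup>2"
proof -
  have "0 \<le> (x - y)\<^sup>2 + (x - z)\<^sup>2 + (y - z)\<^sup>2" by simp
  then show ?thesis by (simp add: power2_eq_square algebra_simps)
qed

context linproc_dens
begin

text \<open>Three approximations in L2, uniform after normalisation: cutting the transform of G off
  at frequency R, truncating the process to m coefficients, and dropping the indices outside the
  separated blocks of period p. The parameters are chosen in this order, each depending on the
  previous ones.\<close>

lemma process_clt:
  assumes G: "integrable lborel G" and B: "\<And>x. \<bar>G x\<bar> \<le> B"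
  defines "T \<equiv> \<lambda>n \<omega>. csum (\<lambda>i \<omega>. G (lp a i \<omega>)) {1..int n} \<omega> / sqrt (real n)"
  shows "\<exists>\<sigma>\<ge>0. (\<lambda>n. LINT \<omega>|M. (T n \<omega>)\<^sup>2) \<longlonglongrightarrow> \<sigma>\<^sup>2 \<and>
    (\<forall>t. (\<lambda>n. CLINT \<omega>|M. iexp (t * T n \<omega>)) \<longlonglongrightarrow> complex_of_real (exp (- (\<sigma> * t)\<^sup>2 / 2)))"
proof (rule clt_approx)
  have [measurable]: "G \<in> borel_measurable borel" using borel_measurable_integrable[OF G] by simp
  show [measurable]: "T n \<in> borel_measurable M" for n unfolding T_def by measurable
  have ZB: "\<bar>G (lp a i \<omega>)\<bar> \<le> B" for i \<omega> by (rule B)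
  show "integrable M (\<lambda>\<omega>. (T n \<omega>)\<^sup>2)" for n
    using csum_sq_integrable[OF _ ZB, where I="{1..int n}"] by (simp add: T_def power_divide)
  fix \<delta> :: real assume \<delta>: "0 < \<delta>"
  \<comment> \<open>Each of the three errors receives \<epsilon>, and
    \<open>sum_three_squares_le\<close> multiplies their sum 3 \<epsilon> by 3.\<close>
  define \<epsilon> where "\<epsilon> = \<delta>\<^sup>2 / 9"
  have \<epsilon>: "0 < \<epsilon>" using \<delta> by (simp add: \<epsilon>_def)
  obtain Cw :: real where Cw: "0 \<le> Cw"
    "\<And>\<Psi> I. integrable lborel \<Psi> \<Longrightarrow>
       integrable lborel (\<lambda>t. (cmod (\<Psi> t))\<^sup>2) \<Longrightarrow> finite I \<Longrightarrow>
       (LINT \<omega>|M. (csum (\<lambda>i \<omega>. G (lp a i \<omega>) - synth \<Psi> (lp a i \<omega>)) I \<omega>)\<^sup>2)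
         \<le> real (card I) * (Cw * (LBINT t. (cmod (coft G t - \<Psi> t))\<^sup>2))"
    by (rule residual_var[OF G B]) (rule that; assumption)
  define Ps where "Ps R t = coft G t * indicator {-real R..real R} t" for R :: nat and t
  have c2: "integrable lborel (\<lambda>t. (cmod (coft G t))\<^sup>2)" by (rule coft_sq_integrable[OF G B])
  have "(\<lambda>R. \<integral>t. (cmod (coft G t - Ps R t))\<^sup>2 \<partial>lborel) \<longlonglongrightarrow> (\<integral>t. 0 \<partial>(lborel :: real measure))"
  proof (rule integral_dominated_convergence[where w="\<lambda>t. (cmod (coft G t))\<^sup>2"])
    show "AE t in lborel. (\<lambda>R. (cmod (coft G t - Ps R t))\<^sup>2) \<longlonglongrightarrow> 0"
    proof (rule AE_I2)
      fix t
      obtain R0 :: nat where R0: "\<bar>t\<bar> \<le> real R0" using real_arch_simple by blast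
      have "(cmod (coft G t - Ps R t))\<^sup>2 = 0" if "R0 \<le> R" for R
      proof -
        have "\<bar>t\<bar> \<le> real R" using R0 that by linarith
        then show ?thesis by (auto simp: Ps_def indicator_def)
      qed
      then show "(\<lambda>R. (cmod (coft G t - Ps R t))\<^sup>2) \<longlonglongrightarrow> 0"
        by (intro tendsto_eventually eventually_sequentiallyI[of R0]) simp
    qed
    show "AE t in lborel. norm ((cmod (coft G t - Ps R t))\<^sup>2) \<le> (cmod (coft G t))\<^sup>2" for R
      by (intro AE_I2) (simp add: Ps_def indicator_def)
  qed (use c2 in \<open>auto simp: Ps_def[abs_def]\<close>)
  then have "(\<lambda>R. Cw * (LBINT t. (cmod (coft G t - Ps R t))\<^sup>2)) \<longlonglongrightarrow> Cw * 0"
    by (intro tendsto_intros) simp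
  then have "\<forall>\<^sub>F R in sequentially. Cw * (LBINT t. (cmod (coft G t - Ps R t))\<^sup>2) < \<epsilon>"
    using \<epsilon> by (intro order_tendstoD(2)) auto
  then obtain R where R: "Cw * (LBINT t. (cmod (coft G t - Ps R t))\<^sup>2) < \<epsilon>"
    using eventually_happens'[OF sequentially_bot] by blast
  define \<Psi> where "\<Psi> = Ps R"
  have [measurable]: "\<Psi> \<in> borel_measurable borel" unfolding \<Psi>_def Ps_def by measurable
  have \<Psi>R: "\<Psi> t = 0" if "real R < \<bar>t\<bar>" for t using that by (auto simp: \<Psi>_def Ps_def indicator_def)
  have \<Psi>: "integrable lborel \<Psi>"
  proof -
    have i: "integrable lborel (\<lambda>t. complex_of_real (indicator {-real R..real R} t))" by simp
    have "integrable lborel (\<lambda>t. complex_of_real (indicator {-real R..real R} t) * coft G t)"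
    proof (rule integrable_mult_bounded[OF i])
      show "cmod (coft G t) \<le> (LBINT x. \<bar>G x\<bar>) / (2 * pi)" for t
        using cmod_fourier_le[OF G, of t] by (simp add: coft_def norm_mult norm_divide divide_right_mono)
    qed measurable
    moreover have "(\<lambda>t. complex_of_real (indicator {-real R..real R} t) * coft G t) = \<Psi>"
      by (auto simp: \<Psi>_def Ps_def fun_eq_iff indicator_def)
    ultimately show ?thesis by simp
  qed
  have \<Psi>2: "integrable lborel (\<lambda>t. (cmod (\<Psi> t))\<^sup>2)"
    by (rule Bochner_Integration.integrable_bound[OF c2]) (auto simp: \<Psi>_def Ps_def indicator_def)
  obtain m where m: "0 < m" "\<And>I. finite I \<Longrightarrow>
    (LINT \<omega>|M. (csum (\<lambda>i \<omega>. synth \<Psi> (lp a i \<omega>) - synth \<Psi> (lp (tr m) i \<omega>)) I \<omega>)\<^sup>2) \<le> real (card I) * \<epsilon>"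
  proof (rule truncation_var[where R="real R", OF \<Psi> _ \<epsilon>])
    fix t assume "real R < \<bar>t\<bar>" then show "\<Psi> t = 0" by (rule \<Psi>R)
  qed (rule that; assumption)
  define Kc where "Kc = (LBINT t. cmod (\<Psi> t))\<^sup>2 * (2 * (C * \<bar>real R\<bar> powr (2 * \<gamma>) * suminf r))"
  have Kc0: "0 \<le> Kc" using C_nonneg suminf_nonneg[OF r_summable r_nonneg] by (simp add: Kc_def)
  have Kv: "(LINT \<omega>|M. (csum (\<lambda>i \<omega>. synth \<Psi> (lp (tr m) i \<omega>)) I \<omega>)\<^sup>2) \<le> real (card I) * Kc" if fin: "finite I" for I
    unfolding Kc_def by (rule synth_compact_var[OF \<Psi> _ dom_tr fin]) (rule \<Psi>R)
  \<comment> \<open>A fraction m / p of the indices lies in the gaps; p is made so large that their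
    contribution is at most \<epsilon> / 2. The incomplete last block has fewer than p indices and
    is negligible for large n.\<close>
  obtain p0 :: nat where p0: "real m * Kc / (\<epsilon> / 2) \<le> real p0" using real_arch_simple by blast
  define p where "p = max p0 (Suc m)"
  have p: "m < p" "0 < p" by (auto simp: p_def)
  have pK: "real m / real p * Kc \<le> \<epsilon> / 2"
  proof -
    have "real m * Kc \<le> real p0 * (\<epsilon> / 2)" using p0 \<epsilon> by (simp add: pos_divide_le_eq)
    also have "\<dots> \<le> real p * (\<epsilon> / 2)" using \<epsilon> by (intro mult_right_mono) (auto simp: p_def)
    finally show ?thesis using p by (simp add: field_simps)
  qed
  define big where "big b = {int (b * p) + int m ..< int (b * p) + int p}" for b :: nat
  define Z where "Z i \<omega> = synth \<Psi> (lp (tr m) i \<omega>)" for i \<omega>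
  define Zb where "Zb = (LBINT t. cmod (\<Psi> t))"
  have [measurable]: "Z i \<in> borel_measurable M" for i unfolding Z_def by measurable
  have Zb: "\<bar>Z i \<omega>\<bar> \<le> Zb" for i \<omega> unfolding Z_def Zb_def by (rule abs_synth_le)
  define U where "U b = csum Z (big b)" for b
  have Uiid: "indep_vars (\<lambda>_. borel) U UNIV" "distr M borel (U b) = distr M borel (U 0)" for b
    using block_iid[of "synth \<Psi>" m p] m(1) p(1) unfolding U_def[abs_def] big_def Z_def[abs_def] by auto
  have UB: "\<bar>U b \<omega>\<bar> \<le> real p * (2 * Zb)" for b \<omega>
  proof -
    have "\<bar>U b \<omega>\<bar> \<le> real (card (big b)) * (2 * Zb)" unfolding U_def by (rule csum_bounded[OF _ Zb]) measurable
    also have "\<dots> \<le> real p * (2 * Zb)" by (intro mult_right_mono) (auto simp: big_def Zb_def)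
    finally show ?thesis .
  qed
  have UE: "(LINT \<omega>|M. U b \<omega>) = 0" for b
  proof -
    have "integrable M (Z i)" for i by (rule integrable_bounded_M[where B=Zb]) (use Zb in auto)
    then show ?thesis unfolding U_def csum_def by (simp add: Bochner_Integration.integral_sum prob_space)
  qed
  define V where "V n \<omega> = (\<Sum>b<n div p. U b \<omega>) / sqrt (real n)" for n \<omega>
  obtain s where s: "0 \<le> s"
     "\<And>t. (\<lambda>n. CLINT \<omega>|M. iexp (t * V n \<omega>)) \<longlonglongrightarrow> complex_of_real (exp (- (s * t)\<^sup>2 / 2))"
     "(\<lambda>n. LINT \<omega>|M. (V n \<omega>)\<^sup>2) \<longlonglongrightarrow> s\<^sup>2"
    using iid_block_clt[OF Uiid UB UE p(2)] unfolding V_def by blast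
  have [measurable]: "U b \<in> borel_measurable M" for b unfolding U_def by measurable
  have [measurable]: "V n \<in> borel_measurable M" for n unfolding V_def by measurable
  have V2: "integrable M (\<lambda>\<omega>. (V n \<omega>)\<^sup>2)" for n
  proof (rule bounded_square_integrable)
    show "\<bar>V n \<omega>\<bar> \<le> (real (n div p) * (real p * (2 * Zb))) / sqrt (real n)" for \<omega>
      unfolding V_def abs_divide using UB sum_bounded_above[of "{..<n div p}" "\<lambda>b. \<bar>U b \<omega>\<bar>" "real p * (2 * Zb)"]
      by (auto intro!: divide_right_mono order_trans[OF sum_abs])
  qed measurable
  have "\<forall>\<^sub>F n in sequentially. real p * Kc / real n < \<epsilon> / 2"
    using \<epsilon> by (intro order_tendstoD(2)[OF lim_const_over_n]) simp
  then have ev: "\<forall>\<^sub>F n in sequentially. (LINT \<omega>|M. (T n \<omega> - V n \<omega>)\<^sup>2) \<le> \<delta>\<^sup>2"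
    using eventually_gt_at_top[of 0]
  proof eventually_elim
    case (elim n)
    define I where "I = {1..int n}"
    define Bg where "Bg = (\<Union>b<n div p. big b)"
    have fin: "finite I" "finite Bg" by (auto simp: I_def Bg_def big_def)
    have cI: "card I = n" by (simp add: I_def)
    have disj: "big b \<inter> big c = {}" if "b \<noteq> c" for b c
    proof -
      have "b * p + p \<le> c * p \<or> c * p + p \<le> b * p"
        using that by (metis add.commute mult_Suc mult_le_mono1 not_less_eq_eq le_antisym nle_le)
      then have "int (b * p) + int p \<le> int (c * p) \<or> int (c * p) + int p \<le> int (b * p)" by linarith
      then show ?thesis by (auto simp: big_def)
    qed
    have BgI: "Bg \<subseteq> I"
    proof
      fix x assume "x \<in> Bg"
      then obtain b where b: "b < n div p" "x \<in> big b" by (auto simp: Bg_def)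
      have "Suc b * p \<le> n div p * p" using b by (intro mult_le_mono1) auto
      also have "\<dots> \<le> n" by simp
      finally have "b * p + p \<le> n" by simp
      then have "int (b * p + p) \<le> int n" by (simp only: of_nat_le_iff)
      then have "int (b * p) + int p \<le> int n" by (simp only: of_nat_add)
      moreover have "int (b * p) + int m \<le> x" "x < int (b * p) + int p"
        using b(2) by (simp_all only: big_def atLeastLessThan_iff)
      moreover have "0 \<le> int (b * p)" by simp
      ultimately have "1 \<le> x \<and> x \<le> int n" using m(1) by linarith
      then show "x \<in> I" by (simp add: I_def)
    qed
    have cBg: "card Bg = (n div p) * (p - m)"
    proof -
      have "card Bg = (\<Sum>b<n div p. card (big b))"
        unfolding Bg_def by (rule card_UN_disjoint) (use disj in \<open>auto simp: big_def\<close>)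
      also have "\<dots> = (\<Sum>b<n div p. p - m)" by (simp add: big_def nat_diff_distrib')
      finally show ?thesis by simp
    qed
    define Rs where "Rs = I - Bg"
    \<comment> \<open>The leftover consists of \<open>n mod p\<close> indices and of m indices for
      each of the \<open>n div p\<close> blocks.\<close>
    have cRs: "real (card Rs) \<le> real p + real n * (real m / real p)"
    proof -
      have "real (card Rs) = real n - real (n div p) * (real p - real m)"
        unfolding Rs_def using card_Diff_subset[OF fin(2) BgI] card_mono[OF fin(1) BgI] p by (simp add: cI cBg of_nat_diff)
      also have "\<dots> = (real n - real (n div p) * real p) + real (n div p) * real m" by (simp add: algebra_simps)
      also have "real n - real (n div p) * real p = real (n mod p)"
      proof -
        have "real n = real (n div p * p + n mod p)" by simp
        then show ?thesis by (simp only: of_nat_add of_nat_mult)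
      qed
      also have "\<dots> \<le> real p" using p by (simp add: less_imp_le)
      also have "real (n div p) * real m \<le> (real n / real p) * real m"
        by (rule mult_right_mono[OF of_nat_div_le_of_nat]) simp
      finally show ?thesis by simp
    qed
    have VU: "(\<Sum>b<n div p. U b \<omega>) = csum Z Bg \<omega>" for \<omega>
      unfolding U_def csum_def Bg_def by (rule sum.UNION_disjoint[symmetric]) (use disj in \<open>auto simp: big_def\<close>)
    define x1 x2 x3 where "x1 = csum (\<lambda>i \<omega>. G (lp a i \<omega>) - synth \<Psi> (lp a i \<omega>)) I"
      and "x2 = csum (\<lambda>i \<omega>. synth \<Psi> (lp a i \<omega>) - Z i \<omega>) I" and "x3 = csum Z Rs"
    have [measurable]: "x1 \<in> borel_measurable M" "x2 \<in> borel_measurable M" "x3 \<in> borel_measurable M"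
      unfolding x1_def x2_def x3_def by auto
    have TV: "T n \<omega> - V n \<omega> = (x1 \<omega> + x2 \<omega> + x3 \<omega>) / sqrt (real n)" for \<omega>
    proof -
      have "x1 \<omega> = csum (\<lambda>i \<omega>. G (lp a i \<omega>)) I \<omega> - csum (\<lambda>i \<omega>. synth \<Psi> (lp a i \<omega>)) I \<omega>"
        unfolding x1_def by (rule csum_diff[where B=B and B'=Zb]) (use B in \<open>auto simp: Zb_def abs_synth_le\<close>)
      moreover have "x2 \<omega> = csum (\<lambda>i \<omega>. synth \<Psi> (lp a i \<omega>)) I \<omega> - csum Z I \<omega>"
        unfolding x2_def by (rule csum_diff[where B=Zb and B'=Zb]) (use Zb in \<open>auto simp: Zb_def abs_synth_le\<close>)
      moreover have "csum Z I \<omega> = csum Z Bg \<omega> + x3 \<omega>"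
        unfolding x3_def Rs_def using csum_union[of Bg "I - Bg" Z \<omega>] fin BgI by (simp add: Un_absorb1)
      ultimately show ?thesis
        unfolding T_def V_def VU I_def[symmetric] by (simp add: diff_divide_distrib[symmetric])
    qed
    have sqi: "integrable M (\<lambda>\<omega>. (x1 \<omega>)\<^sup>2)" "integrable M (\<lambda>\<omega>. (x2 \<omega>)\<^sup>2)" "integrable M (\<lambda>\<omega>. (x3 \<omega>)\<^sup>2)"
    proof -
      have "\<bar>G (lp a i \<omega>) - synth \<Psi> (lp a i \<omega>)\<bar> \<le> B + Zb" for i \<omega>
        using B[of "lp a i \<omega>"] abs_synth_le[of \<Psi> "lp a i \<omega>"] unfolding Zb_def abs_le_iff by linarith
      then show "integrable M (\<lambda>\<omega>. (x1 \<omega>)\<^sup>2)" unfolding x1_def by (intro csum_sq_integrable[where B="B + Zb"]) auto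
      have "\<bar>synth \<Psi> (lp a i \<omega>) - Z i \<omega>\<bar> \<le> Zb + Zb" for i \<omega>
        using Zb[of i \<omega>] abs_synth_le[of \<Psi> "lp a i \<omega>"] unfolding Zb_def abs_le_iff by linarith
      then show "integrable M (\<lambda>\<omega>. (x2 \<omega>)\<^sup>2)" unfolding x2_def by (intro csum_sq_integrable[where B="Zb + Zb"]) auto
      show "integrable M (\<lambda>\<omega>. (x3 \<omega>)\<^sup>2)" unfolding x3_def by (intro csum_sq_integrable[OF _ Zb]) measurable
    qed
    have e1: "(LINT \<omega>|M. (x1 \<omega>)\<^sup>2) \<le> real n * \<epsilon>"
    proof -
      have "(LINT \<omega>|M. (x1 \<omega>)\<^sup>2) \<le> real n * (Cw * (LBINT t. (cmod (coft G t - \<Psi> t))\<^sup>2))"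
        using Cw(2)[OF \<Psi> \<Psi>2 fin(1)] unfolding x1_def cI .
      also have "\<dots> \<le> real n * \<epsilon>" using R unfolding \<Psi>_def by (intro mult_left_mono) auto
      finally show ?thesis .
    qed
    have e2: "(LINT \<omega>|M. (x2 \<omega>)\<^sup>2) \<le> real n * \<epsilon>"
      using m(2)[OF fin(1)] unfolding x2_def Z_def cI .
    have e3: "(LINT \<omega>|M. (x3 \<omega>)\<^sup>2) \<le> real n * \<epsilon>"
    proof -
      have "(LINT \<omega>|M. (x3 \<omega>)\<^sup>2) \<le> real (card Rs) * Kc"
        unfolding x3_def Z_def[abs_def] by (rule Kv) (use fin in \<open>auto simp: Rs_def\<close>)
      also have "\<dots> \<le> (real p + real n * (real m / real p)) * Kc" by (intro mult_right_mono cRs Kc0)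
      also have "\<dots> = real n * (real p * Kc / real n + real m / real p * Kc)"
        using elim(2) by (simp add: distrib_left distrib_right)
      also have "\<dots> \<le> real n * (\<epsilon> / 2 + \<epsilon> / 2)" using elim(1) pK by (intro mult_left_mono add_mono) auto
      finally show ?thesis by simp
    qed
    have "(LINT \<omega>|M. (T n \<omega> - V n \<omega>)\<^sup>2) = (LINT \<omega>|M. (x1 \<omega> + x2 \<omega> + x3 \<omega>)\<^sup>2) / real n"
      unfolding TV by (simp add: power_divide)
    also have "\<dots> \<le> (LINT \<omega>|M. 3 * (x1 \<omega>)\<^sup>2 + 3 * (x2 \<omega>)\<^sup>2 + 3 * (x3 \<omega>)\<^sup>2) / real n"
      by (intro divide_right_mono integral_mono') (use sqi sum_three_squares_le in auto)
    also have "\<dots> = (3 * (LINT \<omega>|M. (x1 \<omega>)\<^sup>2) + 3 * (LINT \<omega>|M. (x2 \<omega>)\<^sup>2) + 3 * (LINT \<omega>|M. (x3 \<omega>)\<^sup>2)) / real n"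
      using sqi by simp
    also have "\<dots> \<le> (3 * (real n * \<epsilon>) + 3 * (real n * \<epsilon>) + 3 * (real n * \<epsilon>)) / real n"
      by (intro divide_right_mono add_mono mult_left_mono e1 e2 e3) simp_all
    also have "\<dots> = \<delta>\<^sup>2" using elim(2) by (simp add: \<epsilon>_def)
    finally show ?case .
  qed
  show "\<exists>V s. (\<forall>n. V n \<in> borel_measurable M \<and> integrable M (\<lambda>\<omega>. (V n \<omega>)\<^sup>2)) \<and> 0 \<le> s \<and>
      (\<forall>t. (\<lambda>n. CLINT \<omega>|M. iexp (t * V n \<omega>)) \<longlonglongrightarrow> complex_of_real (exp (- (s * t)\<^sup>2 / 2))) \<and>
      (\<lambda>n. LINT \<omega>|M. (V n \<omega>)\<^sup>2) \<longlonglongrightarrow> s\<^sup>2 \<and>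
      (\<forall>\<^sub>F n in sequentially. (LINT \<omega>|M. (T n \<omega> - V n \<omega>)\<^sup>2) \<le> \<delta>\<^sup>2)"
    using s V2 ev by (intro exI[of _ V] exI[of _ s]) auto
qed

end

subsection \<open>Kernels as inverse Fourier transforms\<close>

text \<open>Interpolates between the quadratic bound near 0 and the trivial bound 2. As \<gamma> is
  at most 1, both exponents in use, \<gamma> and 2 \<gamma>, are admissible.\<close>

lemma abs_cos_minus_one_le:
  fixes y \<theta> :: real
  assumes "0 \<le> \<theta>" "\<theta> \<le> 2"
  shows "\<bar>cos y - 1\<bar> \<le> 2 * \<bar>y\<bar> powr \<theta>"
proof (cases "\<bar>y\<bar> \<le> 1")
  case True
  have "1 - cos y = 2 * (sin (y / 2))\<^sup>2"
    using cos_double_sin[of "y / 2"] by simp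
  also have "\<dots> \<le> 2 * (y / 2)\<^sup>2"
    using abs_sin_x_le_abs_x[of "y / 2"] by (intro mult_left_mono abs_le_square_iff[THEN iffD1]) auto
  also have "\<dots> \<le> 2 * \<bar>y\<bar> powr 2"
    by (simp add: power_divide)
  also have "\<dots> \<le> 2 * \<bar>y\<bar> powr \<theta>"
    using True assms by (intro mult_left_mono powr_mono') auto
  finally show ?thesis using cos_le_one[of y] by simp
next
  case False
  have "\<bar>cos y - 1\<bar> \<le> 2" using cos_le_one[of y] cos_ge_minus_one[of y] by linarith
  moreover have "1 \<le> \<bar>y\<bar> powr \<theta>" using False assms by (intro ge_one_powr_ge_zero) auto
  ultimately show ?thesis by linarith
qed

locale density_kernel =
  fixes K :: "real \<Rightarrow> real"
  assumes kernel: "smoothing_kernel K" and fourier_int: "integrable lborel (\<lambda>t. cmod (fourier K t))"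
begin

definition \<kappa> :: "real \<Rightarrow> real" where "\<kappa> t = Re (fourier K t)"

lemma K_int: "integrable lborel K" "(LBINT u. K u) = 1"
  and K_even: "K (- u) = K u"
  and K_moment: "integrable lborel (\<lambda>u. u\<^sup>2 * \<bar>K u\<bar>)"
  using kernel by (auto simp: smoothing_kernel_def)

lemma K_bounded: obtains B where "\<And>x. \<bar>K x\<bar> \<le> B"
proof -
  obtain B where "\<forall>x. \<bar>K x\<bar> \<le> B"
    using kernel by (auto simp: smoothing_kernel_def bounded_iff)
  then show ?thesis using that by blast
qed

lemma K_meas [measurable]: "K \<in> borel_measurable borel"
  using borel_measurable_integrable[OF K_int(1)] by simp

lemma \<kappa>_meas [measurable]: "\<kappa> \<in> borel_measurable borel"
  unfolding \<kappa>_def by measurable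

lemma \<kappa>_int: "integrable lborel \<kappa>"
  by (rule Bochner_Integration.integrable_bound[OF fourier_int]) (auto simp: \<kappa>_def abs_Re_le_cmod)

definition Kb :: real where "Kb = (LBINT u. \<bar>K u\<bar>)"

lemma \<kappa>_bounded: "\<bar>\<kappa> t\<bar> \<le> Kb"
  unfolding \<kappa>_def Kb_def by (rule order_trans[OF abs_Re_le_cmod cmod_fourier_le[OF K_int(1)]])

lemma K_inversion: "cos_inversion K \<kappa>"
proof -
  obtain B where B: "\<And>x. \<bar>K x\<bar> \<le> B" using K_bounded by blast
  show ?thesis
    using kernel_cos_inversion[OF K_int(1) K_even B] \<kappa>_int unfolding \<kappa>_def[abs_def] by simp
qed

definition Km :: real where "Km = 2 * (LBINT x. (1 + x\<^sup>2) * \<bar>K x\<bar>)"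

lemma Km_nonneg: "0 \<le> Km"
  unfolding Km_def by (intro mult_nonneg_nonneg Bochner_Integration.integral_nonneg) auto

text \<open>K has integral 1 and the real part of its transform only involves the cosine, so no term
  of first order occurs and the second moment of K allows every exponent up to 2. The integrand
  \<open>(1 + x\<^sup>2) * \<bar>K x\<bar>\<close> in \<open>Km\<close> comes from estimating
  \<open>\<bar>x\<bar> powr \<theta>\<close> uniformly in \<theta>.\<close>

lemma \<kappa>_minus_one_le:
  assumes \<theta>: "0 \<le> \<theta>" "\<theta> \<le> 2"
  shows "\<bar>\<kappa> u - 1\<bar> \<le> Km * \<bar>u\<bar> powr \<theta>"
proof -
  have i1: "integrable lborel (\<lambda>x. K x * cos (u * x))"
    by (rule integrable_mult_bounded[OF K_int(1), where B=1]) auto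
  have m: "integrable lborel (\<lambda>x. (1 + x\<^sup>2) * \<bar>K x\<bar>)"
    using K_int(1) K_moment by (simp add: distrib_right)
  have "\<kappa> u - 1 = (LBINT x. K x * cos (u * x) - K x)"
    using i1 K_int by (simp add: \<kappa>_def fourier_Re_Im[OF K_int(1)])
  then have "\<bar>\<kappa> u - 1\<bar> \<le> (LBINT x. \<bar>K x * cos (u * x) - K x\<bar>)"
    by (simp only: integral_abs_bound)
  also have "\<dots> \<le> (LBINT x. 2 * \<bar>u\<bar> powr \<theta> * ((1 + x\<^sup>2) * \<bar>K x\<bar>))"
  proof (rule integral_mono)
    show "integrable lborel (\<lambda>x. \<bar>K x * cos (u * x) - K x\<bar>)" using i1 K_int(1) by simp
    show "integrable lborel (\<lambda>x. 2 * \<bar>u\<bar> powr \<theta> * ((1 + x\<^sup>2) * \<bar>K x\<bar>))" using m by simp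
    fix x
    have "\<bar>x\<bar> powr \<theta> \<le> 1 + x\<^sup>2"
    proof (cases "\<bar>x\<bar> \<le> 1")
      case True
      then have "\<bar>x\<bar> powr \<theta> \<le> 1" using \<theta> powr_mono2[of \<theta> "\<bar>x\<bar>" 1] by simp
      then show ?thesis by (simp add: add_increasing2)
    next
      case False
      then have "\<bar>x\<bar> powr \<theta> \<le> \<bar>x\<bar> powr 2" using \<theta> by (intro powr_mono) auto
      then show ?thesis by simp
    qed
    then have "2 * \<bar>u * x\<bar> powr \<theta> \<le> 2 * \<bar>u\<bar> powr \<theta> * (1 + x\<^sup>2)"
      by (simp add: abs_mult powr_mult mult_left_mono)
    then have "\<bar>cos (u * x) - 1\<bar> \<le> 2 * \<bar>u\<bar> powr \<theta> * (1 + x\<^sup>2)"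
      using abs_cos_minus_one_le[OF \<theta>, of "u * x"] by linarith
    then have "\<bar>K x\<bar> * \<bar>cos (u * x) - 1\<bar> \<le> \<bar>K x\<bar> * (2 * \<bar>u\<bar> powr \<theta> * (1 + x\<^sup>2))"
      by (intro mult_left_mono) auto
    moreover have "K x * cos (u * x) - K x = K x * (cos (u * x) - 1)" by (simp add: algebra_simps)
    ultimately show "\<bar>K x * cos (u * x) - K x\<bar> \<le> 2 * \<bar>u\<bar> powr \<theta> * ((1 + x\<^sup>2) * \<bar>K x\<bar>)"
      by (simp add: abs_mult mult_ac)
  qed
  also have "\<dots> = Km * \<bar>u\<bar> powr \<theta>" by (simp add: Km_def)
  finally show ?thesis .
qed

text \<open>Normalised so that \<open>K (z / h) / h\<close> is the plain cosine integral of
  \<open>q h\<close> wherever inversion holds. Its L1 norm is of order 1 / h while its supremum is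
  bounded independently of h; both facts determine the rates.\<close>

definition q :: "real \<Rightarrow> real \<Rightarrow> real" where "q h t = \<kappa> (h * t) / (2 * pi)"

lemma q_meas [measurable]: "q h \<in> borel_measurable borel"
  unfolding q_def by measurable

lemma q_int: "0 < h \<Longrightarrow> integrable lborel (q h)"
  using lborel_integrable_real_affine[OF \<kappa>_int, of h 0] by (simp add: q_def[abs_def])

lemma q_norm: "0 < h \<Longrightarrow> (LBINT t. \<bar>q h t\<bar>) = (LBINT t. \<bar>\<kappa> t\<bar>) / (2 * pi) / h"
  using lborel_integral_real_affine[of h "\<lambda>t. \<bar>\<kappa> t\<bar>" 0] by (simp add: q_def)

lemma q_bounded: "\<bar>q h t\<bar> \<le> Kb"
proof -
  have "\<bar>q h t\<bar> = \<bar>\<kappa> (h * t)\<bar> / (2 * pi)" by (simp add: q_def)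
  also have "\<dots> \<le> \<bar>\<kappa> (h * t)\<bar> / 1" using pi_ge_two by (intro divide_left_mono) auto
  finally show ?thesis using \<kappa>_bounded[of "h * t"] by simp
qed

text \<open>A version of \<open>K (z / h) / h\<close> for which the integral formula holds at every
  z.\<close>

definition qsyn :: "real \<Rightarrow> real \<Rightarrow> real" where
  "qsyn h z = (LBINT t. q h t * cos (t * z))"

lemma qsyn_meas [measurable]: "qsyn h \<in> borel_measurable borel"
  unfolding qsyn_def by measurable

lemma q_cos_int:
  assumes "0 < h" shows "integrable lborel (\<lambda>t. q h t * cos (t * z))"
  by (rule integrable_mult_bounded[OF q_int[OF assms], where B=1]) auto

lemma qsyn_bounded: "0 < h \<Longrightarrow> \<bar>qsyn h z\<bar> \<le> (LBINT t. \<bar>q h t\<bar>)"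
proof -
  assume h: "0 < h"
  have "\<bar>qsyn h z\<bar> \<le> (LBINT t. \<bar>q h t * cos (t * z)\<bar>)" unfolding qsyn_def by (rule integral_abs_bound)
  also have "\<dots> \<le> (LBINT t. \<bar>q h t\<bar>)"
    by (rule integral_mono') (use q_int[OF h] in \<open>auto simp: abs_mult mult_left_le\<close>)
  finally show ?thesis .
qed

lemma qsyn_kernel:
  assumes h: "0 < h" and z: "K (z / h) = 1 / (2 * pi) * (LBINT t. \<kappa> t * cos (t * (z / h)))"
  shows "K (z / h) / h = qsyn h z"
proof -
  have "(LBINT t. \<kappa> t * cos (t * (z / h))) = h * (LBINT t. \<kappa> (h * t) * cos (h * t * (z / h)))"
    using lborel_integral_real_affine[of h "\<lambda>t. \<kappa> t * cos (t * (z / h))" 0] h by simp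
  also have "(LBINT t. \<kappa> (h * t) * cos (h * t * (z / h))) = (LBINT t. 2 * pi * (q h t * cos (t * z)))"
    using h by (intro Bochner_Integration.integral_cong) (auto simp: q_def)
  also have "\<dots> = 2 * pi * qsyn h z" unfolding qsyn_def by (rule integral_mult_right_zero)
  finally show ?thesis unfolding z using h by simp
qed

definition K_bad :: "real set" where
  "K_bad = {u. K u \<noteq> 1 / (2 * pi) * (LBINT t. \<kappa> t * cos (t * u))}"

lemma K_bad_null: "K_bad \<in> null_sets lborel"
proof -
  have "AE u in lborel. \<not> u \<in> K_bad"
    using K_inversion by (simp add: cos_inversion_def K_bad_def)
  moreover have "K_bad \<in> sets lborel" unfolding K_bad_def by measurable
  ultimately show ?thesis by (simp add: AE_iff_null_sets)
qed

lemma qsyn_kernel_AE: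
  assumes h: "0 < h" and N: "prob_space N" and [measurable]: "Z \<in> borel_measurable N"
    and null: "\<And>S. S \<in> null_sets lborel \<Longrightarrow> S \<in> null_sets (distr N borel (\<lambda>w. Z w / h))"
  shows "AE w in N. K (Z w / h) / h = qsyn h (Z w)"
proof -
  have "AE u in distr N borel (\<lambda>w. Z w / h). u \<notin> K_bad"
    by (rule AE_not_in[OF null[OF K_bad_null]])
  then have "AE w in N. Z w / h \<notin> K_bad"
    by (subst (asm) AE_distr_iff) (use K_bad_null in \<open>auto simp: null_sets_def\<close>)
  then show ?thesis
    by eventually_elim (rule qsyn_kernel[OF h], simp add: K_bad_def)
qed

lemma sum_qsyn_pairs:
  assumes h: "0 < h"
  shows "(\<Sum>i\<in>I. \<Sum>j\<in>J. qsyn h (x i - y j))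
    = (LBINT t. q h t * Re ((\<Sum>i\<in>I. iexp (t * x i)) * cnj (\<Sum>j\<in>J. iexp (t * y j))))"
proof -
  have "Re ((\<Sum>i\<in>I. iexp (t * x i)) * cnj (\<Sum>j\<in>J. iexp (t * y j))) = (\<Sum>i\<in>I. \<Sum>j\<in>J. cos (t * (x i - y j)))" for t
  proof -
    have "(\<Sum>i\<in>I. iexp (t * x i)) * cnj (\<Sum>j\<in>J. iexp (t * y j)) = (\<Sum>i\<in>I. \<Sum>j\<in>J. iexp (t * x i) * cnj (iexp (t * y j)))"
      by (simp only: cnj_sum sum_product)
    moreover have "Re (iexp (t * x i) * cnj (iexp (t * y j))) = cos (t * (x i - y j))" for i j
      by (simp add: Re_exp Im_exp right_diff_distrib cos_diff)
    ultimately show ?thesis by (simp only: Re_sum)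
  qed
  then have "(LBINT t. q h t * Re ((\<Sum>i\<in>I. iexp (t * x i)) * cnj (\<Sum>j\<in>J. iexp (t * y j))))
     = (LBINT t. (\<Sum>i\<in>I. \<Sum>j\<in>J. q h t * cos (t * (x i - y j))))"
    by (simp only: sum_distrib_left)
  also have "\<dots> = (\<Sum>i\<in>I. \<Sum>j\<in>J. qsyn h (x i - y j))"
    unfolding qsyn_def using q_cos_int[OF h]
    by (simp only: Bochner_Integration.integral_sum Bochner_Integration.integrable_sum)
  finally show ?thesis by simp
qed

lemma qsyn_even: "qsyn h (- z) = qsyn h z"
  by (simp add: qsyn_def)

text \<open>By evenness the sum over i < j is half of the full double sum without its diagonal. Each
  diagonal term is the integral of \<open>q h\<close>, which accounts for the subtraction of
  n.\<close>

lemma sum_qsyn_ordered: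
  assumes h: "0 < h"
  shows "2 * (\<Sum>j\<in>{1..int n}. \<Sum>i\<in>{1..<j}. qsyn h (x i - x j))
    = (LBINT t. q h t * ((cmod (\<Sum>i\<in>{1..int n}. iexp (t * x i)))\<^sup>2 - real n))"
proof -
  define I where "I = {1..int n}"
  define F where "F i j = qsyn h (x i - x j)" for i j
  have Fsym: "F i j = F j i" for i j
    using qsyn_even[of h "x i - x j"] by (simp add: F_def)
  have "(\<Sum>j\<in>I. \<Sum>i\<in>I. F i j) = (\<Sum>j\<in>I. (\<Sum>i\<in>{1..<j}. F i j) + F j j + (\<Sum>i\<in>{j<..int n}. F i j))"
  proof (rule sum.cong[OF refl])
    fix j assume j: "j \<in> I"
    have "I = {1..<j} \<union> {j} \<union> {j<..int n}" using j by (auto simp: I_def)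
    then show "(\<Sum>i\<in>I. F i j) = (\<Sum>i\<in>{1..<j}. F i j) + F j j + (\<Sum>i\<in>{j<..int n}. F i j)"
      by (simp only:) (subst sum.union_disjoint, auto)+
  qed
  also have "\<dots> = (\<Sum>j\<in>I. \<Sum>i\<in>{1..<j}. F i j) + (\<Sum>j\<in>I. F j j) + (\<Sum>j\<in>I. \<Sum>i\<in>{j<..int n}. F i j)"
    by (simp add: sum.distrib)
  also have "(\<Sum>j\<in>I. \<Sum>i\<in>{j<..int n}. F i j) = (\<Sum>j\<in>I. \<Sum>i\<in>{1..<j}. F i j)"
  proof -
    have "(\<Sum>j\<in>I. \<Sum>i\<in>{j<..int n}. F i j) = (\<Sum>j\<in>I. \<Sum>i\<in>{i\<in>I. j < i}. F i j)"
      by (intro sum.cong refl) (auto simp: I_def)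
    also have "\<dots> = (\<Sum>i\<in>I. \<Sum>j\<in>{j\<in>I. j < i}. F i j)"
      by (rule sum.swap_restrict) (auto simp: I_def)
    also have "\<dots> = (\<Sum>i\<in>I. \<Sum>j\<in>{1..<i}. F j i)"
      by (intro sum.cong) (auto simp: I_def Fsym)
    finally show ?thesis .
  qed
  finally have "2 * (\<Sum>j\<in>I. \<Sum>i\<in>{1..<j}. F i j) = (\<Sum>j\<in>I. \<Sum>i\<in>I. F i j) - (\<Sum>j\<in>I. F j j)"
    by simp
  also have "(\<Sum>j\<in>I. F j j) = real n * (LBINT t. q h t)" by (simp add: F_def qsyn_def I_def)
  also have "(\<Sum>j\<in>I. \<Sum>i\<in>I. F i j) = (\<Sum>i\<in>I. \<Sum>j\<in>I. F i j)" by (rule sum.swap)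
  also have "\<dots> = (LBINT t. q h t * Re ((\<Sum>i\<in>I. iexp (t * x i)) * cnj (\<Sum>j\<in>I. iexp (t * x j))))"
    unfolding F_def by (rule sum_qsyn_pairs[OF h])
  also have "\<dots> = (LBINT t. q h t * (cmod (\<Sum>i\<in>I. iexp (t * x i)))\<^sup>2)"
    by (simp only: complex_norm_square[symmetric] Re_complex_of_real)
  also have "\<dots> - real n * (LBINT t. q h t) = (LBINT t. q h t * (cmod (\<Sum>i\<in>I. iexp (t * x i)))\<^sup>2 - real n * q h t)"
  proof -
    have "integrable lborel (\<lambda>t. q h t * (cmod (\<Sum>i\<in>I. iexp (t * x i)))\<^sup>2)"
    proof (rule integrable_mult_bounded[OF q_int[OF h], where B="(real n)\<^sup>2"])
      have "cmod (\<Sum>i\<in>I. iexp (t * x i)) \<le> (\<Sum>i\<in>I. cmod (iexp (t * x i)))" for t by (rule norm_sum)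
      then have "cmod (\<Sum>i\<in>I. iexp (t * x i)) \<le> real n" for t by (simp add: I_def)
      then show "norm ((cmod (\<Sum>i\<in>I. iexp (t * x i)))\<^sup>2) \<le> (real n)\<^sup>2" for t
        using power_mono[of "cmod (\<Sum>i\<in>I. iexp (t * x i))" "real n" 2] by simp
    qed measurable
    then show ?thesis using q_int[OF h] by simp
  qed
  finally show ?thesis by (simp add: F_def I_def algebra_simps)
qed

end

lemma integrable_char_scale:
  fixes u :: "real \<Rightarrow> complex"
  assumes "integrable lborel (\<lambda>t. cmod (u t))" "(0::real) < h"
  shows "integrable lborel (\<lambda>t. cmod (u (t / h)))"
  using lborel_integrable_real_affine[OF assms(1), of "1 / h" 0] assms(2) by simp

context density_kernel
begin

lemma qsyn_char_AE:
  assumes h: "0 < h" and N: "prob_space N" and Z[measurable]: "Z \<in> borel_measurable N"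
    and i: "integrable lborel (\<lambda>t. cmod (CLINT w|N. iexp (t * Z w)))"
  shows "AE w in N. K (Z w / h) / h = qsyn h (Z w)"
proof (rule qsyn_kernel_AE[OF h N Z])
  interpret N: prob_space N by (rule N)
  interpret D: real_distribution "distr N borel (\<lambda>w. Z w / h)"
    by (rule N.real_distribution_distr) measurable
  have c: "char (distr N borel (\<lambda>w. Z w / h)) t = (CLINT w|N. iexp (t / h * Z w))" for t
    unfolding char_def by (subst integral_distr) auto
  have "integrable lborel (\<lambda>t. cmod (char (distr N borel (\<lambda>w. Z w / h)) t))"
    unfolding c by (rule integrable_char_scale[OF i h])
  then show "S \<in> null_sets (distr N borel (\<lambda>w. Z w / h))" if "S \<in> null_sets lborel" for S
    using D.integrable_char_null_sets that by blast
qed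

lemma qsyn_eq_synth:
  assumes h: "0 < h"
  shows "qsyn h = synth (\<lambda>t. complex_of_real (q h t))"
proof
  fix z
  have i: "complex_integrable lborel (\<lambda>t. complex_of_real (q h t) * iexp (t * z))"
    by (rule integrable_synth) (use q_int[OF h] in auto)
  show "qsyn h z = synth (\<lambda>t. complex_of_real (q h t)) z"
    unfolding qsyn_def synth_def by (subst integral_Re[OF i, symmetric]) (simp add: Re_exp)
qed

lemma expectation_qsyn:
  assumes h: "0 < h" and N: "prob_space N" and Z[measurable]: "Z \<in> borel_measurable N"
  shows "(LINT w|N. qsyn h (Z w)) = (LBINT t. q h t * Re (CLINT w|N. iexp (t * Z w)))"
proof -
  interpret N: prob_space N by (rule N)
  have le1: "cmod (CLINT w|N. iexp (t * Z w)) \<le> 1" for t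
  proof -
    have "cmod (CLINT w|N. iexp (t * Z w)) \<le> (LINT w|N. cmod (iexp (t * Z w)))" by (rule integral_norm_bound)
    then show ?thesis by (simp add: N.prob_space)
  qed
  have i: "complex_integrable lborel (\<lambda>t. complex_of_real (q h t) * (CLINT w|N. iexp (t * Z w)))"
    by (rule integrable_mult_bounded[where B=1]) (use q_int[OF h] le1 in auto)
  have "(LINT w|N. qsyn h (Z w)) = Re (CLINT t|lborel. complex_of_real (q h t) * (CLINT w|N. iexp (t * Z w)))"
    unfolding qsyn_eq_synth[OF h] by (rule N.expectation_synth) (use q_int[OF h] in auto)
  also have "\<dots> = (LBINT t. q h t * Re (CLINT w|N. iexp (t * Z w)))"
    by (subst integral_Re[OF i, symmetric]) simp
  finally show ?thesis .
qed

lemma q_mult_int: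
  assumes "0 < h" "u \<in> borel_measurable borel" "\<And>t. \<bar>u t\<bar> \<le> B"
  shows "integrable lborel (\<lambda>t. q h t * u t)"
  by (rule integrable_mult_bounded[OF q_int[OF assms(1)], where B=B]) (use assms in auto)

end

lemma sum_ordered_pairs_one: "2 * (\<Sum>j\<in>{1..int n}. \<Sum>i\<in>{1..<j}. (1::real)) = real n * (real n - 1)"
proof (induction n)
  case (Suc n)
  have "{1..int (Suc n)} = insert (int n + 1) {1..int n}" by auto
  then show ?case using Suc by (simp add: algebra_simps)
qed simp

lemma sum_differences_le_suminf:
  fixes \<beta> :: "nat \<Rightarrow> real"
  assumes "summable \<beta>" "\<And>k. 0 \<le> \<beta> k"
  shows "(\<Sum>i\<in>{1..<j}. \<beta> (nat (j - i))) \<le> suminf \<beta>"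
proof -
  have "inj_on (\<lambda>i. nat (j - i)) {1..<j}" by (auto simp: inj_on_def)
  then have "(\<Sum>i\<in>{1..<j}. \<beta> (nat (j - i))) = (\<Sum>k\<in>(\<lambda>i. nat (j - i)) ` {1..<j}. \<beta> k)"
    by (simp add: sum.reindex)
  also have "\<dots> \<le> suminf \<beta>" using assms by (intro sum_le_suminf) auto
  finally show ?thesis .
qed

section \<open>Expectation and fluctuation of the within-sample statistic\<close>

locale kernel_process = linproc_dens M e a \<gamma> C f Fb + density_kernel K
  for M :: "'a measure" and e a \<gamma> C f Fb K
begin

lemma cmod_fourier_f_le1: "cmod (fourier f t) \<le> 1"
  using cmod_char_le1[of "\<lambda>w. t * lp a 0 w"] unfolding char_f by measurable

lemma fourier_f_meas [measurable]: "fourier f \<in> borel_measurable borel"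
  by (rule fourier_measurable) measurable

lemma within_kernel_AE:
  assumes h: "0 < h"
  shows "AE w in M. \<forall>i j. i < j \<longrightarrow> K ((lp a i w - lp a j w) / h) / h = qsyn h (lp a i w - lp a j w)"
proof -
  have "AE w in M. i < j \<longrightarrow> K ((lp a i w - lp a j w) / h) / h = qsyn h (lp a i w - lp a j w)" for i j
  proof (cases "i < j")
    case True
    have "AE w in M. K ((lp a j w - lp a i w) / h) / h = qsyn h (lp a j w - lp a i w)"
      by (rule qsyn_char_AE[OF h]) (use char_diff_integrable[OF True] prob_space_axioms in \<open>auto simp: right_diff_distrib\<close>)
    then show ?thesis
    proof eventually_elim
      case (elim w)
      have "(lp a i w - lp a j w) / h = - ((lp a j w - lp a i w) / h)" by (simp add: diff_divide_distrib)
      then show ?case using elim K_even[of "(lp a j w - lp a i w) / h"] qsyn_even[of h "lp a j w - lp a i w"] by simp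
    qed
  qed simp
  then show ?thesis by (simp add: AE_all_countable)
qed

text \<open>The statistic \<open>T_within\<close> with \<open>K (z / h) / h\<close> replaced by
  \<open>qsyn h z\<close>; the two agree almost surely.\<close>

definition Tq :: "real \<Rightarrow> nat \<Rightarrow> 'a \<Rightarrow> real" where
  "Tq h n w = 1 / (real n * (real n - 1)) * (2 * (\<Sum>j\<in>{1..int n}. \<Sum>i\<in>{1..<j}. qsyn h (lp a i w - lp a j w)))"

lemma Tq_meas [measurable]: "Tq h n \<in> borel_measurable M"
  unfolding Tq_def by measurable

lemma T_within_AE:
  assumes h: "0 < h"
  shows "AE w in M. T_within K (lp a) h n w = Tq h n w"
  using within_kernel_AE[OF h]
proof eventually_elim
  case (elim w)
  have "(\<Sum>j\<in>{1..int n}. \<Sum>i\<in>{1..<j}. qsyn h (lp a i w - lp a j w))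
      = (\<Sum>j\<in>{1..int n}. \<Sum>i\<in>{1..<j}. K ((lp a i w - lp a j w) / h)) / h"
    unfolding sum_divide_distrib by (intro sum.cong refl) (use elim in auto)
  then show ?case by (simp add: T_within_def Tq_def)
qed

lemma qsyn_integrable:
  assumes h: "0 < h" and [measurable]: "Z \<in> borel_measurable M"
  shows "integrable M (\<lambda>w. qsyn h (Z w))"
  by (rule integrable_const_bound[where B="\<integral>t. \<bar>q h t\<bar> \<partial>lborel"]) (use qsyn_bounded[OF h] in auto)

lemma Tq_int: "0 < h \<Longrightarrow> integrable M (Tq h n)"
  unfolding Tq_def by (intro integrable_mult_right Bochner_Integration.integrable_sum qsyn_integrable) measurable

text \<open>The mean of a pair term is the value for independent copies plus the integral of
  \<open>q h t * Re (covx i j t)\<close>. Since \<open>q h\<close> is bounded by \<open>Kb\<close>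
  for all h and the integrated covariances are summable over the lag, averaging over the pairs
  leaves 1 / n without any power of h. The 4 collects a 2 from ordered pairs and a 2 from n - 1
  \<ge> n / 2.\<close>

lemma within_bias:
  "\<exists>c\<ge>0. \<forall>n\<ge>2. \<forall>h>0. \<bar>(LINT w|M. Tq h n w) - (LBINT t. q h t * (cmod (fourier f t))\<^sup>2)\<bar> \<le> c / real n"
proof (rule covx_integral_summable)
  fix \<beta> :: "nat \<Rightarrow> real"
  assume \<beta>: "summable \<beta>" "\<And>k. 0 \<le> \<beta> k"
    and ci: "\<And>i j. i < j \<Longrightarrow> integrable lborel (\<lambda>s. cmod (covx i j s))"
    and cb: "\<And>i j. i < j \<Longrightarrow> (LBINT s. cmod (covx i j s)) \<le> \<beta> (nat (j - i))"
  have Kb0: "0 \<le> Kb" unfolding Kb_def by simp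
  show ?thesis
  proof (intro exI[of _ "4 * Kb * suminf \<beta>"] conjI allI impI)
    show "0 \<le> 4 * Kb * suminf \<beta>" using Kb0 \<beta> by (simp add: suminf_nonneg)
    fix n :: nat and h :: real assume n: "2 \<le> n" and h: "0 < h"
    define c0 where "c0 = (LBINT t. q h t * (cmod (fourier f t))\<^sup>2)"
    have f1: "(cmod (fourier f t))\<^sup>2 \<le> 1" for t
      using cmod_fourier_f_le1 by (simp add: power_le_one)
    have i0: "integrable lborel (\<lambda>t. q h t * (cmod (fourier f t))\<^sup>2)"
      by (rule q_mult_int[OF h, where B=1]) (use f1 in auto)
    have pair: "\<bar>(LINT w|M. qsyn h (lp a i w - lp a j w)) - c0\<bar> \<le> Kb * \<beta> (nat (j - i))" if ij: "i < j" for i j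
    proof -
      have i1: "integrable lborel (\<lambda>t. q h t * Re (covx i j t))"
      proof (rule Bochner_Integration.integrable_bound[of _ "\<lambda>t. Kb * cmod (covx i j t)"])
        show "AE t in lborel. norm (q h t * Re (covx i j t)) \<le> norm (Kb * cmod (covx i j t))"
          using q_bounded abs_Re_le_cmod Kb0 by (intro AE_I2) (auto simp: abs_mult intro!: mult_mono)
      qed (use ci[OF ij] in auto)
      have "(LINT w|M. qsyn h (lp a i w - lp a j w)) = (LINT w|M. qsyn h (lp a j w - lp a i w))"
      proof (intro Bochner_Integration.integral_cong refl)
        fix w show "qsyn h (lp a i w - lp a j w) = qsyn h (lp a j w - lp a i w)"
          using qsyn_even[of h "lp a i w - lp a j w"] by simp
      qed
      also have "\<dots> = (LBINT t. q h t * Re (CLINT w|M. iexp (t * (lp a j w - lp a i w))))"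
        by (rule expectation_qsyn[OF h prob_space_axioms]) measurable
      also have "\<dots> = (LBINT t. q h t * Re (covx i j t) + q h t * (cmod (fourier f t))\<^sup>2)"
      proof (intro Bochner_Integration.integral_cong refl)
        fix t
        have "(CLINT w|M. iexp (t * (lp a j w - lp a i w))) = covx i j t + complex_of_real ((cmod (fourier f t))\<^sup>2)"
          unfolding covx_def char_f complex_norm_square by (simp add: right_diff_distrib)
        then show "q h t * Re (CLINT w|M. iexp (t * (lp a j w - lp a i w))) = q h t * Re (covx i j t) + q h t * (cmod (fourier f t))\<^sup>2"
          by (simp only: plus_complex.sel Re_complex_of_real distrib_left)
      qed
      also have "\<dots> = (LBINT t. q h t * Re (covx i j t)) + c0" unfolding c0_def using i0 i1 by simp
      finally have "\<bar>(LINT w|M. qsyn h (lp a i w - lp a j w)) - c0\<bar> = \<bar>\<integral>t. q h t * Re (covx i j t) \<partial>lborel\<bar>" by simp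
      also have "\<dots> \<le> (LBINT t. \<bar>q h t * Re (covx i j t)\<bar>)" by (rule integral_abs_bound)
      also have "\<dots> \<le> (LBINT t. Kb * cmod (covx i j t))"
        using q_bounded abs_Re_le_cmod Kb0 ci[OF ij]
        by (intro integral_mono') (auto simp: abs_mult intro!: mult_mono)
      also have "\<dots> \<le> Kb * \<beta> (nat (j - i))" using cb[OF ij] Kb0 by (simp add: mult_left_mono)
      finally show ?thesis .
    qed
    define P where "P = 1 / (real n * (real n - 1))"
    have P0: "0 \<le> P" using n by (simp add: P_def)
    have Pn: "P * (real n * (real n - 1)) = 1" using n by (simp add: P_def)
    have "(LINT w|M. Tq h n w) = P * (2 * (\<Sum>j\<in>{1..int n}. \<Sum>i\<in>{1..<j}. (LINT w|M. qsyn h (lp a i w - lp a j w))))"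
      unfolding Tq_def P_def
      by (simp add: Bochner_Integration.integral_sum Bochner_Integration.integrable_sum qsyn_integrable[OF h])
    moreover have "c0 = P * (2 * (\<Sum>j\<in>{1..int n}. \<Sum>i\<in>{1..<j}. c0))"
    proof -
      have "P * (2 * (\<Sum>j\<in>{1..int n}. \<Sum>i\<in>{1..<j}. c0)) = P * (2 * (\<Sum>j\<in>{1..int n}. \<Sum>i\<in>{1..<j}. 1)) * c0"
        by (simp only: sum_distrib_right mult.assoc mult_1)
      then show ?thesis unfolding sum_ordered_pairs_one Pn by simp
    qed
    ultimately have "(LINT w|M. Tq h n w) - c0 = P * (2 * (\<Sum>j\<in>{1..int n}. \<Sum>i\<in>{1..<j}. (LINT w|M. qsyn h (lp a i w - lp a j w)) - c0))"
      by (simp only: sum_subtractf right_diff_distrib)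
    then have "\<bar>(LINT w|M. Tq h n w) - c0\<bar> = P * (2 * \<bar>\<Sum>j\<in>{1..int n}. \<Sum>i\<in>{1..<j}. (LINT w|M. qsyn h (lp a i w - lp a j w)) - c0\<bar>)"
      using P0 by (simp only: abs_mult abs_of_nonneg abs_numeral)
    also have "\<dots> \<le> P * (2 * (\<Sum>j\<in>{1..int n}. Kb * suminf \<beta>))"
    proof (intro mult_left_mono P0)
      have "\<bar>\<Sum>j\<in>{1..int n}. \<Sum>i\<in>{1..<j}. (LINT w|M. qsyn h (lp a i w - lp a j w)) - c0\<bar>
          \<le> (\<Sum>j\<in>{1..int n}. \<Sum>i\<in>{1..<j}. \<bar>(LINT w|M. qsyn h (lp a i w - lp a j w)) - c0\<bar>)"
        by (rule order_trans[OF sum_abs]) (intro sum_mono sum_abs)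
      also have "\<dots> \<le> (\<Sum>j\<in>{1..int n}. \<Sum>i\<in>{1..<j}. Kb * \<beta> (nat (j - i)))"
        by (intro sum_mono pair) auto
      also have "\<dots> \<le> (\<Sum>j\<in>{1..int n}. Kb * suminf \<beta>)"
        unfolding sum_distrib_left[symmetric] using sum_differences_le_suminf[OF \<beta>] Kb0 by (intro sum_mono mult_left_mono)
      finally show "\<bar>\<Sum>j\<in>{1..int n}. \<Sum>i\<in>{1..<j}. (LINT w|M. qsyn h (lp a i w - lp a j w)) - c0\<bar> \<le> (\<Sum>j\<in>{1..int n}. Kb * suminf \<beta>)" .
    qed simp
    also have "\<dots> = 2 * Kb * suminf \<beta> / (real n - 1)" using n by (simp add: P_def)
    also have "\<dots> \<le> 2 * Kb * suminf \<beta> / (real n / 2)"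
      using n Kb0 \<beta> by (intro divide_left_mono mult_nonneg_nonneg suminf_nonneg) auto
    also have "\<dots> = 4 * Kb * suminf \<beta> / real n" by simp
    finally show "\<bar>(LINT w|M. Tq h n w) - (LBINT t. q h t * (cmod (fourier f t))\<^sup>2)\<bar> \<le> 4 * Kb * suminf \<beta> / real n"
      unfolding c0_def .
  qed
qed

definition quad :: "real \<Rightarrow> nat \<Rightarrow> 'a \<Rightarrow> real" where
  "quad h n w = (LBINT t. \<bar>q h t\<bar> * (cmod (Sx a {1..int n} t w))\<^sup>2)"

lemma Sx_sq_bounded: "(cmod (Sx c {1..int n} t w))\<^sup>2 \<le> (2 * real n)\<^sup>2"
  using Sx_bounded[of c "{1..int n}" t w] by (intro power_mono) auto

text \<open>The bounded part A of the variance is integrated against |q h|, whose L1 norm is of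
  order 1 / h. The integrable part v meets the supremum of |q h| and contributes a constant, which
  is at most that constant times H / h because h \<le> H.\<close>

lemma quad_bound:
  "\<exists>Q\<ge>0. \<forall>n. \<forall>h. 0 < h \<and> h \<le> H \<longrightarrow> integrable M (quad h n) \<and> (LINT w|M. quad h n w) \<le> real n * (Q / h)"
proof (rule Sx_var_a)
  fix A v assume v: "integrable lborel v" "\<And>s. 0 \<le> v s" and A: "(0::real) \<le> A"
    and var: "\<And>I s. finite I \<Longrightarrow> (LINT w|M. (cmod (Sx a I s w))\<^sup>2) \<le> real (card I) * (A + v s)"
  define Q where "Q = A * ((LBINT t. \<bar>\<kappa> t\<bar>) / (2 * pi)) + Kb * (LBINT t. v t) * \<bar>H\<bar>"
  have Kb0: "0 \<le> Kb" unfolding Kb_def by simp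
  have V0: "0 \<le> (LBINT t. v t)" using v by simp
  show ?thesis
  proof (intro exI[of _ Q] conjI allI impI; (elim conjE)?)
    show "0 \<le> Q" unfolding Q_def using A Kb0 V0 by (intro add_nonneg_nonneg mult_nonneg_nonneg) auto
    fix n :: nat and h assume h: "0 < h" and hH: "h \<le> H"
    interpret LM: pair_sigma_finite lborel M ..
    have qa: "integrable lborel (\<lambda>t. \<bar>q h t\<bar>)" using q_int[OF h] by simp
    have LMi: "integrable (lborel \<Otimes>\<^sub>M M) (\<lambda>(t, w). \<bar>q h t\<bar> * 1 * (cmod (Sx a {1..int n} t w))\<^sup>2)"
      by (rule LM.integrable_product_bounded[OF qa, where B="(2 * real n)\<^sup>2"]) (use Sx_sq_bounded in auto)
    show "integrable M (quad h n)" using LM.integrable_snd[OF LMi] unfolding quad_def by simp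
    have "(LINT w|M. quad h n w) = (LBINT t. \<bar>q h t\<bar> * (LINT w|M. (cmod (Sx a {1..int n} t w))\<^sup>2))"
      unfolding quad_def using LM.Fubini_integral[OF LMi] by simp
    also have "\<dots> \<le> (LBINT t. real n * A * \<bar>q h t\<bar> + real n * Kb * v t)"
    proof (rule integral_mono')
      show "integrable lborel (\<lambda>t. real n * A * \<bar>q h t\<bar> + real n * Kb * v t)" using qa v by simp
      fix t
      have "\<bar>q h t\<bar> * (LINT w|M. (cmod (Sx a {1..int n} t w))\<^sup>2) \<le> \<bar>q h t\<bar> * (real n * (A + v t))"
        using var[of "{1..int n}" t] by (intro mult_left_mono) auto
      also have "\<dots> = real n * A * \<bar>q h t\<bar> + real n * (\<bar>q h t\<bar> * v t)" by (simp add: algebra_simps)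
      also have "\<dots> \<le> real n * A * \<bar>q h t\<bar> + real n * (Kb * v t)"
        using q_bounded v(2) by (intro add_left_mono mult_left_mono mult_right_mono) auto
      finally show "\<bar>q h t\<bar> * (LINT w|M. (cmod (Sx a {1..int n} t w))\<^sup>2) \<le> real n * A * \<bar>q h t\<bar> + real n * Kb * v t"
        by (simp add: mult.assoc)
      show "0 \<le> real n * A * \<bar>q h t\<bar> + real n * Kb * v t" using A Kb0 v by simp
    qed
    also have "\<dots> = real n * (A * ((LBINT t. \<bar>\<kappa> t\<bar>) / (2 * pi)) / h + Kb * (LBINT t. v t))"
      using qa v q_norm[OF h] by (simp add: algebra_simps)
    also have "\<dots> \<le> real n * (Q / h)"
    proof (rule mult_left_mono)
      have "Kb * (LBINT t. v t) \<le> Kb * (LBINT t. v t) * \<bar>H\<bar> / h"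
      proof -
        have "Kb * (LBINT t. v t) * 1 \<le> Kb * (LBINT t. v t) * (\<bar>H\<bar> / h)"
          using h hH Kb0 V0 by (intro mult_left_mono mult_nonneg_nonneg) (auto simp: le_divide_eq)
        then show ?thesis by simp
      qed
      then show "A * ((LBINT t. \<bar>\<kappa> t\<bar>) / (2 * pi)) / h + Kb * (LBINT t. v t) \<le> Q / h"
        by (simp add: Q_def add_divide_distrib)
    qed simp
    finally show "(LINT w|M. quad h n w) \<le> real n * (Q / h)" .
  qed
qed

lemma sum_iexp_eq: "(\<Sum>i\<in>{1..int n}. iexp (t * lp a i w)) = of_nat n * fourier f t + Sx a {1..int n} t w"
  unfolding Sx_def char_f sum_subtractf by simp

lemma Tq_eq:
  assumes h: "0 < h"
  shows "Tq h n w = (LBINT t. q h t * (((cmod (of_nat n * fourier f t + Sx a {1..int n} t w))\<^sup>2 - real n) / (real n * (real n - 1))))"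
  unfolding Tq_def sum_qsyn_ordered[OF h] sum_iexp_eq
  by (simp add: mult.commute flip: integral_mult_right_zero)

end

subsection \<open>Two independent linear processes\<close>

text \<open>After expanding the square, all that is left is \<open>N * U - N + 2 * R + Q\<close>
  over \<open>N * (N - 1)\<close>. It contains a linear term 2 R, due to the mismatch of N^2 and N
  (N - 1), which is absorbed through |2 R| \<le> 1 + Q.\<close>

lemma within_remainder:
  fixes u S :: complex and N :: real
  assumes u: "cmod u \<le> 1" and N: "2 \<le> N"
  shows "\<bar>((cmod (of_real N * u + S))\<^sup>2 - N) / (N * (N - 1)) - (cmod u)\<^sup>2 - 2 / N * Re (cnj u * S)\<bar>
    \<le> (N + 1 + 2 * (cmod S)\<^sup>2) / (N * (N - 1))"
proof -
  define U where "U = (cmod u)\<^sup>2"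
  define Q where "Q = (cmod S)\<^sup>2"
  define R where "R = Re (cnj u * S)"
  have U: "0 \<le> U" "U \<le> 1" using u by (auto simp: U_def power_le_one)
  have R: "\<bar>R\<bar> \<le> cmod S"
  proof -
    have "\<bar>R\<bar> \<le> cmod (cnj u * S)" unfolding R_def by (rule abs_Re_le_cmod)
    also have "\<dots> \<le> 1 * cmod S" unfolding norm_mult using u by (intro mult_right_mono) auto
    finally show ?thesis by simp
  qed
  have "2 * cmod S \<le> 1 + Q" using sum_squares_bound[of 1 "cmod S"] by (simp add: Q_def)
  then have 1: "\<bar>2 * R\<bar> \<le> 1 + Q" using R by linarith
  have 2: "\<bar>N * U - N\<bar> \<le> N"
  proof -
    have "0 \<le> N * U" "N * U \<le> N * 1" using U N by (auto intro!: mult_left_mono)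
    then show ?thesis by (simp add: abs_le_iff)
  qed
  have e: "(cmod (of_real N * u + S))\<^sup>2 = N\<^sup>2 * U + 2 * N * R + Q"
    by (simp add: U_def Q_def R_def cmod_power2) (simp add: algebra_simps power2_eq_square)
  have nz: "N \<noteq> 0" "N - 1 \<noteq> 0" "0 < N * (N - 1)" using N by auto
  have "((cmod (of_real N * u + S))\<^sup>2 - N) / (N * (N - 1)) - U - 2 / N * R = (N * U - N + 2 * R + Q) / (N * (N - 1))"
    unfolding e using nz(1,2) by (simp add: divide_simps) (simp add: algebra_simps power2_eq_square)
  also have "\<bar>\<dots>\<bar> = \<bar>N * U - N + 2 * R + Q\<bar> / (N * (N - 1))" using nz(3) by (simp add: abs_divide)
  also have "\<dots> \<le> (N + 1 + 2 * Q) / (N * (N - 1))"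
  proof (rule divide_right_mono)
    have "0 \<le> Q" by (simp add: Q_def)
    then show "\<bar>N * U - N + 2 * R + Q\<bar> \<le> N + 1 + 2 * Q" using 1 2 by linarith
  qed (use nz in simp)
  finally show ?thesis unfolding U_def Q_def R_def .
qed

lemma between_remainder:
  fixes u w S R :: complex and N :: real
  assumes N: "2 \<le> N"
  shows "\<bar>2 * (Re ((of_real N * u + S) * cnj (of_real N * w + R)) / N\<^sup>2) - 2 * Re (u * cnj w) - 2 / N * (Re (cnj u * R) + Re (cnj w * S))\<bar>
    \<le> ((cmod S)\<^sup>2 + (cmod R)\<^sup>2) / (N * (N - 1))"
proof -
  define c where "c = Re (S * cnj R)"
  have e: "Re ((of_real N * u + S) * cnj (of_real N * w + R))
      = N\<^sup>2 * Re (u * cnj w) + N * (Re (cnj u * R) + Re (cnj w * S)) + c"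
    by (simp add: c_def) (simp add: algebra_simps power2_eq_square)
  have nz: "N \<noteq> 0" "0 < N * (N - 1)" "N * (N - 1) \<le> N\<^sup>2" using N by (auto simp: power2_eq_square)
  have "2 * (Re ((of_real N * u + S) * cnj (of_real N * w + R)) / N\<^sup>2) - 2 * Re (u * cnj w) - 2 / N * (Re (cnj u * R) + Re (cnj w * S)) = 2 * c / N\<^sup>2"
    unfolding e using nz(1) by (simp add: divide_simps) (simp add: algebra_simps power2_eq_square)
  also have "\<bar>\<dots>\<bar> = \<bar>2 * c\<bar> / N\<^sup>2" by (simp add: abs_divide)
  also have "\<dots> \<le> ((cmod S)\<^sup>2 + (cmod R)\<^sup>2) / (N * (N - 1))"
  proof (rule frac_le)
    have "\<bar>c\<bar> \<le> cmod (S * cnj R)" unfolding c_def by (rule abs_Re_le_cmod)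
    then show "\<bar>2 * c\<bar> \<le> (cmod S)\<^sup>2 + (cmod R)\<^sup>2"
      using sum_squares_bound[of "cmod S" "cmod R"] by (simp add: norm_mult)
  qed (use nz in auto)
  finally show ?thesis .
qed

text \<open>In the combination of the three expansions the terms of order zero complete to the
  square of |u - w| and the linear ones to a product with u - w. This is how the difference f - g
  arises in the linear part.\<close>

lemma divergence_remainder:
  fixes u w S R :: complex and N :: real
  assumes u: "cmod u \<le> 1" and w: "cmod w \<le> 1" and N: "2 \<le> N"
  shows "\<bar>((cmod (of_real N * u + S))\<^sup>2 - N) / (N * (N - 1)) + ((cmod (of_real N * w + R))\<^sup>2 - N) / (N * (N - 1))
      - 2 * (Re ((of_real N * u + S) * cnj (of_real N * w + R)) / N\<^sup>2) - (cmod (u - w))\<^sup>2 - 2 / N * Re (cnj (u - w) * (S - R))\<bar>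
    \<le> (2 * (N + 1) + 3 * (cmod S)\<^sup>2 + 3 * (cmod R)\<^sup>2) / (N * (N - 1))"
proof -
  have a: "(cmod (u - w))\<^sup>2 = (cmod u)\<^sup>2 + (cmod w)\<^sup>2 - 2 * Re (u * cnj w)"
    by (simp add: cmod_power2) (simp add: algebra_simps power2_eq_square)
  have b: "Re (cnj (u - w) * (S - R)) = Re (cnj u * S) + Re (cnj w * R) - (Re (cnj u * R) + Re (cnj w * S))"
    by (simp add: algebra_simps)
  have d: "2 / N * Re (cnj (u - w) * (S - R)) = 2 / N * Re (cnj u * S) + 2 / N * Re (cnj w * R) - 2 / N * (Re (cnj u * R) + Re (cnj w * S))"
    unfolding b by (simp only: right_diff_distrib distrib_left)
  have r: "(2 * (N + 1) + 3 * (cmod S)\<^sup>2 + 3 * (cmod R)\<^sup>2) / (N * (N - 1))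
     = (N + 1 + 2 * (cmod S)\<^sup>2) / (N * (N - 1)) + (N + 1 + 2 * (cmod R)\<^sup>2) / (N * (N - 1)) + ((cmod S)\<^sup>2 + (cmod R)\<^sup>2) / (N * (N - 1))"
    by (simp flip: add_divide_distrib)
  show ?thesis unfolding a d r
    using within_remainder[OF u N, of S] within_remainder[OF w N, of R] between_remainder[OF N, of u S w R] by linarith
qed

text \<open>The bound H on the bandwidths serves to absorb terms of order 1 into terms of order 1 /
  h.\<close>

locale two_sample = prob_space M + density_kernel K +
    X: kernel_process M \<epsilon> a \<gamma> C f Fb K + Y: kernel_process M \<xi> b \<gamma> C g Gb K
  for M :: "'a measure" and \<epsilon> a \<gamma> C f Fb \<xi> b g Gb K +
  fixes h :: "nat \<Rightarrow> real" and H :: real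
  assumes indep_XY: "indep_var (PiM UNIV (\<lambda>_. borel)) (\<lambda>w n. linear_process a \<epsilon> n w)
                               (PiM UNIV (\<lambda>_. borel)) (\<lambda>w n. linear_process b \<xi> n w)"
    and h_pos: "1 \<le> n \<Longrightarrow> 0 < h n" and h_le: "1 \<le> n \<Longrightarrow> h n \<le> H"
begin

abbreviation x :: "int \<Rightarrow> 'a \<Rightarrow> real" where "x \<equiv> linear_process a \<epsilon>"
abbreviation y :: "int \<Rightarrow> 'a \<Rightarrow> real" where "y \<equiv> linear_process b \<xi>"

lemma expectation_indep:
  fixes U V :: "(int \<Rightarrow> real) \<Rightarrow> 'c::{real_normed_field, banach, second_countable_topology}"
  assumes [measurable]: "U \<in> borel_measurable (PiM UNIV (\<lambda>_. borel))" "V \<in> borel_measurable (PiM UNIV (\<lambda>_. borel))"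
    and U: "\<And>v. norm (U v) \<le> B" and V: "\<And>v. norm (V v) \<le> B'"
  shows "integral\<^sup>L M (\<lambda>w. U (\<lambda>n. x n w) * V (\<lambda>n. y n w)) = integral\<^sup>L M (\<lambda>w. U (\<lambda>n. x n w)) * integral\<^sup>L M (\<lambda>w. V (\<lambda>n. y n w))"
proof -
  have [measurable]: "(\<lambda>w n. x n w) \<in> M \<rightarrow>\<^sub>M PiM UNIV (\<lambda>_. borel)" "(\<lambda>w n. y n w) \<in> M \<rightarrow>\<^sub>M PiM UNIV (\<lambda>_. borel)"
    using indep_XY by (auto dest: indep_var_rv1 indep_var_rv2)
  have "indep_var borel (U \<circ> (\<lambda>w n. x n w)) borel (V \<circ> (\<lambda>w n. y n w))"
    by (rule indep_var_compose[OF indep_XY]) measurable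
  then have "indep_var borel (\<lambda>w. U (\<lambda>n. x n w)) borel (\<lambda>w. V (\<lambda>n. y n w))" by (simp add: comp_def)
  then show ?thesis
  proof (rule indep_var_lebesgue_integral)
    show "integrable M (\<lambda>w. U (\<lambda>n. x n w))" by (rule integrable_const_bound[where B=B]) (use U in auto)
    show "integrable M (\<lambda>w. V (\<lambda>n. y n w))" by (rule integrable_const_bound[where B=B']) (use V in auto)
  qed
qed

lemma char_between: "(CLINT w|M. iexp (t * (x i w - y j w))) = fourier f t * cnj (fourier g t)"
proof -
  have "(CLINT w|M. iexp (t * (x i w - y j w))) = (CLINT w|M. iexp (t * x i w) * iexp (- t * y j w))"
    by (intro Bochner_Integration.integral_cong refl) (simp add: algebra_simps exp_add[symmetric])
  also have "\<dots> = (CLINT w|M. iexp (t * x i w)) * (CLINT w|M. iexp (- t * y j w))"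
    by (rule expectation_indep[where U="\<lambda>v. iexp (t * v i)" and V="\<lambda>v. iexp (- t * v j)" and B=1 and B'=1]) auto
  also have "(CLINT w|M. iexp (- t * y j w)) = cnj (CLINT w|M. iexp (t * y j w))"
    unfolding Y.iexp_cov(2) by simp
  finally show ?thesis unfolding X.char_f Y.char_f .
qed

text \<open>By independence the characteristic function of the difference is a product of two
  transforms, both square-integrable by Plancherel since f and g are bounded and integrable.\<close>

lemma between_kernel_AE:
  assumes h: "0 < s"
  shows "AE w in M. \<forall>i j. K ((x i w - y j w) / s) / s = qsyn s (x i w - y j w)"
proof -
  have i: "integrable lborel (\<lambda>t. cmod (CLINT w|M. iexp (t * (x i w - y j w))))" for i j
    unfolding char_between norm_mult complex_mod_cnj
    by (rule integrable_mult_of_squares) (use plancherel(1)[OF X.f_int X.f_abs] plancherel(1)[OF Y.f_int Y.f_abs] in auto)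
  have "AE w in M. K ((x i w - y j w) / s) / s = qsyn s (x i w - y j w)" for i j
    by (rule qsyn_char_AE[OF h prob_space_axioms _ i]) measurable
  then show ?thesis by (simp add: AE_all_countable)
qed

definition Tb :: "real \<Rightarrow> nat \<Rightarrow> 'a \<Rightarrow> real" where
  "Tb s n w = 1 / (real n)\<^sup>2 * (\<Sum>i\<in>{1..int n}. \<Sum>j\<in>{1..int n}. qsyn s (x i w - y j w))"

lemma Tb_meas [measurable]: "Tb s n \<in> borel_measurable M"
  unfolding Tb_def by measurable

lemma T_between_AE:
  assumes h: "0 < s"
  shows "AE w in M. T_between K x y s n w = Tb s n w"
  using between_kernel_AE[OF h]
proof eventually_elim
  case (elim w)
  have "(\<Sum>i\<in>{1..int n}. \<Sum>j\<in>{1..int n}. qsyn s (x i w - y j w))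
      = (\<Sum>i\<in>{1..int n}. \<Sum>j\<in>{1..int n}. K ((x i w - y j w) / s)) / s"
    unfolding sum_divide_distrib by (intro sum.cong refl) (use elim in auto)
  then show ?case by (simp add: T_between_def Tb_def)
qed

lemma Tb_int: "0 < s \<Longrightarrow> integrable M (Tb s n)"
  unfolding Tb_def by (intro integrable_mult_right Bochner_Integration.integrable_sum X.qsyn_integrable) measurable

text \<open>Exact, in contrast to \<open>within_bias\<close>: the two processes are independent, so
  there is no covariance to sum.\<close>

lemma expectation_Tb:
  assumes s: "0 < s" and n: "1 \<le> n"
  shows "(LINT w|M. Tb s n w) = (LBINT t. q s t * Re (fourier f t * cnj (fourier g t)))"
proof -
  have "(LINT w|M. qsyn s (x i w - y j w)) = (LBINT t. q s t * Re (fourier f t * cnj (fourier g t)))" for i j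
    by (subst expectation_qsyn[OF s prob_space_axioms]) (measurable, simp only: char_between)
  then show ?thesis unfolding Tb_def using n
    by (simp add: Bochner_Integration.integral_sum Bochner_Integration.integrable_sum X.qsyn_integrable[OF s] power2_eq_square)
qed

lemma Tb_eq:
  assumes s: "0 < s"
  shows "Tb s n w = (LBINT t. q s t * (Re ((of_nat n * fourier f t + X.Sx a {1..int n} t w) * cnj (of_nat n * fourier g t + Y.Sx b {1..int n} t w)) / (real n)\<^sup>2))"
  unfolding Tb_def sum_qsyn_pairs[OF s] X.sum_iexp_eq Y.sum_iexp_eq
  by (simp add: mult.commute flip: integral_mult_right_zero)

end

text \<open>Allows linearisation around any convenient constant c: as L has mean zero, c differs
  from the mean of Z by at most the mean of R, which merely doubles the bound.\<close>

lemma (in prob_space) centered_abs_le: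
  fixes Z L R :: "'a \<Rightarrow> real"
  assumes Z: "integrable M Z" and L: "integrable M L" "(LINT w|M. L w) = 0" and R: "integrable M R"
    and le: "\<And>w. w \<in> space M \<Longrightarrow> \<bar>Z w - c - L w\<bar> \<le> R w"
  shows "(LINT w|M. \<bar>Z w - (LINT w'|M. Z w') - L w\<bar>) \<le> 2 * (LINT w|M. R w)"
proof -
  have "(LINT w|M. Z w - c - L w) = (LINT w|M. Z w) - c" using Z L by (simp add: prob_space)
  then have "\<bar>(LINT w|M. Z w) - c\<bar> \<le> (LINT w|M. \<bar>Z w - c - L w\<bar>)" by (metis integral_abs_bound)
  also have "\<dots> \<le> (LINT w|M. R w)" using Z L R le by (intro integral_mono) auto
  finally have m: "\<bar>(LINT w|M. Z w) - c\<bar> \<le> (LINT w|M. R w)" .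
  have "(LINT w|M. \<bar>Z w - (LINT w'|M. Z w') - L w\<bar>) \<le> (LINT w|M. R w + (LINT w|M. R w))"
  proof (rule integral_mono)
    fix w assume "w \<in> space M"
    then show "\<bar>Z w - (LINT w'|M. Z w') - L w\<bar> \<le> R w + (LINT w|M. R w)"
      using le[of w] m by linarith
  qed (use Z L R in auto)
  also have "\<dots> = 2 * (LINT w|M. R w)" using R by (simp add: prob_space)
  finally show ?thesis .
qed

lemma (in prob_space) csum_mean_zero:
  assumes [measurable]: "\<And>i. Z i \<in> borel_measurable M" and B: "\<And>i w. \<bar>Z i w\<bar> \<le> B"
  shows "integrable M (csum Z I)" "(LINT w|M. csum Z I w) = 0"
proof -
  have i: "integrable M (Z i)" for i by (rule integrable_const_bound[where B=B]) (use B in auto)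
  show "integrable M (csum Z I)" unfolding csum_def by (intro Bochner_Integration.integrable_sum Bochner_Integration.integrable_diff i) auto
  show "(LINT w|M. csum Z I w) = 0" unfolding csum_def
    by (subst Bochner_Integration.integral_sum) (use i in \<open>auto simp: prob_space\<close>)
qed

section \<open>Bias of the estimator\<close>

context two_sample
begin

definition G :: "real \<Rightarrow> real" where "G z = f z - g z"

lemma G_int: "integrable lborel G"
  unfolding G_def using X.f_int Y.f_int by simp

lemma G_meas [measurable]: "G \<in> borel_measurable borel"
  unfolding G_def by measurable

lemma G_bounded: "\<bar>G z\<bar> \<le> Fb + Gb"
  using X.f_abs[of z] Y.f_abs[of z] unfolding G_def by linarith

lemma fourier_G: "fourier G t = fourier f t - fourier g t"
proof -
  have "complex_integrable lborel (\<lambda>z. iexp (z * t) * complex_of_real (u z))" if "integrable lborel u" for u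
  proof -
    have "complex_integrable lborel (\<lambda>z. complex_of_real (u z) * iexp (z * t))"
      by (rule integrable_mult_bounded[where B=1]) (use that in auto)
    then show ?thesis by (simp add: mult.commute)
  qed
  from this[OF X.f_int] this[OF Y.f_int] show ?thesis
    unfolding fourier_def G_def of_real_diff right_diff_distrib by (rule Bochner_Integration.integral_diff)
qed

lemma cmod_fourier_G_sq_le: "(cmod (fourier G t))\<^sup>2 \<le> 4"
proof -
  have "cmod (fourier G t) \<le> 2"
    unfolding fourier_G using norm_triangle_ineq4[of "fourier f t" "fourier g t"] X.cmod_fourier_f_le1[of t] Y.cmod_fourier_f_le1[of t] by linarith
  then show ?thesis using power_mono[of "cmod (fourier G t)" 2 2] by simp
qed

definition Dq :: "nat \<Rightarrow> 'a \<Rightarrow> real" where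
  "Dq n w = X.Tq (h n) n w + Y.Tq (h n) n w - 2 * Tb (h n) n w"

lemma Dq_meas [measurable]: "Dq n \<in> borel_measurable M"
  unfolding Dq_def by measurable

lemma Dq_int: "1 \<le> n \<Longrightarrow> integrable M (Dq n)"
  unfolding Dq_def using X.Tq_int Y.Tq_int Tb_int h_pos by simp

lemma D_hat_AE: "1 \<le> n \<Longrightarrow> AE w in M. D_hat K x y h n w = Dq n w"
  using X.T_within_AE[OF h_pos, of n n] Y.T_within_AE[OF h_pos, of n n] T_between_AE[OF h_pos, of n n]
  by (auto elim!: eventually_elim2 simp: D_hat_def Dq_def elim: AE_mp)

lemma D_hat_meas [measurable]: "D_hat K x y h n \<in> borel_measurable M"
  unfolding D_hat_def[abs_def] T_within_def T_between_def by measurable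

lemma D_hat_expectation: "1 \<le> n \<Longrightarrow> (LINT w|M. D_hat K x y h n w) = (LINT w|M. Dq n w)"
  by (rule integral_cong_AE) (use D_hat_AE in auto)

text \<open>By \<open>smooth_quadratic\<close> this is the integral of
  \<open>G z * smooth K (h n) G z\<close>, the divergence smoothed at scale
  \<open>h n\<close>.\<close>

definition center :: "nat \<Rightarrow> real" where
  "center n = (LBINT t. q (h n) t * (cmod (fourier G t))\<^sup>2)"

lemma expectation_Dq: "\<exists>c\<ge>0. \<forall>n\<ge>2. \<bar>(LINT w|M. Dq n w) - center n\<bar> \<le> c / real n"
proof -
  obtain cx where cx: "0 \<le> cx" "\<forall>n\<ge>2. \<forall>h>0. \<bar>(LINT w|M. X.Tq h n w) - (LBINT t. q h t * (cmod (fourier f t))\<^sup>2)\<bar> \<le> cx / real n"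
    using X.within_bias by blast
  obtain cy where cy: "0 \<le> cy" "\<forall>n\<ge>2. \<forall>h>0. \<bar>(LINT w|M. Y.Tq h n w) - (LBINT t. q h t * (cmod (fourier g t))\<^sup>2)\<bar> \<le> cy / real n"
    using Y.within_bias by blast
  show ?thesis
  proof (intro exI[of _ "cx + cy"] conjI allI impI)
    show "0 \<le> cx + cy" using cx cy by simp
    fix n :: nat assume n: "2 \<le> n"
    have hn: "0 < h n" using h_pos n by simp
    have le1: "(cmod (fourier f t))\<^sup>2 \<le> 1" "(cmod (fourier g t))\<^sup>2 \<le> 1" for t
      using X.cmod_fourier_f_le1 Y.cmod_fourier_f_le1 by (auto simp: power_le_one)
    have le2: "\<bar>Re (fourier f t * cnj (fourier g t))\<bar> \<le> 1" for t
    proof -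
      have "\<bar>Re (fourier f t * cnj (fourier g t))\<bar> \<le> cmod (fourier f t) * cmod (fourier g t)"
        using abs_Re_le_cmod[of "fourier f t * cnj (fourier g t)"] by (simp only: norm_mult complex_mod_cnj)
      also have "\<dots> \<le> 1 * 1" using X.cmod_fourier_f_le1 Y.cmod_fourier_f_le1 by (intro mult_mono) auto
      finally show ?thesis by simp
    qed
    have i: "integrable lborel (\<lambda>t. q (h n) t * (cmod (fourier f t))\<^sup>2)"
      "integrable lborel (\<lambda>t. q (h n) t * (cmod (fourier g t))\<^sup>2)"
      "integrable lborel (\<lambda>t. q (h n) t * Re (fourier f t * cnj (fourier g t)))"
      by (rule q_mult_int[OF hn, where B=1]; use le1 le2 in auto)+
    have "center n = (LBINT t. q (h n) t * (cmod (fourier f t))\<^sup>2 + q (h n) t * (cmod (fourier g t))\<^sup>2 - 2 * (q (h n) t * Re (fourier f t * cnj (fourier g t))))"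
      unfolding center_def
    proof (intro Bochner_Integration.integral_cong refl)
      fix t
      have "(cmod (fourier G t))\<^sup>2 = (cmod (fourier f t))\<^sup>2 + (cmod (fourier g t))\<^sup>2 - 2 * Re (fourier f t * cnj (fourier g t))"
        unfolding fourier_G by (simp add: cmod_power2) (simp add: algebra_simps power2_eq_square)
      then show "q (h n) t * (cmod (fourier G t))\<^sup>2 = q (h n) t * (cmod (fourier f t))\<^sup>2 + q (h n) t * (cmod (fourier g t))\<^sup>2 - 2 * (q (h n) t * Re (fourier f t * cnj (fourier g t)))"
        by (simp only: distrib_left right_diff_distrib mult.left_commute)
    qed
    also have "\<dots> = (LBINT t. q (h n) t * (cmod (fourier f t))\<^sup>2) + (LBINT t. q (h n) t * (cmod (fourier g t))\<^sup>2) - 2 * (LINT w|M. Tb (h n) n w)"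
      using expectation_Tb[OF hn, of n] n i by simp
    finally have c: "center n = (LBINT t. q (h n) t * (cmod (fourier f t))\<^sup>2) + (LBINT t. q (h n) t * (cmod (fourier g t))\<^sup>2) - 2 * (LINT w|M. Tb (h n) n w)" .
    have "(LINT w|M. Dq n w) = (LINT w|M. X.Tq (h n) n w) + (LINT w|M. Y.Tq (h n) n w) - 2 * (LINT w|M. Tb (h n) n w)"
      unfolding Dq_def using X.Tq_int[OF hn] Y.Tq_int[OF hn] Tb_int[OF hn] by simp
    moreover have "\<bar>(LINT w|M. X.Tq (h n) n w) - (LBINT t. q (h n) t * (cmod (fourier f t))\<^sup>2)\<bar> \<le> cx / real n"
      "\<bar>(LINT w|M. Y.Tq (h n) n w) - (LBINT t. q (h n) t * (cmod (fourier g t))\<^sup>2)\<bar> \<le> cy / real n"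
      using cx(2) cy(2) n hn by auto
    ultimately show "\<bar>(LINT w|M. Dq n w) - center n\<bar> \<le> (cx + cy) / real n"
      unfolding c add_divide_distrib by linarith
  qed
qed

text \<open>The characteristic functions of the two processes are dominated by one factor of the
  innovations each, so the integrability conditions pass to f - g. This is fractional smoothness of
  order \<gamma> in L2 and fixes the powers of the bandwidth in both estimates.\<close>

lemma fourier_G_weighted: "integrable lborel (\<lambda>t. \<bar>t\<bar> powr (2 * \<gamma>) * (cmod (fourier G t))\<^sup>2)"
proof (rule Bochner_Integration.integrable_bound)
  show "integrable lborel (\<lambda>t. 2 * (\<bar>t\<bar> powr \<gamma> * cmod (X.\<phi> (t * a 0)))\<^sup>2 + 2 * (\<bar>t\<bar> powr \<gamma> * cmod (Y.\<phi> (t * b 0)))\<^sup>2)"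
    using X.\<phi>_scaled_int(2)[OF X.a0] Y.\<phi>_scaled_int(2)[OF Y.a0] by simp
  have "\<bar>t\<bar> powr (2 * \<gamma>) * (cmod (fourier G t))\<^sup>2 \<le> 2 * (\<bar>t\<bar> powr \<gamma> * cmod (X.\<phi> (t * a 0)))\<^sup>2 + 2 * (\<bar>t\<bar> powr \<gamma> * cmod (Y.\<phi> (t * b 0)))\<^sup>2" for t
  proof -
    have "(cmod (fourier G t))\<^sup>2 \<le> 2 * (cmod (fourier f t))\<^sup>2 + 2 * (cmod (fourier g t))\<^sup>2"
      unfolding fourier_G by (rule cmod_diff_square_le)
    also have "\<dots> \<le> 2 * (cmod (X.\<phi> (t * a 0)))\<^sup>2 + 2 * (cmod (Y.\<phi> (t * b 0)))\<^sup>2"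
      using X.char_lp_le[of t 0] Y.char_lp_le[of t 0] unfolding X.char_f Y.char_f
      by (intro add_mono mult_left_mono power_mono) auto
    finally have "\<bar>t\<bar> powr (2 * \<gamma>) * (cmod (fourier G t))\<^sup>2 \<le> \<bar>t\<bar> powr (2 * \<gamma>) * (2 * (cmod (X.\<phi> (t * a 0)))\<^sup>2 + 2 * (cmod (Y.\<phi> (t * b 0)))\<^sup>2)"
      by (intro mult_left_mono) auto
    then show ?thesis by (simp add: power_mult_distrib powr_twice algebra_simps)
  qed
  then show "AE t in lborel. norm (\<bar>t\<bar> powr (2 * \<gamma>) * (cmod (fourier G t))\<^sup>2) \<le> norm (2 * (\<bar>t\<bar> powr \<gamma> * cmod (X.\<phi> (t * a 0)))\<^sup>2 + 2 * (\<bar>t\<bar> powr \<gamma> * cmod (Y.\<phi> (t * b 0)))\<^sup>2)"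
    by (intro AE_I2) (simp add: abs_mult)
qed measurable

definition Wt :: real where "Wt = (LBINT t. \<bar>t\<bar> powr (2 * \<gamma>) * (cmod (fourier G t))\<^sup>2)"

lemma Wt0: "0 \<le> Wt" unfolding Wt_def by simp

text \<open>Plancherel writes the divergence as the same integral with \<kappa> replaced by 1. The
  transform enters squared, so the full exponent 2 \<gamma> can be spent on \<kappa> - 1.\<close>

lemma center_bias:
  assumes n: "1 \<le> n"
  shows "\<bar>center n - L2_divergence f g\<bar> \<le> Km * Wt * h n powr (2 * \<gamma>)"
proof -
  have hn: "0 < h n" using h_pos n by simp
  have i1: "integrable lborel (\<lambda>t. q (h n) t * (cmod (fourier G t))\<^sup>2)"
    by (rule q_mult_int[OF hn, where B=4]) (use cmod_fourier_G_sq_le in auto)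
  have i2: "integrable lborel (\<lambda>t. 1 / (2 * pi) * (cmod (fourier G t))\<^sup>2)"
    using plancherel(1)[OF G_int G_bounded] by simp
  have "L2_divergence f g = (LBINT t. 1 / (2 * pi) * (cmod (fourier G t))\<^sup>2)"
  proof -
    have "L2_divergence f g = (LBINT z. (G z)\<^sup>2)" by (simp add: L2_divergence_def G_def)
    also have "\<dots> = 1 / (2 * pi) * (LBINT t. (cmod (fourier G t))\<^sup>2)" by (rule plancherel(2)[OF G_int G_bounded])
    also have "\<dots> = (LBINT t. 1 / (2 * pi) * (cmod (fourier G t))\<^sup>2)" by (rule integral_mult_right_zero[symmetric])
    finally show ?thesis .
  qed
  then have "center n - L2_divergence f g = (LBINT t. q (h n) t * (cmod (fourier G t))\<^sup>2 - 1 / (2 * pi) * (cmod (fourier G t))\<^sup>2)"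
    unfolding center_def using i1 i2 by (simp only: Bochner_Integration.integral_diff)
  then have "\<bar>center n - L2_divergence f g\<bar> = \<bar>\<integral>t. q (h n) t * (cmod (fourier G t))\<^sup>2 - 1 / (2 * pi) * (cmod (fourier G t))\<^sup>2 \<partial>lborel\<bar>"
    by (rule arg_cong)
  also have "\<dots> \<le> (LBINT t. \<bar>q (h n) t * (cmod (fourier G t))\<^sup>2 - 1 / (2 * pi) * (cmod (fourier G t))\<^sup>2\<bar>)"
    by (rule integral_abs_bound)
  also have "\<dots> \<le> (LBINT t. Km * h n powr (2 * \<gamma>) * (\<bar>t\<bar> powr (2 * \<gamma>) * (cmod (fourier G t))\<^sup>2))"
  proof (rule integral_mono')
    show "integrable lborel (\<lambda>t. Km * h n powr (2 * \<gamma>) * (\<bar>t\<bar> powr (2 * \<gamma>) * (cmod (fourier G t))\<^sup>2))"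
      by (rule integrable_mult_right[OF fourier_G_weighted])
    fix t
    have "\<bar>q (h n) t - 1 / (2 * pi)\<bar> = \<bar>\<kappa> (h n * t) - 1\<bar> / (2 * pi)"
      unfolding q_def diff_divide_distrib[symmetric] abs_divide by simp
    also have "\<dots> \<le> \<bar>\<kappa> (h n * t) - 1\<bar> / 1" using pi_ge_two by (intro divide_left_mono) auto
    also have "\<dots> \<le> Km * \<bar>h n * t\<bar> powr (2 * \<gamma>)"
      unfolding div_by_1 by (rule \<kappa>_minus_one_le) (use X.\<gamma>_pos X.\<gamma>_le in auto)
    also have "\<dots> = Km * h n powr (2 * \<gamma>) * \<bar>t\<bar> powr (2 * \<gamma>)"
      using hn by (simp only: abs_mult powr_mult abs_of_pos mult.assoc)
    finally have "\<bar>q (h n) t - 1 / (2 * pi)\<bar> * (cmod (fourier G t))\<^sup>2 \<le> Km * h n powr (2 * \<gamma>) * \<bar>t\<bar> powr (2 * \<gamma>) * (cmod (fourier G t))\<^sup>2"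
      by (intro mult_right_mono) auto
    moreover have "\<bar>q (h n) t * (cmod (fourier G t))\<^sup>2 - 1 / (2 * pi) * (cmod (fourier G t))\<^sup>2\<bar> = \<bar>q (h n) t - 1 / (2 * pi)\<bar> * (cmod (fourier G t))\<^sup>2"
      by (simp only: left_diff_distrib[symmetric] abs_mult abs_power2)
    ultimately show "\<bar>q (h n) t * (cmod (fourier G t))\<^sup>2 - 1 / (2 * pi) * (cmod (fourier G t))\<^sup>2\<bar>
      \<le> Km * h n powr (2 * \<gamma>) * (\<bar>t\<bar> powr (2 * \<gamma>) * (cmod (fourier G t))\<^sup>2)" by (simp only: mult.assoc)
    show "0 \<le> Km * h n powr (2 * \<gamma>) * (\<bar>t\<bar> powr (2 * \<gamma>) * (cmod (fourier G t))\<^sup>2)"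
      using Km_nonneg by (intro mult_nonneg_nonneg) auto
  qed
  also have "\<dots> = Km * Wt * h n powr (2 * \<gamma>)" by (simp add: Wt_def)
  finally show ?thesis .
qed

lemma bias_bound:
  "\<exists>c>0. \<forall>n\<ge>2. \<bar>(LINT w|M. D_hat K x y h n w) - L2_divergence f g\<bar> \<le> c * (1 / real n + h n powr (2 * \<gamma>))"
proof -
  obtain c where c: "0 \<le> c" "\<forall>n\<ge>2. \<bar>(LINT w|M. Dq n w) - center n\<bar> \<le> c / real n"
    using expectation_Dq by blast
  have k: "0 \<le> Km * Wt" using Km_nonneg Wt0 by simp
  show ?thesis
  \<comment> \<open>The added 1 keeps the constant positive when the others are 0.\<close>
  proof (intro exI[of _ "c + Km * Wt + 1"] conjI allI impI)
    show "0 < c + Km * Wt + 1" using c(1) k by linarith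
    fix n :: nat assume n: "2 \<le> n"
    have "\<bar>(LINT w|M. D_hat K x y h n w) - L2_divergence f g\<bar> \<le> c / real n + Km * Wt * h n powr (2 * \<gamma>)"
      using c(2) n D_hat_expectation[of n] center_bias[of n] by force
    also have "\<dots> \<le> (c + Km * Wt + 1) * (1 / real n) + (c + Km * Wt + 1) * h n powr (2 * \<gamma>)"
    proof (rule add_mono)
      have "c * (1 / real n) \<le> (c + Km * Wt + 1) * (1 / real n)" using c(1) k by (intro mult_right_mono) auto
      then show "c / real n \<le> (c + Km * Wt + 1) * (1 / real n)" by simp
      show "Km * Wt * h n powr (2 * \<gamma>) \<le> (c + Km * Wt + 1) * h n powr (2 * \<gamma>)" using c(1) k by (intro mult_right_mono) auto
    qed
    finally show "\<bar>(LINT w|M. D_hat K x y h n w) - L2_divergence f g\<bar> \<le> (c + Km * Wt + 1) * (1 / real n + h n powr (2 * \<gamma>))"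
      by (simp only: distrib_left)
  qed
qed

end

section \<open>Linearisation of the estimator\<close>

context two_sample
begin

text \<open>By \<open>smooth_eq_synth\<close> the synthesis of this transform is
  \<open>smooth K (h n) G\<close> for n \<ge> 1.\<close>

definition Psi :: "nat \<Rightarrow> real \<Rightarrow> complex" where
  "Psi n t = complex_of_real (\<kappa> (h n * t)) * coft G t"

lemma Psi_meas [measurable]: "Psi n \<in> borel_measurable borel"
  unfolding Psi_def by measurable

lemma Psi_int: "1 \<le> n \<Longrightarrow> integrable lborel (Psi n)"
  unfolding Psi_def using smooth_eq_synth(2)[OF K_inversion K_meas G_int h_pos] .

lemma Psi_eq: "Psi n t = complex_of_real (q (h n) t) * cnj (fourier G t)"
  by (simp add: Psi_def coft_def q_def)

lemma Psi_sq_int: "1 \<le> n \<Longrightarrow> integrable lborel (\<lambda>t. (cmod (Psi n t))\<^sup>2)"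
proof -
  assume n: "1 \<le> n"
  have "integrable lborel (\<lambda>t. (cmod (coft G t))\<^sup>2 * (\<kappa> (h n * t))\<^sup>2)"
  proof (rule integrable_mult_bounded[OF coft_sq_integrable[OF G_int G_bounded], where B="Kb\<^sup>2"])
    show "norm ((\<kappa> (h n * t))\<^sup>2) \<le> Kb\<^sup>2" for t
      using power_mono[OF \<kappa>_bounded[of "h n * t"], of 2] by simp
  qed measurable
  then show ?thesis by (simp add: Psi_def norm_mult power_mult_distrib mult.commute)
qed

text \<open>The term of first order in the fluctuations: the average of the \<open>W\<close> with f
  - g replaced by its smoothing at scale \<open>h n\<close>.\<close>

definition lin :: "nat \<Rightarrow> 'a \<Rightarrow> real" where
  "lin n w = 2 / real n * (csum (\<lambda>i w. synth (Psi n) (x i w)) {1..int n} w - csum (\<lambda>i w. synth (Psi n) (y i w)) {1..int n} w)"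

lemma lin_meas [measurable]: "lin n \<in> borel_measurable M"
  unfolding lin_def by measurable

lemma lin_mean_zero: "integrable M (lin n)" "(LINT w|M. lin n w) = 0"
proof -
  have i: "integrable M (csum (\<lambda>i w. synth (Psi n) (x i w)) {1..int n})" "(LINT w|M. csum (\<lambda>i w. synth (Psi n) (x i w)) {1..int n} w) = 0"
    "integrable M (csum (\<lambda>i w. synth (Psi n) (y i w)) {1..int n})" "(LINT w|M. csum (\<lambda>i w. synth (Psi n) (y i w)) {1..int n} w) = 0"
    by (rule csum_mean_zero[OF _ abs_synth_le]; measurable)+
  then show "integrable M (lin n)" "(LINT w|M. lin n w) = 0" unfolding lin_def by simp_all
qed

lemma Sx_section_measurable:
  assumes "w \<in> space M"
  shows "(\<lambda>t. X.Sx a I t w) \<in> borel_measurable borel" "(\<lambda>t. Y.Sx b I t w) \<in> borel_measurable borel"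
  using measurable_Pair1[OF X.Sx_measurable assms] measurable_Pair1[OF Y.Sx_measurable assms] by simp_all

lemma lin_eq:
  assumes n: "1 \<le> n" and w: "w \<in> space M"
  shows "lin n w = (LBINT t. q (h n) t * (2 / real n * Re (cnj (fourier G t) * (X.Sx a {1..int n} t w - Y.Sx b {1..int n} t w))))"
proof -
  note [measurable] = Sx_section_measurable[OF w]
  have i: "integrable lborel (\<lambda>t. Psi n t * X.Sx a {1..int n} t w)" "integrable lborel (\<lambda>t. Psi n t * Y.Sx b {1..int n} t w)"
    by (rule integrable_mult_bounded[OF Psi_int[OF n], where B="2 * real n"];
        use X.Sx_bounded[of a "{1..int n}"] Y.Sx_bounded[of b "{1..int n}"] in simp)+
  have "lin n w = 2 / real n * (Re (CLINT t|lborel. Psi n t * X.Sx a {1..int n} t w) - Re (CLINT t|lborel. Psi n t * Y.Sx b {1..int n} t w))"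
    unfolding lin_def csum_def X.synth_sum[OF Psi_int[OF n]] Y.synth_sum[OF Psi_int[OF n]] ..
  also have "\<dots> = 2 / real n * (LBINT t. Re (Psi n t * X.Sx a {1..int n} t w - Psi n t * Y.Sx b {1..int n} t w))"
    unfolding integral_Re[OF Bochner_Integration.integrable_diff[OF i]] Bochner_Integration.integral_diff[OF i] by simp
  also have "\<dots> = (LBINT t. 2 / real n * Re (Psi n t * X.Sx a {1..int n} t w - Psi n t * Y.Sx b {1..int n} t w))"
    by (rule integral_mult_right_zero[symmetric])
  also have "\<dots> = (LBINT t. q (h n) t * (2 / real n * Re (cnj (fourier G t) * (X.Sx a {1..int n} t w - Y.Sx b {1..int n} t w))))"
  proof (intro Bochner_Integration.integral_cong refl)
    fix t
    have "Psi n t * X.Sx a {1..int n} t w - Psi n t * Y.Sx b {1..int n} t w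
      = complex_of_real (q (h n) t) * (cnj (fourier G t) * (X.Sx a {1..int n} t w - Y.Sx b {1..int n} t w))"
      unfolding Psi_eq by (simp only: right_diff_distrib mult.assoc)
    then show "2 / real n * Re (Psi n t * X.Sx a {1..int n} t w - Psi n t * Y.Sx b {1..int n} t w)
      = q (h n) t * (2 / real n * Re (cnj (fourier G t) * (X.Sx a {1..int n} t w - Y.Sx b {1..int n} t w)))"
      by simp
  qed
  finally show ?thesis .
qed

definition rem :: "nat \<Rightarrow> 'a \<Rightarrow> real" where
  "rem n w = (2 * (real n + 1) * (LBINT t. \<bar>q (h n) t\<bar>) + 3 * X.quad (h n) n w + 3 * Y.quad (h n) n w) / (real n * (real n - 1))"

text \<open>All terms are integrals over t against \<open>q (h n) t\<close>, so
  \<open>divergence_remainder\<close> can be applied at each frequency separately. The rest of the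
  work is integrability for a fixed outcome, from the trivial bound 2 n on the exponential
  sums.\<close>

lemma Dq_linearization:
  assumes n: "2 \<le> n" and \<omega>: "\<omega> \<in> space M"
  shows "\<bar>Dq n \<omega> - center n - lin n \<omega>\<bar> \<le> rem n \<omega>"
proof -
  note [measurable] = Sx_section_measurable[OF \<omega>]
  define S R where "S t = X.Sx a {1..int n} t \<omega>" and "R t = Y.Sx b {1..int n} t \<omega>" for t
  have [measurable]: "S \<in> borel_measurable borel" "R \<in> borel_measurable borel" unfolding S_def[abs_def] R_def[abs_def] by measurable
  define N where "N = real n"
  have N: "2 \<le> N" using n by (simp add: N_def)
  have hn: "0 < h n" using h_pos n by simp
  have Sb: "cmod (S t) \<le> 2 * N" "cmod (R t) \<le> 2 * N" for t
    using X.Sx_bounded[of a "{1..int n}" t \<omega>] Y.Sx_bounded[of b "{1..int n}" t \<omega>] by (auto simp: S_def R_def N_def)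
  have fb: "cmod (fourier f t) \<le> 1" "cmod (fourier g t) \<le> 1" for t by (rule X.cmod_fourier_f_le1 Y.cmod_fourier_f_le1)+
  define u v where "u t = of_real N * fourier f t + S t" and "v t = of_real N * fourier g t + R t" for t
  have [measurable]: "u \<in> borel_measurable borel" "v \<in> borel_measurable borel" unfolding u_def v_def by measurable
  have ub: "cmod (u t) \<le> 3 * N" "cmod (v t) \<le> 3 * N" for t
  proof -
    have "cmod (of_real N * fourier f t) \<le> N * 1" "cmod (of_real N * fourier g t) \<le> N * 1"
      unfolding norm_mult using fb[of t] N by (auto intro!: mult_left_mono)
    then show "cmod (u t) \<le> 3 * N" "cmod (v t) \<le> 3 * N"
      unfolding u_def v_def using Sb[of t] norm_triangle_ineq[of "of_real N * fourier f t" "S t"] norm_triangle_ineq[of "of_real N * fourier g t" "R t"] by linarith+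
  qed
  define P1 where "P1 t = ((cmod (u t))\<^sup>2 - N) / (N * (N - 1))" for t
  define P2 where "P2 t = ((cmod (v t))\<^sup>2 - N) / (N * (N - 1))" for t
  define P3 where "P3 t = Re (u t * cnj (v t)) / N\<^sup>2" for t
  define P4 where "P4 t = (cmod (fourier G t))\<^sup>2" for t
  define P5 where "P5 t = 2 / N * Re (cnj (fourier G t) * (S t - R t))" for t
  have sq: "(cmod z)\<^sup>2 \<le> (3 * N)\<^sup>2" if "cmod z \<le> 3 * N" for z
    using that by (intro power_mono) auto
  have "0 < N * (N - 1)" using N by simp
  have qb: "integrable lborel (\<lambda>t. q (h n) t * w t)" if "w \<in> borel_measurable borel" "\<And>t. \<bar>w t\<bar> \<le> B" for w B
    using q_mult_int[OF hn that] .
  have i1: "integrable lborel (\<lambda>t. q (h n) t * P1 t)" "integrable lborel (\<lambda>t. q (h n) t * P2 t)"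
  proof -
    have "\<bar>((cmod z)\<^sup>2 - N) / (N * (N - 1))\<bar> \<le> ((3 * N)\<^sup>2 + N) / (N * (N - 1))" if "cmod z \<le> 3 * N" for z
    proof -
      have "\<bar>(cmod z)\<^sup>2 - N\<bar> \<le> (3 * N)\<^sup>2 + N" using sq[OF that] N zero_le_power2[of "cmod z"] by linarith
      then show ?thesis using \<open>0 < N * (N - 1)\<close> unfolding abs_divide by (simp add: divide_right_mono)
    qed
    note PB = this
    have [measurable]: "P1 \<in> borel_measurable borel" "P2 \<in> borel_measurable borel"
      unfolding P1_def P2_def by measurable
    show "integrable lborel (\<lambda>t. q (h n) t * P1 t)"
      by (rule qb) (measurable, unfold P1_def, rule PB[OF ub(1)])
    show "integrable lborel (\<lambda>t. q (h n) t * P2 t)"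
      by (rule qb) (measurable, unfold P2_def, rule PB[OF ub(2)])
  qed
  have i3: "integrable lborel (\<lambda>t. q (h n) t * P3 t)"
  proof (rule qb)
    show "P3 \<in> borel_measurable borel" unfolding P3_def by measurable
    fix t
    have "\<bar>Re (u t * cnj (v t))\<bar> \<le> cmod (u t) * cmod (v t)"
      using abs_Re_le_cmod[of "u t * cnj (v t)"] by (simp only: norm_mult complex_mod_cnj)
    also have "\<dots> \<le> (3 * N) * (3 * N)" using ub N by (intro mult_mono) auto
    finally show "\<bar>P3 t\<bar> \<le> (3 * N) * (3 * N) / N\<^sup>2" unfolding P3_def abs_divide by (simp add: divide_right_mono)
  qed
  have i4: "integrable lborel (\<lambda>t. q (h n) t * P4 t)"
    unfolding P4_def by (rule qb[of _ 4]) (use cmod_fourier_G_sq_le in auto)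
  have i5: "integrable lborel (\<lambda>t. q (h n) t * P5 t)"
  proof (rule qb)
    show "P5 \<in> borel_measurable borel" unfolding P5_def by measurable
    fix t
    have "\<bar>Re (cnj (fourier G t) * (S t - R t))\<bar> \<le> cmod (fourier G t) * cmod (S t - R t)"
      using abs_Re_le_cmod[of "cnj (fourier G t) * (S t - R t)"] by (simp only: norm_mult complex_mod_cnj)
    also have "\<dots> \<le> 2 * (4 * N)"
    proof (rule mult_mono)
      show "cmod (fourier G t) \<le> 2" using cmod_fourier_G_sq_le[of t] power2_le_imp_le[of "cmod (fourier G t)" 2] by simp
      show "cmod (S t - R t) \<le> 4 * N" using norm_triangle_ineq4[of "S t" "R t"] Sb[of t] by linarith
    qed auto
    finally have "2 / N * \<bar>Re (cnj (fourier G t) * (S t - R t))\<bar> \<le> 2 / N * (2 * (4 * N))" using N by (intro mult_left_mono) auto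
    then show "\<bar>P5 t\<bar> \<le> 2 / N * (2 * (4 * N))" unfolding P5_def abs_mult using N by simp
  qed
  have qi: "integrable lborel (\<lambda>t. \<bar>q (h n) t\<bar> * (cmod (S t))\<^sup>2)" "integrable lborel (\<lambda>t. \<bar>q (h n) t\<bar> * (cmod (R t))\<^sup>2)"
    by (rule integrable_mult_bounded[where B="(2 * N)\<^sup>2"]; use q_int[OF hn] Sb power_mono[OF Sb(1) norm_ge_zero, of _ 2] power_mono[OF Sb(2) norm_ge_zero, of _ 2] in simp)+
  have D: "Dq n \<omega> = (LBINT t. q (h n) t * P1 t) + (LBINT t. q (h n) t * P2 t) - 2 * (LBINT t. q (h n) t * P3 t)"
    unfolding Dq_def X.Tq_eq[OF hn] Y.Tq_eq[OF hn] Tb_eq[OF hn] P1_def P2_def P3_def u_def v_def N_def S_def R_def by simp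
  have L: "lin n \<omega> = (LBINT t. q (h n) t * P5 t)"
    unfolding P5_def S_def R_def N_def using lin_eq[OF _ \<omega>, of n] n by simp
  have Cn: "center n = (LBINT t. q (h n) t * P4 t)" unfolding center_def P4_def ..
  have "Dq n \<omega> - center n - lin n \<omega> = (LBINT t. q (h n) t * P1 t + q (h n) t * P2 t - 2 * (q (h n) t * P3 t) - q (h n) t * P4 t - q (h n) t * P5 t)"
    unfolding D L Cn using i1 i3 i4 i5 by simp
  then have "\<bar>Dq n \<omega> - center n - lin n \<omega>\<bar> = \<bar>(LBINT t. q (h n) t * P1 t + q (h n) t * P2 t - 2 * (q (h n) t * P3 t) - q (h n) t * P4 t - q (h n) t * P5 t)\<bar>"
    by (rule arg_cong)
  also have "\<dots> \<le> (LBINT t. \<bar>q (h n) t * P1 t + q (h n) t * P2 t - 2 * (q (h n) t * P3 t) - q (h n) t * P4 t - q (h n) t * P5 t\<bar>)"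
    by (rule integral_abs_bound)
  also have "\<dots> \<le> (LBINT t. (2 * (N + 1) * \<bar>q (h n) t\<bar> + 3 * (\<bar>q (h n) t\<bar> * (cmod (S t))\<^sup>2) + 3 * (\<bar>q (h n) t\<bar> * (cmod (R t))\<^sup>2)) / (N * (N - 1)))"
  proof (rule integral_mono)
    fix t
    have "\<bar>P1 t + P2 t - 2 * P3 t - P4 t - P5 t\<bar> \<le> (2 * (N + 1) + 3 * (cmod (S t))\<^sup>2 + 3 * (cmod (R t))\<^sup>2) / (N * (N - 1))"
      unfolding P1_def P2_def P3_def P4_def P5_def u_def v_def fourier_G by (rule divergence_remainder[OF fb N])
    then have "\<bar>q (h n) t\<bar> * \<bar>P1 t + P2 t - 2 * P3 t - P4 t - P5 t\<bar> \<le> \<bar>q (h n) t\<bar> * ((2 * (N + 1) + 3 * (cmod (S t))\<^sup>2 + 3 * (cmod (R t))\<^sup>2) / (N * (N - 1)))"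
      by (rule mult_left_mono) simp
    then show "\<bar>q (h n) t * P1 t + q (h n) t * P2 t - 2 * (q (h n) t * P3 t) - q (h n) t * P4 t - q (h n) t * P5 t\<bar>
      \<le> (2 * (N + 1) * \<bar>q (h n) t\<bar> + 3 * (\<bar>q (h n) t\<bar> * (cmod (S t))\<^sup>2) + 3 * (\<bar>q (h n) t\<bar> * (cmod (R t))\<^sup>2)) / (N * (N - 1))"
      unfolding abs_mult[symmetric] by (simp add: algebra_simps)
  qed (use i1 i3 i4 i5 q_int[OF hn] qi in auto)
  also have "\<dots> = rem n \<omega>"
    unfolding rem_def X.quad_def Y.quad_def using q_int[OF hn] qi by (simp add: N_def S_def R_def)
  finally show ?thesis .
qed

end

lemma (in linproc_dens) csum_residual_L1:
  assumes G: "integrable lborel G" and B: "\<And>z. \<bar>G z\<bar> \<le> B"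
  shows "\<exists>c\<ge>0. \<forall>\<Psi> I. integrable lborel \<Psi> \<longrightarrow> integrable lborel (\<lambda>t. (cmod (\<Psi> t))\<^sup>2) \<longrightarrow> finite I \<longrightarrow>
     (LINT w|M. \<bar>csum (\<lambda>i w. G (lp a i w)) I w - csum (\<lambda>i w. synth \<Psi> (lp a i w)) I w\<bar>)
       \<le> c * sqrt (real (card I)) * sqrt (LBINT t. (cmod (coft G t - \<Psi> t))\<^sup>2)"
proof (rule residual_var[OF G B])
  fix Cw assume Cw: "(0::real) \<le> Cw"
    and var: "\<And>\<Psi> I. integrable lborel \<Psi> \<Longrightarrow>
       integrable lborel (\<lambda>t. (cmod (\<Psi> t))\<^sup>2) \<Longrightarrow> finite I \<Longrightarrow>
       (LINT w|M. (csum (\<lambda>i w. G (lp a i w) - synth \<Psi> (lp a i w)) I w)\<^sup>2)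
         \<le> real (card I) * (Cw * (LBINT t. (cmod (coft G t - \<Psi> t))\<^sup>2))"
  have [measurable]: "G \<in> borel_measurable borel" using borel_measurable_integrable[OF G] by simp
  show ?thesis
  proof (intro exI[of _ "sqrt Cw"] conjI allI impI)
    show "0 \<le> sqrt Cw" using Cw by simp
    fix \<Psi> :: "real \<Rightarrow> complex" and I :: "int set"
    assume \<Psi>: "integrable lborel \<Psi>" and \<Psi>2: "integrable lborel (\<lambda>t. (cmod (\<Psi> t))\<^sup>2)" and I: "finite I"
    have [measurable]: "\<Psi> \<in> borel_measurable borel" using borel_measurable_integrable[OF \<Psi>] by simp
    define Z where "Z = (\<lambda>i w. G (lp a i w) - synth \<Psi> (lp a i w))"
    have [measurable]: "Z i \<in> borel_measurable M" for i unfolding Z_def by measurable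
    have ZB: "\<bar>Z i w\<bar> \<le> B + (LBINT t. cmod (\<Psi> t))" for i w
      using B[of "lp a i w"] abs_synth_le[of \<Psi> "lp a i w"] unfolding Z_def by linarith
    have "csum (\<lambda>i w. G (lp a i w)) I w - csum (\<lambda>i w. synth \<Psi> (lp a i w)) I w = csum Z I w" for w
      unfolding Z_def by (rule csum_diff[symmetric, OF _ _ B abs_synth_le]) measurable
    then have "(LINT w|M. \<bar>csum (\<lambda>i w. G (lp a i w)) I w - csum (\<lambda>i w. synth \<Psi> (lp a i w)) I w\<bar>) = (LINT w|M. \<bar>csum Z I w\<bar>)"
      by simp
    also have "\<dots> \<le> sqrt (LINT w|M. (csum Z I w)\<^sup>2)"
      by (rule L1_le_L2(2)[OF _ csum_sq_integrable[OF _ ZB]]) measurable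
    also have "\<dots> \<le> sqrt (real (card I) * (Cw * (LBINT t. (cmod (coft G t - \<Psi> t))\<^sup>2)))"
      using var[OF \<Psi> \<Psi>2 I] unfolding Z_def by (rule real_sqrt_le_mono)
    also have "\<dots> = sqrt Cw * sqrt (real (card I)) * sqrt (LBINT t. (cmod (coft G t - \<Psi> t))\<^sup>2)"
      by (simp add: real_sqrt_mult)
    finally show "(LINT w|M. \<bar>csum (\<lambda>i w. G (lp a i w)) I w - csum (\<lambda>i w. synth \<Psi> (lp a i w)) I w\<bar>)
       \<le> sqrt Cw * sqrt (real (card I)) * sqrt (LBINT t. (cmod (coft G t - \<Psi> t))\<^sup>2)" .
  qed
qed

context two_sample
begin

lemma linearization_L1:
  "\<exists>c\<ge>0. \<forall>n\<ge>2. (LINT w|M. \<bar>Dq n w - (LINT w'|M. Dq n w') - lin n w\<bar>) \<le> c / (real n * h n)"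
proof -
  obtain Qx where Qx: "0 \<le> Qx" "\<forall>n. \<forall>h. 0 < h \<and> h \<le> H \<longrightarrow> integrable M (X.quad h n) \<and> (LINT w|M. X.quad h n w) \<le> real n * (Qx / h)"
    using X.quad_bound by blast
  obtain Qy where Qy: "0 \<le> Qy" "\<forall>n. \<forall>h. 0 < h \<and> h \<le> H \<longrightarrow> integrable M (Y.quad h n) \<and> (LINT w|M. Y.quad h n w) \<le> real n * (Qy / h)"
    using Y.quad_bound by blast
  define k where "k = (LBINT t. \<bar>\<kappa> t\<bar>) / (2 * pi)"
  have k0: "0 \<le> k" unfolding k_def by simp
  \<comment> \<open>The 4 k comes from 2 (n + 1) \<le> 4 n in the deterministic part of
    \<open>rem\<close>.\<close>
  define c where "c = 4 * k + 3 * Qx + 3 * Qy"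
  have c0: "0 \<le> c" using k0 Qx Qy by (simp add: c_def)
  show ?thesis
  \<comment> \<open>One factor 2 is due to the centring in \<open>centered_abs_le\<close>, the other
    to n - 1 \<ge> n / 2.\<close>
  proof (intro exI[of _ "4 * c"] conjI allI impI)
    show "0 \<le> 4 * c" using c0 by simp
    fix n :: nat assume n: "2 \<le> n"
    have hn: "0 < h n" "h n \<le> H" using h_pos h_le n by auto
    have q: "integrable M (X.quad (h n) n)" "integrable M (Y.quad (h n) n)"
      "(LINT w|M. X.quad (h n) n w) \<le> real n * (Qx / h n)" "(LINT w|M. Y.quad (h n) n w) \<le> real n * (Qy / h n)"
      using Qx(2) Qy(2) hn by auto
    have ri: "integrable M (rem n)" unfolding rem_def using q by simp
    have nn: "0 < real n * (real n - 1)" using n by simp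
    have Ex: "\<And>w. w \<in> space M \<Longrightarrow> \<bar>Dq n w - center n - lin n w\<bar> \<le> rem n w" by (rule Dq_linearization[OF n])
    have "(LINT w|M. \<bar>Dq n w - (LINT w'|M. Dq n w') - lin n w\<bar>) \<le> 2 * (LINT w|M. rem n w)"
      by (rule centered_abs_le[OF Dq_int lin_mean_zero ri Ex]) (use n in auto)
    also have "(LINT w|M. rem n w) = (2 * (real n + 1) * (k / h n) + 3 * (LINT w|M. X.quad (h n) n w) + 3 * (LINT w|M. Y.quad (h n) n w)) / (real n * (real n - 1))"
      unfolding rem_def q_norm[OF hn(1)] k_def[symmetric] using q by (simp add: prob_space)
    also have "\<dots> \<le> (real n * (c / h n)) / (real n * (real n - 1))"
    proof (rule divide_right_mono)
      have "2 * (real n + 1) * (k / h n) \<le> 4 * real n * (k / h n)"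
        using n k0 hn by (intro mult_right_mono) auto
      then have "2 * (real n + 1) * (k / h n) + 3 * (LINT w|M. X.quad (h n) n w) + 3 * (LINT w|M. Y.quad (h n) n w)
        \<le> 4 * real n * (k / h n) + 3 * (real n * (Qx / h n)) + 3 * (real n * (Qy / h n))" using q by linarith
      also have "\<dots> = real n * (c / h n)" by (simp add: c_def add_divide_distrib algebra_simps)
      finally show "2 * (real n + 1) * (k / h n) + 3 * (LINT w|M. X.quad (h n) n w) + 3 * (LINT w|M. Y.quad (h n) n w) \<le> real n * (c / h n)" .
    qed (use nn in simp)
    also have "\<dots> = (c / h n) / (real n - 1)" using n by simp
    also have "\<dots> \<le> (c / h n) / (real n / 2)"
      using n c0 hn by (intro divide_left_mono divide_nonneg_pos mult_pos_pos) auto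
    finally show "(LINT w|M. \<bar>Dq n w - (LINT w'|M. Dq n w') - lin n w\<bar>) \<le> 4 * c / (real n * h n)"
      by (simp add: mult.commute)
  qed
qed

text \<open>Here \<kappa> - 1 is squared together with the transform, so it is estimated with
  exponent \<gamma> only. This explains the power \<gamma> of the bandwidth in the linear part
  against 2 \<gamma> in the bias.\<close>

lemma coft_Psi_L2:
  assumes n: "1 \<le> n"
  shows "(LBINT t. (cmod (coft G t - Psi n t))\<^sup>2) \<le> (Km * h n powr \<gamma>)\<^sup>2 * Wt"
proof -
  have hn: "0 < h n" using h_pos n by simp
  have "(LBINT t. (cmod (coft G t - Psi n t))\<^sup>2) \<le> (LBINT t. (Km * h n powr \<gamma>)\<^sup>2 * (\<bar>t\<bar> powr (2 * \<gamma>) * (cmod (fourier G t))\<^sup>2))"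
  proof (rule integral_mono')
    show "integrable lborel (\<lambda>t. (Km * h n powr \<gamma>)\<^sup>2 * (\<bar>t\<bar> powr (2 * \<gamma>) * (cmod (fourier G t))\<^sup>2))"
      by (rule integrable_mult_right[OF fourier_G_weighted])
    fix t
    have k: "\<bar>\<kappa> (h n * t) - 1\<bar> \<le> Km * h n powr \<gamma> * \<bar>t\<bar> powr \<gamma>"
    proof -
      have "\<bar>\<kappa> (h n * t) - 1\<bar> \<le> Km * \<bar>h n * t\<bar> powr \<gamma>"
        by (rule \<kappa>_minus_one_le) (use X.\<gamma>_pos X.\<gamma>_le in auto)
      also have "\<dots> = Km * h n powr \<gamma> * \<bar>t\<bar> powr \<gamma>" using hn by (simp only: abs_mult powr_mult abs_of_pos mult.assoc)
      finally show ?thesis .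
    qed
    have c: "cmod (coft G t) \<le> cmod (fourier G t)"
    proof -
      have "cmod (coft G t) = cmod (fourier G t) / (2 * pi)" by (simp add: coft_def norm_mult norm_divide)
      also have "\<dots> \<le> cmod (fourier G t) / 1" using pi_ge_two by (intro divide_left_mono) auto
      finally show ?thesis by simp
    qed
    have "coft G t - Psi n t = complex_of_real (1 - \<kappa> (h n * t)) * coft G t"
      by (simp add: Psi_def algebra_simps)
    then have "cmod (coft G t - Psi n t) = \<bar>\<kappa> (h n * t) - 1\<bar> * cmod (coft G t)"
      by (simp only: norm_mult norm_of_real abs_minus_commute)
    also have "\<dots> \<le> (Km * h n powr \<gamma> * \<bar>t\<bar> powr \<gamma>) * cmod (fourier G t)"
      using k c Km_nonneg by (intro mult_mono) auto
    finally have "(cmod (coft G t - Psi n t))\<^sup>2 \<le> ((Km * h n powr \<gamma> * \<bar>t\<bar> powr \<gamma>) * cmod (fourier G t))\<^sup>2"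
      by (rule power_mono) simp
    then show "(cmod (coft G t - Psi n t))\<^sup>2 \<le> (Km * h n powr \<gamma>)\<^sup>2 * (\<bar>t\<bar> powr (2 * \<gamma>) * (cmod (fourier G t))\<^sup>2)"
      unfolding powr_twice[symmetric] power_mult_distrib[symmetric] by (simp only: mult.assoc)
  qed simp
  then show ?thesis by (simp add: Wt_def)
qed

definition avg :: "nat \<Rightarrow> 'a \<Rightarrow> real" where
  "avg n w = 2 / real n * (csum (\<lambda>i w. G (x i w)) {1..int n} w - csum (\<lambda>i w. G (y i w)) {1..int n} w)"

text \<open>The integrals in \<open>W\<close> are exactly the means of f and g along the two
  processes: for instance f has the mean of f^2 under its own density and the mean of f g under g.
  So the \<open>W\<close> are centred values of G = f - g along x, minus those along y, times
  2.\<close>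

lemma W_sum: "(\<Sum>i\<in>{1..int n}. W f g x y i w)
  = 2 * (csum (\<lambda>i w. G (x i w)) {1..int n} w - csum (\<lambda>i w. G (y i w)) {1..int n} w)"
proof -
  have i: "integrable lborel (\<lambda>z. (f z)\<^sup>2)" "integrable lborel (\<lambda>z. (g z)\<^sup>2)" "integrable lborel (\<lambda>z. f z * g z)"
  proof -
    show "integrable lborel (\<lambda>z. (f z)\<^sup>2)" unfolding power2_eq_square
      by (rule integrable_mult_bounded[OF X.f_int, where B=Fb]) (use X.f_abs in auto)
    show "integrable lborel (\<lambda>z. (g z)\<^sup>2)" unfolding power2_eq_square
      by (rule integrable_mult_bounded[OF Y.f_int, where B=Gb]) (use Y.f_abs in auto)
    show "integrable lborel (\<lambda>z. f z * g z)"
      by (rule integrable_mult_bounded[OF X.f_int, where B=Gb]) (use Y.f_abs in auto)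
  qed
  have 1: "(LINT w|M. G (x i w)) = (LINT z|lborel. (f z)\<^sup>2) - (LINT z|lborel. f z * g z)" for i
  proof -
    have "(LINT w|M. G (x i w)) = (LINT z|lborel. (f z)\<^sup>2 - f z * g z)"
      unfolding X.E_dens[OF G_meas] by (simp add: G_def algebra_simps power2_eq_square)
    then show ?thesis using i by simp
  qed
  have 2: "(LINT w|M. G (y i w)) = (LINT z|lborel. f z * g z) - (LINT z|lborel. (g z)\<^sup>2)" for i
  proof -
    have "(LINT w|M. G (y i w)) = (LINT z|lborel. f z * g z - (g z)\<^sup>2)"
      unfolding Y.E_dens[OF G_meas] by (simp add: G_def algebra_simps power2_eq_square)
    then show ?thesis using i by simp
  qed
  have "W f g x y i w = 2 * ((G (x i w) - (LINT w|M. G (x i w))) - (G (y i w) - (LINT w|M. G (y i w))))" for i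
    unfolding W_def 1 2 by (simp add: G_def)
  then show ?thesis unfolding csum_def by (simp only: sum_distrib_left sum_subtractf[symmetric])
qed

lemma csum_G_int: "integrable M (csum (\<lambda>i w. G (x i w)) I)" "integrable M (csum (\<lambda>i w. G (y i w)) I)"
  and csum_G_mean: "(LINT w|M. csum (\<lambda>i w. G (x i w)) I w) = 0" "(LINT w|M. csum (\<lambda>i w. G (y i w)) I w) = 0"
  by (rule csum_mean_zero[OF _ G_bounded]; measurable)+

lemma avg_meas [measurable]: "avg n \<in> borel_measurable M"
  unfolding avg_def by measurable

lemma avg_int: "integrable M (avg n)"
  unfolding avg_def using csum_G_int by simp

text \<open>Both processes contribute the residual between G and its smoothing. Its L1 norm is at
  most the L2 norm, of order the square root of n times the distance in \<open>coft_Psi_L2\<close>;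
  division by n leaves the rate.\<close>

lemma lin_avg_L1: "\<exists>c\<ge>0. \<forall>n\<ge>1. (LINT \<omega>|M. \<bar>lin n \<omega> - avg n \<omega>\<bar>) \<le> c * (h n powr \<gamma> / sqrt (real n))"
proof -
  obtain cx where cx: "0 \<le> cx" "\<forall>\<Psi> I. integrable lborel \<Psi> \<longrightarrow> integrable lborel (\<lambda>t. (cmod (\<Psi> t))\<^sup>2) \<longrightarrow> finite I \<longrightarrow>
     (LINT \<omega>|M. \<bar>csum (\<lambda>i \<omega>. G (x i \<omega>)) I \<omega> - csum (\<lambda>i \<omega>. synth \<Psi> (x i \<omega>)) I \<omega>\<bar>)
       \<le> cx * sqrt (real (card I)) * sqrt (LBINT t. (cmod (coft G t - \<Psi> t))\<^sup>2)"
    using X.csum_residual_L1[OF G_int G_bounded] by blast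
  obtain cy where cy: "0 \<le> cy" "\<forall>\<Psi> I. integrable lborel \<Psi> \<longrightarrow> integrable lborel (\<lambda>t. (cmod (\<Psi> t))\<^sup>2) \<longrightarrow> finite I \<longrightarrow>
     (LINT \<omega>|M. \<bar>csum (\<lambda>i \<omega>. G (y i \<omega>)) I \<omega> - csum (\<lambda>i \<omega>. synth \<Psi> (y i \<omega>)) I \<omega>\<bar>)
       \<le> cy * sqrt (real (card I)) * sqrt (LBINT t. (cmod (coft G t - \<Psi> t))\<^sup>2)"
    using Y.csum_residual_L1[OF G_int G_bounded] by blast
  define w where "w = Km * sqrt Wt"
  have w0: "0 \<le> w" using Km_nonneg Wt0 by (simp add: w_def)
  show ?thesis
  proof (intro exI[of _ "2 * (cx + cy) * w"] conjI allI impI)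
    show "0 \<le> 2 * (cx + cy) * w" using cx cy w0 by simp
    fix n :: nat assume n: "1 \<le> n"
    define sx where "sx \<omega> = csum (\<lambda>i \<omega>. G (x i \<omega>)) {1..int n} \<omega> - csum (\<lambda>i \<omega>. synth (Psi n) (x i \<omega>)) {1..int n} \<omega>" for \<omega>
    define sy where "sy \<omega> = csum (\<lambda>i \<omega>. G (y i \<omega>)) {1..int n} \<omega> - csum (\<lambda>i \<omega>. synth (Psi n) (y i \<omega>)) {1..int n} \<omega>" for \<omega>
    have "integrable M (csum (\<lambda>i \<omega>. synth (Psi n) (x i \<omega>)) {1..int n})" "integrable M (csum (\<lambda>i \<omega>. synth (Psi n) (y i \<omega>)) {1..int n})"
      by (rule csum_mean_zero[OF _ abs_synth_le]; measurable)+
    then have si: "integrable M sx" "integrable M sy" unfolding sx_def[abs_def] sy_def[abs_def] using csum_G_int by auto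
    have "sqrt (LBINT t. (cmod (coft G t - Psi n t))\<^sup>2) \<le> sqrt ((Km * h n powr \<gamma>)\<^sup>2 * Wt)"
      using coft_Psi_L2[OF n] by (rule real_sqrt_le_mono)
    also have "\<dots> = w * h n powr \<gamma>" using Km_nonneg by (simp add: real_sqrt_mult w_def)
    finally have J: "sqrt (LBINT t. (cmod (coft G t - Psi n t))\<^sup>2) \<le> w * h n powr \<gamma>" .
    have "(LINT \<omega>|M. \<bar>sx \<omega>\<bar>) \<le> cx * sqrt (real (card {1..int n})) * sqrt (LBINT t. (cmod (coft G t - Psi n t))\<^sup>2)"
      unfolding sx_def using cx(2) Psi_int[OF n] Psi_sq_int[OF n] by blast
    also have "\<dots> \<le> cx * sqrt (real n) * (w * h n powr \<gamma>)"
      using J cx(1) by (simp add: mult_left_mono)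
    finally have ex: "(LINT \<omega>|M. \<bar>sx \<omega>\<bar>) \<le> cx * sqrt (real n) * (w * h n powr \<gamma>)" .
    have "(LINT \<omega>|M. \<bar>sy \<omega>\<bar>) \<le> cy * sqrt (real (card {1..int n})) * sqrt (LBINT t. (cmod (coft G t - Psi n t))\<^sup>2)"
      unfolding sy_def using cy(2) Psi_int[OF n] Psi_sq_int[OF n] by blast
    also have "\<dots> \<le> cy * sqrt (real n) * (w * h n powr \<gamma>)"
      using J cy(1) by (simp add: mult_left_mono)
    finally have ey: "(LINT \<omega>|M. \<bar>sy \<omega>\<bar>) \<le> cy * sqrt (real n) * (w * h n powr \<gamma>)" .
    have "(LINT \<omega>|M. \<bar>lin n \<omega> - avg n \<omega>\<bar>) \<le> (LINT \<omega>|M. 2 / real n * (\<bar>sx \<omega>\<bar> + \<bar>sy \<omega>\<bar>))"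
    proof (rule integral_mono')
      show "integrable M (\<lambda>\<omega>. 2 / real n * (\<bar>sx \<omega>\<bar> + \<bar>sy \<omega>\<bar>))" using si by simp
      fix \<omega>
      have "lin n \<omega> - avg n \<omega> = 2 / real n * (sy \<omega> - sx \<omega>)"
        unfolding lin_def avg_def sx_def sy_def right_diff_distrib[symmetric] by simp
      then have "\<bar>lin n \<omega> - avg n \<omega>\<bar> = 2 / real n * \<bar>sy \<omega> - sx \<omega>\<bar>" by (simp only: abs_mult) simp
      also have "\<dots> \<le> 2 / real n * (\<bar>sx \<omega>\<bar> + \<bar>sy \<omega>\<bar>)" by (rule mult_left_mono) auto
      finally show "\<bar>lin n \<omega> - avg n \<omega>\<bar> \<le> 2 / real n * (\<bar>sx \<omega>\<bar> + \<bar>sy \<omega>\<bar>)" .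
    qed auto
    also have "\<dots> = 2 / real n * ((LINT \<omega>|M. \<bar>sx \<omega>\<bar>) + (LINT \<omega>|M. \<bar>sy \<omega>\<bar>))" using si by simp
    also have "\<dots> \<le> 2 / real n * (cx * sqrt (real n) * (w * h n powr \<gamma>) + cy * sqrt (real n) * (w * h n powr \<gamma>))"
      using ex ey by (intro mult_left_mono add_mono) auto
    also have "\<dots> = 2 * (cx + cy) * w * (h n powr \<gamma> / (real n / sqrt (real n)))" by (simp add: field_simps)
    also have "real n / sqrt (real n) = sqrt (real n)" by (rule real_div_sqrt) simp
    finally show "(LINT \<omega>|M. \<bar>lin n \<omega> - avg n \<omega>\<bar>) \<le> 2 * (cx + cy) * w * (h n powr \<gamma> / sqrt (real n))" .
  qed
qed

lemma linearization_bound: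
  "\<exists>c>0. \<forall>n\<ge>2. (LINT w|M. \<bar>D_hat K x y h n w - (LINT w'|M. D_hat K x y h n w') - 1 / real n * (\<Sum>i\<in>{1..int n}. W f g x y i w)\<bar>)
     \<le> c * (1 / (real n * h n) + h n powr \<gamma> / sqrt (real n))"
proof -
  obtain c1 where c1: "0 \<le> c1" "\<forall>n\<ge>2. (LINT w|M. \<bar>Dq n w - (LINT w'|M. Dq n w') - lin n w\<bar>) \<le> c1 / (real n * h n)"
    using linearization_L1 by blast
  obtain c2 where c2: "0 \<le> c2" "\<forall>n\<ge>1. (LINT w|M. \<bar>lin n w - avg n w\<bar>) \<le> c2 * (h n powr \<gamma> / sqrt (real n))"
    using lin_avg_L1 by blast
  show ?thesis
  proof (intro exI[of _ "c1 + c2 + 1"] conjI allI impI)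
    show "0 < c1 + c2 + 1" using c1 c2 by simp
    fix n :: nat assume n: "2 \<le> n"
    define m where "m = (LINT w'|M. Dq n w')"
    have hn: "0 < h n" using h_pos n by simp
    have i: "integrable M (\<lambda>w. Dq n w - m - lin n w)" "integrable M (\<lambda>w. lin n w - avg n w)"
      using Dq_int[of n] lin_mean_zero(1) avg_int n by auto
    have "(LINT w|M. \<bar>D_hat K x y h n w - (LINT w'|M. D_hat K x y h n w') - 1 / real n * (\<Sum>i\<in>{1..int n}. W f g x y i w)\<bar>)
       = (LINT w|M. \<bar>Dq n w - m - avg n w\<bar>)"
    proof (rule integral_cong_AE)
      show "AE w in M. \<bar>D_hat K x y h n w - (LINT w'|M. D_hat K x y h n w') - 1 / real n * (\<Sum>i\<in>{1..int n}. W f g x y i w)\<bar> = \<bar>Dq n w - m - avg n w\<bar>"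
        using D_hat_AE[of n] n by (auto simp: D_hat_expectation m_def W_sum avg_def elim: AE_mp)
      show "(\<lambda>w. \<bar>D_hat K x y h n w - (LINT w'|M. D_hat K x y h n w') - 1 / real n * (\<Sum>i\<in>{1..int n}. W f g x y i w)\<bar>) \<in> borel_measurable M"
        unfolding W_sum by measurable
    qed measurable
    also have "\<dots> \<le> (LINT w|M. \<bar>Dq n w - m - lin n w\<bar> + \<bar>lin n w - avg n w\<bar>)"
      by (rule integral_mono') (use i in auto)
    also have "\<dots> = (LINT w|M. \<bar>Dq n w - m - lin n w\<bar>) + (LINT w|M. \<bar>lin n w - avg n w\<bar>)" using i by simp
    also have "\<dots> \<le> c1 / (real n * h n) + c2 * (h n powr \<gamma> / sqrt (real n))"
      using c1(2) c2(2) n unfolding m_def by (intro add_mono) auto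
    also have "\<dots> \<le> (c1 + c2 + 1) * (1 / (real n * h n)) + (c1 + c2 + 1) * (h n powr \<gamma> / sqrt (real n))"
    proof (rule add_mono)
      have "c1 * (1 / (real n * h n)) \<le> (c1 + c2 + 1) * (1 / (real n * h n))"
        using c1(1) c2(1) hn by (intro mult_right_mono) auto
      then show "c1 / (real n * h n) \<le> (c1 + c2 + 1) * (1 / (real n * h n))" by simp
      show "c2 * (h n powr \<gamma> / sqrt (real n)) \<le> (c1 + c2 + 1) * (h n powr \<gamma> / sqrt (real n))"
        using c1(1) c2(1) by (intro mult_right_mono) auto
    qed
    finally show "(LINT w|M. \<bar>D_hat K x y h n w - (LINT w'|M. D_hat K x y h n w') - 1 / real n * (\<Sum>i\<in>{1..int n}. W f g x y i w)\<bar>)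
      \<le> (c1 + c2 + 1) * (1 / (real n * h n) + h n powr \<gamma> / sqrt (real n))" by (simp only: distrib_left)
  qed
qed

end

lemma char_centered_normal:
  assumes "0 < s"
  shows "real_distribution (density lborel (\<lambda>x. ennreal (normal_density 0 s x)))"
    and "char (density lborel (\<lambda>x. ennreal (normal_density 0 s x))) t = complex_of_real (exp (- (s * t)\<^sup>2 / 2))"
proof -
  interpret N: real_distribution std_normal_distribution by (rule real_dist_normal_dist)
  have "distributed std_normal_distribution lborel (\<lambda>x. x) (\<lambda>x. ennreal (std_normal_density x))"
    unfolding distributed_def by (auto simp: distr_id2)
  then have "distributed std_normal_distribution lborel (\<lambda>x. 0 + s * x) (\<lambda>x. ennreal (normal_density (0 + s * 0) (\<bar>s\<bar> * 1) x))"
    by (rule N.normal_density_affine) (use assms in auto)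
  then have "distributed std_normal_distribution lborel (\<lambda>x. s * x) (\<lambda>x. ennreal (normal_density 0 s x))"
    using assms by simp
  then have "distr std_normal_distribution lborel (\<lambda>x. s * x) = density lborel (\<lambda>x. ennreal (normal_density 0 s x))"
    by (simp add: distributed_def)
  moreover have "distr std_normal_distribution lborel (\<lambda>x. s * x) = distr std_normal_distribution borel (\<lambda>x. s * x)"
    by (rule distr_cong) auto
  ultimately have d: "density lborel (\<lambda>x. ennreal (normal_density 0 s x)) = distr std_normal_distribution borel (\<lambda>x. s * x)"
    by simp
  show "real_distribution (density lborel (\<lambda>x. ennreal (normal_density 0 s x)))"
    unfolding d by (rule N.real_distribution_distr) simp
  have "char (density lborel (\<lambda>x. ennreal (normal_density 0 s x))) t = char std_normal_distribution (s * t)"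
    unfolding d char_def by (subst integral_distr) (auto simp: mult_ac)
  then show "char (density lborel (\<lambda>x. ennreal (normal_density 0 s x))) t = complex_of_real (exp (- (s * t)\<^sup>2 / 2))"
    by (simp add: char_std_normal_distribution)
qed

lemma (in prob_space) weak_conv_of_char:
  assumes "\<And>n. Z n \<in> borel_measurable M" and "real_distribution N"
    and "\<And>t. (\<lambda>n. CLINT w|M. iexp (t * Z n w)) \<longlonglongrightarrow> char N t"
  shows "weak_conv_m (\<lambda>n. distr M borel (Z n)) N"
proof (rule levy_continuity)
  show "real_distribution (distr M borel (Z n))" for n by (rule real_distribution_distr) fact
  have "char (distr M borel (Z n)) t = (CLINT w|M. iexp (t * Z n w))" for n t
    unfolding char_def using assms(1)[of n] by (subst integral_distr) auto
  then show "(\<lambda>n. char (distr M borel (Z n)) t) \<longlonglongrightarrow> char N t" for t using assms(3) by simp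
qed fact

section \<open>Limit law of the estimator\<close>

context two_sample
begin

definition Tx :: "nat \<Rightarrow> 'a \<Rightarrow> real" where "Tx n w = csum (\<lambda>i w. G (x i w)) {1..int n} w / sqrt (real n)"
definition Ty :: "nat \<Rightarrow> 'a \<Rightarrow> real" where "Ty n w = csum (\<lambda>i w. G (y i w)) {1..int n} w / sqrt (real n)"

lemma T_meas [measurable]: "Tx n \<in> borel_measurable M" "Ty n \<in> borel_measurable M"
  unfolding Tx_def Ty_def by measurable

text \<open>Exhibits \<open>Tx\<close> and \<open>Ty\<close> as bounded measurable functions of
  whole trajectories, the form in which independence of the two processes can be applied.\<close>

definition cs :: "(int \<Rightarrow> real) \<Rightarrow> nat \<Rightarrow> (int \<Rightarrow> real) \<Rightarrow> real" where
  "cs m n v = (\<Sum>i\<in>{1..int n}. G (v i) - m i) / sqrt (real n)"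

lemma cs_meas [measurable]: "cs m n \<in> borel_measurable (PiM UNIV (\<lambda>_. borel))"
  unfolding cs_def by measurable

lemma T_cs: "Tx n w = cs (\<lambda>i. LINT w|M. G (x i w)) n (\<lambda>i. x i w)" "Ty n w = cs (\<lambda>i. LINT w|M. G (y i w)) n (\<lambda>i. y i w)"
  unfolding Tx_def Ty_def csum_def cs_def by simp_all

lemma cs_bounded:
  assumes "\<And>i. \<bar>m i\<bar> \<le> Fb + Gb"
  shows "\<bar>cs m n v\<bar> \<le> real n * (2 * (Fb + Gb)) / sqrt (real n)"
proof -
  have "\<bar>\<Sum>i\<in>{1..int n}. G (v i) - m i\<bar> \<le> (\<Sum>i\<in>{1..int n}. 2 * (Fb + Gb))"
  proof (rule order_trans[OF sum_abs sum_mono])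
    fix i
    have "\<bar>G (v i) - m i\<bar> \<le> \<bar>G (v i)\<bar> + \<bar>m i\<bar>" by (rule abs_triangle_ineq4)
    also have "\<dots> \<le> (Fb + Gb) + (Fb + Gb)" by (intro add_mono[OF G_bounded assms])
    finally show "\<bar>G (v i) - m i\<bar> \<le> 2 * (Fb + Gb)" by simp
  qed
  then show ?thesis unfolding cs_def abs_divide by (simp add: divide_right_mono)
qed

lemma G_mean_bounded: "\<bar>LINT w|M. G (x i w)\<bar> \<le> Fb + Gb" "\<bar>LINT w|M. G (y i w)\<bar> \<le> Fb + Gb"
proof -
  have "\<bar>LINT w|M. G (u w)\<bar> \<le> Fb + Gb" if [measurable]: "u \<in> borel_measurable M" for u
  proof -
    have "\<bar>LINT w|M. G (u w)\<bar> \<le> (LINT w|M. \<bar>G (u w)\<bar>)" by (rule integral_abs_bound)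
    also have "\<dots> \<le> (LINT w|M. Fb + Gb)"
    proof (rule integral_mono')
      show "0 \<le> Fb + Gb" using X.Fb0 Y.Fb0 by simp
    qed (use G_bounded in auto)
    finally show ?thesis by (simp add: prob_space)
  qed
  then show "\<bar>LINT w|M. G (x i w)\<bar> \<le> Fb + Gb" "\<bar>LINT w|M. G (y i w)\<bar> \<le> Fb + Gb" by auto
qed

lemma T_product: "(LINT w|M. Tx n w * Ty n w) = 0"
proof -
  have "(LINT w|M. Tx n w * Ty n w) = (LINT w|M. Tx n w) * (LINT w|M. Ty n w)"
    unfolding T_cs
  proof (rule expectation_indep)
    show "norm (cs (\<lambda>i. LINT w|M. G (x i w)) n v) \<le> real n * (2 * (Fb + Gb)) / sqrt (real n)" for v
      unfolding real_norm_def by (intro cs_bounded G_mean_bounded)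
    show "norm (cs (\<lambda>i. LINT w|M. G (y i w)) n v) \<le> real n * (2 * (Fb + Gb)) / sqrt (real n)" for v
      unfolding real_norm_def by (intro cs_bounded G_mean_bounded)
  qed measurable
  then show ?thesis unfolding Tx_def using csum_G_mean by simp
qed

lemma T_char: "(CLINT w|M. iexp (t * (2 * (Tx n w - Ty n w)))) = (CLINT w|M. iexp (2 * t * Tx n w)) * (CLINT w|M. iexp (- 2 * t * Ty n w))"
proof -
  have "(CLINT w|M. iexp (t * (2 * (Tx n w - Ty n w)))) = (CLINT w|M. iexp (2 * t * Tx n w) * iexp (- 2 * t * Ty n w))"
    by (intro Bochner_Integration.integral_cong refl) (simp add: algebra_simps exp_add[symmetric])
  also have "\<dots> = (CLINT w|M. iexp (2 * t * Tx n w)) * (CLINT w|M. iexp (- 2 * t * Ty n w))"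
    unfolding T_cs by (rule expectation_indep[where B=1 and B'=1]) auto
  finally show ?thesis .
qed

lemma T_sq_int: "integrable M (\<lambda>w. (Tx n w)\<^sup>2)" "integrable M (\<lambda>w. (Ty n w)\<^sup>2)" "integrable M (\<lambda>w. Tx n w * Ty n w)"
proof -
  show i: "integrable M (\<lambda>w. (Tx n w)\<^sup>2)" "integrable M (\<lambda>w. (Ty n w)\<^sup>2)"
    unfolding Tx_def Ty_def power_divide
    by (intro integrable_divide csum_sq_integrable[OF _ G_bounded]; measurable)+
  show "integrable M (\<lambda>w. Tx n w * Ty n w)"
    by (rule integrable_mult_of_squares) (use i in auto)
qed

text \<open>The mixed moment vanishes by independence, so the normalised variance of the sum of the
  \<open>W\<close> is governed by the second moments of \<open>Tx\<close> and \<open>Ty\<close>,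
  whose limits come with the central limit theorems. This ties the vanishing of the long-run
  variance to that of the limiting variance; the 4 is the one in N(0, 4 \<sigma>^2).\<close>

lemma W_variance:
  assumes n: "1 \<le> n"
  shows "variance (\<lambda>w. \<Sum>i\<in>{1..int n}. W f g x y i w) / real n = 4 * ((LINT w|M. (Tx n w)\<^sup>2) + (LINT w|M. (Ty n w)\<^sup>2))"
proof -
  have e: "(\<Sum>i\<in>{1..int n}. W f g x y i w) = 2 * sqrt (real n) * (Tx n w - Ty n w)" for w
    unfolding W_sum Tx_def Ty_def diff_divide_distrib[symmetric] using n by simp
  have m: "(LINT w|M. 2 * sqrt (real n) * (Tx n w - Ty n w)) = 0"
    unfolding Tx_def Ty_def using csum_G_int csum_G_mean by simp
  have "variance (\<lambda>w. \<Sum>i\<in>{1..int n}. W f g x y i w) = (LINT w|M. (2 * sqrt (real n) * (Tx n w - Ty n w))\<^sup>2)"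
    unfolding e m by simp
  also have "\<dots> = (LINT w|M. 4 * real n * ((Tx n w)\<^sup>2 + (Ty n w)\<^sup>2 - 2 * (Tx n w * Ty n w)))"
    by (intro Bochner_Integration.integral_cong refl) (simp add: power_mult_distrib power2_diff)
  also have "\<dots> = 4 * real n * ((LINT w|M. (Tx n w)\<^sup>2) + (LINT w|M. (Ty n w)\<^sup>2))"
    using T_sq_int[of n] T_product[of n] by simp
  finally show ?thesis using n by simp
qed

text \<open>By independence the limits of \<open>Tx\<close> and \<open>Ty\<close> combine on the
  level of characteristic functions and their variances add up to \<sigma>2. Replacing the estimator
  by its linear part costs 1 / (sqrt(n) h) + h^\<gamma> in L1 after multiplication by sqrt(n); this
  is where the bandwidth condition enters. The limit is stated through its characteristic function
  so as to include \<sigma>2 = 0.\<close>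

lemma clt:
  assumes h0: "h \<longlonglongrightarrow> 0" and nh: "filterlim (\<lambda>n. sqrt (real n) * h n) at_top sequentially"
  defines "Z \<equiv> \<lambda>n w. sqrt (real n) * (D_hat K x y h n w - (LINT w'|M. D_hat K x y h n w'))"
  shows "\<exists>\<sigma>2\<ge>0. (vanishing_long_run_variance M (W f g x y) \<longleftrightarrow> \<sigma>2 = 0) \<and>
    (\<forall>t. (\<lambda>n. CLINT w|M. iexp (t * Z n w)) \<longlonglongrightarrow> complex_of_real (exp (- (sqrt (4 * \<sigma>2) * t)\<^sup>2 / 2)))"
proof -
  obtain sx where sx: "0 \<le> sx" "(\<lambda>n. LINT w|M. (Tx n w)\<^sup>2) \<longlonglongrightarrow> sx\<^sup>2"
    "\<forall>t. (\<lambda>n. CLINT w|M. iexp (t * Tx n w)) \<longlonglongrightarrow> complex_of_real (exp (- (sx * t)\<^sup>2 / 2))"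
    using X.process_clt[OF G_int G_bounded] unfolding Tx_def by blast
  obtain sy where sy: "0 \<le> sy" "(\<lambda>n. LINT w|M. (Ty n w)\<^sup>2) \<longlonglongrightarrow> sy\<^sup>2"
    "\<forall>t. (\<lambda>n. CLINT w|M. iexp (t * Ty n w)) \<longlonglongrightarrow> complex_of_real (exp (- (sy * t)\<^sup>2 / 2))"
    using Y.process_clt[OF G_int G_bounded] unfolding Ty_def by blast
  define \<sigma>2 where "\<sigma>2 = sx\<^sup>2 + sy\<^sup>2"
  have s0: "0 \<le> \<sigma>2" by (simp add: \<sigma>2_def)
  have var: "(\<lambda>n. variance (\<lambda>w. \<Sum>i\<in>{1..int n}. W f g x y i w) / real n) \<longlonglongrightarrow> 4 * \<sigma>2"
  proof (rule Lim_transform_eventually)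
    show "(\<lambda>n. 4 * ((LINT w|M. (Tx n w)\<^sup>2) + (LINT w|M. (Ty n w)\<^sup>2))) \<longlonglongrightarrow> 4 * \<sigma>2"
      unfolding \<sigma>2_def by (intro tendsto_intros sx sy)
    show "\<forall>\<^sub>F n in sequentially. 4 * ((LINT w|M. (Tx n w)\<^sup>2) + (LINT w|M. (Ty n w)\<^sup>2)) = variance (\<lambda>w. \<Sum>i\<in>{1..int n}. W f g x y i w) / real n"
      using eventually_ge_at_top[of 1] by eventually_elim (rule W_variance[symmetric])
  qed
  have van: "vanishing_long_run_variance M (W f g x y) \<longleftrightarrow> \<sigma>2 = 0"
    unfolding vanishing_long_run_variance_def using var LIMSEQ_unique by fastforce
  define U where "U n w = 2 * (Tx n w - Ty n w)" for n w
  have charU: "(\<lambda>n. CLINT w|M. iexp (t * U n w)) \<longlonglongrightarrow> complex_of_real (exp (- (sqrt (4 * \<sigma>2) * t)\<^sup>2 / 2))" for t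
  proof -
    have "(\<lambda>n. (CLINT w|M. iexp (2 * t * Tx n w)) * (CLINT w|M. iexp (- 2 * t * Ty n w)))
      \<longlonglongrightarrow> complex_of_real (exp (- (sx * (2 * t))\<^sup>2 / 2)) * complex_of_real (exp (- (sy * (- 2 * t))\<^sup>2 / 2))"
      using sx(3) sy(3) by (intro tendsto_mult) blast+
    also have "complex_of_real (exp (- (sx * (2 * t))\<^sup>2 / 2)) * complex_of_real (exp (- (sy * (- 2 * t))\<^sup>2 / 2))
      = complex_of_real (exp (- (sx * (2 * t))\<^sup>2 / 2 + - (sy * (- 2 * t))\<^sup>2 / 2))" by (simp only: exp_add of_real_mult)
    also have "- (sx * (2 * t))\<^sup>2 / 2 + - (sy * (- 2 * t))\<^sup>2 / 2 = - (sqrt (4 * \<sigma>2) * t)\<^sup>2 / 2"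
      using s0 by (simp add: power_mult_distrib) (simp add: \<sigma>2_def algebra_simps)
    finally show ?thesis unfolding U_def T_char .
  qed
  obtain c where c: "0 < c" "\<forall>n\<ge>2. (LINT w|M. \<bar>D_hat K x y h n w - (LINT w'|M. D_hat K x y h n w') - 1 / real n * (\<Sum>i\<in>{1..int n}. W f g x y i w)\<bar>)
     \<le> c * (1 / (real n * h n) + h n powr \<gamma> / sqrt (real n))"
    using linearization_bound by blast
  have Zm[measurable]: "Z n \<in> borel_measurable M" for n unfolding Z_def by measurable
  have Um[measurable]: "U n \<in> borel_measurable M" for n unfolding U_def by measurable
  have Zi: "integrable M (Z n)" if n: "1 \<le> n" for n
  proof -
    have "integrable M (D_hat K x y h n)"
      by (subst integrable_cong_AE[of _ _ "Dq n"]) (use D_hat_AE[OF n] Dq_int[OF n] in auto)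
    then show ?thesis unfolding Z_def by simp
  qed
  have Ui: "integrable M (U n)" for n unfolding U_def Tx_def Ty_def using csum_G_int by simp
  have diff: "(LINT w|M. \<bar>Z n w - U n w\<bar>) \<le> c * (1 / (sqrt (real n) * h n) + h n powr \<gamma>)" if n: "2 \<le> n" for n
  proof -
    have rn: "sqrt (real n) * sqrt (real n) = real n" by simp
    have nz: "sqrt (real n) \<noteq> 0" using n by simp
    have scale: "2 * (A / sqrt (real n) - B / sqrt (real n)) = sqrt (real n) * (1 / real n * (2 * (A - B)))" for A B
    proof -
      have "2 * (A / s - B / s) = s * (1 / (s * s) * (2 * (A - B)))" if "s \<noteq> 0" for s :: real
        using that by (simp add: field_simps)
      from this[OF nz] show ?thesis unfolding rn .
    qed
    have scale': "sqrt (real n) * (c * (1 / (real n * u) + v / sqrt (real n))) = c * (1 / (sqrt (real n) * u) + v)" if "u \<noteq> 0" for u v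
    proof -
      have "s * (c * (1 / (s * s * u) + v / s)) = c * (1 / (s * u) + v)" if "s \<noteq> 0" for s :: real
        using that \<open>u \<noteq> 0\<close> by (simp add: field_simps)
      from this[OF nz] show ?thesis unfolding rn .
    qed
    have "\<bar>Z n w - U n w\<bar> = sqrt (real n) * \<bar>D_hat K x y h n w - (LINT w'|M. D_hat K x y h n w') - 1 / real n * (\<Sum>i\<in>{1..int n}. W f g x y i w)\<bar>" for w
    proof -
      have "U n w = sqrt (real n) * (1 / real n * (\<Sum>i\<in>{1..int n}. W f g x y i w))"
        unfolding U_def W_sum Tx_def Ty_def by (rule scale)
      then have "Z n w - U n w = sqrt (real n) * (D_hat K x y h n w - (LINT w'|M. D_hat K x y h n w') - 1 / real n * (\<Sum>i\<in>{1..int n}. W f g x y i w))"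
        unfolding Z_def by (simp only: right_diff_distrib)
      then show ?thesis by (simp only: abs_mult) simp
    qed
    then have "(LINT w|M. \<bar>Z n w - U n w\<bar>) = sqrt (real n) * (LINT w|M. \<bar>D_hat K x y h n w - (LINT w'|M. D_hat K x y h n w') - 1 / real n * (\<Sum>i\<in>{1..int n}. W f g x y i w)\<bar>)"
      by (simp only: integral_mult_right_zero)
    also have "\<dots> \<le> sqrt (real n) * (c * (1 / (real n * h n) + h n powr \<gamma> / sqrt (real n)))"
      using c(2) n by (intro mult_left_mono) auto
    also have "\<dots> = c * (1 / (sqrt (real n) * h n) + h n powr \<gamma>)"
      by (rule scale') (use h_pos[of n] n in simp)
    finally show ?thesis .
  qed
  have lim0: "(\<lambda>n. c * (1 / (sqrt (real n) * h n) + h n powr \<gamma>)) \<longlonglongrightarrow> 0"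
  proof -
    have 1: "(\<lambda>n. 1 / (sqrt (real n) * h n)) \<longlonglongrightarrow> 0"
      using tendsto_inverse_0_at_top[OF nh] by (simp add: inverse_eq_divide)
    have 2: "(\<lambda>n. h n powr \<gamma>) \<longlonglongrightarrow> 0"
    proof (rule tendsto_zero_powrI[OF h0 tendsto_const])
      show "\<forall>\<^sub>F n in sequentially. 0 \<le> h n"
        using eventually_ge_at_top[of 1] by eventually_elim (use h_pos less_imp_le in blast)
    qed (rule X.\<gamma>_pos)
    show ?thesis using tendsto_mult_left[OF tendsto_add[OF 1 2], of c] by simp
  qed
  have charZ: "(\<lambda>n. CLINT w|M. iexp (t * Z n w)) \<longlonglongrightarrow> complex_of_real (exp (- (sqrt (4 * \<sigma>2) * t)\<^sup>2 / 2))" for t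
  proof -
    have "(\<lambda>n. (CLINT w|M. iexp (t * Z n w)) - (CLINT w|M. iexp (t * U n w))) \<longlonglongrightarrow> 0"
    proof (rule Lim_null_comparison)
      show "\<forall>\<^sub>F n in sequentially. norm ((CLINT w|M. iexp (t * Z n w)) - (CLINT w|M. iexp (t * U n w))) \<le> \<bar>t\<bar> * (c * (1 / (sqrt (real n) * h n) + h n powr \<gamma>))"
        using eventually_ge_at_top[of 2]
      proof eventually_elim
        case (elim n)
        have "norm ((CLINT w|M. iexp (t * Z n w)) - (CLINT w|M. iexp (t * U n w))) \<le> \<bar>t\<bar> * (LINT w|M. \<bar>Z n w - U n w\<bar>)"
          by (rule char_diff_le_L1) (use Zi Ui elim in auto)
        also have "\<dots> \<le> \<bar>t\<bar> * (c * (1 / (sqrt (real n) * h n) + h n powr \<gamma>))"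
          using diff[OF elim] by (rule mult_left_mono) simp
        finally show ?case .
      qed
      show "(\<lambda>n. \<bar>t\<bar> * (c * (1 / (sqrt (real n) * h n) + h n powr \<gamma>))) \<longlonglongrightarrow> 0"
        using tendsto_mult_left[OF lim0, of "\<bar>t\<bar>"] by simp
    qed
    from tendsto_add[OF this charU[of t]] show ?thesis by simp
  qed
  show ?thesis using s0 van charZ by blast
qed

lemma conclusion:
  assumes h0: "h \<longlonglongrightarrow> 0"
  shows
    "(\<exists>c>0. \<forall>n\<ge>2.
        (LINT w|M. \<bar>D_hat K x y h n w - (LINT w'|M. D_hat K x y h n w')
                     - 1 / real n * (\<Sum>i\<in>{1..int n}. W f g x y i w)\<bar>)
          \<le> c * (1 / (real n * h n) + h n powr \<gamma> / sqrt (real n))) \<and>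
     (\<exists>c\<^sub>1>0. \<forall>n\<ge>2.
        \<bar>(LINT w|M. D_hat K x y h n w) - L2_divergence f g\<bar>
          \<le> c\<^sub>1 * (1 / real n + h n powr (2 * \<gamma>))) \<and>
     (filterlim (\<lambda>n. sqrt (real n) * h n) at_top sequentially \<longrightarrow>
        (\<not> vanishing_long_run_variance M (W f g x y) \<longrightarrow>
           (\<exists>\<sigma>2>0. weak_conv_m
              (\<lambda>n. distr M borel
                 (\<lambda>w. sqrt (real n) * (D_hat K x y h n w - (LINT w'|M. D_hat K x y h n w'))))
              (density lborel (\<lambda>x. ennreal (normal_density 0 (sqrt (4 * \<sigma>2)) x))))) \<and>
        (vanishing_long_run_variance M (W f g x y) \<longrightarrow>
           weak_conv_m
              (\<lambda>n. distr M borel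
                 (\<lambda>w. sqrt (real n) * (D_hat K x y h n w - (LINT w'|M. D_hat K x y h n w'))))
              (return borel 0)))"
    (is "?A \<and> ?B \<and> (_ \<longrightarrow> ?C)")
proof (intro conjI[OF linearization_bound conjI[OF bias_bound]] impI)
  assume nh: "filterlim (\<lambda>n. sqrt (real n) * h n) at_top sequentially"
  obtain \<sigma>2 where s: "0 \<le> \<sigma>2" "vanishing_long_run_variance M (W f g x y) \<longleftrightarrow> \<sigma>2 = 0"
    "\<forall>t. (\<lambda>n. CLINT w|M. iexp (t * (sqrt (real n) * (D_hat K x y h n w - (LINT w'|M. D_hat K x y h n w')))))
       \<longlonglongrightarrow> complex_of_real (exp (- (sqrt (4 * \<sigma>2) * t)\<^sup>2 / 2))"
    using clt[OF h0 nh] by blast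
  have m: "(\<lambda>w. sqrt (real n) * (D_hat K x y h n w - (LINT w'|M. D_hat K x y h n w'))) \<in> borel_measurable M" for n
    by measurable
  show ?C
  proof (intro conjI impI)
    assume "\<not> vanishing_long_run_variance M (W f g x y)"
    then have p: "0 < \<sigma>2" using s by simp
    then have q: "0 < sqrt (4 * \<sigma>2)" by simp
    have "weak_conv_m (\<lambda>n. distr M borel (\<lambda>w. sqrt (real n) * (D_hat K x y h n w - (LINT w'|M. D_hat K x y h n w'))))
              (density lborel (\<lambda>x. ennreal (normal_density 0 (sqrt (4 * \<sigma>2)) x)))"
      by (rule weak_conv_of_char[OF m char_centered_normal(1)[OF q]]) (unfold char_centered_normal(2)[OF q], use s(3) in blast)
    then show "\<exists>\<sigma>2>0. weak_conv_m (\<lambda>n. distr M borel (\<lambda>w. sqrt (real n) * (D_hat K x y h n w - (LINT w'|M. D_hat K x y h n w'))))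
              (density lborel (\<lambda>x. ennreal (normal_density 0 (sqrt (4 * \<sigma>2)) x)))" using p by blast
  next
    assume "vanishing_long_run_variance M (W f g x y)"
    then have z: "\<sigma>2 = 0" using s by simp
    interpret R: prob_space "return borel (0::real)" by (rule prob_space_return) simp
    have r: "real_distribution (return borel (0::real))"
      by standard simp_all
    \<comment> \<open>The Gaussian characteristic function with variance 0 is the constant 1, which
      is that of the point mass.\<close>
    have c: "char (return borel (0::real)) t = 1" for t
      unfolding char_def by (subst integral_return) auto
    show "weak_conv_m (\<lambda>n. distr M borel (\<lambda>w. sqrt (real n) * (D_hat K x y h n w - (LINT w'|M. D_hat K x y h n w')))) (return borel 0)"
    proof (rule weak_conv_of_char[OF m r])
      fix t
      show "(\<lambda>n. CLINT w|M. iexp (t * (sqrt (real n) * (D_hat K x y h n w - (LINT w'|M. D_hat K x y h n w'))))) \<longlonglongrightarrow> char (return borel 0) t"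
        using s(3)[rule_format, of t] unfolding c z by simp
    qed
  qed
qed

end

section \<open>Removing leading zero coefficients\<close>

text \<open>The equality also holds where the series diverges: the two relations \<open>sums\<close>
  coincide, so \<open>suminf\<close> selects the same value on both sides.\<close>

lemma linear_process_shift:
  assumes "\<And>i. i < d \<Longrightarrow> a i = 0"
  shows "linear_process (\<lambda>i. a (i + d)) (\<lambda>n. e (n - int d)) = linear_process a e"
proof (intro ext)
  fix n w
  have "(\<lambda>i. a (i + d) * e (n - int (i + d)) w) sums s \<longleftrightarrow> (\<lambda>i. a i * e (n - int i) w) sums s" for s
    by (rule sums_zero_iff_shift[where f="\<lambda>i. a i * e (n - int i) w"]) (simp add: assms)
  then have "(sums) (\<lambda>i. a (i + d) * e (n - int (i + d)) w) = (sums) (\<lambda>i. a i * e (n - int i) w)"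
    by (intro ext)
  moreover have "(\<lambda>i. a (i + d) * e (n - int i - int d) w) = (\<lambda>i. a (i + d) * e (n - int (i + d)) w)"
    by (simp add: algebra_simps)
  ultimately show "linear_process (\<lambda>i. a (i + d)) (\<lambda>n. e (n - int d)) n w = linear_process a e n w"
    unfolding linear_process_def suminf_def by (simp only:)
qed

lemma (in prob_space) const_no_density:
  assumes "distributed M lborel (\<lambda>_. c) (\<lambda>x. ennreal (f x))"
  shows False
proof -
  have "emeasure M ((\<lambda>_. c) -` {c} \<inter> space M) = (\<integral>\<^sup>+x. ennreal (f x) * indicator {c} x \<partial>lborel)"
    by (rule distributed_emeasure[OF assms]) simp
  also have "\<dots> = 0"
    by (rule nn_integral_null_set) (simp add: null_sets_def)
  finally show False by (simp add: emeasure_space_1 vimage_def)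
qed

lemma (in prob_space) indep_vars_reindex:
  assumes s: "inj s" and X: "indep_vars (\<lambda>_. N) X UNIV"
  shows "indep_vars (\<lambda>_. N) (\<lambda>i. X (s i)) UNIV"
proof -
  define F where "F i = {X i -` A \<inter> space M | A. A \<in> sets N}" for i
  have rv: "\<And>i. random_variable N (X i)" and F: "indep_sets F UNIV"
    using X unfolding indep_vars_def2 F_def by auto
  have "indep_sets (\<lambda>i. F (s i)) UNIV"
  proof (rule indep_setsI)
    show "F (s i) \<subseteq> events" for i using F by (simp add: indep_sets_def)
    fix A J assume J: "J \<noteq> {}" "finite J" and A: "\<forall>j\<in>J. A j \<in> F (s j)"
    have js: "inv s (s j) = j" for j using s by simp
    have "prob (\<Inter>k\<in>s ` J. A (inv s k)) = (\<Prod>k\<in>s ` J. prob (A (inv s k)))"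
      by (rule indep_setsD[OF F]) (use J A js in auto)
    then show "prob (\<Inter>j\<in>J. A j) = (\<Prod>j\<in>J. prob (A j))"
      using s by (simp add: js prod.reindex[OF inj_on_subset[OF s subset_UNIV]])
  qed
  then show ?thesis unfolding indep_vars_def2 F_def using rv by auto
qed

text \<open>If all coefficients vanished, the process would be constant and could not have a
  density. Dropping the leading zeros and delaying the innovations by their number leaves the
  process unchanged, and as the innovations are identically distributed the conditions on
  \<open>e 1\<close> carry over.\<close>

lemma kernel_process_exists:
  assumes M: "prob_space M" and e: "iid M e" and dens: "has_marginal_density M (linear_process a e) f"
    and fB: "\<And>x. \<bar>f x\<bar> \<le> Fb" and K: "smoothing_kernel K" "integrable lborel (\<lambda>t. cmod (fourier K t))"
    and \<gamma>: "0 < \<gamma>" "\<gamma> \<le> 1" and a: "summable (\<lambda>i. \<bar>a i\<bar> powr \<gamma>)"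
    and ci: "integrable lborel (\<lambda>t. \<bar>t\<bar> powr (2 * \<gamma>) * (cmod (char (distr M borel (e 1)) t))\<^sup>2)"
    and cv: "\<And>t. (LINT w|M. (cmod (iexp (t * e 1 w) - char (distr M borel (e 1)) t))\<^sup>2) \<le> C * min (\<bar>t\<bar> powr (2 * \<gamma>)) 1"
  shows "\<exists>e' a'. linear_process a' e' = linear_process a e \<and> kernel_process M e' a' \<gamma> C f Fb K"
proof -
  interpret prob_space M by (rule M)
  have ind: "indep_vars (\<lambda>_. borel) e UNIV" and id: "\<And>i j. distr M borel (e i) = distr M borel (e j)"
    using e by (auto simp: iid_def)
  have [measurable]: "e i \<in> borel_measurable M" for i using ind by (auto simp: indep_vars_def)
  have f: "0 \<le> f x" "distributed M lborel (linear_process a e n) (\<lambda>x. ennreal (f x))" for x n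
    using dens by (auto simp: has_marginal_density_def)
  have nz: "\<exists>i. a i \<noteq> 0"
  proof (rule ccontr)
    assume "\<nexists>i. a i \<noteq> 0"
    then have "linear_process a e 0 = (\<lambda>_. 0)" by (auto simp: linear_process_def)
    then show False using f(2)[of 0] const_no_density by metis
  qed
  define d where "d = (LEAST i. a i \<noteq> 0)"
  have d: "a d \<noteq> 0" "\<And>i. i < d \<Longrightarrow> a i = 0"
    using LeastI_ex[OF nz] not_less_Least unfolding d_def by auto
  define e' where "e' = (\<lambda>n. e (n - int d))"
  define a' where "a' = (\<lambda>i. a (i + d))"
  have same: "linear_process a' e' = linear_process a e"
    unfolding a'_def e'_def by (rule linear_process_shift) (rule d)
  have ee: "distr M borel (e' i) = distr M borel (e j)" for i j unfolding e'_def by (rule id)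
  have [measurable]: "e' i \<in> borel_measurable M" for i unfolding e'_def by measurable
  have v: "(LINT w|M. (cmod (iexp (t * e' 1 w) - z))\<^sup>2) = (LINT w|M. (cmod (iexp (t * e 1 w) - z))\<^sup>2)" for t z
  proof -
    have "(LINT w|M. (cmod (iexp (t * e' 1 w) - z))\<^sup>2) = (LINT u|distr M borel (e' 1). (cmod (iexp (t * u) - z))\<^sup>2)"
      by (subst integral_distr) auto
    also have "\<dots> = (LINT w|M. (cmod (iexp (t * e 1 w) - z))\<^sup>2)"
      unfolding ee[of 1 1] by (subst integral_distr) auto
    finally show ?thesis .
  qed
  have ind': "indep_vars (\<lambda>_. borel) e' UNIV"
    unfolding e'_def by (rule indep_vars_reindex[OF _ ind]) (simp add: inj_def)
  have "kernel_process M e' a' \<gamma> C f Fb K"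
  proof (intro kernel_process.intro linproc_dens.intro linproc.intro linproc_axioms.intro linproc_dens_axioms.intro density_kernel.intro)
    show "prob_space M" by (rule M)
    show "indep_vars (\<lambda>_. borel) e' UNIV" by (rule ind')
    show "distr M borel (e' i) = distr M borel (e' j)" for i j unfolding e'_def by (rule id)
    show "a' 0 \<noteq> 0" using d by (simp add: a'_def)
    show "summable (\<lambda>i. \<bar>a' i\<bar> powr \<gamma>)" unfolding a'_def using a by (subst summable_iff_shift)
    show "integrable lborel (\<lambda>t. \<bar>t\<bar> powr (2 * \<gamma>) * (cmod (char (distr M borel (e' 1)) t))\<^sup>2)" unfolding ee[of 1 1] by (rule ci)
    show "(LINT w|M. (cmod (iexp (t * e' 1 w) - char (distr M borel (e' 1)) t))\<^sup>2) \<le> C * min (\<bar>t\<bar> powr (2 * \<gamma>)) 1" for t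
      unfolding ee[of 1 1] v by (rule cv)
    show "distributed M lborel (linear_process a' e' n) (\<lambda>x. ennreal (f x))" for n unfolding same by (rule f)
    show "0 \<le> f x" "f x \<le> Fb" for x using f fB[of x] by auto
  qed (use K \<gamma> in auto)
  then show ?thesis using same by blast
qed

text \<open>The limit law is stated in two cases because the limiting variance can be 0, for example
  when f = g and all \<open>W\<close> vanish identically. The first case gives a positive \<sigma>2;
  in the second, the normalised estimator converges to the point mass at 0, which is the normal law
  of variance 0.\<close>

theorem theorem4p2:
  fixes M :: "'a measure"
    and \<epsilon> \<xi> X Y :: "int \<Rightarrow> 'a \<Rightarrow> real"
    and a b :: "nat \<Rightarrow> real"
    and f g K :: "real \<Rightarrow> real"
    and h :: "nat \<Rightarrow> real"
    and \<gamma> C :: real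
  assumes "prob_space M"
    and "iid M \<epsilon>" and "iid M \<xi>"
    and "\<And>n. converges_in_distribution M (linear_partial_sum a \<epsilon> n)"
    and "\<And>n. converges_in_distribution M (linear_partial_sum b \<xi> n)"
    and "X = linear_process a \<epsilon>" and "Y = linear_process b \<xi>"
    and "indep_processes M X Y"
    and "has_marginal_density M X f" and "has_marginal_density M Y g"
    and "smoothing_kernel K"
    and "\<And>n. n \<ge> 1 \<Longrightarrow> 0 < h n" and "h \<longlonglongrightarrow> 0"
    and "0 < \<gamma>" and "\<gamma> \<le> 1"
    and "summable (\<lambda>i. \<bar>a i\<bar> powr \<gamma>)" and "summable (\<lambda>i. \<bar>b i\<bar> powr \<gamma>)"
    and "integrable lborel
           (\<lambda>t. \<bar>t\<bar> powr (2 * \<gamma>) * (cmod (char (distr M borel (\<epsilon> 1)) t))\<^sup>2)"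
    and "integrable lborel
           (\<lambda>t. \<bar>t\<bar> powr (2 * \<gamma>) * (cmod (char (distr M borel (\<xi> 1)) t))\<^sup>2)"
    and "\<And>t. (LINT \<omega>|M. (cmod (iexp (t * \<epsilon> 1 \<omega>) - char (distr M borel (\<epsilon> 1)) t))\<^sup>2)
               \<le> C * min (\<bar>t\<bar> powr (2 * \<gamma>)) 1"
    and "\<And>t. (LINT \<omega>|M. (cmod (iexp (t * \<xi> 1 \<omega>) - char (distr M borel (\<xi> 1)) t))\<^sup>2)
               \<le> C * min (\<bar>t\<bar> powr (2 * \<gamma>)) 1"
    and "bounded (range f)" and "bounded (range g)"
    and "integrable lborel (\<lambda>t. cmod (fourier K t))"
  shows
    "(\<exists>c>0. \<forall>n\<ge>2.
        (LINT \<omega>|M. \<bar>D_hat K X Y h n \<omega> - (LINT \<omega>'|M. D_hat K X Y h n \<omega>')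
                     - 1 / real n * (\<Sum>i\<in>{1..int n}. W f g X Y i \<omega>)\<bar>)
          \<le> c * (1 / (real n * h n) + h n powr \<gamma> / sqrt (real n))) \<and>
     (\<exists>c\<^sub>1>0. \<forall>n\<ge>2.
        \<bar>(LINT \<omega>|M. D_hat K X Y h n \<omega>) - L2_divergence f g\<bar>
          \<le> c\<^sub>1 * (1 / real n + h n powr (2 * \<gamma>))) \<and>
     (filterlim (\<lambda>n. sqrt (real n) * h n) at_top sequentially \<longrightarrow>
        (\<not> vanishing_long_run_variance M (W f g X Y) \<longrightarrow>
           (\<exists>\<sigma>2>0. weak_conv_m
              (\<lambda>n. distr M borel
                 (\<lambda>\<omega>. sqrt (real n) * (D_hat K X Y h n \<omega> - (LINT \<omega>'|M. D_hat K X Y h n \<omega>'))))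
              (density lborel (\<lambda>x. ennreal (normal_density 0 (sqrt (4 * \<sigma>2)) x))))) \<and>
        (vanishing_long_run_variance M (W f g X Y) \<longrightarrow>
           weak_conv_m
              (\<lambda>n. distr M borel
                 (\<lambda>\<omega>. sqrt (real n) * (D_hat K X Y h n \<omega> - (LINT \<omega>'|M. D_hat K X Y h n \<omega>'))))
              (return borel 0)))"
proof -
  have bd: "\<exists>B. \<forall>x. \<bar>u x\<bar> \<le> B" if "bounded (range u)" for u :: "real \<Rightarrow> real"
    using that by (auto simp: bounded_iff)
  obtain Fb where Fb: "\<And>x. \<bar>f x\<bar> \<le> Fb" using bd[OF assms(22)] by blast
  obtain Gb where Gb: "\<And>x. \<bar>g x\<bar> \<le> Gb" using bd[OF assms(23)] by blast
  \<comment> \<open>A convergent sequence of bandwidths is bounded.\<close>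
  obtain H where H: "\<And>n. \<bar>h n\<bar> \<le> H"
    using convergent_imp_Bseq[OF convergentI[OF assms(13)]] by (auto simp: Bseq_def)
  obtain \<epsilon>' a' where X': "linear_process a' \<epsilon>' = X" "kernel_process M \<epsilon>' a' \<gamma> C f Fb K"
    using kernel_process_exists[OF assms(1,2) assms(9)[unfolded assms(6)] Fb assms(11,24,14,15,16,18,20)] assms(6) by auto
  obtain \<xi>' b' where Y': "linear_process b' \<xi>' = Y" "kernel_process M \<xi>' b' \<gamma> C g Gb K"
    using kernel_process_exists[OF assms(1,3) assms(10)[unfolded assms(7)] Gb assms(11,24,14,15,17,19,21)] assms(7) by auto
  have "two_sample M \<epsilon>' a' \<gamma> C f Fb \<xi>' b' g Gb K h H"
  proof (intro two_sample.intro two_sample_axioms.intro X'(2) Y'(2) assms(1) density_kernel.intro assms(11,24))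
    show "prob_space.indep_var M (Pi\<^sub>M UNIV (\<lambda>_. borel)) (\<lambda>\<omega> n. linear_process a' \<epsilon>' n \<omega>) (Pi\<^sub>M UNIV (\<lambda>_. borel)) (\<lambda>\<omega> n. linear_process b' \<xi>' n \<omega>)"
      using assms(8) unfolding indep_processes_def X'(1) Y'(1) .
    show "0 < h n" if "1 \<le> n" for n using assms(12)[OF that] .
    show "h n \<le> H" for n using H[of n] by simp
  qed
  from two_sample.conclusion[OF this assms(13)] show ?thesis unfolding X'(1) Y'(1) .
qed

end
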